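(* Suppose the vector fields satisfy the sublinear growth assumption, and that the system is a controllable driftless system. Let $\mu_0,\mu_T\in\mathcal{P}(\mathbb{R}^d)$ be compactly supported. Let $U=\mathbb{R}^n$ and $L(t,x,u)=\sum_{i=1}^n|u_i|^2$ for all $(t,x,u)\in I\times\mathbb{R}^d\times U$. Then there exists a pair $(\mu,u)$ that solves the Benamou-Brenier problem.
   Context: Let $d,n\ge1$, $T>0$, $I=[0,T]$, $f_0,\dots,f_n:\mathbb{R}^d\to\mathbb{R}^d$ vector fields, and $f(x,u)=f_0(x)+\sum_{i=1}^n u_i f_i(x)$. Sublinear growth assumption: each $f_i$ is $C^1$ and there is $M>0$ with $|f_i(x)|\le M(|x|+1)$ for all $x$ and $i$. Controllable driftless system: $f_0\equiv0$, $f_1,\dots,f_n\in C^\infty(\mathbb{R}^d;\mathbb{R}^d)$, and, with $\mathcal{V}^0=\mathcal{V}=\{f_1,\dots,f_n\}$ and $\mathcal{V}^i=\{[g,h]: g\in\mathcal{V},\ h\in\mathcal{V}^{j-1},\ j=1,\dots,i\}$ ($[\cdot,\cdot]$ the Lie bracket of vector fields), for some sufficiently large $r$ one has ${\rm span}\{g(x): g\in\cup_{i=0}^r\mathcal{V}^i\}=\mathbb{R}^d$ for all $x\in\mathbb{R}^d$. $\mathcal{P}(\mathbb{R}^d)$ is the set of Borel probability measures with the narrow topology. The Benamou-Brenier problem is to minimize $\int_I\int_{\mathbb{R}^d}L(t,x,u(t,x))\,d\mu_t(x)\,dt$ over measurable $u:I\times\mathbb{R}^d\to U$ and narrowly continuous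 curves $\mu:I\to\mathcal{P}(\mathbb{R}^d)$ with endpoints $\mu_0,\mu_T$ such that for all $\phi\in C^1_c(I\times\mathbb{R}^d)$ $$\int_I\int_{\mathbb{R}^d}[\partial_t\phi+\partial_x\phi\cdot f(x,u(t,x))]\,d\mu_t(x)\,dt=\int\phi(T,x)\,d\mu_T(x)-\int\phi(0,x)\,d\mu_0(x).$$ A pair solves the problem if it attains the infimum. *)

theory Defs
  imports "HOL-Probability.Probability"
begin

subsection \<open>Regularity and Lie brackets of vector fields\<close>

text \<open>
  Functions of class \<open>C\<^sup>k\<close> on \<open>S\<close>: all iterated directional derivatives up to order \<open>k\<close> exist and are
  continuous. The domain being finite-dimensional, continuity of \<open>x \<mapsto> Df(x) v\<close> for every \<open>v\<close> is
  continuity of \<open>Df\<close> in operator norm. This is only meaningful for sets \<open>S\<close> on which the derivative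
  within \<open>S\<close> is unique; below \<open>S\<close> is the whole space or \<open>[0,T] \<times> \<real>\<^sup>d\<close> with \<open>T > 0\<close>, where it means
  one-sided time derivatives at the endpoints.
\<close>

primrec Ck_on ::
  "nat \<Rightarrow> 'a::euclidean_space set \<Rightarrow> ('a \<Rightarrow> 'b::real_normed_vector) \<Rightarrow> bool" where
  "Ck_on 0 S f \<longleftrightarrow> continuous_on S f"
| "Ck_on (Suc k) S f \<longleftrightarrow>
     (\<forall>x\<in>S. f differentiable (at x within S)) \<and>
     (\<forall>v. Ck_on k S (\<lambda>x. frechet_derivative f (at x within S) v))"

definition smooth_on :: "'a::euclidean_space set \<Rightarrow> ('a \<Rightarrow> 'b::real_normed_vector) \<Rightarrow> bool" where
  "smooth_on S f \<longleftrightarrow> (\<forall>k. Ck_on k S f)"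

text \<open>Sign convention: \<open>[g,h] = Dh g - Dg h\<close>.\<close>

definition lie_bracket ::
  "('a::euclidean_space \<Rightarrow> 'a) \<Rightarrow> ('a \<Rightarrow> 'a) \<Rightarrow> 'a \<Rightarrow> 'a" where
  "lie_bracket g h x = frechet_derivative h (at x) (g x) - frechet_derivative g (at x) (h x)"

fun iterated_brackets ::
  "('a::euclidean_space \<Rightarrow> 'a) set \<Rightarrow> nat \<Rightarrow> ('a \<Rightarrow> 'a) set" where
  "iterated_brackets V 0 = V"
| "iterated_brackets V (Suc i) =
     (\<Union>j\<in>{1..Suc i}. {lie_bracket g h | g h. g \<in> V \<and> h \<in> iterated_brackets V (j - 1)})"


subsection \<open>Control-affine systems\<close>

text \<open>
  \<open>f0\<close> is the drift and the controlled fields \<open>f i\<close> are indexed by the elements of the finite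
  type \<open>'n\<close>.
\<close>

definition control_affine ::
  "('a::euclidean_space \<Rightarrow> 'a) \<Rightarrow> ('n::finite \<Rightarrow> 'a \<Rightarrow> 'a) \<Rightarrow> 'a \<Rightarrow> real ^ 'n \<Rightarrow> 'a" where
  "control_affine f0 f x u = f0 x + (\<Sum>i\<in>UNIV. (u $ i) *\<^sub>R f i x)"

definition sublinear_growth ::
  "('a::euclidean_space \<Rightarrow> 'a) \<Rightarrow> ('n::finite \<Rightarrow> 'a \<Rightarrow> 'a) \<Rightarrow> bool" where
  "sublinear_growth f0 f \<longleftrightarrow>
     Ck_on 1 UNIV f0 \<and> (\<forall>i. Ck_on 1 UNIV (f i)) \<and>
     (\<exists>M>0. \<forall>x. norm (f0 x) \<le> M * (norm x + 1) \<and> (\<forall>i. norm (f i x) \<le> M * (norm x + 1)))"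

definition controllable_driftless ::
  "('a::euclidean_space \<Rightarrow> 'a) \<Rightarrow> ('n::finite \<Rightarrow> 'a \<Rightarrow> 'a) \<Rightarrow> bool" where
  "controllable_driftless f0 f \<longleftrightarrow>
     (\<forall>x. f0 x = 0) \<and> (\<forall>i. smooth_on UNIV (f i)) \<and>
     (\<exists>r. \<forall>x. span {g x | g. g \<in> (\<Union>i\<in>{0..r}. iterated_brackets (range f) i)} = UNIV)"


subsection \<open>Probability measures and the narrow topology\<close>

text \<open>\<open>space (prob_algebra borel)\<close> is the set of all Borel probability measures.\<close>

definition narrow_topology :: "'a::euclidean_space measure topology" where
  "narrow_topology = topology_generated_by
     {{\<nu> \<in> space (prob_algebra borel). (LINT x|\<nu>. apply_bcontfun g x) \<in> W} |
        (g :: 'a \<Rightarrow>\<^sub>C real) (W :: real set). open W}"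

lemma topspace_narrow_topology:
  "topspace (narrow_topology :: 'a::euclidean_space measure topology) = space (prob_algebra borel)"
proof -
  have "space (prob_algebra borel) \<subseteq> topspace (narrow_topology :: 'a measure topology)"
    unfolding narrow_topology_def topology_generated_by_topspace
    by (auto intro: exI[of _ "UNIV :: real set"])
  then show ?thesis
    unfolding narrow_topology_def topology_generated_by_topspace by blast
qed

lemma continuous_map_narrow_topology_iff:
  fixes \<mu> :: "real \<Rightarrow> 'a::euclidean_space measure"
  shows "continuous_map (top_of_set S) narrow_topology \<mu> \<longleftrightarrow>
    (\<forall>t\<in>S. \<mu> t \<in> space (prob_algebra borel)) \<and>
    (\<forall>g :: 'a \<Rightarrow>\<^sub>C real. continuous_on S (\<lambda>t. LINT x|\<mu> t. apply_bcontfun g x))"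
    (is "?L \<longleftrightarrow> ?P \<and> ?C")
proof
  assume L: ?L
  have P: ?P
    using continuous_map_funspace[OF L] by (auto simp: topspace_narrow_topology)
  have "continuous_on S (\<lambda>t. LINT x|\<mu> t. apply_bcontfun g x)" for g :: "'a \<Rightarrow>\<^sub>C real"
    unfolding continuous_on_open_invariant openin_open[symmetric]
  proof (intro allI impI)
    fix W :: "real set" assume "open W"
    let ?X = "{\<nu> \<in> space (prob_algebra borel). (LINT x|\<nu>. apply_bcontfun g x) \<in> W}"
    have "openin narrow_topology ?X"
      unfolding narrow_topology_def
      by (rule topology_generated_by_Basis) (use \<open>open W\<close> in blast)
    with L have "openin (top_of_set S) {t \<in> S. \<mu> t \<in> ?X}"
      by (auto dest: openin_continuous_map_preimage)
    moreover have "{t \<in> S. \<mu> t \<in> ?X} = (\<lambda>t. LINT x|\<mu> t. apply_bcontfun g x) -` W \<inter> S"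
      using P by blast
    ultimately show "\<exists>A. open A \<and> A \<inter> S = (\<lambda>t. LINT x|\<mu> t. apply_bcontfun g x) -` W \<inter> S"
      by (metis openin_open Int_commute)
  qed
  with P show "?P \<and> ?C" by blast
next
  assume PC: "?P \<and> ?C"
  show ?L
    unfolding narrow_topology_def
  proof (rule continuous_on_generated_topo)
    show "\<mu> ` topspace (top_of_set S) \<subseteq> \<Union> {{\<nu> \<in> space (prob_algebra borel). (LINT x|\<nu>. apply_bcontfun g x) \<in> W} |
        (g :: 'a \<Rightarrow>\<^sub>C real) (W :: real set). open W}"
      using PC topspace_narrow_topology[where 'a = 'a]
      unfolding narrow_topology_def topology_generated_by_topspace by auto
  next
    fix U assume "U \<in> {{\<nu> \<in> space (prob_algebra borel). (LINT x|\<nu>. apply_bcontfun g x) \<in> W} |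
        (g :: 'a \<Rightarrow>\<^sub>C real) (W :: real set). open W}"
    then obtain g :: "'a \<Rightarrow>\<^sub>C real" and W where W: "open W"
      and U: "U = {\<nu> \<in> space (prob_algebra borel). (LINT x|\<nu>. apply_bcontfun g x) \<in> W}" by blast
    have "\<mu> -` U \<inter> S = S \<inter> (\<lambda>t. LINT x|\<mu> t. apply_bcontfun g x) -` W"
      using PC U by blast
    then show "openin (top_of_set S) (\<mu> -` U \<inter> topspace (top_of_set S))"
      using PC W by (simp add: continuous_openin_preimage_gen)
  qed
qed

definition measure_support :: "'a::topological_space measure \<Rightarrow> 'a set" where
  "measure_support \<nu> = {x. \<forall>W. open W \<and> x \<in> W \<longrightarrow> emeasure \<nu> W > 0}"


subsection \<open>The Benamou--Brenier problem\<close>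

definition C1c_test_function :: "real \<Rightarrow> (real \<times> 'a::euclidean_space \<Rightarrow> real) \<Rightarrow> bool" where
  "C1c_test_function T \<phi> \<longleftrightarrow>
     Ck_on 1 ({0..T} \<times> UNIV) \<phi> \<and> compact (closure {z \<in> {0..T} \<times> UNIV. \<phi> z \<noteq> 0})"

text \<open>The integrand \<open>\<partial>\<^sub>t\<phi> + \<partial>\<^sub>x\<phi> \<cdot> f(x,u)\<close> of the weak continuity equation.\<close>

definition transport_integrand ::
  "real \<Rightarrow> ('a::euclidean_space \<Rightarrow> 'c \<Rightarrow> 'a) \<Rightarrow> (real \<Rightarrow> 'a \<Rightarrow> 'c) \<Rightarrow> (real \<times> 'a \<Rightarrow> real) \<Rightarrow>
   real \<Rightarrow> 'a \<Rightarrow> real" where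
  "transport_integrand T F u \<phi> t x =
     vector_derivative (\<lambda>s. \<phi> (s, x)) (at t within {0..T}) +
     frechet_derivative (\<lambda>y. \<phi> (t, y)) (at x) (F x (u t x))"

text \<open>
  The finiteness clause says that the left-hand side of the weak equation is well defined. It has to
  be stated because the Bochner integral of a non-integrable function is \<open>0\<close> by convention.
\<close>

definition weak_continuity_equation ::
  "real \<Rightarrow> ('a::euclidean_space \<Rightarrow> 'c \<Rightarrow> 'a) \<Rightarrow> (real \<Rightarrow> 'a measure) \<Rightarrow> (real \<Rightarrow> 'a \<Rightarrow> 'c) \<Rightarrow> bool" where
  "weak_continuity_equation T F \<mu> u \<longleftrightarrow>
     (\<forall>\<phi>. C1c_test_function T \<phi> \<longrightarrow>
        (\<integral>\<^sup>+t\<in>{0..T}. (\<integral>\<^sup>+x. ennreal \<bar>transport_integrand T F u \<phi> t x\<bar> \<partial>\<mu> t) \<partial>lborel) < \<infinity> \<and>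
        (LINT t:{0..T}|lborel. (LINT x|\<mu> t. transport_integrand T F u \<phi> t x)) =
          (LINT x|\<mu> T. \<phi> (T, x)) - (LINT x|\<mu> 0. \<phi> (0, x)))"

definition BB_admissible ::
  "real \<Rightarrow> ('a::euclidean_space \<Rightarrow> 'c::topological_space \<Rightarrow> 'a) \<Rightarrow> 'c set \<Rightarrow>
   'a measure \<Rightarrow> 'a measure \<Rightarrow> ((real \<Rightarrow> 'a measure) \<times> (real \<Rightarrow> 'a \<Rightarrow> 'c)) set" where
  "BB_admissible T F U \<mu>0 \<mu>T =
     {(\<mu>, u).
        continuous_map (top_of_set {0..T}) narrow_topology \<mu> \<and>
        \<mu> 0 = \<mu>0 \<and> \<mu> T = \<mu>T \<and>
        (\<lambda>(t, x). u t x) \<in> restrict_space borel ({0..T} \<times> UNIV) \<rightarrow>\<^sub>M borel \<and>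
        (\<forall>t\<in>{0..T}. \<forall>x. u t x \<in> U) \<and>
        weak_continuity_equation T F \<mu> u}"

definition BB_cost ::
  "real \<Rightarrow> (real \<Rightarrow> 'a::euclidean_space \<Rightarrow> 'c \<Rightarrow> ennreal) \<Rightarrow>
   (real \<Rightarrow> 'a measure) \<Rightarrow> (real \<Rightarrow> 'a \<Rightarrow> 'c) \<Rightarrow> ennreal" where
  "BB_cost T L \<mu> u = (\<integral>\<^sup>+t\<in>{0..T}. (\<integral>\<^sup>+x. L t x (u t x) \<partial>\<mu> t) \<partial>lborel)"

definition solves_BB ::
  "real \<Rightarrow> ('a::euclidean_space \<Rightarrow> 'c::topological_space \<Rightarrow> 'a) \<Rightarrow> 'c set \<Rightarrow>
   (real \<Rightarrow> 'a \<Rightarrow> 'c \<Rightarrow> ennreal) \<Rightarrow> 'a measure \<Rightarrow> 'a measure \<Rightarrow>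
   (real \<Rightarrow> 'a measure) \<Rightarrow> (real \<Rightarrow> 'a \<Rightarrow> 'c) \<Rightarrow> bool" where
  "solves_BB T F U L \<mu>0 \<mu>T \<mu> u \<longleftrightarrow>
     (\<mu>, u) \<in> BB_admissible T F U \<mu>0 \<mu>T \<and>
     BB_cost T L \<mu> u = (INF (\<nu>, v) \<in> BB_admissible T F U \<mu>0 \<mu>T. BB_cost T L \<nu> v)"

end

theory Submission
  imports Defs "HOL-Real_Asymp.Real_Asymp"
begin

text \<open>
  Replacing the pair \<open>(\<mu>, u)\<close> by \<open>\<mu>\<close> and the joint law of \<open>(t, x, u(t, x))\<close> makes the continuity
  equation linear and the cost a second moment of the control. With sublinear growth, a logarithmic
  cutoff gives tightness uniformly in time from the energy bound, so minimising sequences of such plans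
  have limits, by Prokhorov's theorem and lower semicontinuity of the second moment. Averaging the
  control given \<open>(t, x)\<close> turns the limit plan back into an admissible pair, with no larger cost by
  convexity.

  Finiteness of the infimum needs only approximate controllability: since brackets of the fields are
  leading terms of commutators of their flows, every point of a ball is joined to points
  arbitrarily close to every other point of the ball by horizontal paths of bounded length.
  Random paths between nearly the right endpoints give plans of bounded energy, and the same
  compactness gives a plan with exactly the prescribed endpoints.
\<close>

subsection \<open>Compactness of tight sequences of measures\<close>

text \<open>Two steps named above hide the difficulty. Convergence of the joint laws determines the
  limit marginals only for almost every time, while the endpoints are prescribed. The link is
  \<open>plan_increment\<close>: the integral of a test function at time \<open>t\<close> is its
  initial value plus the flux accumulated up to \<open>t\<close>. The energy bound makes the flux
  through short time windows uniformly small, so the marginals converge at every time. The same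
  quadratic bound lets integrands of linear growth in the control pass to the limit. For
  controllability, following a bracket of length \<open>k\<close> for time \<open>t\<close>
  displaces by order \<open>t ^ k\<close>, so a displacement \<open>\<delta>\<close> costs a path
  length of order the \<open>k\<close>-th root of \<open>\<delta>\<close>. A move that leaves at
  most half of the error can be repeated, and the roots of a geometric sequence are again summable,
  which keeps the total length bounded. Leading terms are computed by ring arithmetic in formal
  series, where inverses and commutators are purely algebraic; words then act as differential
  operators on coordinate functions, with Taylor remainders uniform on balls.\<close>

definition triangle_wave :: "real \<Rightarrow> real" where
  "triangle_wave s = arccos (cos (pi * s)) / pi"

lemma continuous_triangle_wave: "continuous_on A triangle_wave"
  unfolding triangle_wave_def by (intro continuous_intros) auto

lemma triangle_wave_shift:
  assumes "0 \<le> \<theta>" "\<theta> \<le> 1"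
  shows "triangle_wave (2 * real_of_int k + \<theta>) = \<theta>"
proof -
  have "cos (pi * (2 * real_of_int k + \<theta>)) = cos (pi * \<theta> + 2 * pi * real_of_int k)"
    by (simp add: algebra_simps)
  also have "\<dots> = cos (pi * \<theta>)"
    by (metis cos_add cos_int_2pin sin_int_2pin diff_zero mult.right_neutral mult_zero_right)
  finally show ?thesis
    unfolding triangle_wave_def using assms by (simp add: arccos_cos mult_left_le)
qed

text \<open>\<open>triangle_wave s\<close> is the distance from \<open>s\<close> to the nearest even
  integer. The clipped affine image is 0 where that distance is at most 1/3 and 1 where it is at
  least 2/3; the Cantor-type parameters chosen below only visit these two ranges.\<close>

definition schoenberg_digit :: "real \<Rightarrow> real" where
  "schoenberg_digit s = max 0 (min 1 (3 * triangle_wave s - 1))"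

lemma continuous_schoenberg_digit: "continuous_on A schoenberg_digit"
  unfolding schoenberg_digit_def by (intro continuous_intros continuous_triangle_wave)

lemma schoenberg_digit_bounds: "0 \<le> schoenberg_digit s" "schoenberg_digit s \<le> 1"
  unfolding schoenberg_digit_def by auto

text \<open>Take the point \<open>t\<close> of the Cantor set whose ternary digits are
  \<open>2 * a n\<close>. Multiplication by \<open>3 ^ n\<close> splits off an even integer, which
  \<open>triangle_wave\<close> does not see, and leaves a tail in [0,1/3] or in [2/3,1] according to
  its first digit. The offset \<open>2 * j\<close> disappears for the same reason.\<close>

lemma schoenberg_digits:
  fixes a :: "nat \<Rightarrow> int"
  assumes a: "\<And>n. a n \<in> {0, 1}"
  obtains t where "0 \<le> t" "t \<le> 1"
    "\<And>n j. schoenberg_digit (3 ^ n * (2 * real_of_int j + t)) = of_int (a n)"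
proof -
  define c where "c n k = 2 * real_of_int (a (n + k)) * (1/3) ^ Suc k" for n k
  have geo: "(\<lambda>k. 2 * (1/3::real) ^ Suc k) sums 1"
    using sums_mult[OF geometric_sums[of "1/3::real"], of "2/3"] by simp
  have a01: "0 \<le> real_of_int (a n)" "real_of_int (a n) \<le> 1" for n
    using a[of n] by auto
  have c0: "0 \<le> c n k" and c1: "c n k \<le> 2 * (1/3::real) ^ Suc k" for n k
    using a01[of "n + k"] unfolding c_def
    by (auto intro!: mult_nonneg_nonneg simp: mult_left_le)
  have csum: "summable (c n)" for n
    by (rule summable_comparison_test'[OF sums_summable[OF geo], of 0]) (use c0 c1 in auto)
  define \<tau> where "\<tau> n = (\<Sum>k. c n k)" for n
  have \<tau>0: "0 \<le> \<tau> n" for n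
    unfolding \<tau>_def using csum c0 by (intro suminf_nonneg) auto
  have \<tau>1: "\<tau> n \<le> 1" for n
    unfolding \<tau>_def using suminf_le[OF c1 csum sums_summable[OF geo]] sums_unique[OF geo] by metis
  have rec: "3 * \<tau> n = 2 * real_of_int (a n) + \<tau> (Suc n)" for n
  proof -
    have "\<tau> n = c n 0 + (\<Sum>k. c n (Suc k))"
      unfolding \<tau>_def using suminf_split_head[OF csum[of n]] by simp
    also have "(\<lambda>k. c n (Suc k)) = (\<lambda>k. (1/3) * c (Suc n) k)"
      unfolding c_def by (auto simp: fun_eq_iff)
    also have "(\<Sum>k. (1/3) * c (Suc n) k) = (1/3) * \<tau> (Suc n)"
      unfolding \<tau>_def by (rule suminf_mult[OF csum])
    finally show ?thesis unfolding c_def by simp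
  qed
  have shift: "\<exists>m::int. 3 ^ n * (2 * real_of_int j + \<tau> 0) = 2 * of_int m + \<tau> n" for n j
  proof (induction n)
    case (Suc n)
    then obtain m :: int where m: "3 ^ n * (2 * real_of_int j + \<tau> 0) = 2 * of_int m + \<tau> n" by blast
    have "3 ^ Suc n * (2 * real_of_int j + \<tau> 0) = 3 * (2 * of_int m + \<tau> n)"
      using m by simp
    also have "\<dots> = 2 * of_int (3 * m + a n) + \<tau> (Suc n)"
      using rec[of n] by simp
    finally show ?case by blast
  qed auto
  have digit: "schoenberg_digit (3 ^ n * (2 * real_of_int j + \<tau> 0)) = of_int (a n)" for n j
  proof -
    obtain m :: int where m: "3 ^ n * (2 * real_of_int j + \<tau> 0) = 2 * of_int m + \<tau> n"
      using shift by blast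
    have "triangle_wave (3 ^ n * (2 * real_of_int j + \<tau> 0)) = \<tau> n"
      unfolding m by (rule triangle_wave_shift[OF \<tau>0 \<tau>1])
    then show ?thesis
      unfolding schoenberg_digit_def using rec[of n] \<tau>0[of "Suc n"] \<tau>1[of "Suc n"] \<tau>0[of n] \<tau>1[of n] a[of n]
      by (auto simp: max_def min_def)
  qed
  show ?thesis using that[OF \<tau>0 \<tau>1 digit] .
qed

text \<open>The digits are the parities of \<open>\<lfloor>2 ^ Suc k * y\<rfloor>\<close>, so the
  partial sums are the dyadic truncations of \<open>y\<close>; \<open>y < 1\<close> removes the
  integer part.\<close>

lemma binary_expansion:
  fixes y :: real
  assumes "0 \<le> y" "y < 1"
  obtains d :: "nat \<Rightarrow> int" where "\<And>k. d k \<in> {0, 1}" "(\<lambda>k. (1/2) ^ Suc k * of_int (d k)) sums y"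
proof -
  define d where "d k = \<lfloor>2 ^ Suc k * y\<rfloor> mod 2" for k
  have part: "(\<Sum>k<n. (1/2) ^ Suc k * real_of_int (d k)) = of_int \<lfloor>2 ^ n * y\<rfloor> / 2 ^ n" for n
  proof (induction n)
    case 0
    show ?case using assms by (simp add: floor_unique)
  next
    case (Suc n)
    have "\<lfloor>2 ^ Suc n * y\<rfloor> div 2 = \<lfloor>2 ^ n * y\<rfloor>"
      using floor_divide_real_eq_div[of 2 "2 ^ Suc n * y"] by simp
    then have "\<lfloor>2 ^ Suc n * y\<rfloor> = 2 * \<lfloor>2 ^ n * y\<rfloor> + d n"
      unfolding d_def by (metis mult_div_mod_eq)
    then have "real_of_int \<lfloor>2 ^ Suc n * y\<rfloor> = 2 * of_int \<lfloor>2 ^ n * y\<rfloor> + of_int (d n)"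
      by simp
    then show ?case
      using Suc by (simp add: field_simps power_one_over)
  qed
  have "(\<lambda>n. of_int \<lfloor>2 ^ n * y\<rfloor> / 2 ^ n) \<longlonglongrightarrow> y"
  proof (rule Lim_null[THEN iffD2], rule Lim_null_comparison)
    show "\<forall>\<^sub>F n in sequentially. norm (of_int \<lfloor>2 ^ n * y\<rfloor> / 2 ^ n - y) \<le> (1/2) ^ n"
    proof (rule always_eventually, rule allI)
      fix n :: nat
      have "of_int \<lfloor>2 ^ n * y\<rfloor> / 2 ^ n - y = (of_int \<lfloor>2 ^ n * y\<rfloor> - 2 ^ n * y) / 2 ^ n"
        by (simp add: field_simps)
      moreover have "\<bar>of_int \<lfloor>2 ^ n * y\<rfloor> - 2 ^ n * y\<bar> \<le> 1"
        by linarith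
      ultimately show "norm (of_int \<lfloor>2 ^ n * y\<rfloor> / 2 ^ n - y) \<le> (1/2) ^ n"
        by (simp add: power_one_over divide_right_mono abs_divide)
    qed
  qed (intro LIMSEQ_power_zero, simp)
  then have "(\<lambda>k. (1/2) ^ Suc k * of_int (d k)) sums y"
    unfolding sums_def part .
  moreover have "d k \<in> {0, 1}" for k unfolding d_def by auto
  ultimately show ?thesis using that by blast
qed

text \<open>
  Schoenberg's space-filling curve is 2-periodic; multiplying it by a continuous function that
  equals \<open>j\<close> on \<open>[2j, 2j+1]\<close> makes it cover the whole space.
\<close>

definition filling_coord :: "'a::euclidean_space \<Rightarrow> real \<Rightarrow> real" where
  "filling_coord b s =
     (\<Sum>k. (1/2) ^ Suc k * schoenberg_digit (3 ^ prod_encode (to_nat_on Basis b, k) * s))"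

definition filling_curve :: "real \<Rightarrow> 'a::euclidean_space" where
  "filling_curve s = (\<Sum>b\<in>Basis. ((s - triangle_wave s) / 2 * (2 * filling_coord b s - 1)) *\<^sub>R b)"

lemma continuous_filling_coord: "continuous_on UNIV (filling_coord b)"
proof -
  have geo: "summable (\<lambda>k. (1/2::real) ^ Suc k)"
    using summable_geometric[of "1/2::real"] by (subst summable_Suc_iff) simp
  have "uniform_limit UNIV (\<lambda>n s. \<Sum>k<n. (1/2) ^ Suc k * schoenberg_digit (3 ^ prod_encode (to_nat_on Basis b, k) * s))
      (filling_coord b) sequentially"
    unfolding filling_coord_def
    by (rule Weierstrass_m_test[OF _ geo])
       (auto simp: abs_mult schoenberg_digit_bounds intro!: mult_left_le)
  then show ?thesis
    by (rule uniform_limit_theorem[rotated])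
       (auto intro!: always_eventually continuous_intros
          continuous_on_compose2[OF continuous_schoenberg_digit[of UNIV]])
qed

lemma continuous_filling_curve: "continuous_on UNIV (filling_curve :: real \<Rightarrow> 'a::euclidean_space)"
  unfolding filling_curve_def
  by (intro continuous_intros continuous_triangle_wave continuous_filling_coord) auto

text \<open>With \<open>j\<close> at least \<open>norm z + 1\<close>, every coordinate of
  \<open>z / j\<close> lies strictly between -1 and 1, so its affine image in [0,1) has a binary
  expansion to prescribe. The bound on \<open>s\<close>, linear in the norm, is what later transfers
  tightness to the line.\<close>

lemma filling_curve_onto:
  fixes z :: "'a::euclidean_space"
  obtains s where "0 \<le> s" "s \<le> 2 * norm z + 5" "filling_curve s = z"
proof -
  define j :: nat where "j = nat \<lceil>norm z\<rceil> + 1"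
  have j: "norm z + 1 \<le> real j" "real j \<le> norm z + 2"
    unfolding j_def using norm_ge_zero[of z] by linarith+
  define y where "y b = (z \<bullet> b / real j + 1) / 2" for b
  have y: "0 \<le> y b" "y b < 1" if "b \<in> Basis" for b
  proof -
    have "\<bar>z \<bullet> b\<bar> \<le> norm z" using Basis_le_norm[OF that] .
    then have "\<bar>z \<bullet> b / real j\<bar> < 1" using j by (simp add: abs_divide divide_simps)
    then have "- 1 < z \<bullet> b / real j" "z \<bullet> b / real j < 1" by linarith+
    then show "0 \<le> y b" "y b < 1" unfolding y_def by simp_all
  qed
  have "\<exists>d. (\<forall>k. d k \<in> {0, 1::int}) \<and> (\<lambda>k. (1/2) ^ Suc k * of_int (d k)) sums y b"
    if "b \<in> Basis" for b
    using binary_expansion[OF y[OF that]] by metis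
  then obtain d where d: "\<And>b k. b \<in> Basis \<Longrightarrow> d b k \<in> {0, 1::int}"
    and dsum: "\<And>b. b \<in> Basis \<Longrightarrow> (\<lambda>k. (1/2) ^ Suc k * of_int (d b k)) sums y b"
    by metis
  \<comment> \<open>One digit sequence interleaves the expansions of all coordinates: the position
    \<open>prod_encode (i, k)\<close> stores the \<open>k\<close>-th binary digit of the
    \<open>i\<close>-th coordinate.\<close>
  define a where "a n = (case prod_decode n of (i, k) \<Rightarrow>
      if i \<in> to_nat_on (Basis :: 'a set) ` Basis
      then d (from_nat_into (Basis :: 'a set) i) k else 0)" for n
  have count: "countable (Basis :: 'a set)" by (simp add: uncountable_infinite countable_finite)
  have a01: "a n \<in> {0, 1}" for n
  proof -
    obtain i k where ik: "prod_decode n = (i, k)" by fastforce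
    show ?thesis
      using d[of "from_nat_into Basis i" k] from_nat_into_to_nat_on[OF count]
      by (auto simp: a_def ik)
  qed
  obtain t where t: "0 \<le> t" "t \<le> 1"
    "\<And>n i. schoenberg_digit (3 ^ n * (2 * real_of_int i + t)) = of_int (a n)"
    using schoenberg_digits[of a, OF a01] by metis
  define s where "s = 2 * real_of_int (int j) + t"
  have tw: "triangle_wave s = t"
    unfolding s_def using triangle_wave_shift t by blast
  have coord: "filling_coord b s = y b" if "b \<in> Basis" for b :: 'a
  proof -
    have "a (prod_encode (to_nat_on Basis b, k)) = d b k" for k
      unfolding a_def using that count by simp
    then have "filling_coord b s = (\<Sum>k. (1/2) ^ Suc k * of_int (d b k))"
      unfolding filling_coord_def s_def t(3) by simp
    then show ?thesis using sums_unique[OF dsum[OF that]] by simp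
  qed
  have "filling_curve s = (\<Sum>b\<in>Basis. (z \<bullet> b) *\<^sub>R b)"
    unfolding filling_curve_def tw
  proof (rule sum.cong[OF refl])
    fix b :: 'a assume b: "b \<in> Basis"
    have "(s - t) / 2 * (2 * filling_coord b s - 1) = z \<bullet> b"
    proof -
      have "(s - t) / 2 = real j" unfolding s_def by simp
      moreover have "real j \<noteq> 0" using j norm_ge_zero[of z] by linarith
      ultimately show ?thesis unfolding coord[OF b] y_def by (simp add: field_simps)
    qed
    then show "((s - t) / 2 * (2 * filling_coord b s - 1)) *\<^sub>R b = (z \<bullet> b) *\<^sub>R b" by simp
  qed
  then have "filling_curve s = z" by (simp add: euclidean_representation)
  moreover have "0 \<le> s" "s \<le> 2 * norm z + 5"
    unfolding s_def using j t by auto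
  ultimately show ?thesis using that by blast
qed

text \<open>Choosing the first parameter that hits \<open>z\<close> makes each sublevel set the
  image of a compact interval under a continuous curve, hence compact, which is the source of
  measurability.\<close>

definition filling_section :: "'a::euclidean_space \<Rightarrow> real" where
  "filling_section z = Inf {s. 0 \<le> s \<and> filling_curve s = z}"

lemma filling_section:
  fixes z :: "'a::euclidean_space"
  shows "0 \<le> filling_section z" "filling_curve (filling_section z) = z"
    "filling_section z \<le> 2 * norm z + 5"
proof -
  let ?S = "{s. 0 \<le> s \<and> filling_curve s = z}"
  obtain s where s: "0 \<le> s" "s \<le> 2 * norm z + 5" "filling_curve s = z"
    using filling_curve_onto by metis
  have cl: "closed ?S"
    using continuous_closed_preimage[OF continuous_filling_curve[where 'a = 'a] closed_UNIV, of "{z}"]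
    by (auto simp: Collect_conj_eq vimage_def intro!: closed_Int closed_Collect_le continuous_intros)
  have "Inf ?S \<in> ?S"
    by (rule closed_contains_Inf[OF _ _ cl]) (use s in \<open>auto intro!: bdd_belowI[of _ 0]\<close>)
  then show "0 \<le> filling_section z" "filling_curve (filling_section z) = z"
    unfolding filling_section_def by auto
  have "Inf ?S \<le> s"
    by (rule cInf_lower) (use s in \<open>auto intro!: bdd_belowI[of _ 0]\<close>)
  then show "filling_section z \<le> 2 * norm z + 5"
    unfolding filling_section_def using s by auto
qed

lemma borel_measurable_filling_section [measurable]:
  "(filling_section :: 'a::euclidean_space \<Rightarrow> real) \<in> borel_measurable borel"
proof (rule borel_measurableI_le)
  fix c :: real
  have "{z :: 'a. filling_section z \<le> c} = filling_curve ` {0..c}"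
  proof (intro set_eqI iffI)
    fix z :: 'a assume "z \<in> {z. filling_section z \<le> c}"
    then show "z \<in> filling_curve ` {0..c}"
      using filling_section[of z] by (auto intro!: image_eqI[of _ _ "filling_section z"])
  next
    fix z :: 'a assume "z \<in> filling_curve ` {0..c}"
    then obtain s where s: "0 \<le> s" "s \<le> c" "filling_curve s = z" by auto
    have "filling_section z \<le> s"
      unfolding filling_section_def
      by (rule cInf_lower) (use s in \<open>auto intro!: bdd_belowI[of _ 0]\<close>)
    then show "z \<in> {z. filling_section z \<le> c}" using s by auto
  qed
  moreover have "compact (filling_curve ` {0..c} :: 'a set)"
    by (intro compact_continuous_image continuous_on_subset[OF continuous_filling_curve]) auto
  ultimately show "{z \<in> space borel. filling_section (z :: 'a) \<le> c} \<in> sets borel"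
    by (simp add: borel_compact)
qed

text \<open>
  Pulled back to the line along a measurable section of the space-filling curve, the measures are
  tight there and subsequences converge by Helly's selection theorem.
\<close>

theorem prokhorov:
  fixes \<nu> :: "nat \<Rightarrow> 'a::euclidean_space measure"
  assumes \<nu>: "\<And>k. \<nu> k \<in> space (prob_algebra borel)"
    and tight: "\<And>e. e > 0 \<Longrightarrow> \<exists>R. \<forall>k. measure (\<nu> k) {z. norm z > R} \<le> e"
  obtains r \<pi> where "strict_mono (r :: nat \<Rightarrow> nat)" "\<pi> \<in> space (prob_algebra borel)"
    "\<And>g :: 'a \<Rightarrow> real. continuous_on UNIV g \<Longrightarrow> bounded (range g) \<Longrightarrow>
       (\<lambda>k. LINT z|\<nu> (r k). g z) \<longlonglongrightarrow> (LINT z|\<pi>. g z)"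
proof -
  have pr: "prob_space (\<nu> k)" and se [measurable_cong, simp]: "sets (\<nu> k) = sets borel" for k
    using \<nu>[of k] by (auto simp: space_prob_algebra)
  have sp [simp]: "space (\<nu> k) = UNIV" for k using sets_eq_imp_space_eq[OF se[of k]] by simp
  define \<sigma> where "\<sigma> k = distr (\<nu> k) borel filling_section" for k
  have rd: "real_distribution (\<sigma> k)" for k
  proof -
    have "prob_space (\<sigma> k)"
      unfolding \<sigma>_def by (rule prob_space.prob_space_distr[OF pr]) simp
    then show ?thesis
      unfolding real_distribution_def real_distribution_axioms_def \<sigma>_def by simp
  qed
  have "tight \<sigma>"
    unfolding tight_def
  proof (intro conjI allI impI)
    fix e :: real assume "e > 0"
    then obtain R where R: "\<And>k. measure (\<nu> k) {z. norm z > R} \<le> e / 2"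
      using tight[of "e / 2"] by auto
    \<comment> \<open>These are the constants of the bound on
      \<open>filling_section\<close>.\<close>
    define b where "b = 2 * \<bar>R\<bar> + 5"
    have "measure (\<sigma> k) {-1<..b} > 1 - e" for k
    proof -
      interpret prob_space "\<nu> k" by (rule pr)
      have "1 - e / 2 \<le> measure (\<nu> k) (space (\<nu> k) - {z. norm z > R})"
        using R[of k] by (subst prob_compl) (auto intro!: borel_open open_Collect_less continuous_intros)
      also have "\<dots> \<le> measure (\<nu> k) {z. filling_section z \<in> {-1<..b}}"
      proof (rule finite_measure_mono)
        show "space (\<nu> k) - {z. norm z > R} \<subseteq> {z. filling_section z \<in> {-1<..b}}"
        proof
          fix z assume "z \<in> space (\<nu> k) - {z. norm z > R}"
          then have "norm z \<le> R" by simp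
          then show "z \<in> {z. filling_section z \<in> {-1<..b}}"
            unfolding b_def using filling_section[of z] by auto
        qed
        have "Measurable.pred borel (\<lambda>z :: 'a. filling_section z \<in> {-1<..b})" by measurable
        then show "{z. filling_section z \<in> {-1<..b}} \<in> events"
          by (simp add: pred_def)
      qed
      also have "\<dots> = measure (\<sigma> k) {-1<..b}"
        unfolding \<sigma>_def by (subst measure_distr) (auto intro!: arg_cong[of _ _ "measure (\<nu> k)"])
      finally show ?thesis using \<open>e > 0\<close> by simp
    qed
    then show "\<exists>a b. a < b \<and> (\<forall>k. measure (\<sigma> k) {a<..b} > 1 - e)"
      by (intro exI[of _ "-1"] exI[of _ b]) (auto simp: b_def)
  qed (rule rd)
  from tight_imp_convergent_subsubsequence[OF this, of id]
  obtain r M where r: "strict_mono r" and M: "real_distribution M"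
    and wc: "weak_conv_m (\<sigma> \<circ> id \<circ> r) M"
    by (auto simp: strict_mono_id)
  interpret M: real_distribution M by (rule M)
  have [measurable]: "filling_curve \<in> M \<rightarrow>\<^sub>M (borel :: 'a measure)"
    using borel_measurable_continuous_onI[OF continuous_filling_curve]
    by (simp add: measurable_cong_sets[OF M.events_eq_borel refl])
  \<comment> \<open>The section is merely measurable, but the return trip uses the continuous curve,
    which inverts it: integrals of \<open>g\<close> against \<open>\<nu> k\<close> are integrals of
    the continuous function \<open>g (filling_curve s)\<close> on the line.\<close>
  define \<pi> where "\<pi> = distr M (borel :: 'a measure) filling_curve"
  have "\<pi> \<in> space (prob_algebra borel)"
    unfolding space_prob_algebra \<pi>_def
    by (auto intro!: M.prob_space_distr)
  moreover have "(\<lambda>k. LINT z|\<nu> (r k). g z) \<longlonglongrightarrow> (LINT z|\<pi>. g z)"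
    if g: "continuous_on UNIV g" and b: "bounded (range g)" for g :: "'a \<Rightarrow> real"
  proof -
    have gm [measurable]: "g \<in> borel_measurable borel"
      by (rule borel_measurable_continuous_onI[OF g])
    obtain B where B: "\<And>z. norm (g z) \<le> B"
      using b by (auto simp: bounded_iff)
    have "(\<lambda>k. integral\<^sup>L ((\<sigma> \<circ> id \<circ> r) k) (\<lambda>s. g (filling_curve s)))
        \<longlonglongrightarrow> integral\<^sup>L M (\<lambda>s. g (filling_curve s))"
    proof (rule weak_conv_imp_integral_bdd_continuous_conv[OF _ M wc])
      show "isCont (\<lambda>s. g (filling_curve s)) s" for s
        using continuous_on_compose2[OF g continuous_filling_curve] continuous_on_eq_continuous_at open_UNIV
        by blast
    qed (use B rd in auto)
    moreover have "integral\<^sup>L ((\<sigma> \<circ> id \<circ> r) k) (\<lambda>s. g (filling_curve s)) = (LINT z|\<nu> (r k). g z)" for k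
    proof -
      have "(\<lambda>s. g (filling_curve s)) \<in> borel_measurable borel"
        using borel_measurable_continuous_onI[OF continuous_filling_curve] by measurable
      then show ?thesis
        unfolding \<sigma>_def o_def by (subst integral_distr) (auto simp: filling_section)
    qed
    moreover have "integral\<^sup>L M (\<lambda>s. g (filling_curve s)) = (LINT z|\<pi>. g z)"
      unfolding \<pi>_def by (subst integral_distr) auto
    ultimately show ?thesis by simp
  qed
  ultimately show ?thesis using that[OF r] by blast
qed

subsection \<open>Test functions and vague limits\<close>

text \<open>The gradient is carried along as \<open>G\<close>, so that fluxes can be written as
  inner products with it and no derivative operator has to be unfolded later.\<close>

definition C1_fun :: "('a::euclidean_space \<Rightarrow> real) \<Rightarrow> ('a \<Rightarrow> 'a) \<Rightarrow> bool" where
  "C1_fun \<psi> G \<longleftrightarrow> (\<forall>x. (\<psi> has_derivative (\<lambda>w. G x \<bullet> w)) (at x)) \<and> continuous_on UNIV G"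

definition C1c_fun :: "('a::euclidean_space \<Rightarrow> real) \<Rightarrow> ('a \<Rightarrow> 'a) \<Rightarrow> bool" where
  "C1c_fun \<psi> G \<longleftrightarrow> C1_fun \<psi> G \<and> (\<exists>R. \<forall>x. norm x > R \<longrightarrow> \<psi> x = 0 \<and> G x = 0)"

lemma C1_funD:
  assumes "C1_fun \<psi> G"
  shows "(\<psi> has_derivative (\<lambda>w. G x \<bullet> w)) (at x)" "continuous_on A G" "continuous_on A \<psi>"
proof -
  show d: "(\<psi> has_derivative (\<lambda>w. G x \<bullet> w)) (at x)" for x
    using assms unfolding C1_fun_def by auto
  show "continuous_on A G"
    using assms unfolding C1_fun_def by (auto intro: continuous_on_subset)
  show "continuous_on A \<psi>"
    by (rule has_derivative_continuous_on[OF has_derivative_at_withinI[OF d]])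
qed

lemma C1c_funD:
  assumes "C1c_fun \<psi> G"
  shows "C1_fun \<psi> G" "\<exists>R>0. \<forall>x. norm x > R \<longrightarrow> \<psi> x = 0 \<and> G x = 0"
proof -
  show "C1_fun \<psi> G" using assms unfolding C1c_fun_def by auto
  obtain R where R: "\<forall>x. norm x > R \<longrightarrow> \<psi> x = 0 \<and> G x = 0"
    using assms unfolding C1c_fun_def by auto
  then show "\<exists>R>0. \<forall>x. norm x > R \<longrightarrow> \<psi> x = 0 \<and> G x = 0"
    by (intro exI[of _ "max 1 R"]) auto
qed

text \<open>Outside the ball the function is zero on an open set, so uniqueness of the derivative
  forces the gradient to vanish there too.\<close>

lemma C1c_funI:
  assumes \<psi>: "C1_fun \<psi> G" and R: "\<And>x. norm x > R \<Longrightarrow> \<psi> x = 0"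
  shows "C1c_fun \<psi> G"
proof -
  have "G x = 0" if "norm x > R" for x
  proof -
    have "((\<lambda>x. 0) has_derivative (\<lambda>w. G x \<bullet> w)) (at x)"
      using C1_funD(1)[OF \<psi>, of x]
    proof (rule has_derivative_transform_within_open[of _ _ _ _ "{y. norm y > R}"])
      show "open {y :: 'a. norm y > R}" by (intro open_Collect_less continuous_intros)
    qed (use that R in auto)
    then have "(\<lambda>w. G x \<bullet> w) = (\<lambda>w. 0)"
      using has_derivative_unique[OF _ has_derivative_const] by blast
    then show ?thesis by (metis inner_eq_zero_iff)
  qed
  then show ?thesis unfolding C1c_fun_def using assms by blast
qed

lemma compact_support_bounded:
  fixes g :: "'a::euclidean_space \<Rightarrow> 'b::real_normed_vector"
  assumes "continuous_on UNIV g" and "\<And>x. norm x > R \<Longrightarrow> g x = 0"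
  obtains B where "B > 0" "\<And>x. norm (g x) \<le> B"
proof -
  have "compact (g ` cball 0 R)"
    by (intro compact_continuous_image continuous_on_subset[OF assms(1)]) auto
  then have "bounded (g ` cball 0 R)" by (rule compact_imp_bounded)
  then obtain B where B: "B > 0" "\<And>x. x \<in> cball 0 R \<Longrightarrow> norm (g x) \<le> B"
    unfolding bounded_pos by blast
  have "norm (g x) \<le> B" for x
    using B assms(2)[of x] by (cases "norm x > R") auto
  then show ?thesis using that B by blast
qed

lemma C1c_fun_bounded:
  assumes "C1c_fun \<psi> G"
  obtains B where "B > 0" "\<And>x. \<bar>\<psi> x\<bar> \<le> B" "\<And>x. norm (G x) \<le> B"
proof -
  obtain R where R: "\<forall>x. norm x > R \<longrightarrow> \<psi> x = 0 \<and> G x = 0"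
    using C1c_funD(2)[OF assms] by auto
  obtain B1 where B1: "B1 > 0" "\<And>x. norm (\<psi> x) \<le> B1"
    by (rule compact_support_bounded[OF C1_funD(3)[OF C1c_funD(1)[OF assms]], of R]) (use R in auto)
  obtain B2 where B2: "B2 > 0" "\<And>x. norm (G x) \<le> B2"
    by (rule compact_support_bounded[OF C1_funD(2)[OF C1c_funD(1)[OF assms]], of R]) (use R in auto)
  show ?thesis
  proof (rule that[of "max B1 B2"])
    show "\<bar>\<psi> x\<bar> \<le> max B1 B2" for x using B1(2)[of x] by simp
    show "norm (G x) \<le> max B1 B2" for x using B2(2)[of x] by simp
  qed (use B1 in simp)
qed

lemma C1_fun_mult:
  assumes "C1_fun \<psi> G" "C1_fun \<zeta> H"
  shows "C1_fun (\<lambda>x. \<psi> x * \<zeta> x) (\<lambda>x. \<psi> x *\<^sub>R H x + \<zeta> x *\<^sub>R G x)"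
  unfolding C1_fun_def
proof (intro conjI allI)
  fix x
  show "((\<lambda>x. \<psi> x * \<zeta> x) has_derivative (\<lambda>w. (\<psi> x *\<^sub>R H x + \<zeta> x *\<^sub>R G x) \<bullet> w)) (at x)"
    using has_derivative_mult[OF C1_funD(1)[OF assms(1), of x] C1_funD(1)[OF assms(2), of x]]
    by (simp add: inner_add_left mult.commute)
qed (intro continuous_intros C1_funD[OF assms(1)] C1_funD[OF assms(2)])

lemma C1_fun_prod:
  assumes "finite I" "\<And>i. i \<in> I \<Longrightarrow> \<exists>G. C1_fun (\<psi> i) G"
  shows "\<exists>G. C1_fun (\<lambda>x. \<Prod>i\<in>I. \<psi> i x) G"
  using assms
proof (induction I rule: finite_induct)
  case empty
  have "C1_fun (\<lambda>x. 1) (\<lambda>x. 0)" 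
    unfolding C1_fun_def inner_zero_left by auto
  then show ?case by auto
next
  case (insert i I)
  obtain G where "C1_fun (\<psi> i) G" using insert.prems by blast
  moreover obtain H where "C1_fun (\<lambda>x. \<Prod>i\<in>I. \<psi> i x) H" using insert by blast
  ultimately have "\<exists>K. C1_fun (\<lambda>x. \<psi> i x * (\<Prod>i\<in>I. \<psi> i x)) K"
    using C1_fun_mult by blast
  then show ?case using insert.hyps by simp
qed

lemma C1_fun_compose:
  assumes "C1_fun \<psi> G" "\<And>s. (\<sigma> has_real_derivative \<sigma>' s) (at s)" "continuous_on UNIV \<sigma>'"
  shows "C1_fun (\<lambda>x. \<sigma> (\<psi> x)) (\<lambda>x. \<sigma>' (\<psi> x) *\<^sub>R G x)"
  unfolding C1_fun_def
proof (intro conjI allI)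
  fix x
  show "((\<lambda>x. \<sigma> (\<psi> x)) has_derivative (\<lambda>w. (\<sigma>' (\<psi> x) *\<^sub>R G x) \<bullet> w)) (at x)"
    using has_derivative_compose[OF C1_funD(1)[OF assms(1), of x] assms(2)[of "\<psi> x", unfolded has_field_derivative_def]]
    by simp
  show "continuous_on UNIV (\<lambda>x. \<sigma>' (\<psi> x) *\<^sub>R G x)"
    using C1_funD[OF assms(1)] by (auto intro!: continuous_intros continuous_on_compose2[OF assms(3)])
qed

section \<open>C1 bumps on boxes, and measures determined by test functions\<close>

definition pos_sq :: "real \<Rightarrow> real" where "pos_sq s = (max 0 s)\<^sup>2"

lemma pos_sq_deriv: "(pos_sq has_real_derivative 2 * max 0 s) (at s)"
proof -
  consider "s < 0" | "s = 0" | "s > 0" by linarith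
  then show ?thesis
  proof cases
    case 1
    have "((\<lambda>_. 0) has_real_derivative 2 * max 0 s) (at s)"
      using 1 by (auto intro!: derivative_eq_intros)
    then show ?thesis
      by (rule has_field_derivative_transform_within_open[of _ _ _ "{..<0}"])
         (use 1 in \<open>auto simp: pos_sq_def max_def\<close>)
  next
    case 2
    have "((\<lambda>h. (pos_sq (0 + h) - pos_sq 0) / h) \<longlongrightarrow> 0) (at 0)"
    proof (rule Lim_null_comparison)
      show "\<forall>\<^sub>F h in at 0. norm ((pos_sq (0 + h) - pos_sq 0) / h) \<le> \<bar>h\<bar>"
        by (rule always_eventually) (auto simp: pos_sq_def max_def power2_eq_square)
      show "((\<lambda>h::real. \<bar>h\<bar>) \<longlongrightarrow> 0) (at 0)"
        by (intro tendsto_rabs_zero tendsto_ident_at)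
    qed
    then show ?thesis using 2 by (simp add: DERIV_def)
  next
    case 3
    have "((\<lambda>s. s\<^sup>2) has_real_derivative 2 * max 0 s) (at s)"
      using 3 by (auto intro!: derivative_eq_intros)
    then show ?thesis
      by (rule has_field_derivative_transform_within_open[of _ _ _ "{0<..}"])
         (use 3 in \<open>auto simp: pos_sq_def max_def\<close>)
  qed
qed

text \<open>Squaring the positive part removes its corner at 0, and the quotient saturates at 1.
  Stretching the argument then gives C1 functions tending to the indicator of the open half-line,
  with value 0 at the end point itself.\<close>

definition sat_sq :: "real \<Rightarrow> real" where "sat_sq s = pos_sq s / (1 + pos_sq s)"

lemma pos_sq_nonneg: "0 \<le> pos_sq s" unfolding pos_sq_def by simp

lemma sat_sq_bounds: "0 \<le> sat_sq s" "sat_sq s \<le> 1" "s \<le> 0 \<Longrightarrow> sat_sq s = 0"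
proof -
  have "0 < 1 + pos_sq s" using pos_sq_nonneg[of s] by linarith
  then show "0 \<le> sat_sq s" "sat_sq s \<le> 1"
    unfolding sat_sq_def using pos_sq_nonneg[of s] by (simp_all add: divide_simps)
qed (simp add: sat_sq_def pos_sq_def max_def)

lemma sat_sq_deriv: "(sat_sq has_real_derivative 2 * max 0 s / (1 + pos_sq s)\<^sup>2) (at s)"
proof -
  have nz: "1 + pos_sq s \<noteq> 0" using pos_sq_nonneg[of s] by linarith
  have "((\<lambda>s. pos_sq s / (1 + pos_sq s)) has_real_derivative
      (2 * max 0 s * (1 + pos_sq s) - pos_sq s * (0 + 2 * max 0 s)) / ((1 + pos_sq s) * (1 + pos_sq s))) (at s)"
    by (intro DERIV_divide DERIV_add DERIV_const pos_sq_deriv nz)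
  then show ?thesis
    unfolding sat_sq_def by (simp add: power2_eq_square algebra_simps)
qed

lemma sat_sq_limit: "(\<lambda>n. sat_sq (real n * s)) \<longlonglongrightarrow> (if s > 0 then 1 else 0)"
proof (cases "s > 0")
  case True
  have "(\<lambda>n. 1 - 1 / (1 + (real n * s)\<^sup>2)) \<longlonglongrightarrow> 1 - 0"
    by (intro tendsto_diff tendsto_const, use True in real_asymp)
  moreover have "1 - 1 / (1 + (real n * s)\<^sup>2) = sat_sq (real n * s)" for n
  proof -
    have "1 + (real n * s)\<^sup>2 \<noteq> 0" by (metis add.commute sum_power2_eq_zero_iff one_neq_zero power_one)
    then show ?thesis
      unfolding sat_sq_def pos_sq_def using True by (simp add: max_def field_simps)
  qed
  ultimately show ?thesis using True by simp
next
  case False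
  then have "sat_sq (real n * s) = 0" for n
    by (intro sat_sq_bounds(3)) (auto simp: mult_nonneg_nonpos)
  then show ?thesis using False by simp
qed

definition box_bump :: "'a::euclidean_space \<Rightarrow> 'a \<Rightarrow> nat \<Rightarrow> 'a \<Rightarrow> real" where
  "box_bump a b n x =
     (\<Prod>i\<in>Basis. sat_sq (real n * (x \<bullet> i - a \<bullet> i)) * sat_sq (real n * (b \<bullet> i - x \<bullet> i)))"

lemma box_bump_bounds: "0 \<le> box_bump a b n x" "box_bump a b n x \<le> 1"
  unfolding box_bump_def
  by (rule prod_nonneg, rule mult_nonneg_nonneg; rule sat_sq_bounds)
     (rule prod_le_1, rule conjI, rule mult_nonneg_nonneg; (rule sat_sq_bounds | rule mult_le_one; rule sat_sq_bounds))

lemma C1c_box_bump: "\<exists>G. C1c_fun (box_bump a b n) G"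
proof -
  have c: "continuous_on UNIV (\<lambda>s. 2 * max 0 s / (1 + pos_sq s)\<^sup>2)"
    unfolding pos_sq_def
    by (intro continuous_intros) (metis add.commute add_nonneg_eq_0_iff one_neq_zero power_eq_0_iff zero_le_one zero_le_power2)
  have lin: "\<exists>G. C1_fun (\<lambda>x. real n * (c * (x \<bullet> i) + e)) G" for c e and i :: 'a
    by (rule exI[of _ "\<lambda>x. (real n * c) *\<^sub>R i"])
       (auto simp: C1_fun_def intro!: derivative_eq_intros simp: inner_commute)
  have 1: "\<exists>G. C1_fun (\<lambda>x. sat_sq (real n * (x \<bullet> i - a \<bullet> i))) G" for i
    using lin[of 1 i "- a \<bullet> i"] C1_fun_compose[OF _ sat_sq_deriv c] by fastforce
  have 2: "\<exists>G. C1_fun (\<lambda>x. sat_sq (real n * (b \<bullet> i - x \<bullet> i))) G" for i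
    using lin[of "-1" i "b \<bullet> i"] C1_fun_compose[OF _ sat_sq_deriv c] by fastforce
  have "\<exists>G. C1_fun (box_bump a b n) G"
    unfolding box_bump_def
    by (rule C1_fun_prod) (use 1 2 C1_fun_mult in \<open>simp, blast\<close>)
  then obtain G where G: "C1_fun (box_bump a b n) G" by blast
  have "bounded (cbox a b)" by simp
  then obtain R where R: "\<And>x. x \<in> cbox a b \<Longrightarrow> norm x \<le> R" by (auto simp: bounded_iff)
  have "box_bump a b n x = 0" if "norm x > R" for x
  proof -
    have "x \<notin> cbox a b" using R that by force
    then obtain i where i: "i \<in> Basis" "x \<bullet> i < a \<bullet> i \<or> b \<bullet> i < x \<bullet> i"
      unfolding mem_box by force
    then have "sat_sq (real n * (x \<bullet> i - a \<bullet> i)) * sat_sq (real n * (b \<bullet> i - x \<bullet> i)) = 0"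
      by (auto simp: sat_sq_bounds(3) mult_nonneg_nonpos)
    then show ?thesis unfolding box_bump_def using i by (intro prod_zero) auto
  qed
  then show ?thesis using C1c_funI[OF G] by blast
qed

lemma box_bump_limit: "(\<lambda>n. box_bump a b n x) \<longlonglongrightarrow> indicator (box a b) x"
proof -
  have "(\<lambda>n. box_bump a b n x) \<longlonglongrightarrow>
      (\<Prod>i\<in>Basis. (if x \<bullet> i - a \<bullet> i > 0 then 1 else 0) * (if b \<bullet> i - x \<bullet> i > 0 then 1 else 0))"
    unfolding box_bump_def by (intro tendsto_prod tendsto_mult sat_sq_limit)
  also have "(\<Prod>i\<in>Basis. (if x \<bullet> i - a \<bullet> i > 0 then 1 else 0) * (if b \<bullet> i - x \<bullet> i > 0 then 1 else 0))
      = (indicator (box a b) x :: real)"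
  proof (cases "x \<in> box a b")
    case True
    then show ?thesis by (auto simp: mem_box intro!: prod.neutral)
  next
    case False
    then obtain i where "i \<in> Basis" "\<not> (x \<bullet> i - a \<bullet> i > 0) \<or> \<not> (b \<bullet> i - x \<bullet> i > 0)"
      by (auto simp: mem_box)
    then show ?thesis using False by (auto intro!: prod_zero)
  qed
  finally show ?thesis .
qed

lemma C1c_fun_measurable:
  assumes "C1c_fun \<psi> G"
  shows "\<psi> \<in> borel_measurable borel" "G \<in> borel_measurable borel"
  by (rule borel_measurable_continuous_onI, rule C1_funD[OF C1c_funD(1)[OF assms]])+

lemma box_bump_measurable [measurable]: "box_bump a b n \<in> borel_measurable borel"
  using C1c_box_bump[of a b n] C1c_fun_measurable(1) by auto

lemma prob_algebra_borelD:
  assumes "M \<in> space (prob_algebra borel)"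
  shows "prob_space M" "sets M = sets borel" "space M = UNIV"
  using assms sets_eq_imp_space_eq[of M borel] by (auto simp: space_prob_algebra)

lemma box_bump_integral_limit:
  assumes "M \<in> space (prob_algebra borel)"
  shows "(\<lambda>n. LINT x|M. box_bump a b n x) \<longlonglongrightarrow> measure M (box a b)"
proof -
  note M = prob_algebra_borelD[OF assms]
  interpret prob_space M by (rule M)
  note [measurable_cong] = M(2)
  have "(\<lambda>n. LINT x|M. box_bump a b n x) \<longlonglongrightarrow> (LINT x|M. indicator (box a b) x)"
  proof (rule integral_dominated_convergence[of _ _ _ "\<lambda>_. 1"])
    show "AE x in M. norm (box_bump a b n x) \<le> 1" for n
      by (rule AE_I2) (simp add: box_bump_bounds)
  qed (auto intro: box_bump_limit)
  then show ?thesis using M by simp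
qed

lemma prob_measure_eqI_boxes:
  fixes M N :: "'a::euclidean_space measure"
  assumes M: "M \<in> space (prob_algebra borel)" and N: "N \<in> space (prob_algebra borel)"
    and eq: "\<And>a b. measure M (box a b) = measure N (box a b)"
  shows "M = N"
proof -
  note M' = prob_algebra_borelD[OF M] note N' = prob_algebra_borelD[OF N]
  interpret M: prob_space M by (rule M') interpret N: prob_space N by (rule N')
  show ?thesis
  proof (rule measure_eqI_generator_eq[where E = "range (\<lambda>(a, b). box a b)" and \<Omega> = UNIV
        and A = "\<lambda>n. box (- real n *\<^sub>R One) (real n *\<^sub>R One)"])
    show "Int_stable (range (\<lambda>(a, b). box a b) :: 'a set set)"
      by (auto simp: Int_stable_def box_Int_box)
    show "sets M = sigma_sets UNIV (range (\<lambda>(a, b). box a b))"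
      "sets N = sigma_sets UNIV (range (\<lambda>(a, b). box a b))"
      using M' N' by (simp_all add: borel_eq_box)
    show "(\<Union>n. box (- real n *\<^sub>R One) (real n *\<^sub>R One)) = (UNIV :: 'a set)"
      using UN_box_eq_UNIV by simp
  qed (auto simp: eq M.emeasure_eq_measure N.emeasure_eq_measure)
qed

text \<open>Open boxes form an intersection-stable generator of the Borel sets, and their measures
  are limits of integrals of the bumps above.\<close>

lemma prob_measure_eqI_C1c:
  fixes M N :: "'a::euclidean_space measure"
  assumes M: "M \<in> space (prob_algebra borel)" and N: "N \<in> space (prob_algebra borel)"
    and eq: "\<And>\<psi> G. C1c_fun \<psi> G \<Longrightarrow> (LINT x|M. \<psi> x) = (LINT x|N. \<psi> x)"
  shows "M = N"
proof (rule prob_measure_eqI_boxes[OF M N])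
  fix a b :: 'a
  have "(LINT x|M. box_bump a b n x) = (LINT x|N. box_bump a b n x)" for n
    using C1c_box_bump eq by blast
  then show "measure M (box a b) = measure N (box a b)"
    using LIMSEQ_unique[OF box_bump_integral_limit[OF M, of a b]] box_bump_integral_limit[OF N, of a b] by simp
qed

section \<open>Logarithmic cutoffs and control of escaping mass\<close>

definition log_cutoff :: "real \<Rightarrow> 'a::euclidean_space \<Rightarrow> real" where
  "log_cutoff R x = pos_sq (1 - ln (1 + x \<bullet> x) / R)"

definition log_cutoff_grad :: "real \<Rightarrow> 'a::euclidean_space \<Rightarrow> 'a" where
  "log_cutoff_grad R x = (2 * max 0 (1 - ln (1 + x \<bullet> x) / R) * - (2 / (1 + x \<bullet> x)) / R) *\<^sub>R x"

lemma log_cutoff_zero: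
  assumes "R > 0" "norm x > exp R"
  shows "log_cutoff R x = 0"
proof -
  have "norm x > 1" using assms exp_gt_one[of R] by linarith
  then have "norm x * 1 \<le> norm x * norm x" by (intro mult_left_mono) auto
  then have "exp R \<le> 1 + x \<bullet> x" using assms by (simp add: dot_square_norm power2_eq_square)
  then have "R \<le> ln (1 + x \<bullet> x)"
    by (metis exp_gt_zero ln_exp ln_le_cancel_iff order_less_le_trans)
  then show ?thesis
    unfolding log_cutoff_def pos_sq_def using assms by (auto simp: max_def divide_simps)
qed

lemma C1c_log_cutoff:
  assumes "R > 0"
  shows "C1c_fun (log_cutoff R :: 'a::euclidean_space \<Rightarrow> real) (log_cutoff_grad R)"
proof (rule C1c_funI)
  have pos: "1 + x \<bullet> x > 0" for x :: 'a by (simp add: add_pos_nonneg)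
  have nz: "1 + x \<bullet> x \<noteq> 0" for x :: 'a using pos[of x] by simp
  have "C1_fun (\<lambda>x :: 'a. 1 - ln (1 + x \<bullet> x) / R) (\<lambda>x. (- (2 / (1 + x \<bullet> x)) / R) *\<^sub>R x)"
    unfolding C1_fun_def
  proof (intro conjI allI)
    fix x :: 'a
    show "((\<lambda>x :: 'a. 1 - ln (1 + x \<bullet> x) / R) has_derivative
        (\<lambda>w. ((- (2 / (1 + x \<bullet> x)) / R) *\<^sub>R x) \<bullet> w)) (at x)"
    proof -
      have "((\<lambda>x :: 'a. x \<bullet> x) has_derivative (\<lambda>w. x \<bullet> w + w \<bullet> x)) (at x)"
        by (intro has_derivative_inner has_derivative_ident)
      then have "((\<lambda>x :: 'a. 1 + x \<bullet> x) has_derivative (\<lambda>w. 2 * (x \<bullet> w))) (at x)"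
        by (auto intro!: derivative_eq_intros simp: inner_commute fun_eq_iff)
      from has_derivative_compose[OF this DERIV_ln[OF pos, unfolded has_field_derivative_def]]
      have "((\<lambda>x :: 'a. ln (1 + x \<bullet> x)) has_derivative (\<lambda>w. inverse (1 + x \<bullet> x) * (2 * (x \<bullet> w)))) (at x)" .
      from has_derivative_diff[OF has_derivative_const[of 1] has_derivative_mult_right[OF this, of "1 / R"]]
      show ?thesis by (simp add: divide_inverse mult.commute mult.left_commute)
    qed
  qed (use nz assms in \<open>auto intro!: continuous_intros\<close>)
  from C1_fun_compose[OF this pos_sq_deriv]
  show "C1_fun (log_cutoff R :: 'a \<Rightarrow> real) (log_cutoff_grad R)"
    unfolding log_cutoff_def log_cutoff_grad_def by (simp add: continuous_intros)
qed (rule log_cutoff_zero[OF assms])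

text \<open>The last bound is the reason for the logarithm: the gradient decays like
  \<open>1 / (R * (norm x + 1))\<close>, so its product with a field of linear growth is of order
  \<open>1 / R\<close> everywhere, at the price of a support of radius exponential in
  \<open>R\<close>. The third bound is the inequality \<open>(1 - a)\<close> squared at least
  \<open>1 - 2 * a\<close>, and lets the mass captured at time 0 be estimated.\<close>

lemma log_cutoff_bounds:
  assumes "R > 0"
  shows "0 \<le> log_cutoff R x" "log_cutoff R x \<le> 1"
    "1 - 2 * ln (1 + x \<bullet> x) / R \<le> log_cutoff R x"
    "norm (log_cutoff_grad R x) * (norm x + 1) \<le> 8 / R"
proof -
  define l where "l = ln (1 + x \<bullet> x)"
  have "l \<ge> 0" unfolding l_def by simp
  then have m: "0 \<le> max 0 (1 - l / R)" "max 0 (1 - l / R) \<le> 1" using assms by auto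
  show "0 \<le> log_cutoff R x" unfolding log_cutoff_def pos_sq_def by simp
  show "log_cutoff R x \<le> 1"
    unfolding log_cutoff_def pos_sq_def l_def[symmetric] using m by (simp add: power_le_one)
  have "1 - 2 * (l / R) \<le> (max 0 (1 - l / R))\<^sup>2"
  proof (cases "l / R \<le> 1")
    case True
    then have "(max 0 (1 - l / R))\<^sup>2 = 1 - 2 * (l / R) + (l / R)\<^sup>2"
      by (simp add: max_def power2_eq_square algebra_simps)
    then show ?thesis by simp
  next
    case False
    have "1 - 2 * (l / R) \<le> 0" using False by linarith
    then show ?thesis by (metis order_trans zero_le_power2)
  qed
  then show "1 - 2 * ln (1 + x \<bullet> x) / R \<le> log_cutoff R x"
    unfolding log_cutoff_def pos_sq_def l_def by simp
  have p: "1 + x \<bullet> x > 0" by (simp add: add_pos_nonneg)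
  have "norm x * (norm x + 1) \<le> 2 * (1 + x \<bullet> x)"
  proof -
    have "0 \<le> (norm x - 1)\<^sup>2" by simp
    then have "2 * norm x \<le> (norm x)\<^sup>2 + 1" by (simp add: power2_eq_square algebra_simps)
    then show ?thesis
      unfolding dot_square_norm using norm_ge_zero[of x]
      by (simp add: power2_eq_square algebra_simps) (smt (verit) zero_le_square)
  qed
  then have 2: "norm x * (norm x + 1) / (1 + x \<bullet> x) \<le> 2" using p by (simp add: divide_simps)
  have "norm (log_cutoff_grad R x) * (norm x + 1)
      = (4 / R) * max 0 (1 - l / R) * (norm x * (norm x + 1) / (1 + x \<bullet> x))"
    unfolding log_cutoff_grad_def l_def[symmetric] using m p assms
    by (simp add: abs_mult abs_divide ac_simps)
  also have "\<dots> \<le> (4 / R) * 1 * 2"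
    using m assms p 2 by (intro mult_mono) auto
  finally show "norm (log_cutoff_grad R x) * (norm x + 1) \<le> 8 / R" by simp
qed

lemma log_cutoff_integral_limit:
  assumes "M \<in> space (prob_algebra (borel :: 'a::euclidean_space measure))"
  shows "(\<lambda>k. LINT x|M. log_cutoff (real (Suc k)) x) \<longlonglongrightarrow> 1"
proof -
  note M = prob_algebra_borelD[OF assms]
  interpret prob_space M by (rule M)
  note [measurable_cong] = M(2)
  have "(\<lambda>k. LINT x|M. log_cutoff (real (Suc k)) x) \<longlonglongrightarrow> (LINT x|M. 1)"
  proof (rule integral_dominated_convergence[of _ _ _ "\<lambda>_. 1"])
    show "(\<lambda>x. log_cutoff (real (Suc k)) x) \<in> borel_measurable M" for k
      using C1c_fun_measurable(1)[OF C1c_log_cutoff[of "real (Suc k)"]] by measurable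
    have "(\<lambda>k. log_cutoff (real (Suc k)) x) \<longlonglongrightarrow> 1" for x :: 'a
    proof (rule tendsto_sandwich[of "\<lambda>k. 1 - 2 * ln (1 + x \<bullet> x) / real (Suc k)" _ _ "\<lambda>_. 1"])
      show "(\<lambda>k. 1 - 2 * ln (1 + x \<bullet> x) / real (Suc k)) \<longlonglongrightarrow> 1" by real_asymp
    qed (auto intro!: always_eventually log_cutoff_bounds simp del: of_nat_Suc)
    then show "AE x in M. (\<lambda>k. log_cutoff (real (Suc k)) x) \<longlonglongrightarrow> 1" by simp
    show "AE x in M. norm (log_cutoff (real (Suc k)) x) \<le> 1" for k
    proof (rule AE_I2)
      fix x :: 'a
      show "norm (log_cutoff (real (Suc k)) x) \<le> 1"
        using log_cutoff_bounds(1,2)[of "real (Suc k)" x] by (simp del: of_nat_Suc)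
    qed
  qed auto
  then show ?thesis by (simp add: prob_space)
qed

lemma log_cutoff_tail:
  assumes "M \<in> space (prob_algebra (borel :: 'a::euclidean_space measure))" "R > 0"
  shows "measure M {x. norm x > exp R} \<le> 1 - (LINT x|M. log_cutoff R x)"
proof -
  note M = prob_algebra_borelD[OF assms(1)]
  interpret prob_space M by (rule M)
  note [measurable_cong] = M(2)
  have [measurable]: "(log_cutoff R :: 'a \<Rightarrow> real) \<in> borel_measurable borel"
    by (rule C1c_fun_measurable(1)[OF C1c_log_cutoff[OF assms(2)]])
  have S: "{x :: 'a. norm x > exp R} \<in> sets borel"
    by (intro borel_open open_Collect_less continuous_intros)
  have i: "integrable M (log_cutoff R)"
    by (rule integrable_const_bound[of _ 1]) (auto simp: log_cutoff_bounds[OF assms(2)])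
  have "measure M {x. norm x > exp R} = (LINT x|M. indicator {x. norm x > exp R} x)"
    using S M by simp
  also have "\<dots> \<le> (LINT x|M. 1 - log_cutoff R x)"
  proof (rule integral_mono)
    show "integrable M (indicator {x. norm x > exp R} :: 'a \<Rightarrow> real)"
      by (rule integrable_const_bound[of _ 1]) (use S in \<open>auto simp: indicator_def\<close>)
    show "indicator {x. norm x > exp R} x \<le> 1 - log_cutoff R x" for x :: 'a
      using log_cutoff_bounds(1,2)[OF assms(2), of x] log_cutoff_zero[OF assms(2), of x]
      by (simp add: indicator_def)
  qed (use i in auto)
  also have "\<dots> = 1 - (LINT x|M. log_cutoff R x)" using i by (simp add: prob_space)
  finally show ?thesis .
qed

text \<open>No mass can escape because the limit already has mass one. A cutoff that captures almost
  all of \<open>\<pi>\<close> captures almost all of \<open>\<nu> k\<close> for large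
  \<open>k\<close>; each of the finitely many remaining measures has a cutoff of its own, and the
  largest radius serves all of them.\<close>

lemma tight_if_vague_limit_prob:
  fixes \<nu> :: "nat \<Rightarrow> 'a::euclidean_space measure"
  assumes \<nu>: "\<And>k. \<nu> k \<in> space (prob_algebra borel)" and \<pi>: "\<pi> \<in> space (prob_algebra borel)"
    and vague: "\<And>\<psi> G. C1c_fun \<psi> G \<Longrightarrow> (\<lambda>k. LINT x|\<nu> k. \<psi> x) \<longlonglongrightarrow> (LINT x|\<pi>. \<psi> x)"
    and "e > 0"
  shows "\<exists>R. \<forall>k. measure (\<nu> k) {z. norm z > R} \<le> e"
proof -
  have tail: "\<exists>j. 1 - (LINT x|M. log_cutoff (real (Suc j)) x) < e'" 
    if "M \<in> space (prob_algebra borel)" "e' > 0" for M :: "'a measure" and e'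
  proof -
    have "\<forall>\<^sub>F j in sequentially. (LINT x|M. log_cutoff (real (Suc j)) x) > 1 - e'"
      using order_tendstoD(1)[OF log_cutoff_integral_limit[OF that(1)], of "1 - e'"] that by simp
    then obtain j where "(LINT x|M. log_cutoff (real (Suc j)) x) > 1 - e'"
      by (auto simp: eventually_sequentially)
    then show ?thesis by (intro exI[of _ j]) simp
  qed
  obtain j where j: "1 - (LINT x|\<pi>. log_cutoff (real (Suc j)) x) < e"
    using tail[OF \<pi> \<open>e > 0\<close>] by blast
  have "(\<lambda>k. LINT x|\<nu> k. log_cutoff (real (Suc j)) x) \<longlonglongrightarrow> (LINT x|\<pi>. log_cutoff (real (Suc j)) x)"
    by (rule vague[OF C1c_log_cutoff]) simp
  then have "\<forall>\<^sub>F k in sequentially. (LINT x|\<nu> k. log_cutoff (real (Suc j)) x) > 1 - e"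
    by (rule order_tendstoD) (use j in simp)
  then obtain K where K: "\<And>k. k \<ge> K \<Longrightarrow> (LINT x|\<nu> k. log_cutoff (real (Suc j)) x) > 1 - e"
    by (auto simp: eventually_sequentially)
  have "\<forall>k. \<exists>i. 1 - (LINT x|\<nu> k. log_cutoff (real (Suc i)) x) < e"
    using tail[OF \<nu> \<open>e > 0\<close>] by blast
  then obtain i where i: "\<And>k. 1 - (LINT x|\<nu> k. log_cutoff (real (Suc (i k))) x) < e" by metis
  define R where "R = Max (insert (exp (real (Suc j))) ((\<lambda>k. exp (real (Suc (i k)))) ` {..K}))"
  have "measure (\<nu> k) {z. norm z > R} \<le> e" for k
  proof -
    note M = prob_algebra_borelD[OF \<nu>[of k]]
    interpret prob_space "\<nu> k" by (rule M)
    obtain m where m: "exp (real (Suc m)) \<le> R" "1 - (LINT x|\<nu> k. log_cutoff (real (Suc m)) x) < e"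
    proof (cases "k \<le> K")
      case True
      have "exp (real (Suc (i k))) \<le> R" unfolding R_def by (rule Max_ge) (use True in auto)
      then show ?thesis using that i by blast
    next
      case False
      have "exp (real (Suc j)) \<le> R" unfolding R_def by (rule Max_ge) auto
      then show ?thesis using that[of j] K[of k] False by simp
    qed
    have "measure (\<nu> k) {z. norm z > R} \<le> measure (\<nu> k) {z. norm z > exp (real (Suc m))}"
      by (rule finite_measure_mono)
         (use m in \<open>auto simp: M intro!: borel_open open_Collect_less continuous_intros simp del: of_nat_Suc\<close>)
    also have "\<dots> \<le> 1 - (LINT x|\<nu> k. log_cutoff (real (Suc m)) x)"
      by (rule log_cutoff_tail[OF \<nu>]) simp
    finally show ?thesis using m by simp
  qed
  then show ?thesis by blast
qed

text \<open>A subsequence whose integrals stay away from the claimed value would still be tight,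
  hence have a further subsequence converging against all bounded continuous functions. Its limit
  agrees with \<open>\<pi>\<close> on C1 test functions and is therefore \<open>\<pi>\<close>, a
  contradiction.\<close>

lemma narrow_if_vague_limit_prob:
  fixes \<nu> :: "nat \<Rightarrow> 'a::euclidean_space measure"
  assumes \<nu>: "\<And>k. \<nu> k \<in> space (prob_algebra borel)" and \<pi>: "\<pi> \<in> space (prob_algebra borel)"
    and vague: "\<And>\<psi> G. C1c_fun \<psi> G \<Longrightarrow> (\<lambda>k. LINT x|\<nu> k. \<psi> x) \<longlonglongrightarrow> (LINT x|\<pi>. \<psi> x)"
    and g: "continuous_on UNIV (g :: 'a \<Rightarrow> real)" "bounded (range g)"
  shows "(\<lambda>k. LINT x|\<nu> k. g x) \<longlonglongrightarrow> (LINT x|\<pi>. g x)"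
proof (rule ccontr)
  assume "\<not> ?thesis"
  then obtain e where e: "e > 0"
    "\<not> (\<forall>\<^sub>F k in sequentially. dist (LINT x|\<nu> k. g x) (LINT x|\<pi>. g x) < e)"
    unfolding tendsto_iff by auto
  obtain s :: "nat \<Rightarrow> nat" where s: "strict_mono s"
    "\<And>k. \<not> dist (LINT x|\<nu> (s k). g x) (LINT x|\<pi>. g x) < e"
    using not_eventually_sequentiallyD[OF e(2)] by auto
  obtain r \<pi>' where r: "strict_mono r" "\<pi>' \<in> space (prob_algebra borel)"
    and conv: "\<And>g :: 'a \<Rightarrow> real. continuous_on UNIV g \<Longrightarrow> bounded (range g) \<Longrightarrow>
       (\<lambda>k. LINT z|\<nu> (s (r k)). g z) \<longlonglongrightarrow> (LINT z|\<pi>'. g z)"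
  proof (rule prokhorov[of "\<lambda>k. \<nu> (s k)"])
    show "\<exists>R. \<forall>k. measure (\<nu> (s k)) {z. R < norm z} \<le> e" if "e > 0" for e
    proof -
      have "\<exists>R. \<forall>k. measure (\<nu> k) {z. R < norm z} \<le> e"
        by (rule tight_if_vague_limit_prob[OF \<nu> \<pi> _ that]) (rule vague)
      then show ?thesis by blast
    qed
  qed (use \<nu> in auto)
  have "\<pi>' = \<pi>"
  proof (rule prob_measure_eqI_C1c[OF r(2) \<pi>])
    fix \<psi> :: "'a \<Rightarrow> real" and G assume c: "C1c_fun \<psi> G"
    obtain B where B: "\<And>x. \<bar>\<psi> x\<bar> \<le> B" using C1c_fun_bounded[OF c] by blast
    have "(\<lambda>k. LINT z|\<nu> (s (r k)). \<psi> z) \<longlonglongrightarrow> (LINT z|\<pi>'. \<psi> z)"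
      by (rule conv) (use C1_funD[OF C1c_funD(1)[OF c]] B in \<open>auto simp: bounded_iff\<close>)
    moreover have "(\<lambda>k. LINT z|\<nu> (s (r k)). \<psi> z) \<longlonglongrightarrow> (LINT z|\<pi>. \<psi> z)"
      using LIMSEQ_subseq_LIMSEQ[OF vague[OF c] strict_mono_o[OF s(1) r(1)]] by (simp add: o_def)
    ultimately show "(LINT x|\<pi>'. \<psi> x) = (LINT x|\<pi>. \<psi> x)" by (rule LIMSEQ_unique)
  qed
  then have "(\<lambda>k. LINT z|\<nu> (s (r k)). g z) \<longlonglongrightarrow> (LINT z|\<pi>. g z)" using conv[OF g] by simp
  then have "\<forall>\<^sub>F k in sequentially. dist (LINT z|\<nu> (s (r k)). g z) (LINT z|\<pi>. g z) < e"
    using e(1) unfolding tendsto_iff by blast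
  then show False using s(2) by (auto simp: eventually_sequentially)
qed

subsection \<open>Commutators in the algebra of noncommutative power series\<close>

text \<open>Formal power series in noncommuting variables, given by their coefficients on words. The
  wrapper type permits an instance of \<open>ring_1\<close>, after which identities between
  commutators and inverses are settled by ring arithmetic.\<close>

typedef 'n ncs = "UNIV :: ('n list \<Rightarrow> real) set"
  morphisms nc_coeff Ncs by auto

setup_lifting type_definition_ncs

lemma ncs_eqI: "(\<And>w. nc_coeff a w = nc_coeff b w) \<Longrightarrow> a = b"
  by transfer auto

instantiation ncs :: (type) ring_1
begin

lift_definition zero_ncs :: "'a ncs" is "\<lambda>_. 0" .
lift_definition one_ncs :: "'a ncs" is "\<lambda>w. if w = [] then 1 else 0" .
lift_definition plus_ncs :: "'a ncs \<Rightarrow> 'a ncs \<Rightarrow> 'a ncs" is "\<lambda>c d w. c w + d w" .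
lift_definition minus_ncs :: "'a ncs \<Rightarrow> 'a ncs \<Rightarrow> 'a ncs" is "\<lambda>c d w. c w - d w" .
lift_definition uminus_ncs :: "'a ncs \<Rightarrow> 'a ncs" is "\<lambda>c w. - c w" .
lift_definition times_ncs :: "'a ncs \<Rightarrow> 'a ncs \<Rightarrow> 'a ncs" is
  "\<lambda>c d w. \<Sum>k\<le>length w. c (take k w) * d (drop k w)" .

instance
proof
  fix a b c :: "'a ncs"
  show "a * b * c = a * (b * c)"
  proof (rule ncs_eqI)
    fix w :: "'a list"
    define n where "n = length w"
    \<comment> \<open>Both bracketings sum over the ways to cut \<open>w\<close> into three pieces;
      \<open>f j l\<close> is the term whose first two pieces have lengths \<open>j\<close> and
      \<open>l\<close>.\<close>
    define f where "f j l = nc_coeff a (take j w) * nc_coeff b (take l (drop j w)) * nc_coeff c (drop (j + l) w)" for j l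
    have "nc_coeff (a * b * c) w = (\<Sum>k\<le>n. \<Sum>j\<le>k. f j (k - j))"
      unfolding times_ncs.rep_eq n_def[symmetric]
    proof (rule sum.cong[OF refl])
      fix k assume "k \<in> {..n}"
      then have k: "length (take k w) = k" unfolding n_def by simp
      show "(\<Sum>j\<le>length (take k w). nc_coeff a (take j (take k w)) * nc_coeff b (drop j (take k w))) * nc_coeff c (drop k w)
          = (\<Sum>j\<le>k. f j (k - j))"
        unfolding k sum_distrib_right f_def
        by (intro sum.cong refl) (auto simp: take_drop min_def)
    qed
    also have "\<dots> = (\<Sum>(j, l)\<in>{(j, l). j + l \<le> n}. f j l)"
      by (rule sum.triangle_reindex_eq[symmetric])
    also have "{(j, l). j + l \<le> n} = Sigma {..n} (\<lambda>j. {..n - j})" by auto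
    also have "(\<Sum>(j, l)\<in>Sigma {..n} (\<lambda>j. {..n - j}). f j l) = (\<Sum>j\<le>n. \<Sum>l\<le>n - j. f j l)"
      by (rule sum.Sigma[symmetric]) auto
    also have "\<dots> = nc_coeff (a * (b * c)) w"
      unfolding times_ncs.rep_eq n_def f_def
      by (simp add: sum_distrib_left mult.assoc add.commute)
    finally show "nc_coeff (a * b * c) w = nc_coeff (a * (b * c)) w" .
  qed
  show "1 * a = a"
  proof (rule ncs_eqI)
    fix w :: "'a list"
    have "nc_coeff (1 * a) w = (\<Sum>k\<le>length w. if k = 0 then nc_coeff a w else 0)"
      unfolding times_ncs.rep_eq one_ncs.rep_eq by (intro sum.cong refl) auto
    then show "nc_coeff (1 * a) w = nc_coeff a w" by simp
  qed
  show "a * 1 = a"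
  proof (rule ncs_eqI)
    fix w :: "'a list"
    have "nc_coeff (a * 1) w = (\<Sum>k\<le>length w. if k = length w then nc_coeff a w else 0)"
      unfolding times_ncs.rep_eq one_ncs.rep_eq by (intro sum.cong refl) auto
    then show "nc_coeff (a * 1) w = nc_coeff a w" by simp
  qed
  show "(a + b) * c = a * c + b * c" "a * (b + c) = a * b + a * c"
    by (transfer; simp add: algebra_simps sum.distrib fun_eq_iff)+
  show "(0 :: 'a ncs) \<noteq> 1"
  proof
    assume "(0 :: 'a ncs) = 1"
    then have "nc_coeff (0 :: 'a ncs) [] = nc_coeff 1 []" by simp
    then show False by (simp add: zero_ncs.rep_eq one_ncs.rep_eq)
  qed
qed (transfer; simp add: fun_eq_iff)+

end

text \<open>The powers of the ideal of series without constant term. Agreement up to higher order is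
  always expressed as the order of a difference.\<close>

definition nc_order :: "nat \<Rightarrow> 'n ncs \<Rightarrow> bool" where
  "nc_order k a \<longleftrightarrow> (\<forall>w. length w < k \<longrightarrow> nc_coeff a w = 0)"

lemma nc_order_arith:
  assumes "nc_order k a" "nc_order k b"
  shows "nc_order k (a + b)" "nc_order k (a - b)" "nc_order k (- a)"
  using assms unfolding nc_order_def
  by (auto simp: plus_ncs.rep_eq minus_ncs.rep_eq uminus_ncs.rep_eq)

lemma nc_order_mono: "nc_order k a \<Longrightarrow> j \<le> k \<Longrightarrow> nc_order j a"
  unfolding nc_order_def by auto

lemma nc_order_0: "nc_order 0 a"
  unfolding nc_order_def by auto

lemma nc_order_mult:
  assumes "nc_order k a" "nc_order l b"
  shows "nc_order (k + l) (a * b)"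
  unfolding nc_order_def times_ncs.rep_eq
proof (intro allI impI sum.neutral ballI)
  fix w :: "'a list" and j assume "length w < k + l" "j \<in> {..length w}"
  then have "length (take j w) < k \<or> length (drop j w) < l" by auto
  then show "nc_coeff a (take j w) * nc_coeff b (drop j w) = 0"
    using assms unfolding nc_order_def by auto
qed

section \<open>Letters, exponentials and programs of group commutators\<close>

definition nc_letter :: "'n \<Rightarrow> 'n ncs" where
  "nc_letter i = Ncs (\<lambda>w. if w = [i] then 1 else 0)"

text \<open>The exponential series of \<open>e\<close> times the letter \<open>i\<close>: the formal
  counterpart of the flow along the field \<open>F i\<close> with speed \<open>e\<close>.\<close>

definition nc_exp :: "real \<Rightarrow> 'n \<Rightarrow> 'n ncs" where
  "nc_exp e i = Ncs (\<lambda>w. if w = replicate (length w) i then e ^ length w / fact (length w) else 0)"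

lemma nc_coeff_letter: "nc_coeff (nc_letter i) w = (if w = [i] then 1 else 0)"
  unfolding nc_letter_def by (simp add: Ncs_inverse)

lemma nc_coeff_exp:
  "nc_coeff (nc_exp e i) w = (if w = replicate (length w) i then e ^ length w / fact (length w) else 0)"
  unfolding nc_exp_def by (simp add: Ncs_inverse)

text \<open>On a power of the letter this is the addition formula for the exponential series; any
  other word has no cut into two powers of \<open>i\<close>, so all terms of the product
  vanish.\<close>

lemma nc_exp_inverse: "nc_exp e i * nc_exp (- e) i = 1"
proof (rule ncs_eqI)
  fix w :: "'a list"
  show "nc_coeff (nc_exp e i * nc_exp (- e) i) w = nc_coeff 1 w"
  proof (cases "w = replicate (length w) i")
    case True
    define n where "n = length w"
    have w: "w = replicate n i" using True n_def by simp
    have "nc_coeff (nc_exp e i * nc_exp (- e) i) w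
        = (\<Sum>k\<le>n. (e ^ k /\<^sub>R fact k) * ((- e) ^ (n - k) /\<^sub>R fact (n - k)))"
      unfolding times_ncs.rep_eq nc_coeff_exp w
      by (intro sum.cong) (auto simp: min_def divide_inverse)
    also have "\<dots> = (e + - e) ^ n /\<^sub>R fact n"
      by (rule exp_series_add_commuting[symmetric]) simp
    also have "\<dots> = nc_coeff 1 w" unfolding w one_ncs.rep_eq by (cases n) auto
    finally show ?thesis .
  next
    case False
    have "\<not> (take k w = replicate (length (take k w)) i \<and> drop k w = replicate (length (drop k w)) i)" for k
    proof
      assume "take k w = replicate (length (take k w)) i \<and> drop k w = replicate (length (drop k w)) i"
      then have "w = replicate (length (take k w)) i @ replicate (length (drop k w)) i"
        by (metis append_take_drop_id)
      then have "w = replicate (length w) i"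
        by (metis append_take_drop_id length_append replicate_add)
      then show False using False by simp
    qed
    then have "nc_coeff (nc_exp e i * nc_exp (- e) i) w = 0"
      unfolding times_ncs.rep_eq nc_coeff_exp by (intro sum.neutral) auto
    moreover have "w \<noteq> []" using False by auto
    ultimately show ?thesis by (simp add: one_ncs.rep_eq)
  qed
qed

lemma nc_exp_expansion:
  "nc_order 2 (nc_exp 1 i - 1 - nc_letter i)" "nc_order 2 (nc_exp (- 1) i - 1 + nc_letter i)"
  unfolding nc_order_def
  by (auto simp: minus_ncs.rep_eq plus_ncs.rep_eq one_ncs.rep_eq nc_coeff_letter nc_coeff_exp
      less_2_cases_iff length_Suc_conv)

text \<open>A program is a list of instructions "follow the field \<open>F i\<close> with speed
  \<open>e\<close>"; all instructions are executed for one common time \<open>t\<close>.\<close>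

type_synonym 'n prog = "('n \<times> real) list"

text \<open>The first instruction is the leftmost factor. Evaluating a function at the end of a run
  pulls it back through the last flow first, so the operator of the first flow is applied
  last.\<close>

fun prog_series :: "'n prog \<Rightarrow> 'n ncs" where
  "prog_series [] = 1"
| "prog_series ((i, e) # p) = nc_exp e i * prog_series p"

definition prog_inv :: "'n prog \<Rightarrow> 'n prog" where
  "prog_inv p = rev (map (\<lambda>(i, e). (i, - e)) p)"

lemma prog_series_append: "prog_series (p @ q) = prog_series p * prog_series q"
  by (induction p rule: prog_series.induct) (auto simp: mult.assoc)

lemma prog_inv_simps: "prog_inv [] = []" "prog_inv ((i, e) # p) = prog_inv p @ [(i, - e)]"
  "prog_inv (p @ q) = prog_inv q @ prog_inv p" "prog_inv (prog_inv p) = p"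
  unfolding prog_inv_def by (auto simp: rev_map[symmetric] o_def case_prod_beta)

lemma prog_series_inv: "prog_series p * prog_series (prog_inv p) = 1"
proof (induction p rule: prog_series.induct)
  case (2 i e p)
  have "prog_series ((i, e) # p) * prog_series (prog_inv ((i, e) # p))
      = nc_exp e i * (prog_series p * prog_series (prog_inv p)) * nc_exp (- e) i"
    by (simp add: prog_inv_simps prog_series_append mult.assoc)
  then show ?case using 2 by (simp add: nc_exp_inverse)
qed (simp add: prog_inv_simps)

fun bracket_prog :: "'n list \<Rightarrow> 'n prog" where
  "bracket_prog [] = []"
| "bracket_prog [i] = [(i, 1)]"
| "bracket_prog (i # J) = [(i, 1)] @ bracket_prog J @ [(i, - 1)] @ prog_inv (bracket_prog J)"

fun lie_poly :: "'n list \<Rightarrow> 'n ncs" where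
  "lie_poly [] = 0"
| "lie_poly [i] = nc_letter i"
| "lie_poly (i # J) = nc_letter i * lie_poly J - lie_poly J * nc_letter i"

lemma nc_order_letter: "nc_order 1 (nc_letter i)"
  unfolding nc_order_def by (auto simp: nc_coeff_letter)

lemma nc_order_inverse:
  assumes inv: "p * p' = 1" and b: "nc_order k b" and k: "k \<ge> 1"
    and p: "nc_order (Suc k) (p - 1 - b)" and p'1: "nc_order 1 (p' - 1)"
  shows "nc_order (Suc k) (p' - 1 + b)"
proof -
  have "p' - 1 + b = - ((p - 1 - b) * p') - b * (p' - 1)"
    using inv by (simp add: algebra_simps)
  moreover have "nc_order (Suc k + 0) ((p - 1 - b) * p')"
    by (rule nc_order_mult[OF p nc_order_0])
  moreover have "nc_order (k + 1) (b * (p' - 1))"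
    by (rule nc_order_mult[OF b p'1])
  ultimately show ?thesis
    using nc_order_arith(2)[OF nc_order_arith(3)] by (simp only: add_0_right Suc_eq_plus1)
qed

lemma nc_order_prog_series: "nc_order 1 (prog_series p - 1)"
proof (induction p rule: prog_series.induct)
  case (2 i e p)
  have "nc_order 1 (nc_exp e i - 1)"
    unfolding nc_order_def by (auto simp: minus_ncs.rep_eq nc_coeff_exp one_ncs.rep_eq)
  then have "nc_order (1 + 0) ((nc_exp e i - 1) * prog_series p)"
    by (rule nc_order_mult[OF _ nc_order_0])
  moreover have "prog_series ((i, e) # p) - 1 = (nc_exp e i - 1) * prog_series p + (prog_series p - 1)"
    by (simp add: algebra_simps)
  ultimately show ?case using nc_order_arith(1)[OF _ 2] by (simp only: add_0_right)
qed (simp add: nc_order_def zero_ncs.rep_eq)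

text \<open>
  The group commutator \<open>p q p\<inverse> q\<inverse> = 1 + (pq - qp) p\<inverse> q\<inverse>\<close> of \<open>p = 1 + X + \<dots>\<close> and
  \<open>q = 1 + b + \<dots>\<close> has leading term \<open>Xb - bX\<close>.
\<close>

lemma bracket_prog_series:
  assumes "I \<noteq> []"
  shows "nc_order (length I) (lie_poly I)"
    "nc_order (Suc (length I)) (prog_series (bracket_prog I) - 1 - lie_poly I)"
  using assms
proof (induction I rule: lie_poly.induct)
  case (2 i)
  { case 1 then show ?case using nc_order_letter by simp }
  { case 2 then show ?case using nc_exp_expansion(1) by (simp add: numeral_2_eq_2) }
next
  case (3 i j J)
  define K where "K = j # J"
  define k where "k = length K"
  define X where "X = nc_letter i"
  define b where "b = lie_poly K"
  define p where "p = nc_exp 1 i"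
  define p' where "p' = nc_exp (- 1) i"
  define q where "q = prog_series (bracket_prog K)"
  define q' where "q' = prog_series (prog_inv (bracket_prog K))"
  have b: "nc_order k b" and q: "nc_order (Suc k) (q - 1 - b)"
    using 3 unfolding k_def b_def q_def K_def by auto
  have X: "nc_order 1 X" unfolding X_def by (rule nc_order_letter)
  have p: "nc_order 2 (p - 1 - X)" unfolding p_def X_def by (rule nc_exp_expansion)
  have p1: "nc_order 1 (p - 1)"
    using nc_order_arith(1)[OF nc_order_mono[OF p, of 1] X] by simp
  have q1: "nc_order k (q - 1)"
    using nc_order_arith(1)[OF nc_order_mono[OF q, of k] b] by simp
  have pp: "p * p' = 1" unfolding p_def p'_def by (rule nc_exp_inverse)
  have qq: "q * q' = 1" unfolding q_def q'_def by (rule prog_series_inv)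
  have lie: "lie_poly (i # K) = X * b - b * X" unfolding K_def X_def b_def by simp
  have "nc_order (Suc k) (X * b)" "nc_order (Suc k) (b * X)"
    using nc_order_mult[OF X b] nc_order_mult[OF b X] by simp_all
  then have ord: "nc_order (Suc k) (X * b - b * X)" by (rule nc_order_arith)
  { case 1 show ?case using ord lie unfolding k_def K_def by simp }
  { case 2
    have pq': "nc_order 1 (p' * q' - 1)"
      using nc_order_prog_series[of "(i, - 1) # prog_inv (bracket_prog K)"] unfolding p'_def q'_def by simp
    have qpinv: "q * p * (p' * q') = 1"
      using pp qq by (metis mult.assoc mult.right_neutral)
    have "prog_series (bracket_prog (i # K)) = p * q * (p' * q')"
      unfolding K_def p_def q_def p'_def q'_def by (simp add: prog_series_append mult.assoc)
    then have "prog_series (bracket_prog (i # K)) - 1 = (p * q - q * p) * (p' * q')"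
      using qpinv by (simp add: algebra_simps)
    \<comment> \<open>Constant terms commute with everything; removing them exposes the orders
      \<open>1\<close> and \<open>k\<close> of the two factors.\<close>
    also have "p * q - q * p = (p - 1) * (q - 1) - (q - 1) * (p - 1)"
      by (simp add: algebra_simps)
    also have "\<dots> = (X * b - b * X) + (((p - 1 - X) * (q - 1) + X * (q - 1 - b))
        - ((q - 1 - b) * (p - 1) + b * (p - 1 - X)))" (is "_ = _ + ?r")
      by (simp add: algebra_simps)
    finally have eq: "prog_series (bracket_prog (i # K)) - 1 - (X * b - b * X)
        = (X * b - b * X) * (p' * q' - 1) + ?r * (p' * q')"
      by (simp add: algebra_simps)
    have "nc_order (Suc (Suc k)) ?r"
    proof (intro nc_order_arith)
      show "nc_order (Suc (Suc k)) ((p - 1 - X) * (q - 1))" using nc_order_mult[OF p q1] by simp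
      show "nc_order (Suc (Suc k)) (X * (q - 1 - b))" using nc_order_mult[OF X q] by simp
      show "nc_order (Suc (Suc k)) ((q - 1 - b) * (p - 1))" using nc_order_mult[OF q p1] by simp
      show "nc_order (Suc (Suc k)) (b * (p - 1 - X))" using nc_order_mult[OF b p] by simp
    qed
    then have "nc_order (Suc (Suc k)) (?r * (p' * q'))"
      using nc_order_mult[OF _ nc_order_0] by fastforce
    moreover have "nc_order (Suc (Suc k)) ((X * b - b * X) * (p' * q' - 1))"
      using nc_order_mult[OF ord pq'] by simp
    ultimately have "nc_order (Suc (Suc k)) (prog_series (bracket_prog (i # K)) - 1 - (X * b - b * X))"
      unfolding eq by (intro nc_order_arith)
    then show ?case using lie unfolding k_def K_def by simp }
qed auto

text \<open>The inverse program moves along the negative of the bracket. Reversing time would not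
  achieve this for brackets of even length, since the leading displacement carries the factor
  \<open>t ^ length I\<close>.\<close>

lemma bracket_prog_inv_series:
  assumes "I \<noteq> []"
  shows "nc_order (Suc (length I)) (prog_series (prog_inv (bracket_prog I)) - 1 + lie_poly I)"
  by (rule nc_order_inverse[OF prog_series_inv bracket_prog_series(1)[OF assms] _
        bracket_prog_series(2)[OF assms] nc_order_prog_series])
     (use assms in \<open>simp add: Suc_le_eq\<close>)

subsection \<open>Smooth vector fields\<close>

lemma Ck_on_UNIV_Suc:
  "Ck_on (Suc k) UNIV f \<longleftrightarrow>
     (\<forall>x. f differentiable (at x)) \<and> (\<forall>v. Ck_on k UNIV (\<lambda>x. frechet_derivative f (at x) v))"
  by simp

lemma Ck_on_SucD: "Ck_on (Suc k) UNIV f \<Longrightarrow> Ck_on k UNIV f"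
proof (induction k arbitrary: f)
  case 0
  then show ?case
    by (auto intro!: continuous_at_imp_continuous_on differentiable_imp_continuous_within)
next
  case (Suc k)
  then show ?case unfolding Ck_on_UNIV_Suc by blast
qed

lemma has_derivative_frechet:
  "f differentiable (at x) \<Longrightarrow> (f has_derivative frechet_derivative f (at x)) (at x)"
  by (rule frechet_derivative_works[THEN iffD1])

lemma Ck_on_add:
  assumes "Ck_on k UNIV f" "Ck_on k UNIV g"
  shows "Ck_on k UNIV (\<lambda>x. f x + g x)"
  using assms
proof (induction k arbitrary: f g)
  case (Suc k)
  have d: "f differentiable (at x)" "g differentiable (at x)" for x
    using Suc.prems by auto
  have "frechet_derivative (\<lambda>x. f x + g x) (at x) v = frechet_derivative f (at x) v + frechet_derivative g (at x) v" for x v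
    by (rule fun_cong[OF frechet_derivative_at[symmetric, OF has_derivative_add[OF has_derivative_frechet[OF d(1)] has_derivative_frechet[OF d(2)]]]])
  then show ?case
    unfolding Ck_on_UNIV_Suc using d Suc by (auto intro!: Suc.IH)
qed (auto intro!: continuous_intros)

lemma Ck_on_scaleR:
  fixes f :: "'a::euclidean_space \<Rightarrow> real" and g :: "'a \<Rightarrow> 'b::real_normed_vector"
  assumes "Ck_on k UNIV f" "Ck_on k UNIV g"
  shows "Ck_on k UNIV (\<lambda>x. f x *\<^sub>R g x)"
  using assms
proof (induction k arbitrary: f g)
  case (Suc k)
  have d: "f differentiable (at x)" "g differentiable (at x)" for x
    using Suc.prems by auto
  have "frechet_derivative (\<lambda>x. f x *\<^sub>R g x) (at x) v
      = f x *\<^sub>R frechet_derivative g (at x) v + frechet_derivative f (at x) v *\<^sub>R g x" for x v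
    by (rule fun_cong[OF frechet_derivative_at[symmetric, OF has_derivative_scaleR[OF has_derivative_frechet[OF d(1)] has_derivative_frechet[OF d(2)]]]])
  then show ?case
    unfolding Ck_on_UNIV_Suc using d Suc Ck_on_SucD[OF Suc.prems(1)] Ck_on_SucD[OF Suc.prems(2)]
    by (auto intro!: Ck_on_add Suc.IH)
qed (auto intro!: continuous_intros)

lemma Ck_on_const: "Ck_on k UNIV (\<lambda>x. c)"
  by (induction k arbitrary: c) auto

lemma Ck_on_sum:
  assumes "\<And>i. i \<in> I \<Longrightarrow> Ck_on k UNIV (f i)"
  shows "Ck_on k UNIV (\<lambda>x. \<Sum>i\<in>I. f i x)"
  using assms by (induction I rule: infinite_finite_induct) (auto intro!: Ck_on_add Ck_on_const)

lemma Ck_on_bounded_linear: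
  assumes "bounded_linear L" "Ck_on k UNIV f"
  shows "Ck_on k UNIV (\<lambda>x. L (f x))"
  using assms(2)
proof (induction k arbitrary: f)
  case 0
  then show ?case by (auto intro!: bounded_linear.continuous_on[OF assms(1)])
next
  case (Suc k)
  have d: "f differentiable (at x)" for x using Suc.prems by auto
  note D = bounded_linear.has_derivative[OF assms(1) has_derivative_frechet[OF d]]
  have "frechet_derivative (\<lambda>x. L (f x)) (at x) v = L (frechet_derivative f (at x) v)" for x v
    by (rule fun_cong[OF frechet_derivative_at[symmetric, OF D]])
  then show ?case
    unfolding Ck_on_UNIV_Suc using D Suc by (auto simp: differentiable_def)
qed

lemma smooth_on_UNIV_intros:
  fixes f :: "'a::euclidean_space \<Rightarrow> real" and g h :: "'a \<Rightarrow> 'b::real_normed_vector"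
  shows "smooth_on UNIV g \<Longrightarrow> smooth_on UNIV h \<Longrightarrow> smooth_on UNIV (\<lambda>x. g x + h x)"
    and "smooth_on UNIV f \<Longrightarrow> smooth_on UNIV g \<Longrightarrow> smooth_on UNIV (\<lambda>x. f x *\<^sub>R g x)"
    and "bounded_linear L \<Longrightarrow> smooth_on UNIV g \<Longrightarrow> smooth_on UNIV (\<lambda>x. L (g x))"
    and "(\<And>i. i \<in> I \<Longrightarrow> smooth_on UNIV (G i)) \<Longrightarrow> smooth_on UNIV (\<lambda>x. \<Sum>i\<in>I. G i x :: 'b)"
    and "smooth_on UNIV (\<lambda>x :: 'a. c :: 'b)"
  unfolding smooth_on_def
      apply (blast intro: Ck_on_add)
     apply (blast intro: Ck_on_scaleR)
    apply (simp add: Ck_on_bounded_linear)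
   apply (simp add: Ck_on_sum)
  apply (simp add: Ck_on_const)
  done

lemma smooth_onD:
  assumes "smooth_on UNIV f"
  shows "f differentiable (at x)" "smooth_on UNIV (\<lambda>x. frechet_derivative f (at x) v)"
    "continuous_on A f" "(f has_derivative frechet_derivative f (at x)) (at x)"
proof -
  have S: "Ck_on (Suc k) UNIV f" for k using assms unfolding smooth_on_def by blast
  show d: "f differentiable (at x)" using S[of 0] by simp
  show "smooth_on UNIV (\<lambda>x. frechet_derivative f (at x) v)"
    unfolding smooth_on_def using S unfolding Ck_on_UNIV_Suc by blast
  have "Ck_on 0 UNIV f" using assms unfolding smooth_on_def by blast
  then show "continuous_on A f" by (auto intro: continuous_on_subset)
  show "(f has_derivative frechet_derivative f (at x)) (at x)"
    by (rule has_derivative_frechet[OF d])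
qed

lemma smooth_on_id: "smooth_on UNIV (\<lambda>x :: 'a::euclidean_space. x)"
  unfolding smooth_on_def
proof
  fix k show "Ck_on k UNIV (\<lambda>x :: 'a. x)"
    by (cases k) (auto simp: frechet_derivative_at[symmetric, OF has_derivative_ident] Ck_on_const)
qed

section \<open>Vector fields as first-order differential operators\<close>

lemma frechet_derivative_basis:
  assumes "f differentiable (at x)"
  shows "frechet_derivative f (at x) v = (\<Sum>b\<in>Basis. (v \<bullet> b) *\<^sub>R frechet_derivative f (at x) b)"
proof -
  interpret bounded_linear "frechet_derivative f (at x)"
    by (rule has_derivative_bounded_linear[OF has_derivative_frechet[OF assms]])
  have "frechet_derivative f (at x) v = frechet_derivative f (at x) (\<Sum>b\<in>Basis. (v \<bullet> b) *\<^sub>R b)"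
    by (simp add: euclidean_representation)
  then show ?thesis by (simp add: sum scaleR)
qed

definition vf_op :: "('a::euclidean_space \<Rightarrow> 'a) \<Rightarrow> ('a \<Rightarrow> 'b::real_normed_vector) \<Rightarrow> 'a \<Rightarrow> 'b" where
  "vf_op g \<phi> x = frechet_derivative \<phi> (at x) (g x)"

text \<open>\<open>Ck_on\<close> speaks of derivatives in fixed directions only. The expansion in a
  basis turns the moving direction \<open>g x\<close> into smooth scalar factors, and smoothness of
  \<open>vf_op g \<phi>\<close> becomes a statement about sums and products.\<close>

lemma vf_op_basis:
  assumes "smooth_on UNIV \<phi>"
  shows "vf_op g \<phi> = (\<lambda>x. \<Sum>b\<in>Basis. (g x \<bullet> b) *\<^sub>R frechet_derivative \<phi> (at x) b)"
  unfolding vf_op_def fun_eq_iff using frechet_derivative_basis[OF smooth_onD(1)[OF assms]] by blast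

lemma smooth_vf_op:
  assumes "smooth_on UNIV g" "smooth_on UNIV \<phi>"
  shows "smooth_on UNIV (vf_op g \<phi>)"
  unfolding vf_op_basis[OF assms(2)]
proof (rule smooth_on_UNIV_intros(4), rule smooth_on_UNIV_intros(2))
  show "smooth_on UNIV (\<lambda>x. g x \<bullet> b)" for b
    by (rule smooth_on_UNIV_intros(3)[OF bounded_linear_inner_left assms(1)])
qed (rule smooth_onD(2)[OF assms(2)])

lemma smooth_lie_bracket:
  assumes "smooth_on UNIV g" "smooth_on UNIV h"
  shows "smooth_on UNIV (lie_bracket g h)"
proof -
  have eq: "lie_bracket g h = (\<lambda>x. vf_op g h x + (- 1) *\<^sub>R vf_op h g x)"
    unfolding lie_bracket_def vf_op_def by auto
  show ?thesis
    unfolding eq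
    by (intro smooth_on_UNIV_intros(1) smooth_on_UNIV_intros(2)[of "\<lambda>_. - 1"] smooth_on_UNIV_intros(5) smooth_vf_op assms)
qed

text \<open>The mean value theorem is used twice: along \<open>v\<close> for the increment in
  direction \<open>w\<close>, then along \<open>w\<close> for the derivative in direction
  \<open>v\<close>.\<close>

lemma second_difference_mvt:
  fixes \<phi> :: "'a::euclidean_space \<Rightarrow> real"
  assumes \<phi>: "smooth_on UNIV \<phi>" and h: "h > 0"
  obtains s t where "0 < s" "s < h" "0 < t" "t < h"
    "\<phi> (x + h *\<^sub>R v + h *\<^sub>R w) - \<phi> (x + h *\<^sub>R v) - \<phi> (x + h *\<^sub>R w) + \<phi> x
      = h * h * frechet_derivative (\<lambda>x. frechet_derivative \<phi> (at x) v) (at (x + s *\<^sub>R v + t *\<^sub>R w)) w"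
proof -
  define \<phi>v where "\<phi>v x = frechet_derivative \<phi> (at x) v" for x
  have \<phi>v: "smooth_on UNIV \<phi>v" unfolding \<phi>v_def by (rule smooth_onD(2)[OF \<phi>])
  have line: "((\<lambda>s. f (y + s *\<^sub>R u)) has_real_derivative frechet_derivative f (at (y + s *\<^sub>R u)) u) (at s)"
    if "smooth_on UNIV f" for f :: "'a \<Rightarrow> real" and y u s
  proof -
    have lin: "linear (frechet_derivative f (at (y + s *\<^sub>R u)))"
      by (rule has_derivative_linear[OF smooth_onD(4)[OF that]])
    have "((\<lambda>s. y + s *\<^sub>R u) has_derivative (\<lambda>k. k *\<^sub>R u)) (at s)"
      by (auto intro!: derivative_eq_intros)
    from has_derivative_compose[OF this smooth_onD(4)[OF that]]
    show ?thesis
      unfolding has_field_derivative_def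
      by (simp add: linear_cmul[OF lin] mult.commute[of _ "frechet_derivative f (at (y + s *\<^sub>R u)) u"])
  qed
  define \<Phi> where "\<Phi> s = \<phi> (x + s *\<^sub>R v + h *\<^sub>R w) - \<phi> (x + s *\<^sub>R v)" for s
  have d\<Phi>: "(\<Phi> has_real_derivative \<phi>v (x + s *\<^sub>R v + h *\<^sub>R w) - \<phi>v (x + s *\<^sub>R v)) (at s)" for s
    unfolding \<Phi>_def \<phi>v_def
    using DERIV_diff[OF line[OF \<phi>, of "x + h *\<^sub>R w" v s] line[OF \<phi>, of x v s]]
    by (simp add: add.commute add.left_commute)
  obtain s where s: "0 < s" "s < h"
    "\<Phi> h - \<Phi> 0 = (h - 0) * (\<phi>v (x + s *\<^sub>R v + h *\<^sub>R w) - \<phi>v (x + s *\<^sub>R v))"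
    using MVT2[OF h, of \<Phi> "\<lambda>s. \<phi>v (x + s *\<^sub>R v + h *\<^sub>R w) - \<phi>v (x + s *\<^sub>R v)"] d\<Phi> by blast
  obtain t where t: "0 < t" "t < h"
    "\<phi>v (x + s *\<^sub>R v + h *\<^sub>R w) - \<phi>v (x + s *\<^sub>R v + 0 *\<^sub>R w)
       = (h - 0) * frechet_derivative \<phi>v (at (x + s *\<^sub>R v + t *\<^sub>R w)) w"
    using MVT2[OF h, of "\<lambda>t. \<phi>v (x + s *\<^sub>R v + t *\<^sub>R w)"
        "\<lambda>t. frechet_derivative \<phi>v (at (x + s *\<^sub>R v + t *\<^sub>R w)) w"] line[OF \<phi>v] by blast
  show ?thesis
  proof (rule that[OF s(1,2) t(1,2)])
    show "\<phi> (x + h *\<^sub>R v + h *\<^sub>R w) - \<phi> (x + h *\<^sub>R v) - \<phi> (x + h *\<^sub>R w) + \<phi> x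
      = h * h * frechet_derivative (\<lambda>x. frechet_derivative \<phi> (at x) v) (at (x + s *\<^sub>R v + t *\<^sub>R w)) w"
      using s(3) t(3) unfolding \<Phi>_def \<phi>v_def by (simp add: algebra_simps)
  qed
qed

text \<open>The second difference does not change when \<open>v\<close> and \<open>w\<close> are
  exchanged, while its quotients tend to one or the other mixed derivative according to the order in
  which the mean value theorem is applied.\<close>

lemma second_derivative_symmetric:
  fixes \<phi> :: "'a::euclidean_space \<Rightarrow> real"
  assumes \<phi>: "smooth_on UNIV \<phi>"
  shows "frechet_derivative (\<lambda>x. frechet_derivative \<phi> (at x) v) (at x) w
       = frechet_derivative (\<lambda>x. frechet_derivative \<phi> (at x) w) (at x) v"
proof -
  define D where "D v w x = frechet_derivative (\<lambda>x. frechet_derivative \<phi> (at x) v) (at x) w" for v w x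
  define \<Delta> where "\<Delta> v w h = (\<phi> (x + h *\<^sub>R v + h *\<^sub>R w) - \<phi> (x + h *\<^sub>R v) - \<phi> (x + h *\<^sub>R w) + \<phi> x) / (h * h)" for v w h
  have lim: "(\<lambda>n. \<Delta> v w (1 / Suc n)) \<longlonglongrightarrow> D v w x" for v w
  proof -
    have "\<exists>s t. 0 < s \<and> s < 1 / Suc n \<and> 0 < t \<and> t < 1 / Suc n \<and>
        \<Delta> v w (1 / Suc n) = D v w (x + s *\<^sub>R v + t *\<^sub>R w)" for n
    proof -
      have h: "(0::real) < 1 / Suc n" by simp
      show ?thesis
        unfolding \<Delta>_def D_def by (rule second_difference_mvt[OF \<phi> h, of x v w]) (use h in force)
    qed
    then obtain s t where st: "\<And>n. 0 < s n" "\<And>n. s n < 1 / Suc n" "\<And>n. 0 < t n" "\<And>n. t n < 1 / Suc n"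
      "\<And>n. \<Delta> v w (1 / Suc n) = D v w (x + s n *\<^sub>R v + t n *\<^sub>R w)" by metis
    have inv0: "(\<lambda>n. 1 / real (Suc n)) \<longlonglongrightarrow> 0" using LIMSEQ_inverse_real_of_nat by (simp add: inverse_eq_divide)
    have "s \<longlonglongrightarrow> 0"
      by (rule tendsto_sandwich[OF _ _ tendsto_const inv0]) (use st in \<open>auto intro!: always_eventually less_imp_le\<close>)
    moreover have "t \<longlonglongrightarrow> 0"
      by (rule tendsto_sandwich[OF _ _ tendsto_const inv0]) (use st in \<open>auto intro!: always_eventually less_imp_le\<close>)
    ultimately have "(\<lambda>n. x + s n *\<^sub>R v + t n *\<^sub>R w) \<longlonglongrightarrow> x + 0 *\<^sub>R v + 0 *\<^sub>R w"
      by (intro tendsto_intros)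
    moreover have "isCont (D v w) x"
    proof -
      have "smooth_on UNIV (D v w)" unfolding D_def by (intro smooth_onD(2) \<phi>)
      then have "continuous_on UNIV (D v w)" by (rule smooth_onD(3))
      then show ?thesis by (simp add: continuous_on_eq_continuous_at)
    qed
    ultimately have "(\<lambda>n. D v w (x + s n *\<^sub>R v + t n *\<^sub>R w)) \<longlonglongrightarrow> D v w x"
      using isCont_tendsto_compose by fastforce
    then show ?thesis using st(5) by simp
  qed
  have "\<Delta> v w h = \<Delta> w v h" for h
    unfolding \<Delta>_def by (simp add: add.commute add.left_commute)
  then have "D v w x = D w v x"
    using LIMSEQ_unique[OF lim[of v w]] lim[of w v] by simp
  then show ?thesis unfolding D_def .
qed

lemma vf_op_deriv:
  fixes \<phi> :: "'a::euclidean_space \<Rightarrow> real"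
  assumes \<phi>: "smooth_on UNIV \<phi>" and h: "smooth_on UNIV h"
  shows "frechet_derivative (vf_op h \<phi>) (at x) u
    = (\<Sum>b\<in>Basis. (h x \<bullet> b) * frechet_derivative (\<lambda>y. frechet_derivative \<phi> (at y) b) (at x) u)
      + frechet_derivative \<phi> (at x) (frechet_derivative h (at x) u)"
proof -
  have D: "(vf_op h \<phi> has_derivative (\<lambda>u. \<Sum>b\<in>Basis.
      (h x \<bullet> b) *\<^sub>R frechet_derivative (\<lambda>y. frechet_derivative \<phi> (at y) b) (at x) u
      + (frechet_derivative h (at x) u \<bullet> b) *\<^sub>R frechet_derivative \<phi> (at x) b)) (at x)"
    unfolding vf_op_basis[OF \<phi>]
    by (intro has_derivative_sum has_derivative_scaleR has_derivative_inner_left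
        smooth_onD(4)[OF h] smooth_onD(4)[OF smooth_onD(2)[OF \<phi>]])
  have "frechet_derivative (vf_op h \<phi>) (at x) u = (\<Sum>b\<in>Basis.
      (h x \<bullet> b) *\<^sub>R frechet_derivative (\<lambda>y. frechet_derivative \<phi> (at y) b) (at x) u
      + (frechet_derivative h (at x) u \<bullet> b) *\<^sub>R frechet_derivative \<phi> (at x) b)"
    using fun_cong[OF frechet_derivative_at[OF D], of u, symmetric] by (simp only:)
  also have "\<dots> = (\<Sum>b\<in>Basis. (h x \<bullet> b) * frechet_derivative (\<lambda>y. frechet_derivative \<phi> (at y) b) (at x) u)
      + (\<Sum>b\<in>Basis. (frechet_derivative h (at x) u \<bullet> b) *\<^sub>R frechet_derivative \<phi> (at x) b)"
    by (simp only: sum.distrib real_scaleR_def)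
  also have "(\<Sum>b\<in>Basis. (frechet_derivative h (at x) u \<bullet> b) *\<^sub>R frechet_derivative \<phi> (at x) b)
      = frechet_derivative \<phi> (at x) (frechet_derivative h (at x) u)"
    by (rule frechet_derivative_basis[OF smooth_onD(1)[OF \<phi>], symmetric])
  finally show ?thesis .
qed

text \<open>Both compositions contain the Hessian of \<open>\<phi>\<close> evaluated at the two
  fields. By symmetry these second-order terms cancel, and what remains is first order with exactly
  the sign convention of \<open>lie_bracket\<close>.\<close>

lemma vf_op_lie_bracket:
  fixes \<phi> :: "'a::euclidean_space \<Rightarrow> real"
  assumes \<phi>: "smooth_on UNIV \<phi>" and g: "smooth_on UNIV g" and h: "smooth_on UNIV h"
  shows "vf_op (lie_bracket g h) \<phi> x = vf_op g (vf_op h \<phi>) x - vf_op h (vf_op g \<phi>) x"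
proof -
  define D where "D b c = frechet_derivative (\<lambda>y. frechet_derivative \<phi> (at y) b) (at x) c" for b c
  have exp: "(\<Sum>b\<in>Basis. (h x \<bullet> b) * D b (g x)) = (\<Sum>b\<in>Basis. \<Sum>c\<in>Basis. (h x \<bullet> b) * ((g x \<bullet> c) * D b c))" for g h
  proof (intro sum.cong refl)
    fix b :: 'a
    have "D b (g x) = (\<Sum>c\<in>Basis. (g x \<bullet> c) * D b c)"
      unfolding D_def
      unfolding real_scaleR_def[symmetric]
      by (rule frechet_derivative_basis[OF smooth_onD(1)[OF smooth_onD(2)[OF \<phi>]]])
    then show "(h x \<bullet> b) * D b (g x) = (\<Sum>c\<in>Basis. (h x \<bullet> b) * ((g x \<bullet> c) * D b c))"
      by (simp add: sum_distrib_left)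
  qed
  have "(\<Sum>b\<in>Basis. (h x \<bullet> b) * D b (g x)) = (\<Sum>b\<in>Basis. (g x \<bullet> b) * D b (h x))"
    unfolding exp
    by (subst sum.swap) (auto intro!: sum.cong simp: D_def second_derivative_symmetric[OF \<phi>])
  moreover have "linear (frechet_derivative \<phi> (at x))"
    by (rule has_derivative_linear[OF smooth_onD(4)[OF \<phi>]])
  ultimately show ?thesis
    unfolding vf_op_def[of g "vf_op h \<phi>"] vf_op_def[of h "vf_op g \<phi>"] vf_op_deriv[OF \<phi> g] vf_op_deriv[OF \<phi> h]
      vf_op_def[of "lie_bracket g h"] lie_bracket_def D_def
    by (simp add: linear_diff)
qed

text \<open>Letters act as Lie derivatives and concatenation of words as composition, so
  multiplication of series corresponds to composition of differential operators, up to
  truncation.\<close>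

fun word_op :: "('n \<Rightarrow> 'a::euclidean_space \<Rightarrow> 'a) \<Rightarrow> 'n list \<Rightarrow> ('a \<Rightarrow> real) \<Rightarrow> 'a \<Rightarrow> real" where
  "word_op F [] \<phi> = \<phi>"
| "word_op F (i # w) \<phi> = vf_op (F i) (word_op F w \<phi>)"

fun bracket_field :: "('n \<Rightarrow> 'a::euclidean_space \<Rightarrow> 'a) \<Rightarrow> 'n list \<Rightarrow> 'a \<Rightarrow> 'a" where
  "bracket_field F [] = (\<lambda>_. 0)"
| "bracket_field F [i] = F i"
| "bracket_field F (i # J) = lie_bracket (F i) (bracket_field F J)"

lemma word_op_append: "word_op F (v @ w) \<phi> = word_op F v (word_op F w \<phi>)"
  by (induction v) auto

lemma smooth_word_op:
  assumes "\<And>i. smooth_on UNIV (F i)" "smooth_on UNIV \<phi>"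
  shows "smooth_on UNIV (word_op F w \<phi>)"
  by (induction w) (auto intro: smooth_vf_op assms)

lemma smooth_bracket_field:
  assumes "\<And>i. smooth_on UNIV (F i)"
  shows "smooth_on UNIV (bracket_field F I)"
proof (induction I rule: lie_poly.induct)
  case 1
  then show ?case by (simp add: smooth_on_UNIV_intros(5))
qed (use assms in \<open>auto intro: smooth_lie_bracket\<close>)

lemma finite_words: "finite {w :: 'n::finite list. length w = n}" "finite {w :: 'n::finite list. length w \<le> n}"
  using finite_lists_length_eq[of "UNIV :: 'n set" n] finite_lists_length_le[of "UNIV :: 'n set" n] by auto

lemma nc_letter_mult_Cons: "nc_coeff (nc_letter i * b) (j # w) = (if j = i then nc_coeff b w else 0)"
proof -
  have "nc_coeff (nc_letter i * b) (j # w)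
      = (\<Sum>k\<le>length (j # w). if k = 1 then (if j = i then nc_coeff b w else 0) else 0)"
    unfolding times_ncs.rep_eq nc_coeff_letter
    by (intro sum.cong refl) (auto simp: take_Cons' drop_Cons')
  then show ?thesis by (cases w) (auto simp: Suc_le_eq)
qed

lemma nc_letter_mult_snoc: "nc_coeff (b * nc_letter i) (w @ [j]) = (if j = i then nc_coeff b w else 0)"
proof -
  have "nc_coeff (b * nc_letter i) (w @ [j])
      = (\<Sum>k\<le>length (w @ [j]). if k = length w then (if j = i then nc_coeff b w else 0) else 0)"
    unfolding times_ncs.rep_eq
  proof (intro sum.cong refl)
    fix k assume k: "k \<in> {..length (w @ [j])}"
    show "nc_coeff b (take k (w @ [j])) * nc_coeff (nc_letter i) (drop k (w @ [j]))
        = (if k = length w then if j = i then nc_coeff b w else 0 else 0)"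
    proof (cases "k = length w")
      case False
      then have "length (drop k (w @ [j])) \<noteq> 1" using k by auto
      then have "drop k (w @ [j]) \<noteq> [i]" by (metis length_Cons list.size(3) One_nat_def)
      then show ?thesis using False by (simp add: nc_coeff_letter)
    qed (simp add: nc_coeff_letter)
  qed
  then show ?thesis by simp
qed

lemma sum_words_Cons:
  fixes g :: "'n::finite list \<Rightarrow> real"
  shows "(\<Sum>w\<in>{w. length w = Suc n}. g w) = (\<Sum>j\<in>UNIV. \<Sum>w\<in>{w. length w = n}. g (j # w))"
proof -
  have "(\<Sum>w\<in>{w. length w = Suc n}. g w) = (\<Sum>(j, w)\<in>UNIV \<times> {w. length w = n}. g (j # w))"
    by (rule sum.reindex_bij_witness[of _ "\<lambda>(j, w). j # w" "\<lambda>w. (hd w, tl w)"])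
       (auto simp: length_Suc_conv)
  then show ?thesis by (simp add: sum.cartesian_product)
qed

lemma sum_words_snoc:
  fixes g :: "'n::finite list \<Rightarrow> real"
  shows "(\<Sum>w\<in>{w. length w = Suc n}. g w) = (\<Sum>j\<in>UNIV. \<Sum>w\<in>{w. length w = n}. g (w @ [j]))"
proof -
  have "(\<Sum>w\<in>{w. length w = Suc n}. g w) = (\<Sum>(j, w)\<in>UNIV \<times> {w. length w = n}. g (w @ [j]))"
    by (rule sum.reindex_bij_witness[of _ "\<lambda>(j, w). w @ [j]" "\<lambda>w. (last w, butlast w)"])
       (auto simp: length_Suc_conv_rev)
  then show ?thesis by (simp add: sum.cartesian_product)
qed

text \<open>The action of words is multiplicative, so the commutator of a letter with a Lie
  polynomial acts as the commutator of Lie derivatives, which is the Lie derivative along the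
  bracket. Stripping a first letter handles one product of the commutator, stripping a last letter
  the other.\<close>

lemma lie_poly_action:
  fixes F :: "'n::finite \<Rightarrow> 'a::euclidean_space \<Rightarrow> 'a"
  assumes F: "\<And>i. smooth_on UNIV (F i)" and "smooth_on UNIV \<phi>" "I \<noteq> []"
  shows "(\<Sum>w\<in>{w. length w = length I}. nc_coeff (lie_poly I) w * word_op F w \<phi> x)
       = vf_op (bracket_field F I) \<phi> x"
  using assms(2,3)
proof (induction I arbitrary: \<phi> x rule: lie_poly.induct)
  case (2 i)
  have "(\<Sum>w\<in>{w. length w = length [i]}. nc_coeff (lie_poly [i]) w * word_op F w \<phi> x)
      = (\<Sum>j\<in>UNIV. if j = i then vf_op (F i) \<phi> x else 0)"
    unfolding length_Cons sum_words_Cons by (intro sum.cong refl) (auto simp: nc_coeff_letter)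
  then show ?case by simp
next
  case (3 i j J)
  define K where "K = j # J"
  define b where "b = lie_poly K"
  define h where "h = bracket_field F K"
  let ?W = "{w :: 'n list. length w = length K}"
  have IH: "(\<Sum>w\<in>?W. nc_coeff b w * word_op F w \<phi> x) = vf_op h \<phi> x"
    if "smooth_on UNIV \<phi>" for \<phi> x
    unfolding b_def h_def K_def by (rule "3.IH"(1)[OF that]) simp
  have h: "smooth_on UNIV h" unfolding h_def by (rule smooth_bracket_field[OF F])
  have 1: "(\<Sum>w\<in>{w. length w = Suc (length K)}. nc_coeff (nc_letter i * b) w * word_op F w \<phi> x)
      = vf_op (F i) (vf_op h \<phi>) x"
  proof -
    have "(\<Sum>w\<in>{w. length w = Suc (length K)}. nc_coeff (nc_letter i * b) w * word_op F w \<phi> x)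
        = (\<Sum>j\<in>UNIV. if j = i then (\<Sum>w\<in>?W. nc_coeff b w * vf_op (F i) (word_op F w \<phi>) x) else 0)"
      unfolding sum_words_Cons by (intro sum.cong refl) (auto simp: nc_letter_mult_Cons)
    also have "\<dots> = (\<Sum>w\<in>?W. nc_coeff b w * vf_op (F i) (word_op F w \<phi>) x)" by simp
    also have "\<dots> = frechet_derivative (\<lambda>y. \<Sum>w\<in>?W. nc_coeff b w * word_op F w \<phi> y) (at x) (F i x)"
    proof -
      have "((\<lambda>y. \<Sum>w\<in>?W. nc_coeff b w * word_op F w \<phi> y) has_derivative
          (\<lambda>u. \<Sum>w\<in>?W. nc_coeff b w * frechet_derivative (word_op F w \<phi>) (at x) u)) (at x)"
        by (intro has_derivative_sum has_derivative_mult_right smooth_onD(4) smooth_word_op F "3.prems")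
      from fun_cong[OF frechet_derivative_at[OF this], of "F i x"]
      show ?thesis unfolding vf_op_def by (simp only:)
    qed
    also have "(\<lambda>y. \<Sum>w\<in>?W. nc_coeff b w * word_op F w \<phi> y) = vf_op h \<phi>"
      using IH[OF "3.prems"(1)] by auto
    finally show ?thesis unfolding vf_op_def .
  qed
  \<comment> \<open>The letter now acts first, so the induction hypothesis is applied to
    \<open>vf_op (F i) \<phi>\<close>; this is why \<open>\<phi>\<close> is generalised in the
    induction.\<close>
  have 2: "(\<Sum>w\<in>{w. length w = Suc (length K)}. nc_coeff (b * nc_letter i) w * word_op F w \<phi> x)
      = vf_op h (vf_op (F i) \<phi>) x"
  proof -
    have "(\<Sum>w\<in>{w. length w = Suc (length K)}. nc_coeff (b * nc_letter i) w * word_op F w \<phi> x)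
        = (\<Sum>j\<in>UNIV. if j = i then (\<Sum>w\<in>?W. nc_coeff b w * word_op F w (vf_op (F i) \<phi>) x) else 0)"
      unfolding sum_words_snoc by (intro sum.cong refl) (auto simp: nc_letter_mult_snoc word_op_append)
    then show ?thesis using IH[OF smooth_vf_op[OF F "3.prems"(1)]] by simp
  qed
  have "(\<Sum>w\<in>{w. length w = length (i # K)}. nc_coeff (lie_poly (i # K)) w * word_op F w \<phi> x)
      = vf_op (F i) (vf_op h \<phi>) x - vf_op h (vf_op (F i) \<phi>) x"
    using 1 2 unfolding K_def b_def
    by (simp add: minus_ncs.rep_eq left_diff_distrib sum_subtractf)
  also have "\<dots> = vf_op (lie_bracket (F i) h) \<phi> x"
    by (rule vf_op_lie_bracket[OF "3.prems"(1) F h, symmetric])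
  finally show ?case unfolding K_def h_def by simp
qed auto

subsection \<open>Flows and reachable points\<close>

text \<open>Confinement to the ball of radius \<open>B\<close> is built in, so that all Lipschitz
  and Taylor constants can be taken uniform on that ball.\<close>

definition trajectory :: "real \<Rightarrow> ('a::euclidean_space \<Rightarrow> 'a) \<Rightarrow> real \<Rightarrow> (real \<Rightarrow> 'a) \<Rightarrow> bool" where
  "trajectory B g t \<gamma> \<longleftrightarrow> 0 \<le> t \<and>
     (\<forall>s\<in>{0..t}. norm (\<gamma> s) \<le> B \<and> (\<gamma> has_vector_derivative g (\<gamma> s)) (at s within {0..t}))"

text \<open>Picard iteration in the complete space of bounded continuous functions on the line.
  Composing the field with the nearest-point projection onto the ball makes it globally Lipschitz,
  and stopping the time at \<open>t\<close> keeps the iterates bounded. Since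
  \<open>norm x + t * K \<le> B\<close>, the fixed point never leaves the ball and the projection
  acts as the identity along it.\<close>

lemma trajectory_exists:
  fixes g :: "'a::euclidean_space \<Rightarrow> 'a"
  assumes lip: "\<And>x y. norm x \<le> B \<Longrightarrow> norm y \<le> B \<Longrightarrow> norm (g x - g y) \<le> L * norm (x - y)"
    and bnd: "\<And>x. norm x \<le> B \<Longrightarrow> norm (g x) \<le> K"
    and t: "0 \<le> t" "norm x + t * K \<le> B" "t * L < 1" "0 \<le> L" "0 \<le> K"
  obtains \<gamma> where "trajectory B g t \<gamma>" "\<gamma> 0 = x" "norm (\<gamma> t - x) \<le> t * K"
proof -
  have B: "0 \<le> B" using t norm_ge_zero[of x] mult_nonneg_nonneg[of t K] by linarith
  define P where "P = closest_point (cball (0::'a) B)"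
  have P_in: "norm (P y) \<le> B" for y
    using closest_point_in_set[of "cball (0::'a) B" y] B unfolding P_def by auto
  have P_id: "P y = y" if "norm y \<le> B" for y
    unfolding P_def by (rule closest_point_self) (use that in simp)
  have P_lip: "norm (P y - P z) \<le> norm (y - z)" for y z
    using closest_point_lipschitz[of "cball (0::'a) B" y z] B unfolding P_def dist_norm by auto
  define G where "G y = g (P y)" for y
  have G_lip: "norm (G y - G z) \<le> L * norm (y - z)" for y z
    unfolding G_def using lip[OF P_in P_in] P_lip \<open>0 \<le> L\<close> by (meson mult_left_mono order_trans)
  have G_bnd: "norm (G y) \<le> K" for y unfolding G_def by (rule bnd[OF P_in])
  have "L-lipschitz_on UNIV G"
    using G_lip \<open>0 \<le> L\<close> by (auto simp: lipschitz_on_def dist_norm)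
  then have G_cont: "continuous_on UNIV G" by (rule lipschitz_on_continuous_on)
  define cl where "cl s = max 0 (min t s)" for s
  have cl: "cl s \<in> {0..t}" for s unfolding cl_def using t by auto
  have comp: "continuous_on A (\<lambda>r. G (apply_bcontfun \<gamma> r))" for \<gamma> :: "real \<Rightarrow>\<^sub>C 'a" and A
    by (rule continuous_on_compose2[OF G_cont]) (auto intro: continuous_on_subset[OF continuous_on_apply_bcontfun])
  define \<Phi> where "\<Phi> \<gamma> s = x + integral {0..cl s} (\<lambda>r. G (apply_bcontfun \<gamma> r))" for \<gamma> :: "real \<Rightarrow>\<^sub>C 'a" and s
  have int: "(\<lambda>r. G (apply_bcontfun \<gamma> r)) integrable_on {0..u}" for \<gamma> :: "real \<Rightarrow>\<^sub>C 'a" and u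
    by (rule integrable_continuous_real[OF comp])
  have ibound: "norm (integral {0..cl s} h) \<le> t * C"
    if "continuous_on UNIV h" "\<And>r. norm (h r) \<le> C" for h :: "real \<Rightarrow> 'a" and s C
  proof -
    have C: "0 \<le> C" using that(2)[of 0] norm_ge_zero order_trans by blast
    have "norm (integral {0..cl s} h) \<le> C * (cl s - 0)"
      by (rule integral_bound) (use cl[of s] that in \<open>auto intro: continuous_on_subset\<close>)
    also have "\<dots> \<le> C * t" using cl[of s] C by (intro mult_left_mono) auto
    finally show ?thesis by (simp add: mult.commute)
  qed
  have \<Phi>_mem: "\<Phi> \<gamma> \<in> bcontfun" for \<gamma>
  proof (rule bcontfun_normI)
    have "continuous_on UNIV (\<lambda>s. integral {0..cl s} (\<lambda>r. G (apply_bcontfun \<gamma> r)))"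
      by (rule continuous_on_compose2[OF indefinite_integral_continuous_1[OF int[of \<gamma> t]]])
         (use cl in \<open>auto simp: cl_def[abs_def] intro!: continuous_intros\<close>)
    then show "continuous_on UNIV (\<Phi> \<gamma>)" unfolding \<Phi>_def by (intro continuous_intros)
    show "norm (\<Phi> \<gamma> s) \<le> norm x + t * K" for s
      unfolding \<Phi>_def by (rule norm_triangle_mono[OF order_refl ibound[OF comp G_bnd]])
  qed
  define \<Psi> where "\<Psi> \<gamma> = Bcontfun (\<Phi> \<gamma>)" for \<gamma>
  have \<Psi>: "apply_bcontfun (\<Psi> \<gamma>) = \<Phi> \<gamma>" for \<gamma>
    unfolding \<Psi>_def by (rule Bcontfun_inverse[OF \<Phi>_mem])
  have "\<exists>!\<gamma>. \<Psi> \<gamma> = \<gamma>"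
  proof (rule banach_fix_type)
    show "0 \<le> t * L" "t * L < 1" using t by auto
    show "\<forall>\<gamma> \<gamma>'. dist (\<Psi> \<gamma>) (\<Psi> \<gamma>') \<le> t * L * dist \<gamma> \<gamma>'"
    proof (intro allI dist_bound)
      fix \<gamma> \<gamma>' :: "real \<Rightarrow>\<^sub>C 'a" and s
      have "dist (apply_bcontfun (\<Psi> \<gamma>) s) (apply_bcontfun (\<Psi> \<gamma>') s)
          = norm (integral {0..cl s} (\<lambda>r. G (apply_bcontfun \<gamma> r) - G (apply_bcontfun \<gamma>' r)))"
        unfolding \<Psi> \<Phi>_def dist_norm by (simp add: Henstock_Kurzweil_Integration.integral_diff[OF int int])
      also have "\<dots> \<le> t * (L * dist \<gamma> \<gamma>')"
      proof (rule ibound)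
        fix r
        have "norm (G (apply_bcontfun \<gamma> r) - G (apply_bcontfun \<gamma>' r)) \<le> L * norm (apply_bcontfun \<gamma> r - apply_bcontfun \<gamma>' r)"
          by (rule G_lip)
        also have "\<dots> \<le> L * dist \<gamma> \<gamma>'"
          using dist_bounded[of \<gamma> r \<gamma>'] \<open>0 \<le> L\<close> by (intro mult_left_mono) (auto simp: dist_norm)
        finally show "norm (G (apply_bcontfun \<gamma> r) - G (apply_bcontfun \<gamma>' r)) \<le> L * dist \<gamma> \<gamma>'" .
      qed (intro continuous_intros comp)
      finally show "dist (apply_bcontfun (\<Psi> \<gamma>) s) (apply_bcontfun (\<Psi> \<gamma>') s) \<le> t * L * dist \<gamma> \<gamma>'"
        by (simp add: mult.assoc)
    qed
  qed
  then obtain \<gamma> where eq\<gamma>: "\<Psi> \<gamma> = \<gamma>" by blast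
  have \<gamma>: "apply_bcontfun \<gamma> s = x + integral {0..cl s} (\<lambda>r. G (apply_bcontfun \<gamma> r))" for s
  proof -
    have "apply_bcontfun \<gamma> s = \<Phi> \<gamma> s" using fun_cong[OF \<Psi>[of \<gamma>], of s] eq\<gamma> by metis
    then show ?thesis unfolding \<Phi>_def .
  qed
  have near: "norm (apply_bcontfun \<gamma> s - x) \<le> t * K" for s
    using ibound[OF comp G_bnd, of s \<gamma>] by (simp add: \<gamma>[of s])
  have inB: "norm (apply_bcontfun \<gamma> s) \<le> B" for s
  proof -
    have "norm (apply_bcontfun \<gamma> s) \<le> norm x + norm (apply_bcontfun \<gamma> s - x)"
      using norm_triangle_ineq[of x "apply_bcontfun \<gamma> s - x"] by simp
    then show ?thesis using near[of s] t by linarith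
  qed
  have "trajectory B g t (apply_bcontfun \<gamma>)"
    unfolding trajectory_def
  proof (intro conjI ballI inB t(1))
    fix s assume s: "s \<in> {0..t}"
    have "((\<lambda>u. x + integral {0..u} (\<lambda>r. G (apply_bcontfun \<gamma> r))) has_vector_derivative G (apply_bcontfun \<gamma> s)) (at s within {0..t})"
      using has_vector_derivative_add[OF has_vector_derivative_const[of x] integral_has_vector_derivative[OF comp s]]
      by simp
    then have "(apply_bcontfun \<gamma> has_vector_derivative G (apply_bcontfun \<gamma> s)) (at s within {0..t})"
      by (rule has_vector_derivative_transform[OF s, rotated])
         (subst \<gamma>, auto simp: cl_def)
    then show "(apply_bcontfun \<gamma> has_vector_derivative g (apply_bcontfun \<gamma> s)) (at s within {0..t})"
      unfolding G_def P_id[OF inB] .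
  qed
  moreover have "apply_bcontfun \<gamma> 0 = x" unfolding \<gamma>[of 0] cl_def using t by simp
  ultimately show ?thesis using that near by blast
qed

lemma trajectory_restrict:
  assumes "trajectory B g t \<gamma>" "0 \<le> s" "s \<le> t"
  shows "trajectory B g s \<gamma>"
  unfolding trajectory_def
proof (intro conjI ballI)
  fix r assume r: "r \<in> {0..s}"
  then have "r \<in> {0..t}" using assms by auto
  then have d: "norm (\<gamma> r) \<le> B" "(\<gamma> has_vector_derivative g (\<gamma> r)) (at r within {0..t})"
    using assms(1) unfolding trajectory_def by auto
  show "norm (\<gamma> r) \<le> B" by (rule d)
  show "(\<gamma> has_vector_derivative g (\<gamma> r)) (at r within {0..s})"
    by (rule has_vector_derivative_within_subset[OF d(2)]) (use assms in auto)
qed (rule assms)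

text \<open>Along the trajectory the derivative of \<open>\<phi>\<close> is \<open>e\<close> times
  its Lie derivative. Hence the remainder of order \<open>N + 1\<close> for \<open>\<phi>\<close>
  has as its derivative \<open>e\<close> times the remainder of order \<open>N\<close> for
  \<open>vf_op f \<phi>\<close>, and the mean value inequality adds one power of \<open>t\<close>.
  The constant is inherited from the ball and does not depend on the trajectory.\<close>

lemma trajectory_taylor:
  fixes \<phi> :: "'a::euclidean_space \<Rightarrow> real"
  assumes f: "smooth_on UNIV f" and \<phi>: "smooth_on UNIV \<phi>" and e: "\<bar>e\<bar> \<le> 1"
  shows "\<exists>C\<ge>0. \<forall>t \<gamma>. trajectory B (\<lambda>x. e *\<^sub>R f x) t \<gamma> \<longrightarrow>
     \<bar>\<phi> (\<gamma> t) - (\<Sum>k<N. (e * t) ^ k / fact k * (vf_op f ^^ k) \<phi> (\<gamma> 0))\<bar> \<le> C * t ^ N"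
  using \<phi>
proof (induction N arbitrary: \<phi>)
  case 0
  have "compact (\<phi> ` cball 0 B)"
    by (intro compact_continuous_image smooth_onD(3)[OF 0]) simp
  then have "bounded (\<phi> ` cball 0 B)" by (rule compact_imp_bounded)
  then obtain C where C: "C > 0" "\<And>x. x \<in> cball 0 B \<Longrightarrow> norm (\<phi> x) \<le> C"
    unfolding bounded_pos by blast
  show ?case
    by (rule exI[of _ C]) (use C in \<open>auto simp: trajectory_def\<close>)
next
  case (Suc N)
  define \<psi> where "\<psi> = vf_op f \<phi>"
  have \<psi>: "smooth_on UNIV \<psi>" unfolding \<psi>_def by (rule smooth_vf_op[OF f Suc.prems])
  obtain C where C: "C \<ge> 0" "\<And>t \<gamma>. trajectory B (\<lambda>x. e *\<^sub>R f x) t \<gamma> \<Longrightarrow>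
     \<bar>\<psi> (\<gamma> t) - (\<Sum>k<N. (e * t) ^ k / fact k * (vf_op f ^^ k) \<psi> (\<gamma> 0))\<bar> \<le> C * t ^ N"
    using Suc.IH[OF \<psi>] by blast
  show ?case
  proof (intro exI[of _ C] conjI allI impI C(1))
    fix t \<gamma> assume tr: "trajectory B (\<lambda>x. e *\<^sub>R f x) t \<gamma>"
    then have t: "0 \<le> t" unfolding trajectory_def by simp
    define c where "c k = (vf_op f ^^ k) \<phi> (\<gamma> 0)" for k
    have cS: "c (Suc k) = (vf_op f ^^ k) \<psi> (\<gamma> 0)" for k
      unfolding c_def \<psi>_def by (simp add: funpow_swap1)
    define q where "q s = \<phi> (\<gamma> s) - (\<Sum>k<Suc N. (e * s) ^ k / fact k * c k)" for s
    define q' where "q' s = e * (\<psi> (\<gamma> s) - (\<Sum>k<N. (e * s) ^ k / fact k * c (Suc k)))" for s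
    have dq: "(q has_real_derivative q' s) (at s within {0..t})" if s: "s \<in> {0..t}" for s
    proof -
      have "(\<gamma> has_derivative (\<lambda>h. h *\<^sub>R (e *\<^sub>R f (\<gamma> s)))) (at s within {0..t})"
        using tr s unfolding trajectory_def has_vector_derivative_def by auto
      from has_derivative_compose[OF this smooth_onD(4)[OF Suc.prems]]
      have "((\<lambda>s. \<phi> (\<gamma> s)) has_derivative (\<lambda>h. frechet_derivative \<phi> (at (\<gamma> s)) (h *\<^sub>R (e *\<^sub>R f (\<gamma> s))))) (at s within {0..t})" .
      moreover have "linear (frechet_derivative \<phi> (at (\<gamma> s)))"
        by (rule has_derivative_linear[OF smooth_onD(4)[OF Suc.prems]])
      ultimately have 1: "((\<lambda>s. \<phi> (\<gamma> s)) has_real_derivative e * \<psi> (\<gamma> s)) (at s within {0..t})"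
      proof -
        assume D: "((\<lambda>s. \<phi> (\<gamma> s)) has_derivative (\<lambda>h. frechet_derivative \<phi> (at (\<gamma> s)) (h *\<^sub>R (e *\<^sub>R f (\<gamma> s))))) (at s within {0..t})"
          and lin: "linear (frechet_derivative \<phi> (at (\<gamma> s)))"
        have "(\<lambda>h. frechet_derivative \<phi> (at (\<gamma> s)) (h *\<^sub>R (e *\<^sub>R f (\<gamma> s)))) = (*) (e * \<psi> (\<gamma> s))"
          unfolding \<psi>_def vf_op_def fun_eq_iff by (simp add: linear_cmul[OF lin])
        then show ?thesis using D unfolding has_field_derivative_def by simp
      qed
      have 2: "((\<lambda>s. \<Sum>k<Suc N. (e * s) ^ k / fact k * c k) has_real_derivative
          (\<Sum>k<N. e * ((e * s) ^ k / fact k * c (Suc k)))) (at s within {0..t})"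
        unfolding sum.lessThan_Suc_shift
      proof -
        have "((\<lambda>x. (e * x) ^ Suc k / fact (Suc k) * c (Suc k)) has_real_derivative
           e * ((e * s) ^ k / fact k * c (Suc k))) (at s within {0..t})" for k
        proof -
          have "((\<lambda>x. (e * x) ^ Suc k / fact (Suc k) * c (Suc k)) has_real_derivative
             (of_nat (Suc k) * (e * s) ^ k * e) / fact (Suc k) * c (Suc k)) (at s within {0..t})"
            by (auto intro!: derivative_eq_intros simp del: power_Suc of_nat_Suc fact_Suc)
          moreover have "(of_nat (Suc k) * (e * s) ^ k * e) / fact (Suc k) * c (Suc k)
             = e * ((e * s) ^ k / fact k * c (Suc k))"
          proof -
            have "real (Suc k) \<noteq> 0" by simp
            then show ?thesis
              unfolding fact_Suc by (simp del: of_nat_Suc add: field_simps)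
          qed
          ultimately show ?thesis by (simp only:)
        qed
        then have "((\<lambda>x. \<Sum>k<N. (e * x) ^ Suc k / fact (Suc k) * c (Suc k)) has_real_derivative
            (\<Sum>k<N. e * ((e * s) ^ k / fact k * c (Suc k)))) (at s within {0..t})"
          by (rule DERIV_sum)
        from DERIV_add[OF DERIV_const[of "c 0"] this]
        show "((\<lambda>x. (e * x) ^ 0 / fact 0 * c 0 + (\<Sum>k<N. (e * x) ^ Suc k / fact (Suc k) * c (Suc k))) has_real_derivative
          (\<Sum>k<N. e * ((e * s) ^ k / fact k * c (Suc k)))) (at s within {0..t})"
          by (simp del: power_Suc fact_Suc)
      qed
      show ?thesis
        unfolding q_def q'_def using DERIV_diff[OF 1 2] by (simp add: right_diff_distrib sum_distrib_left)
    qed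
    have bq: "norm (q' s) \<le> C * t ^ N" if s: "s \<in> {0..t}" for s
    proof -
      have "\<bar>\<psi> (\<gamma> s) - (\<Sum>k<N. (e * s) ^ k / fact k * c (Suc k))\<bar> \<le> C * s ^ N"
        unfolding cS by (rule C(2)[OF trajectory_restrict[OF tr]]) (use s in auto)
      also have "\<dots> \<le> C * t ^ N"
        using s C(1) by (intro mult_left_mono power_mono) auto
      finally have "\<bar>\<psi> (\<gamma> s) - (\<Sum>k<N. (e * s) ^ k / fact k * c (Suc k))\<bar> \<le> C * t ^ N" .
      then have "\<bar>e\<bar> * \<bar>\<psi> (\<gamma> s) - (\<Sum>k<N. (e * s) ^ k / fact k * c (Suc k))\<bar> \<le> 1 * (C * t ^ N)"
        by (rule mult_mono[OF e]) auto
      then show ?thesis unfolding q'_def by (simp add: abs_mult)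
    qed
    have q0: "q 0 = 0"
      unfolding q_def sum.lessThan_Suc_shift by (simp add: c_def)
    have "norm (q t - q 0) \<le> C * t ^ N * norm (t - 0)"
      by (rule field_differentiable_bound[OF _ dq bq]) (use t in auto)
    then show "\<bar>\<phi> (\<gamma> t) - (\<Sum>k<Suc N. (e * t) ^ k / fact k * (vf_op f ^^ k) \<phi> (\<gamma> 0))\<bar> \<le> C * t ^ Suc N"
      using t q0 unfolding q_def c_def by (simp add: mult_ac)
  qed
qed

text \<open>A relation instead of a composition of flow maps, because a run exists only as long as
  it stays in the ball of radius \<open>B\<close>.\<close>

fun prog_run :: "real \<Rightarrow> ('n \<Rightarrow> 'a::euclidean_space \<Rightarrow> 'a) \<Rightarrow> 'n prog \<Rightarrow> real \<Rightarrow> 'a \<Rightarrow> 'a \<Rightarrow> bool" where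
  "prog_run B F [] t x y \<longleftrightarrow> x = y \<and> norm x \<le> B"
| "prog_run B F ((i, e) # p) t x y \<longleftrightarrow>
     (\<exists>\<gamma>. trajectory B (\<lambda>z. e *\<^sub>R F i z) t \<gamma> \<and> \<gamma> 0 = x \<and> prog_run B F p t (\<gamma> t) y)"

text \<open>Each letter \<open>i\<close> is replaced by \<open>t\<close> times the Lie derivative
  along \<open>F i\<close>, and words longer than \<open>N\<close> are discarded.\<close>

definition series_op :: "('n::finite \<Rightarrow> 'a::euclidean_space \<Rightarrow> 'a) \<Rightarrow> nat \<Rightarrow> 'n ncs \<Rightarrow> real \<Rightarrow> ('a \<Rightarrow> real) \<Rightarrow> 'a \<Rightarrow> real" where
  "series_op F N c t \<phi> x = (\<Sum>w\<in>{w. length w \<le> N}. nc_coeff c w * t ^ length w * word_op F w \<phi> x)"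

lemma word_op_replicate: "word_op F (replicate k i) \<phi> = (vf_op (F i) ^^ k) \<phi>"
  by (induction k) auto

lemma series_op_exp:
  "series_op F N (nc_exp e i) t \<phi> x = (\<Sum>k<Suc N. (e * t) ^ k / fact k * (vf_op (F i) ^^ k) \<phi> x)"
proof -
  have "series_op F N (nc_exp e i) t \<phi> x
      = (\<Sum>w\<in>(\<lambda>k. replicate k i) ` {..<Suc N}. nc_coeff (nc_exp e i) w * t ^ length w * word_op F w \<phi> x)"
    unfolding series_op_def
  proof (rule sum.mono_neutral_right[OF finite_words(2)])
    show "\<forall>w\<in>{w. length w \<le> N} - (\<lambda>k. replicate k i) ` {..<Suc N}.
        nc_coeff (nc_exp e i) w * t ^ length w * word_op F w \<phi> x = 0"
    proof
      fix w assume "w \<in> {w. length w \<le> N} - (\<lambda>k. replicate k i) ` {..<Suc N}"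
      then have "w \<noteq> replicate (length w) i" by (auto simp: image_iff less_Suc_eq_le)
      then show "nc_coeff (nc_exp e i) w * t ^ length w * word_op F w \<phi> x = 0"
        by (simp add: nc_coeff_exp)
    qed
  qed auto
  also have "\<dots> = (\<Sum>k<Suc N. nc_coeff (nc_exp e i) (replicate k i) * t ^ k * word_op F (replicate k i) \<phi> x)"
    by (subst sum.reindex) (auto simp: inj_on_def dest: arg_cong[of _ _ length])
  finally show ?thesis
    by (simp add: nc_coeff_exp word_op_replicate power_mult_distrib)
qed

lemma word_op_bounded:
  fixes F :: "'n::finite \<Rightarrow> 'a::euclidean_space \<Rightarrow> 'a"
  assumes F: "\<And>i. smooth_on UNIV (F i)" and \<phi>: "smooth_on UNIV \<phi>"
  obtains K where "K \<ge> 0" "\<And>w x. length w \<le> N \<Longrightarrow> norm x \<le> B \<Longrightarrow> \<bar>word_op F w \<phi> x\<bar> \<le> K"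
proof -
  have "\<exists>K\<ge>0. \<forall>x. norm x \<le> B \<longrightarrow> \<bar>word_op F w \<phi> x\<bar> \<le> K" for w
  proof -
    have "compact (word_op F w \<phi> ` cball 0 B)"
      by (intro compact_continuous_image smooth_onD(3)[OF smooth_word_op[OF F \<phi>]]) simp
    then have "bounded (word_op F w \<phi> ` cball 0 B)" by (rule compact_imp_bounded)
    then obtain C where "C > 0" "\<And>x. x \<in> cball 0 B \<Longrightarrow> norm (word_op F w \<phi> x) \<le> C"
      unfolding bounded_pos by blast
    then show ?thesis by (intro exI[of _ C]) auto
  qed
  then obtain K where K: "\<And>w. K w \<ge> 0" "\<And>w x. norm x \<le> B \<Longrightarrow> \<bar>word_op F w \<phi> x\<bar> \<le> K w" by metis
  show ?thesis
  proof (rule that[of "\<Sum>w\<in>{w. length w \<le> N}. K w"])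
    show "0 \<le> (\<Sum>w\<in>{w. length w \<le> N}. K w)" by (intro sum_nonneg K)
    fix w :: "'n list" and x :: 'a assume w: "length w \<le> N" and x: "norm x \<le> B"
    have "\<bar>word_op F w \<phi> x\<bar> \<le> K w" by (rule K(2)[OF x])
    also have "\<dots> \<le> (\<Sum>w\<in>{w. length w \<le> N}. K w)"
      by (rule member_le_sum) (use w K finite_words(2) in auto)
    finally show "\<bar>word_op F w \<phi> x\<bar> \<le> (\<Sum>w\<in>{w. length w \<le> N}. K w)" .
  qed
qed

text \<open>Applying two truncated series in succession produces every pair of words of length at
  most \<open>N\<close>, whereas the truncated product keeps only the pairs of total length at most
  \<open>N\<close>. The surplus pairs are finite in number and each carries at least the factor
  \<open>t ^ Suc N\<close>.\<close>

lemma series_op_mult: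
  fixes F :: "'n::finite \<Rightarrow> 'a::euclidean_space \<Rightarrow> 'a"
  assumes F: "\<And>i. smooth_on UNIV (F i)" and \<phi>: "smooth_on UNIV \<phi>"
  shows "\<exists>C\<ge>0. \<forall>t x. 0 \<le> t \<longrightarrow> t \<le> 1 \<longrightarrow> norm x \<le> B \<longrightarrow>
    \<bar>(\<Sum>w\<in>{w. length w \<le> N}. nc_coeff d w * t ^ length w * series_op F N c t (word_op F w \<phi>) x)
      - series_op F N (c * d) t \<phi> x\<bar> \<le> C * t ^ Suc N"
proof -
  let ?W = "{w :: 'n list. length w \<le> N}"
  have fin: "finite (?W \<times> ?W)" using finite_words(2)[where 'n = 'n] by blast
  obtain K where K: "K \<ge> 0" "\<And>w x. length w \<le> N + N \<Longrightarrow> norm x \<le> B \<Longrightarrow> \<bar>word_op F w \<phi> x\<bar> \<le> K"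
    using word_op_bounded[where F = F and \<phi> = \<phi> and N = "N + N" and B = B, OF F \<phi>] by blast
  define C where "C = (\<Sum>(w, v)\<in>?W \<times> ?W. \<bar>nc_coeff d w * nc_coeff c v\<bar> * K)"
  have "\<bar>(\<Sum>w\<in>?W. nc_coeff d w * t ^ length w * series_op F N c t (word_op F w \<phi>) x)
      - series_op F N (c * d) t \<phi> x\<bar> \<le> C * t ^ Suc N"
    if t: "0 \<le> t" "t \<le> 1" and x: "norm x \<le> B" for t x
  proof -
    define g where "g w v = nc_coeff d w * nc_coeff c v * t ^ (length v + length w) * word_op F (v @ w) \<phi> x" for w v
    let ?A = "{(w, v). (w, v) \<in> ?W \<times> ?W \<and> length v + length w \<le> N}"
    have 1: "(\<Sum>w\<in>?W. nc_coeff d w * t ^ length w * series_op F N c t (word_op F w \<phi>) x)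
        = (\<Sum>(w, v)\<in>?W \<times> ?W. g w v)"
      unfolding series_op_def g_def sum.cartesian_product[symmetric] sum_distrib_left
      by (intro sum.cong refl) (simp add: word_op_append power_add mult_ac)
    have 2: "series_op F N (c * d) t \<phi> x = (\<Sum>(w, v)\<in>?A. g w v)"
    proof -
      have "series_op F N (c * d) t \<phi> x
          = (\<Sum>u\<in>?W. \<Sum>k\<le>length u. nc_coeff c (take k u) * nc_coeff d (drop k u) * t ^ length u * word_op F u \<phi> x)"
        unfolding series_op_def times_ncs.rep_eq by (simp add: sum_distrib_right)
      also have "\<dots> = (\<Sum>(u, k)\<in>Sigma ?W (\<lambda>u. {..length u}). nc_coeff c (take k u) * nc_coeff d (drop k u) * t ^ length u * word_op F u \<phi> x)"
        by (rule sum.Sigma) (use finite_words(2) in auto)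
      also have "\<dots> = (\<Sum>(w, v)\<in>?A. g w v)"
        by (rule sum.reindex_bij_witness[of _ "\<lambda>(w, v). (v @ w, length v)" "\<lambda>(u, k). (drop k u, take k u)"])
           (auto simp: g_def)
      finally show ?thesis .
    qed
    have "(\<Sum>(w, v)\<in>?W \<times> ?W. g w v) - (\<Sum>(w, v)\<in>?A. g w v) = (\<Sum>(w, v)\<in>?W \<times> ?W - ?A. g w v)"
      by (rule sum_diff[symmetric]) (use fin in auto)
    then have "\<bar>(\<Sum>(w, v)\<in>?W \<times> ?W. g w v) - (\<Sum>(w, v)\<in>?A. g w v)\<bar> \<le> (\<Sum>(w, v)\<in>?W \<times> ?W - ?A. \<bar>g w v\<bar>)"
      using sum_abs[of "\<lambda>(w, v). g w v" "?W \<times> ?W - ?A"] by (simp add: case_prod_beta)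
    also have "\<dots> \<le> (\<Sum>(w, v)\<in>?W \<times> ?W - ?A. \<bar>nc_coeff d w * nc_coeff c v\<bar> * K * t ^ Suc N)"
    proof (rule sum_mono)
      fix p :: "'n list \<times> 'n list" assume p: "p \<in> ?W \<times> ?W - ?A"
      obtain w v where p_eq: "p = (w, v)" by fastforce
      have wv: "length w \<le> N" "length v \<le> N" "(w, v) \<notin> ?A" using p unfolding p_eq by auto
      then have len: "length v + length w \<ge> Suc N" by auto
      have tt: "t ^ (length v + length w) \<le> t ^ Suc N"
        by (rule power_decreasing[OF len t])
      have "\<bar>word_op F (v @ w) \<phi> x\<bar> \<le> K" by (rule K(2)) (use wv x in auto)
      then have "t ^ (length v + length w) * \<bar>word_op F (v @ w) \<phi> x\<bar> \<le> t ^ Suc N * K"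
        using tt t by (intro mult_mono) auto
      then have "\<bar>nc_coeff d w * nc_coeff c v\<bar> * (t ^ (length v + length w) * \<bar>word_op F (v @ w) \<phi> x\<bar>)
          \<le> \<bar>nc_coeff d w * nc_coeff c v\<bar> * (t ^ Suc N * K)"
        by (rule mult_left_mono) simp
      then have "\<bar>g w v\<bar> \<le> \<bar>nc_coeff d w * nc_coeff c v\<bar> * K * t ^ Suc N"
        unfolding g_def using t by (simp add: abs_mult mult_ac)
      then show "(case p of (w, v) \<Rightarrow> \<bar>g w v\<bar>)
          \<le> (case p of (w, v) \<Rightarrow> \<bar>nc_coeff d w * nc_coeff c v\<bar> * K * t ^ Suc N)"
        unfolding p_eq by simp
    qed
    also have "\<dots> \<le> (\<Sum>(w, v)\<in>?W \<times> ?W. \<bar>nc_coeff d w * nc_coeff c v\<bar> * K * t ^ Suc N)"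
      by (rule sum_mono2[OF fin]) (use K t in auto)
    also have "\<dots> = C * t ^ Suc N"
      unfolding C_def by (simp add: sum_distrib_right case_prod_beta)
    finally show ?thesis unfolding 1 2 .
  qed
  moreover have "C \<ge> 0" unfolding C_def by (intro sum_nonneg) (use K in auto)
  ultimately show ?thesis by blast
qed

lemma prog_run_bounded: "prog_run B F p t x y \<Longrightarrow> norm x \<le> B"
  by (cases p rule: prog_series.cases) (auto simp: trajectory_def)

text \<open>Three errors add up: the induction hypothesis at the point reached by the first
  instruction, the Taylor remainders of the functions \<open>word_op F w \<phi>\<close> along that
  instruction, and the truncation of the product of the two series.\<close>

lemma prog_run_expansion:
  fixes F :: "'n::finite \<Rightarrow> 'a::euclidean_space \<Rightarrow> 'a"
  assumes F: "\<And>i. smooth_on UNIV (F i)" and "smooth_on UNIV \<phi>" and "\<forall>(i, e)\<in>set p. \<bar>e\<bar> \<le> 1"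
  shows "\<exists>C\<ge>0. \<forall>t x y. 0 \<le> t \<longrightarrow> t \<le> 1 \<longrightarrow> prog_run B F p t x y \<longrightarrow>
    \<bar>\<phi> y - series_op F N (prog_series p) t \<phi> x\<bar> \<le> C * t ^ Suc N"
  using assms(2,3)
proof (induction p arbitrary: \<phi> rule: prog_series.induct)
  case 1
  have "series_op F N (prog_series []) t \<phi> x = \<phi> x" for t x
  proof -
    have "series_op F N (prog_series []) t \<phi> x = (\<Sum>w\<in>{w :: 'n list. length w \<le> N}. if w = [] then \<phi> x else 0)"
      unfolding series_op_def by (intro sum.cong refl) (auto simp: one_ncs.rep_eq)
    then show ?thesis using finite_words(2)[where 'n = 'n, of N] by (simp add: sum.delta')
  qed
  then show ?case by (intro exI[of _ 0]) auto
next
  case (2 i e p)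
  let ?W = "{w :: 'n list. length w \<le> N}"
  define d where "d = prog_series p"
  define c where "c = nc_exp e i"
  have e: "\<bar>e\<bar> \<le> 1" using "2.prems" by auto
  obtain C1 where C1: "C1 \<ge> 0" "\<And>t x y. 0 \<le> t \<Longrightarrow> t \<le> 1 \<Longrightarrow> prog_run B F p t x y \<Longrightarrow>
    \<bar>\<phi> y - series_op F N d t \<phi> x\<bar> \<le> C1 * t ^ Suc N"
    using "2.IH"[OF "2.prems"(1)] "2.prems"(2) unfolding d_def by auto
  have "\<exists>C\<ge>0. \<forall>t \<gamma>. trajectory B (\<lambda>x. e *\<^sub>R F i x) t \<gamma> \<longrightarrow>
     \<bar>word_op F w \<phi> (\<gamma> t) - series_op F N c t (word_op F w \<phi>) (\<gamma> 0)\<bar> \<le> C * t ^ Suc N" for w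
    unfolding series_op_exp c_def
    by (rule trajectory_taylor[OF F smooth_word_op[OF F "2.prems"(1)] e])
  then obtain C2 where C2: "\<And>w. C2 w \<ge> 0" "\<And>w t \<gamma>. trajectory B (\<lambda>x. e *\<^sub>R F i x) t \<gamma> \<Longrightarrow>
     \<bar>word_op F w \<phi> (\<gamma> t) - series_op F N c t (word_op F w \<phi>) (\<gamma> 0)\<bar> \<le> C2 w * t ^ Suc N"
    by metis
  obtain C3 where C3: "C3 \<ge> 0" "\<And>t x. 0 \<le> t \<Longrightarrow> t \<le> 1 \<Longrightarrow> norm x \<le> B \<Longrightarrow>
    \<bar>(\<Sum>w\<in>?W. nc_coeff d w * t ^ length w * series_op F N c t (word_op F w \<phi>) x)
      - series_op F N (c * d) t \<phi> x\<bar> \<le> C3 * t ^ Suc N"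
    using series_op_mult[where F = F and B = B and N = N and d = d and c = c, OF F "2.prems"(1)] by blast
  define C where "C = C1 + (\<Sum>w\<in>?W. \<bar>nc_coeff d w\<bar> * C2 w) + C3"
  have "\<bar>\<phi> y - series_op F N (prog_series ((i, e) # p)) t \<phi> x\<bar> \<le> C * t ^ Suc N"
    if t: "0 \<le> t" "t \<le> 1" and run: "prog_run B F ((i, e) # p) t x y" for t x y
  proof -
    obtain \<gamma> where \<gamma>: "trajectory B (\<lambda>z. e *\<^sub>R F i z) t \<gamma>" "\<gamma> 0 = x" "prog_run B F p t (\<gamma> t) y"
      using run by auto
    define S where "S = (\<Sum>w\<in>?W. nc_coeff d w * t ^ length w * series_op F N c t (word_op F w \<phi>) x)"
    have 1: "\<bar>\<phi> y - series_op F N d t \<phi> (\<gamma> t)\<bar> \<le> C1 * t ^ Suc N"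
      by (rule C1(2)[OF t \<gamma>(3)])
    have 2: "\<bar>series_op F N d t \<phi> (\<gamma> t) - S\<bar> \<le> (\<Sum>w\<in>?W. \<bar>nc_coeff d w\<bar> * C2 w) * t ^ Suc N"
    proof -
      have "series_op F N d t \<phi> (\<gamma> t) - S = (\<Sum>w\<in>?W. nc_coeff d w * t ^ length w *
          (word_op F w \<phi> (\<gamma> t) - series_op F N c t (word_op F w \<phi>) x))"
        unfolding series_op_def[of F N d] S_def by (simp add: sum_subtractf right_diff_distrib)
      also have "\<bar>\<dots>\<bar> \<le> (\<Sum>w\<in>?W. \<bar>nc_coeff d w * t ^ length w *
          (word_op F w \<phi> (\<gamma> t) - series_op F N c t (word_op F w \<phi>) x)\<bar>)"
        by (rule sum_abs)
      also have "\<dots> \<le> (\<Sum>w\<in>?W. \<bar>nc_coeff d w\<bar> * C2 w * t ^ Suc N)"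
      proof (rule sum_mono)
        fix w
        have "t ^ length w * \<bar>word_op F w \<phi> (\<gamma> t) - series_op F N c t (word_op F w \<phi>) x\<bar> \<le> 1 * (C2 w * t ^ Suc N)"
          using C2(2)[OF \<gamma>(1), of w] \<gamma>(2) t by (intro mult_mono) (auto simp: power_le_one)
        then have "\<bar>nc_coeff d w\<bar> * (t ^ length w * \<bar>word_op F w \<phi> (\<gamma> t) - series_op F N c t (word_op F w \<phi>) x\<bar>)
            \<le> \<bar>nc_coeff d w\<bar> * (1 * (C2 w * t ^ Suc N))"
          by (rule mult_left_mono) simp
        then show "\<bar>nc_coeff d w * t ^ length w * (word_op F w \<phi> (\<gamma> t) - series_op F N c t (word_op F w \<phi>) x)\<bar>
            \<le> \<bar>nc_coeff d w\<bar> * C2 w * t ^ Suc N"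
          using t by (simp add: abs_mult mult.assoc)
      qed
      finally show ?thesis by (simp add: sum_distrib_right)
    qed
    have "norm x \<le> B" using prog_run_bounded[OF run] .
    from C3(2)[OF t this] have 3: "\<bar>S - series_op F N (c * d) t \<phi> x\<bar> \<le> C3 * t ^ Suc N" unfolding S_def .
    have "\<bar>\<phi> y - series_op F N (c * d) t \<phi> x\<bar> \<le> C * t ^ Suc N"
      unfolding C_def distrib_right using 1 2 3 by linarith
    then show ?thesis unfolding c_def d_def by simp
  qed
  moreover have "C \<ge> 0" unfolding C_def using C1 C2 C3 by (intro add_nonneg_nonneg sum_nonneg) auto
  ultimately show ?case by blast
qed

text \<open>Controls have norm at most one, so \<open>\<tau>\<close> plays the role of a length:
  concatenation adds it, and the zero control allows waiting, which makes \<open>reach\<close>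
  monotone in \<open>\<tau>\<close>. The finite exceptional set absorbs the switching times of the
  control.\<close>

definition horizontal :: "('n::finite \<Rightarrow> 'a::euclidean_space \<Rightarrow> 'a) \<Rightarrow> real \<Rightarrow> (real \<Rightarrow> 'a) \<Rightarrow> (real \<Rightarrow> real ^ 'n) \<Rightarrow> bool" where
  "horizontal F \<tau> \<gamma> v \<longleftrightarrow> 0 \<le> \<tau> \<and> continuous_on {0..\<tau>} \<gamma> \<and> v \<in> borel_measurable borel \<and>
     (\<forall>t. norm (v t) \<le> 1) \<and>
     (\<exists>S. finite S \<and> (\<forall>t\<in>{0<..<\<tau>} - S.
        (\<gamma> has_vector_derivative (\<Sum>i\<in>UNIV. (v t $ i) *\<^sub>R F i (\<gamma> t))) (at t)))"

definition reach :: "('n::finite \<Rightarrow> 'a::euclidean_space \<Rightarrow> 'a) \<Rightarrow> real \<Rightarrow> 'a \<Rightarrow> 'a \<Rightarrow> bool" where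
  "reach F \<tau> x y \<longleftrightarrow> (\<exists>\<gamma> v. horizontal F \<tau> \<gamma> v \<and> \<gamma> 0 = x \<and> \<gamma> \<tau> = y)"

lemma reach_refl: "0 \<le> \<tau> \<Longrightarrow> reach F \<tau> x x"
  unfolding reach_def horizontal_def
  by (rule exI[of _ "\<lambda>_. x"], rule exI[of _ "\<lambda>_. 0"]) (auto intro!: exI[of _ "{}"])

lemma reach_trans:
  assumes "reach F \<tau>1 x y" "reach F \<tau>2 y z"
  shows "reach F (\<tau>1 + \<tau>2) x z"
proof -
  obtain \<gamma>1 v1 where h1: "horizontal F \<tau>1 \<gamma>1 v1" and e1: "\<gamma>1 0 = x" "\<gamma>1 \<tau>1 = y"
    using assms(1) unfolding reach_def by blast
  obtain \<gamma>2 v2 where h2: "horizontal F \<tau>2 \<gamma>2 v2" and e2: "\<gamma>2 0 = y" "\<gamma>2 \<tau>2 = z"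
    using assms(2) unfolding reach_def by blast
  have t: "0 \<le> \<tau>1" "0 \<le> \<tau>2" using h1 h2 unfolding horizontal_def by auto
  obtain S1 where S1: "finite S1" "\<And>t. t \<in> {0<..<\<tau>1} - S1 \<Longrightarrow>
        (\<gamma>1 has_vector_derivative (\<Sum>i\<in>UNIV. (v1 t $ i) *\<^sub>R F i (\<gamma>1 t))) (at t)"
    using h1 unfolding horizontal_def by auto
  obtain S2 where S2: "finite S2" "\<And>t. t \<in> {0<..<\<tau>2} - S2 \<Longrightarrow>
        (\<gamma>2 has_vector_derivative (\<Sum>i\<in>UNIV. (v2 t $ i) *\<^sub>R F i (\<gamma>2 t))) (at t)"
    using h2 unfolding horizontal_def by auto
  define \<gamma> where "\<gamma> t = (if t \<le> \<tau>1 then \<gamma>1 t else \<gamma>2 (t - \<tau>1))" for t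
  define v where "v t = (if t \<le> \<tau>1 then v1 t else v2 (t - \<tau>1))" for t
  define S where "S = insert \<tau>1 (S1 \<union> (\<lambda>t. t + \<tau>1) ` S2)"
  have "horizontal F (\<tau>1 + \<tau>2) \<gamma> v"
    unfolding horizontal_def
  proof (intro conjI allI exI[of _ S] ballI)
    show "0 \<le> \<tau>1 + \<tau>2" using t by simp
    show "continuous_on {0..\<tau>1 + \<tau>2} \<gamma>"
    proof -
      have "continuous_on ({0..\<tau>1} \<union> {\<tau>1..\<tau>1 + \<tau>2}) \<gamma>"
        unfolding \<gamma>_def
      proof (rule continuous_on_If)
        show "continuous_on {0..\<tau>1} \<gamma>1" using h1 unfolding horizontal_def by auto
        show "continuous_on {\<tau>1..\<tau>1 + \<tau>2} (\<lambda>t. \<gamma>2 (t - \<tau>1))"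
          using h2 unfolding horizontal_def
          by (auto intro!: continuous_on_compose2[of "{0..\<tau>2}" \<gamma>2] continuous_intros)
      qed (use e1 e2 in auto)
      moreover have "{0..\<tau>1} \<union> {\<tau>1..\<tau>1 + \<tau>2} = {0..\<tau>1 + \<tau>2}" using t by auto
      ultimately show ?thesis by simp
    qed
    show "v \<in> borel_measurable borel"
    proof -
      have [measurable]: "v1 \<in> borel_measurable borel" "v2 \<in> borel_measurable borel"
        using h1 h2 unfolding horizontal_def by auto
      show ?thesis unfolding v_def by measurable
    qed
    show "norm (v s) \<le> 1" for s using h1 h2 unfolding v_def horizontal_def by auto
    show "finite S" unfolding S_def using S1 S2 by auto
    fix s assume s: "s \<in> {0<..<\<tau>1 + \<tau>2} - S"
    show "(\<gamma> has_vector_derivative (\<Sum>i\<in>UNIV. (v s $ i) *\<^sub>R F i (\<gamma> s))) (at s)"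
    proof (cases "s < \<tau>1")
      case True
      have "(\<gamma>1 has_vector_derivative (\<Sum>i\<in>UNIV. (v1 s $ i) *\<^sub>R F i (\<gamma>1 s))) (at s)"
        by (rule S1(2)) (use s True in \<open>auto simp: S_def\<close>)
      then have "(\<gamma> has_vector_derivative (\<Sum>i\<in>UNIV. (v1 s $ i) *\<^sub>R F i (\<gamma>1 s))) (at s)"
        by (rule has_vector_derivative_transform_within_open[of _ _ _ "{..<\<tau>1}"])
           (use True in \<open>auto simp: \<gamma>_def\<close>)
      then show ?thesis using True unfolding v_def \<gamma>_def by simp
    next
      case False
      then have g: "s > \<tau>1" using s unfolding S_def by auto
      have "(\<gamma>2 has_vector_derivative (\<Sum>i\<in>UNIV. (v2 (s - \<tau>1) $ i) *\<^sub>R F i (\<gamma>2 (s - \<tau>1)))) (at (s - \<tau>1))"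
        by (rule S2(2)) (use s g in \<open>force simp: S_def image_iff\<close>)
      moreover have "((\<lambda>r. r - \<tau>1) has_vector_derivative 1) (at s)"
        by (auto intro!: derivative_eq_intros)
      ultimately have "(\<gamma>2 \<circ> (\<lambda>r. r - \<tau>1) has_vector_derivative 1 *\<^sub>R (\<Sum>i\<in>UNIV. (v2 (s - \<tau>1) $ i) *\<^sub>R F i (\<gamma>2 (s - \<tau>1)))) (at s)"
        by (intro vector_diff_chain_at)
      then have "(\<gamma> has_vector_derivative 1 *\<^sub>R (\<Sum>i\<in>UNIV. (v2 (s - \<tau>1) $ i) *\<^sub>R F i (\<gamma>2 (s - \<tau>1)))) (at s)"
        by (rule has_vector_derivative_transform_within_open[of _ _ _ "{\<tau>1<..}"])
           (use g in \<open>auto simp: \<gamma>_def\<close>)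
      then show ?thesis using g unfolding v_def \<gamma>_def by simp
    qed
  qed
  moreover have "\<gamma> 0 = x" "\<gamma> (\<tau>1 + \<tau>2) = z"
    unfolding \<gamma>_def using t e1 e2 by auto
  ultimately show ?thesis unfolding reach_def by blast
qed

lemma reach_mono: "reach F \<tau> x y \<Longrightarrow> \<tau> \<le> \<tau>' \<Longrightarrow> reach F \<tau>' x y"
  using reach_trans[of F \<tau> x y "\<tau>' - \<tau>" y] reach_refl[of "\<tau>' - \<tau>" F y] by simp

lemma trajectory_reach:
  fixes F :: "'n::finite \<Rightarrow> 'a::euclidean_space \<Rightarrow> 'a"
  assumes tr: "trajectory B (\<lambda>z. e *\<^sub>R F i z) t \<gamma>" and e: "\<bar>e\<bar> \<le> 1"
  shows "reach F t (\<gamma> 0) (\<gamma> t)"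
  unfolding reach_def
proof (intro exI conjI)
  show "horizontal F t \<gamma> (\<lambda>_. e *\<^sub>R axis i 1)"
    unfolding horizontal_def
  proof (intro conjI allI exI[of _ "{}"] ballI)
    have d: "(\<gamma> has_vector_derivative e *\<^sub>R F i (\<gamma> s)) (at s within {0..t})" if "s \<in> {0..t}" for s
      using tr that unfolding trajectory_def by auto
    show "0 \<le> t" using tr unfolding trajectory_def by auto
    show "continuous_on {0..t} \<gamma>"
      using has_vector_derivative_continuous[OF d] continuous_on_eq_continuous_within by blast
    show "norm (e *\<^sub>R axis i 1 :: real ^ 'n) \<le> 1" using e by (simp add: norm_axis_1)
    fix s assume s: "s \<in> {0<..<t} - {}"
    have "(\<Sum>j\<in>UNIV. ((e *\<^sub>R axis i 1 :: real ^ 'n) $ j) *\<^sub>R F j (\<gamma> s)) = (\<Sum>j\<in>UNIV. if j = i then e *\<^sub>R F i (\<gamma> s) else 0)"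
      by (intro sum.cong refl) (auto simp: axis_def)
    then have "(\<Sum>j\<in>UNIV. ((e *\<^sub>R axis i 1 :: real ^ 'n) $ j) *\<^sub>R F j (\<gamma> s)) = e *\<^sub>R F i (\<gamma> s)" by simp
    then show "(\<gamma> has_vector_derivative (\<Sum>j\<in>UNIV. ((e *\<^sub>R axis i 1 :: real ^ 'n) $ j) *\<^sub>R F j (\<gamma> s))) (at s)"
      using d[of s] s by (simp add: at_within_Icc_at)
  qed auto
qed auto

lemma prog_run_reach:
  assumes "prog_run B F p t x y" "0 \<le> t" "\<forall>(i, e)\<in>set p. \<bar>e\<bar> \<le> 1"
  shows "reach F (real (length p) * t) x y"
  using assms
proof (induction p arbitrary: x rule: prog_series.induct)
  case 1
  then show ?case by (simp add: reach_refl)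
next
  case (2 i e p)
  then obtain \<gamma> where \<gamma>: "trajectory B (\<lambda>z. e *\<^sub>R F i z) t \<gamma>" "\<gamma> 0 = x" "prog_run B F p t (\<gamma> t) y" by auto
  have "reach F t x (\<gamma> t)" using trajectory_reach[where F = F and i = i and e = e, OF \<gamma>(1)] \<gamma>(2) "2.prems" by auto
  moreover have "reach F (real (length p) * t) (\<gamma> t) y" using "2.IH"[OF \<gamma>(3)] "2.prems" by auto
  ultimately show ?case using reach_trans by (fastforce simp: algebra_simps)
qed

section \<open>Moves along brackets and approximate controllability\<close>

lemma smooth_bounded_ball:
  fixes f :: "'a::euclidean_space \<Rightarrow> 'b::real_normed_vector"
  assumes "smooth_on UNIV f"
  obtains K where "K > 0" "\<And>x. norm x \<le> B \<Longrightarrow> norm (f x) \<le> K"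
proof -
  have "compact (f ` cball 0 B)"
    by (intro compact_continuous_image smooth_onD(3)[OF assms]) simp
  then have "bounded (f ` cball 0 B)" by (rule compact_imp_bounded)
  then obtain C where "C > 0" "\<And>x. x \<in> cball 0 B \<Longrightarrow> norm (f x) \<le> C"
    unfolding bounded_pos by blast
  then show ?thesis using that by auto
qed

lemma smooth_lipschitz_ball:
  fixes f :: "'a::euclidean_space \<Rightarrow> 'b::real_normed_vector"
  assumes "smooth_on UNIV f"
  obtains L where "L \<ge> 0" "\<And>x y. norm x \<le> B \<Longrightarrow> norm y \<le> B \<Longrightarrow> norm (f x - f y) \<le> L * norm (x - y)"
proof -
  have "\<exists>K>0. \<forall>x. norm x \<le> B \<longrightarrow> norm (frechet_derivative f (at x) b) \<le> K" for b
    using smooth_bounded_ball[OF smooth_onD(2)[OF assms, of b], of B] by metis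
  then obtain K where K: "\<And>b. K b > 0" "\<And>b x. norm x \<le> B \<Longrightarrow> norm (frechet_derivative f (at x) b) \<le> K b"
    by metis
  define L where "L = (\<Sum>b\<in>Basis. K b)"
  have on: "onorm (frechet_derivative f (at x)) \<le> L" if x: "norm x \<le> B" for x
  proof (rule onorm_le)
    fix v
    have "norm (frechet_derivative f (at x) v) \<le> (\<Sum>b\<in>Basis. norm ((v \<bullet> b) *\<^sub>R frechet_derivative f (at x) b))"
      unfolding frechet_derivative_basis[OF smooth_onD(1)[OF assms], of x v] by (rule norm_sum)
    also have "\<dots> \<le> (\<Sum>b\<in>Basis. norm v * K b)"
      by (intro sum_mono) (auto intro!: mult_mono Basis_le_norm K x)
    finally show "norm (frechet_derivative f (at x) v) \<le> L * norm v"
      unfolding L_def by (simp add: sum_distrib_left mult.commute)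
  qed
  have "norm (f x - f y) \<le> L * norm (x - y)" if "norm x \<le> B" "norm y \<le> B" for x y
  proof (rule differentiable_bound[of "cball 0 B"])
    show "(f has_derivative frechet_derivative f (at z)) (at z within cball 0 B)" for z
      using smooth_onD(4)[OF assms] by (rule has_derivative_at_withinI)
  qed (use that on in auto)
  moreover have "L \<ge> 0" unfolding L_def using K by (intro sum_nonneg) (auto intro: less_imp_le)
  ultimately show ?thesis using that by blast
qed

text \<open>The margin between the radii \<open>R\<close> and \<open>R + 1\<close> pays for the
  whole run, since each instruction moves the point by at most \<open>t * K\<close> with a common
  bound \<open>K\<close> of the fields.\<close>

lemma prog_run_exists:
  fixes F :: "'n::finite \<Rightarrow> 'a::euclidean_space \<Rightarrow> 'a"
  assumes F: "\<And>i. smooth_on UNIV (F i)" and p: "\<forall>(i, e)\<in>set p. \<bar>e\<bar> \<le> 1" and "R \<ge> 0"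
  obtains \<tau> where "0 < \<tau>" "\<tau> \<le> 1"
    "\<And>t x. 0 \<le> t \<Longrightarrow> t \<le> \<tau> \<Longrightarrow> norm x \<le> R \<Longrightarrow> \<exists>y. prog_run (R + 1) F p t x y"
proof -
  define B where "B = R + 1"
  have "\<exists>K>0. \<forall>x. norm x \<le> B \<longrightarrow> norm (F i x) \<le> K" for i
    using smooth_bounded_ball[OF F] by metis
  then obtain K' where K': "\<And>i. K' i > 0" "\<And>i x. norm x \<le> B \<Longrightarrow> norm (F i x) \<le> K' i" by metis
  have "\<exists>L\<ge>0. \<forall>x y. norm x \<le> B \<longrightarrow> norm y \<le> B \<longrightarrow> norm (F i x - F i y) \<le> L * norm (x - y)" for i
    using smooth_lipschitz_ball[of "F i" B, OF F] by metis
  then obtain L' where L': "\<And>i. L' i \<ge> 0"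
    "\<And>i x y. norm x \<le> B \<Longrightarrow> norm y \<le> B \<Longrightarrow> norm (F i x - F i y) \<le> L' i * norm (x - y)" by metis
  define K where "K = (\<Sum>i\<in>UNIV. K' i)"
  define L where "L = (\<Sum>i\<in>UNIV. L' i)"
  have KK: "K' i \<le> K" for i unfolding K_def by (rule member_le_sum) (use K' in \<open>auto intro: less_imp_le\<close>)
  have LL: "L' i \<le> L" for i unfolding L_def by (rule member_le_sum) (use L' in auto)
  have K0: "0 \<le> K" and L0: "0 \<le> L" unfolding K_def L_def by (rule sum_nonneg, use K' L' in \<open>simp add: less_imp_le\<close>)+
  have step: "\<exists>y. prog_run B F q t x y"
    if st: "0 \<le> t" "t * L < 1" "\<forall>(i, e)\<in>set q. \<bar>e\<bar> \<le> 1" "norm x + real (length q) * (t * K) \<le> B" for q t x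
    using st(3,4)
  proof (induction q arbitrary: x rule: prog_series.induct)
    case (2 i e q)
    have e: "\<bar>e\<bar> \<le> 1" using "2.prems" by auto
    have "0 \<le> t * K" using st K0 by simp
    then have q0: "0 \<le> real (length q) * (t * K)" by simp
    obtain \<gamma> where \<gamma>: "trajectory B (\<lambda>z. e *\<^sub>R F i z) t \<gamma>" "\<gamma> 0 = x" "norm (\<gamma> t - x) \<le> t * K"
    proof (rule trajectory_exists[of B "\<lambda>z. e *\<^sub>R F i z" L K t x])
      show "norm (e *\<^sub>R F i x - e *\<^sub>R F i y) \<le> L * norm (x - y)" if "norm x \<le> B" "norm y \<le> B" for x y
      proof -
        have "norm (e *\<^sub>R F i x - e *\<^sub>R F i y) = \<bar>e\<bar> * norm (F i x - F i y)"
          by (simp add: scaleR_diff_right[symmetric])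
        also have "\<dots> \<le> 1 * (L * norm (x - y))"
          by (intro mult_mono e order_trans[OF L'(2)[OF that] mult_right_mono[OF LL]]) auto
        finally show ?thesis by simp
      qed
      show "norm (e *\<^sub>R F i x) \<le> K" if "norm x \<le> B" for x
      proof -
        have "\<bar>e\<bar> * norm (F i x) \<le> 1 * K"
          by (intro mult_mono e order_trans[OF K'(2)[OF that] KK]) auto
        then show ?thesis by simp
      qed
      show "norm x + t * K \<le> B" using "2.prems"(2) q0 by (simp add: algebra_simps)
    qed (use st(1,2) K0 L0 in auto)
    have "norm (\<gamma> t) \<le> norm x + t * K"
      using norm_triangle_ineq[of x "\<gamma> t - x"] \<gamma>(3) by simp
    then have "norm (\<gamma> t) + real (length q) * (t * K) \<le> B"
      using "2.prems"(2) by (simp add: algebra_simps)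
    then obtain y where "prog_run B F q t (\<gamma> t) y" using "2.IH" "2.prems"(1) by auto
    then show ?case using \<gamma> by auto
  qed auto
  \<comment> \<open>The second entry keeps the total displacement \<open>length p * t * K\<close>
    within the margin; the third guarantees \<open>t * L < 1\<close>, the contraction condition of
    the existence lemma.\<close>
  define \<tau> where "\<tau> = min 1 (min (1 / (1 + real (length p) * K)) (1 / (2 * (1 + L))))"
  have pos: "0 < 1 + real (length p) * K" "0 < 2 * (1 + L)" using K0 L0 by (auto intro: add_pos_nonneg)
  show ?thesis
  proof (rule that[of \<tau>])
    show "0 < \<tau>" "\<tau> \<le> 1" unfolding \<tau>_def using pos by auto
    fix t x assume t: "0 \<le> t" "t \<le> \<tau>" and x: "norm (x :: 'a) \<le> R"
    have "t \<le> 1 / (1 + real (length p) * K)" "t \<le> 1 / (2 * (1 + L))" using t unfolding \<tau>_def by auto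
    then have 1: "t * (1 + real (length p) * K) \<le> 1" and 2: "t * (2 * (1 + L)) \<le> 1"
      using pos by (simp_all add: pos_le_divide_eq)
    have "t * L < 1" using 2 t L0 by (simp add: algebra_simps)
    moreover have "norm x + real (length p) * (t * K) \<le> B"
      unfolding B_def using 1 x t by (simp add: algebra_simps)
    ultimately show "\<exists>y. prog_run (R + 1) F p t x y"
      using step[OF t(1) _ p] unfolding B_def by blast
  qed
qed

lemma bracket_prog_letters: "\<forall>(i, e)\<in>set (bracket_prog I). \<bar>e\<bar> \<le> 1"
  "\<forall>(i, e)\<in>set (prog_inv (bracket_prog I)). \<bar>e\<bar> \<le> 1"
proof -
  have inv: "\<forall>(i, e)\<in>set (prog_inv p). \<bar>e\<bar> \<le> 1" if "\<forall>(i, e)\<in>set p. \<bar>e\<bar> \<le> 1" for p :: "'a prog"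
    using that unfolding prog_inv_def by auto
  show 1: "\<forall>(i, e)\<in>set (bracket_prog I). \<bar>e\<bar> \<le> 1"
  proof (induction I rule: bracket_prog.induct)
    case (3 i j J)
    then show ?case using inv[OF 3(1)] by auto
  qed auto
  show "\<forall>(i, e)\<in>set (prog_inv (bracket_prog I)). \<bar>e\<bar> \<le> 1" by (rule inv[OF 1])
qed

text \<open>The sign \<open>\<sigma>\<close> treats a bracket program and its inverse together. Up
  to the length of \<open>I\<close>, only the empty word and words of full length contribute,
  because the rest of the series starts in that degree.\<close>

lemma series_op_leading:
  fixes F :: "'n::finite \<Rightarrow> 'a::euclidean_space \<Rightarrow> 'a"
  assumes F: "\<And>i. smooth_on UNIV (F i)" and \<phi>: "smooth_on UNIV \<phi>" and I: "I \<noteq> []"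
    and c: "nc_order (Suc (length I)) (c - 1 - b)"
    and b: "\<And>w. nc_coeff b w = \<sigma> * nc_coeff (lie_poly I) w"
  shows "series_op F (length I) c t \<phi> x = \<phi> x + \<sigma> * t ^ length I * vf_op (bracket_field F I) \<phi> x"
proof -
  let ?k = "length I"
  have ord: "nc_order ?k (lie_poly I)" by (rule bracket_prog_series(1)[OF I])
  have coeff: "nc_coeff c w = (if w = [] then 1 else 0) + (if length w = ?k then \<sigma> * nc_coeff (lie_poly I) w else 0)"
    if "length w \<le> ?k" for w
  proof -
    have "nc_coeff (c - 1 - b) w = 0" using c that unfolding nc_order_def by auto
    then have "nc_coeff c w = (if w = [] then 1 else 0) + \<sigma> * nc_coeff (lie_poly I) w"
      by (simp add: minus_ncs.rep_eq one_ncs.rep_eq b)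
    then show ?thesis using ord that unfolding nc_order_def by auto
  qed
  have "series_op F ?k c t \<phi> x = (\<Sum>w\<in>{w. length w \<le> ?k}. (if w = [] then \<phi> x else 0)
      + (if length w = ?k then \<sigma> * t ^ ?k * (nc_coeff (lie_poly I) w * word_op F w \<phi> x) else 0))"
    unfolding series_op_def by (intro sum.cong refl) (auto simp: coeff algebra_simps)
  also have "\<dots> = \<phi> x + (\<Sum>w\<in>{w. length w \<le> ?k}. if length w = ?k then \<sigma> * t ^ ?k * (nc_coeff (lie_poly I) w * word_op F w \<phi> x) else 0)"
    using finite_words(2)[where 'n = 'n, of ?k] by (simp add: sum.distrib sum.delta')
  also have "(\<Sum>w\<in>{w. length w \<le> ?k}. if length w = ?k then \<sigma> * t ^ ?k * (nc_coeff (lie_poly I) w * word_op F w \<phi> x) else 0)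
      = (\<Sum>w\<in>{w. length w = ?k}. \<sigma> * t ^ ?k * (nc_coeff (lie_poly I) w * word_op F w \<phi> x))"
    by (rule sum.mono_neutral_cong_right[OF finite_words(2)]) auto
  also have "\<dots> = \<sigma> * t ^ ?k * vf_op (bracket_field F I) \<phi> x"
    unfolding sum_distrib_left[symmetric] lie_poly_action[where F = F, OF F \<phi> I] ..
  finally show ?thesis .
qed

text \<open>The expansion is applied to the coordinate functions, whose Lie derivative along a field
  is the coordinate of the field. The path has length of order \<open>t\<close> while the
  displacement is of order \<open>t ^ length I\<close>; this mismatch is the source of the roots in
  the following lemmas.\<close>

lemma bracket_move:
  fixes F :: "'n::finite \<Rightarrow> 'a::euclidean_space \<Rightarrow> 'a"
  assumes F: "\<And>i. smooth_on UNIV (F i)" and I: "I \<noteq> []" and R: "R \<ge> 0"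
  obtains C \<tau> where "0 \<le> C" "0 < \<tau>" "\<tau> \<le> 1"
    "\<And>x t \<sigma>. norm x \<le> R \<Longrightarrow> 0 \<le> t \<Longrightarrow> t \<le> \<tau> \<Longrightarrow> \<sigma> \<in> {1, - 1} \<Longrightarrow>
      \<exists>y. reach F (C * t) x y \<and>
        norm (y - x - (\<sigma> * t ^ length I) *\<^sub>R bracket_field F I x) \<le> C * t ^ Suc (length I)"
proof -
  let ?k = "length I"
  have one: "\<exists>C \<tau>. 0 \<le> C \<and> 0 < \<tau> \<and> \<tau> \<le> 1 \<and> (\<forall>x t. norm x \<le> R \<longrightarrow> 0 \<le> t \<longrightarrow> t \<le> \<tau> \<longrightarrow>
      (\<exists>y. reach F (C * t) x y \<and> norm (y - x - (\<sigma> * t ^ ?k) *\<^sub>R bracket_field F I x) \<le> C * t ^ Suc ?k))"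
    if p: "\<forall>(i, e)\<in>set p. \<bar>e\<bar> \<le> 1" and ser: "nc_order (Suc ?k) (prog_series p - 1 - b)"
      and b: "\<And>w. nc_coeff b w = \<sigma> * nc_coeff (lie_poly I) w" for p b \<sigma>
  proof -
    obtain \<tau> where \<tau>: "0 < \<tau>" "\<tau> \<le> 1"
      "\<And>t x. 0 \<le> t \<Longrightarrow> t \<le> \<tau> \<Longrightarrow> norm x \<le> R \<Longrightarrow> \<exists>y. prog_run (R + 1) F p t x y"
      using prog_run_exists[where F = F, OF F p R] by blast
    have sm: "smooth_on UNIV (\<lambda>x :: 'a. x \<bullet> b)" for b
      by (rule smooth_on_UNIV_intros(3)[OF bounded_linear_inner_left smooth_on_id])
    have "\<exists>C\<ge>0. \<forall>t x y. 0 \<le> t \<longrightarrow> t \<le> 1 \<longrightarrow> prog_run (R + 1) F p t x y \<longrightarrow>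
        \<bar>y \<bullet> b - series_op F ?k (prog_series p) t (\<lambda>x. x \<bullet> b) x\<bar> \<le> C * t ^ Suc ?k" for b
      by (rule prog_run_expansion[where F = F, OF F sm p])
    then obtain C where C: "\<And>b. C b \<ge> 0" "\<And>b t x y. 0 \<le> t \<Longrightarrow> t \<le> 1 \<Longrightarrow> prog_run (R + 1) F p t x y \<Longrightarrow>
        \<bar>y \<bullet> b - series_op F ?k (prog_series p) t (\<lambda>x. x \<bullet> b) x\<bar> \<le> C b * t ^ Suc ?k" by metis
    define C' where "C' = (\<Sum>b\<in>Basis. C b) + real (length p)"
    have C0: "0 \<le> (\<Sum>b\<in>Basis. C b)" by (intro sum_nonneg C)
    have "\<exists>y. reach F (C' * t) x y \<and> norm (y - x - (\<sigma> * t ^ ?k) *\<^sub>R bracket_field F I x) \<le> C' * t ^ Suc ?k"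
      if x: "norm x \<le> R" and t: "0 \<le> t" "t \<le> \<tau>" for x t
    proof -
      obtain y where y: "prog_run (R + 1) F p t x y" using \<tau>(3)[OF t x] by blast
      have t1: "t \<le> 1" using t \<tau> by simp
      have "vf_op (bracket_field F I) (\<lambda>x. x \<bullet> b) x = bracket_field F I x \<bullet> b" for b
        unfolding vf_op_def
        using frechet_derivative_at[OF bounded_linear_imp_has_derivative[OF bounded_linear_inner_left[of b]]]
        by metis
      then have "\<bar>(y - x - (\<sigma> * t ^ ?k) *\<^sub>R bracket_field F I x) \<bullet> b\<bar> \<le> C b * t ^ Suc ?k" for b
        using C(2)[OF t(1) t1 y, of b] series_op_leading[where F = F, OF F sm[of b] I ser b, of t x]
        by (simp add: inner_diff_left algebra_simps)
      then have "norm (y - x - (\<sigma> * t ^ ?k) *\<^sub>R bracket_field F I x) \<le> (\<Sum>b\<in>Basis. C b * t ^ Suc ?k)"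
        by (intro order_trans[OF norm_le_l1] sum_mono)
      also have "\<dots> = (\<Sum>b\<in>Basis. C b) * t ^ Suc ?k" by (simp only: sum_distrib_right)
      also have "\<dots> \<le> C' * t ^ Suc ?k" unfolding C'_def using t by (intro mult_right_mono) auto
      finally have 1: "norm (y - x - (\<sigma> * t ^ ?k) *\<^sub>R bracket_field F I x) \<le> C' * t ^ Suc ?k" .
      have "real (length p) * t \<le> C' * t" unfolding C'_def using t C0 by (intro mult_right_mono) auto
      then have "reach F (C' * t) x y" by (rule reach_mono[OF prog_run_reach[OF y t(1) p]])
      then show ?thesis using 1 by blast
    qed
    moreover have "0 \<le> C'" unfolding C'_def using C0 by simp
    ultimately show ?thesis using \<tau> by blast
  qed
  obtain C1 \<tau>1 where 1: "0 \<le> C1" "0 < \<tau>1" "\<tau>1 \<le> 1" "\<And>x t. norm x \<le> R \<Longrightarrow> 0 \<le> t \<Longrightarrow> t \<le> \<tau>1 \<Longrightarrow>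
      (\<exists>y. reach F (C1 * t) x y \<and> norm (y - x - (1 * t ^ ?k) *\<^sub>R bracket_field F I x) \<le> C1 * t ^ Suc ?k)"
    using one[OF bracket_prog_letters(1) bracket_prog_series(2)[OF I], of 1] by auto
  have "nc_order (Suc ?k) (prog_series (prog_inv (bracket_prog I)) - 1 - (- lie_poly I))"
    using bracket_prog_inv_series[OF I] by simp
  from one[OF bracket_prog_letters(2) this, of "- 1"]
  obtain C2 \<tau>2 where 2: "0 \<le> C2" "0 < \<tau>2" "\<tau>2 \<le> 1" "\<And>x t. norm x \<le> R \<Longrightarrow> 0 \<le> t \<Longrightarrow> t \<le> \<tau>2 \<Longrightarrow>
      (\<exists>y. reach F (C2 * t) x y \<and> norm (y - x - (- 1 * t ^ ?k) *\<^sub>R bracket_field F I x) \<le> C2 * t ^ Suc ?k)"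
    by (auto simp: uminus_ncs.rep_eq)
  show ?thesis
  proof (rule that[of "max C1 C2" "min \<tau>1 \<tau>2"])
    fix x t \<sigma> assume x: "norm (x :: 'a) \<le> R" and t: "0 \<le> t" "t \<le> min \<tau>1 \<tau>2" and s: "\<sigma> \<in> {1, - 1 :: real}"
    define C where "C = max C1 C2"
    have le: "C1 * t \<le> C * t" "C2 * t \<le> C * t" "C1 * t ^ Suc ?k \<le> C * t ^ Suc ?k" "C2 * t ^ Suc ?k \<le> C * t ^ Suc ?k"
      unfolding C_def using t by (auto intro!: mult_right_mono simp del: power_Suc)
    consider "\<sigma> = 1" | "\<sigma> = - 1" using s by auto
    then show "\<exists>y. reach F (max C1 C2 * t) x y \<and>
        norm (y - x - (\<sigma> * t ^ length I) *\<^sub>R bracket_field F I x) \<le> max C1 C2 * t ^ Suc (length I)"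
    proof cases
      case s1: 1
      obtain y where "reach F (C1 * t) x y" "norm (y - x - (1 * t ^ ?k) *\<^sub>R bracket_field F I x) \<le> C1 * t ^ Suc ?k"
        using 1(4)[OF x t(1)] t(2) by auto
      then show ?thesis
        unfolding C_def[symmetric] s1 using reach_mono[OF _ le(1)] order_trans[OF _ le(3)] by blast
    next
      case s2: 2
      obtain y where "reach F (C2 * t) x y" "norm (y - x - (- 1 * t ^ ?k) *\<^sub>R bracket_field F I x) \<le> C2 * t ^ Suc ?k"
        using 2(4)[OF x t(1)] t(2) by auto
      then show ?thesis
        unfolding C_def[symmetric] s2 using reach_mono[OF _ le(2)] order_trans[OF _ le(4)] by blast
    qed
  qed (use 1 2 in auto)
qed

definition field_comb :: "('n \<Rightarrow> 'a::euclidean_space \<Rightarrow> 'a) \<Rightarrow> ('n list \<Rightarrow> real) \<Rightarrow> 'n list list \<Rightarrow> 'a \<Rightarrow> 'a" where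
  "field_comb F a Is x = (\<Sum>I\<leftarrow>Is. a I *\<^sub>R bracket_field F I x)"

lemma field_comb_lipschitz:
  fixes F :: "'n::finite \<Rightarrow> 'a::euclidean_space \<Rightarrow> 'a"
  assumes F: "\<And>i. smooth_on UNIV (F i)"
  obtains L where "L \<ge> 0" "\<And>a \<delta> x y. (\<And>I. \<bar>a I\<bar> \<le> \<delta>) \<Longrightarrow> norm x \<le> B \<Longrightarrow> norm y \<le> B \<Longrightarrow>
     norm (field_comb F a Is x - field_comb F a Is y) \<le> L * \<delta> * norm (x - y)"
proof -
  have "\<exists>L\<ge>0. \<forall>a \<delta> x y. (\<forall>I. \<bar>a I\<bar> \<le> \<delta>) \<longrightarrow> norm x \<le> B \<longrightarrow> norm y \<le> B \<longrightarrow>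
     norm (field_comb F a Is x - field_comb F a Is y) \<le> L * \<delta> * norm (x - y)"
  proof (induction Is)
    case Nil
    then show ?case by (intro exI[of _ 0]) (auto simp: field_comb_def)
  next
    case (Cons I Is)
    obtain L where L: "L \<ge> 0" "\<And>a \<delta> x y. (\<forall>I. \<bar>a I\<bar> \<le> \<delta>) \<Longrightarrow> norm x \<le> B \<Longrightarrow> norm y \<le> B \<Longrightarrow>
       norm (field_comb F a Is x - field_comb F a Is y) \<le> L * \<delta> * norm (x - y)"
      using Cons.IH by blast
    obtain L1 where L1: "L1 \<ge> 0" "\<And>x y. norm x \<le> B \<Longrightarrow> norm y \<le> B \<Longrightarrow>
        norm (bracket_field F I x - bracket_field F I y) \<le> L1 * norm (x - y)"
      using smooth_lipschitz_ball[OF smooth_bracket_field[of F I, OF F], of B] by blast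
    have "norm (field_comb F a (I # Is) x - field_comb F a (I # Is) y) \<le> (L1 + L) * \<delta> * norm (x - y)"
      if a: "\<forall>I. \<bar>a I\<bar> \<le> \<delta>" and xy: "norm x \<le> B" "norm y \<le> B" for a \<delta> x y
    proof -
      have eq: "field_comb F a (I # Is) x - field_comb F a (I # Is) y
          = a I *\<^sub>R (bracket_field F I x - bracket_field F I y) + (field_comb F a Is x - field_comb F a Is y)"
        unfolding field_comb_def by (simp add: algebra_simps)
      have le: "norm (a I *\<^sub>R (bracket_field F I x - bracket_field F I y)) \<le> \<delta> * (L1 * norm (x - y))"
        unfolding norm_scaleR by (intro mult_mono L1 xy) (use a L1 order_trans[OF abs_ge_zero] in auto)
      have "\<delta> * (L1 * norm (x - y)) + L * \<delta> * norm (x - y) = (L1 + L) * \<delta> * norm (x - y)"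
        by (simp add: algebra_simps)
      then show ?thesis
        unfolding eq using norm_triangle_mono[OF le L(2)[OF a xy]] by simp
    qed
    moreover have "0 \<le> L1 + L" using L1(1) L(1) by simp
    ultimately show ?case by blast
  qed
  then show ?thesis using that by blast
qed

text \<open>The bracket moves of the list are carried out one after another, a bracket of length
  \<open>k\<close> with running time \<open>t = root k \<bar>a I\<bar>\<close>. As
  \<open>\<delta> \<le> 1\<close> and \<open>k \<le> r\<close>, this time is at most
  \<open>root r \<delta>\<close>. A single move errs by order \<open>t ^ Suc k\<close>, at most
  \<open>\<delta> * root r \<delta>\<close>; evaluating the remaining fields at the displaced point
  errs by order \<open>\<delta> * \<delta>\<close>, which is smaller still.\<close>

lemma comb_move:
  fixes F :: "'n::finite \<Rightarrow> 'a::euclidean_space \<Rightarrow> 'a"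
  assumes F: "\<And>i. smooth_on UNIV (F i)" and r: "r \<ge> 1"
    and Is: "\<forall>I\<in>set Is. I \<noteq> [] \<and> length I \<le> r" and R: "R \<ge> 0"
  shows "\<exists>C \<delta>0. 0 \<le> C \<and> 0 < \<delta>0 \<and> \<delta>0 \<le> 1 \<and> (\<forall>x a \<delta>. norm x \<le> R \<longrightarrow> 0 \<le> \<delta> \<longrightarrow> \<delta> \<le> \<delta>0 \<longrightarrow>
      (\<forall>I. \<bar>a I\<bar> \<le> \<delta>) \<longrightarrow>
      (\<exists>y. reach F (C * root r \<delta>) x y \<and> norm (y - x - field_comb F a Is x) \<le> C * (\<delta> * root r \<delta>)))"
  using Is R
proof (induction Is arbitrary: R)
  case Nil
  have "reach F (0 * root r \<delta>) x x" for \<delta> and x :: 'a using reach_refl[of 0 F x] by simp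
  then show ?case by (intro exI[of _ 0] exI[of _ 1]) (auto simp: field_comb_def)
next
  case (Cons I Is)
  define k where "k = length I"
  have k: "1 \<le> k" "k \<le> r" "I \<noteq> []" using Cons.prems unfolding k_def by (auto simp: Suc_le_eq)
  have r0: "0 < r" using r by simp
  obtain C1 \<tau> where 1: "0 \<le> C1" "0 < \<tau>" "\<tau> \<le> 1"
    "\<And>x t \<sigma>. norm x \<le> R \<Longrightarrow> 0 \<le> t \<Longrightarrow> t \<le> \<tau> \<Longrightarrow> \<sigma> \<in> {1, - 1} \<Longrightarrow>
      \<exists>y. reach F (C1 * t) x y \<and>
        norm (y - x - (\<sigma> * t ^ k) *\<^sub>R bracket_field F I x) \<le> C1 * t ^ Suc k"
    using bracket_move[where F = F and I = I and R = R, OF F k(3) Cons.prems(2)] unfolding k_def by blast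
  obtain C2 \<delta>2 where 2: "0 \<le> C2" "0 < \<delta>2" "\<delta>2 \<le> 1" "\<And>x a \<delta>. norm x \<le> R + 1 \<Longrightarrow> 0 \<le> \<delta> \<Longrightarrow> \<delta> \<le> \<delta>2 \<Longrightarrow>
      \<forall>I. \<bar>a I\<bar> \<le> \<delta> \<Longrightarrow>
      \<exists>y. reach F (C2 * root r \<delta>) x y \<and> norm (y - x - field_comb F a Is x) \<le> C2 * (\<delta> * root r \<delta>)"
    using Cons.IH[of "R + 1"] Cons.prems by auto
  obtain L where L: "L \<ge> 0" "\<And>a \<delta> x y. (\<And>I. \<bar>a I\<bar> \<le> \<delta>) \<Longrightarrow> norm x \<le> R + 1 \<Longrightarrow> norm y \<le> R + 1 \<Longrightarrow>
     norm (field_comb F a Is x - field_comb F a Is y) \<le> L * \<delta> * norm (x - y)"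
    using field_comb_lipschitz[where F = F and B = "R + 1" and Is = Is, OF F] by blast
  obtain H where H: "H > 0" "\<And>x. norm x \<le> R \<Longrightarrow> norm (bracket_field F I x) \<le> H"
    using smooth_bounded_ball[OF smooth_bracket_field[of F I, OF F]] by blast
  define C where "C = C1 + C2 + L * (H + C1)"
  \<comment> \<open>The entry \<open>\<tau> ^ r\<close> makes the running time admissible for the
    bracket move, and \<open>1 / (H + C1)\<close> keeps the intermediate point in the ball of radius
    \<open>R + 1\<close>, where the induction hypothesis is available.\<close>
  define \<delta>0 where "\<delta>0 = min (\<tau> ^ r) (min \<delta>2 (1 / (H + C1)))"
  have HC: "0 < H + C1" using H 1 by simp
  have C0: "0 \<le> C" unfolding C_def using 1 2 L HC by simp
  have "\<exists>y. reach F (C * root r \<delta>) x y \<and> norm (y - x - field_comb F a (I # Is) x) \<le> C * (\<delta> * root r \<delta>)"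
    if x: "norm x \<le> R" and d: "0 \<le> \<delta>" "\<delta> \<le> \<delta>0" and a: "\<forall>I. \<bar>a I\<bar> \<le> \<delta>" for x a \<delta>
  proof -
    have d1: "\<delta> \<le> \<tau> ^ r" "\<delta> \<le> \<delta>2" "\<delta> * (H + C1) \<le> 1" "\<delta> \<le> 1"
      using d 2 HC unfolding \<delta>0_def by (auto simp: pos_le_divide_eq)
    define \<epsilon> where "\<epsilon> = root r \<delta>"
    have e: "0 \<le> \<epsilon>" "\<epsilon> ^ r = \<delta>" unfolding \<epsilon>_def using d r0 by simp_all
    have e\<tau>: "\<epsilon> \<le> \<tau>"
      using d1(1) e 1(2) r0 by (metis power_less_imp_less_base power_strict_mono not_le less_imp_le)
    have e1: "\<epsilon> \<le> 1" using e\<tau> 1 by simp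
    have de: "\<delta> \<le> \<epsilon>"
    proof -
      have "\<epsilon> ^ r \<le> \<epsilon> ^ 1" by (rule power_decreasing) (use r e e1 in auto)
      then show ?thesis using e by simp
    qed
    define t where "t = root k \<bar>a I\<bar>"
    have t0: "0 \<le> t" and tk: "t ^ k = \<bar>a I\<bar>" unfolding t_def using k by simp_all
    have te: "t \<le> \<epsilon>"
    proof (rule ccontr)
      assume "\<not> t \<le> \<epsilon>"
      then have "\<epsilon> ^ k < t ^ k" using e k by (intro power_strict_mono) auto
      moreover have "\<epsilon> ^ r \<le> \<epsilon> ^ k" by (rule power_decreasing) (use k e e1 in auto)
      ultimately show False using tk a e by (metis not_le order_trans)
    qed
    define \<sigma> where "\<sigma> = (if a I \<ge> 0 then 1 else - 1 :: real)"
    have sa: "\<sigma> * t ^ k = a I" unfolding tk \<sigma>_def by auto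
    obtain y1 where y1: "reach F (C1 * t) x y1" "norm (y1 - x - a I *\<^sub>R bracket_field F I x) \<le> C1 * t ^ Suc k"
    proof -
      have "\<sigma> \<in> {1, - 1}" unfolding \<sigma>_def by auto
      from 1(4)[OF x t0 order_trans[OF te e\<tau>] this] show ?thesis
        unfolding sa using that by blast
    qed
    have tS: "t ^ Suc k \<le> \<delta> * \<epsilon>"
    proof -
      have "t ^ k * t \<le> \<delta> * \<epsilon>" using tk a te t0 d by (intro mult_mono) auto
      then show ?thesis by (simp add: mult.commute)
    qed
    have e_y1: "norm (y1 - x - a I *\<^sub>R bracket_field F I x) \<le> C1 * (\<delta> * \<epsilon>)"
      using y1(2) mult_left_mono[OF tS 1(1)] by simp
    have d_y1: "norm (y1 - x) \<le> (H + C1) * \<delta>"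
    proof -
      have "C1 * (\<delta> * \<epsilon>) \<le> C1 * (\<delta> * 1)" using e1 d 1 by (intro mult_left_mono) auto
      then have "norm (y1 - x - a I *\<^sub>R bracket_field F I x) \<le> C1 * \<delta>" using e_y1 by simp
      moreover have "norm (a I *\<^sub>R bracket_field F I x) \<le> \<delta> * H"
        unfolding norm_scaleR by (intro mult_mono H x) (use a d in auto)
      moreover have "norm (y1 - x) \<le> norm (y1 - x - a I *\<^sub>R bracket_field F I x) + norm (a I *\<^sub>R bracket_field F I x)"
        using norm_triangle_ineq[of "y1 - x - a I *\<^sub>R bracket_field F I x" "a I *\<^sub>R bracket_field F I x"] by simp
      ultimately show ?thesis by (simp add: algebra_simps)
    qed
    have y1R: "norm y1 \<le> R + 1"
    proof -
      have "norm y1 \<le> norm x + norm (y1 - x)" using norm_triangle_ineq[of x "y1 - x"] by simp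
      then show ?thesis using x d_y1 d1(3) by (simp add: mult.commute)
    qed
    obtain y where y: "reach F (C2 * \<epsilon>) y1 y" "norm (y - y1 - field_comb F a Is y1) \<le> C2 * (\<delta> * \<epsilon>)"
      using 2(4)[OF y1R d(1) d1(2) a] unfolding \<epsilon>_def by blast
    have fc: "norm (field_comb F a Is y1 - field_comb F a Is x) \<le> L * (H + C1) * (\<delta> * \<epsilon>)"
    proof -
      have "norm (field_comb F a Is y1 - field_comb F a Is x) \<le> L * \<delta> * norm (y1 - x)"
        by (rule L(2)) (use a y1R x in auto)
      also have "\<dots> \<le> L * \<delta> * ((H + C1) * \<epsilon>)"
        using L(1) d d_y1 mult_left_mono[OF de less_imp_le[OF HC]] by (intro mult_left_mono) auto
      finally show ?thesis by (simp add: mult_ac)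
    qed
    have eq: "y - x - field_comb F a (I # Is) x = (y1 - x - a I *\<^sub>R bracket_field F I x)
        + (y - y1 - field_comb F a Is y1) + (field_comb F a Is y1 - field_comb F a Is x)"
      unfolding field_comb_def by simp
    have "norm (y - x - field_comb F a (I # Is) x) \<le> C1 * (\<delta> * \<epsilon>) + C2 * (\<delta> * \<epsilon>) + L * (H + C1) * (\<delta> * \<epsilon>)"
      unfolding eq by (rule norm_triangle_mono[OF norm_triangle_mono[OF e_y1 y(2)] fc])
    then have fin: "norm (y - x - field_comb F a (I # Is) x) \<le> C * (\<delta> * \<epsilon>)"
      unfolding C_def by (simp add: algebra_simps)
    have "reach F (C1 * t + C2 * \<epsilon>) x y" by (rule reach_trans[OF y1(1) y(1)])
    moreover have "C1 * t + C2 * \<epsilon> \<le> C * \<epsilon>"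
    proof -
      have "C1 * t \<le> C1 * \<epsilon>" using te 1 by (intro mult_left_mono) auto
      moreover have "0 \<le> L * (H + C1) * \<epsilon>" using L HC e by simp
      ultimately show ?thesis unfolding C_def by (simp add: algebra_simps)
    qed
    ultimately have "reach F (C * \<epsilon>) x y" by (rule reach_mono)
    then show ?thesis using fin unfolding \<epsilon>_def by blast
  qed
  moreover have "0 < \<delta>0" "\<delta>0 \<le> 1" unfolding \<delta>0_def using 1 2 HC by auto
  ultimately show ?case using C0 by blast
qed

text \<open>The first entry of every bracket is one of the given fields, so iterated brackets are
  nested to the right and can be indexed by words.\<close>

lemma iterated_brackets_word:
  assumes "g \<in> iterated_brackets (range F) i"
  shows "\<exists>I. I \<noteq> [] \<and> length I \<le> Suc i \<and> g = bracket_field F I"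
  using assms
proof (induction i arbitrary: g rule: less_induct)
  case (less i)
  show ?case
  proof (cases i)
    case 0
    then obtain j where "g = F j" using less.prems by auto
    then show ?thesis by (intro exI[of _ "[j]"]) simp
  next
    case (Suc m)
    then obtain j l h where j: "j \<in> {1..Suc m}" and g: "g = lie_bracket (F l) h"
      and h: "h \<in> iterated_brackets (range F) (j - 1)"
      using less.prems by auto
    have "j - 1 < i" using j Suc by auto
    then obtain I where I: "I \<noteq> []" "length I \<le> Suc (j - 1)" "h = bracket_field F I"
      using less.IH h by blast
    have "bracket_field F (l # I) = lie_bracket (F l) (bracket_field F I)"
      using I(1) by (cases I) auto
    then show ?thesis using g I j Suc by (intro exI[of _ "l # I"]) auto
  qed
qed

lemma span_image_finite:
  assumes "finite W" "v \<in> span (h ` W)"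
  shows "\<exists>c. v = (\<Sum>I\<in>W. c I *\<^sub>R h I)"
proof -
  let ?S = "{v. \<exists>c. v = (\<Sum>I\<in>W. c I *\<^sub>R h I)}"
  have "subspace ?S"
    unfolding subspace_def
  proof (intro conjI allI ballI)
    show "0 \<in> ?S" by (auto intro!: exI[of _ "\<lambda>_. 0"])
    fix x assume x: "x \<in> ?S"
    then obtain c where c: "x = (\<Sum>I\<in>W. c I *\<^sub>R h I)" by blast
    show "k *\<^sub>R x \<in> ?S" for k
      unfolding c by (auto intro!: exI[of _ "\<lambda>I. k * c I"] simp: scaleR_sum_right)
    fix y assume "y \<in> ?S"
    then obtain d where d: "y = (\<Sum>I\<in>W. d I *\<^sub>R h I)" by blast
    show "x + y \<in> ?S"
      unfolding c d by (auto intro!: exI[of _ "\<lambda>I. c I + d I"] simp: scaleR_add_left sum.distrib)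
  qed
  moreover have "h ` W \<subseteq> ?S"
  proof clarify
    fix I assume I: "I \<in> W"
    have "(\<Sum>J\<in>W. (if J = I then 1 else 0) *\<^sub>R h J) = (\<Sum>J\<in>W. if J = I then h I else 0)"
      by (intro sum.cong) auto
    then have "h I = (\<Sum>J\<in>W. (if J = I then 1 else 0) *\<^sub>R h J)"
      using I assms(1) by simp
    then show "\<exists>c. h I = (\<Sum>J\<in>W. c J *\<^sub>R h J)" by (rule exI[of _ "\<lambda>J. if J = I then 1 else 0"])
  qed
  ultimately show ?thesis using span_minimal assms(2) by blast
qed

text \<open>A displacement \<open>w\<close> is written in the brackets at the centre
  \<open>x0\<close>, with coefficients linear in \<open>w\<close>, and the combined move with these
  coefficients is performed from the nearby point \<open>x\<close>. The variation of the fields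
  between \<open>x\<close> and \<open>x0\<close> and the error of the move are each kept below a
  quarter of \<open>norm w\<close>.\<close>

lemma local_step:
  fixes F :: "'n::finite \<Rightarrow> 'a::euclidean_space \<Rightarrow> 'a"
  assumes F: "\<And>i. smooth_on UNIV (F i)"
    and gen: "span {g x0 | g. g \<in> (\<Union>i\<in>{0..m}. iterated_brackets (range F) i)} = UNIV"
  shows "\<exists>\<rho> s C. 0 < \<rho> \<and> 0 < s \<and> s \<le> 1 \<and> 0 \<le> C \<and> (\<forall>x w. norm (x - x0) < \<rho> \<longrightarrow> norm w \<le> s \<longrightarrow>
     (\<exists>y. reach F (C * root (Suc m) (norm w)) x y \<and> norm (y - x - w) \<le> norm w / 2))"
proof -
  define W :: "'n list set" where "W = {I. I \<noteq> [] \<and> length I \<le> Suc m}"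
  have finW: "finite W" unfolding W_def by (rule finite_subset[OF _ finite_words(2)[of "Suc m"]]) auto
  obtain Is where Is: "set Is = W" "distinct Is" using finite_distinct_list[OF finW] by blast
  have comb: "field_comb F a Is x = (\<Sum>I\<in>W. a I *\<^sub>R bracket_field F I x)" for a x
    unfolding field_comb_def using sum_list_distinct_conv_sum_set[OF Is(2)] Is(1) by metis
  have "{g x0 | g. g \<in> (\<Union>i\<in>{0..m}. iterated_brackets (range F) i)} \<subseteq> (\<lambda>I. bracket_field F I x0) ` W"
  proof clarify
    fix g i assume "i \<in> {0..m}" "g \<in> iterated_brackets (range F) i"
    then obtain I where "I \<noteq> []" "length I \<le> Suc i" "g = bracket_field F I"
      using iterated_brackets_word by blast
    then show "g x0 \<in> (\<lambda>I. bracket_field F I x0) ` W"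
      using \<open>i \<in> {0..m}\<close> unfolding W_def by auto
  qed
  then have spanW: "span ((\<lambda>I. bracket_field F I x0) ` W) = UNIV"
    using gen span_mono by blast
  have "\<exists>c. b = (\<Sum>I\<in>W. c I *\<^sub>R bracket_field F I x0)" for b
    by (rule span_image_finite[OF finW]) (simp add: spanW)
  then obtain c where c: "\<And>b. b = (\<Sum>I\<in>W. c b I *\<^sub>R bracket_field F I x0)" by metis
  define A where "A = 1 + (\<Sum>b\<in>Basis. \<Sum>I\<in>W. \<bar>c b I\<bar>)"
  have A: "A \<ge> 1" unfolding A_def by (simp add: sum_nonneg)
  define a where "a w I = (if I \<in> W then \<Sum>b\<in>Basis. (w \<bullet> b) * c b I else 0)" for w I
  have a_le: "\<bar>a w I\<bar> \<le> A * norm w" for w I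
  proof (cases "I \<in> W")
    case True
    have "\<bar>a w I\<bar> \<le> (\<Sum>b\<in>Basis. \<bar>(w \<bullet> b) * c b I\<bar>)" unfolding a_def using True by simp
    also have "\<dots> \<le> (\<Sum>b\<in>Basis. norm w * (\<Sum>I\<in>W. \<bar>c b I\<bar>))"
      unfolding abs_mult
      by (intro sum_mono mult_mono Basis_le_norm member_le_sum[OF True]) (use finW in auto)
    also have "\<dots> \<le> A * norm w" unfolding A_def by (simp add: sum_distrib_left algebra_simps)
    finally show ?thesis .
  qed (use A in \<open>simp add: a_def\<close>)
  have a_comb: "field_comb F (a w) Is x0 = w" for w
  proof -
    have "field_comb F (a w) Is x0 = (\<Sum>I\<in>W. \<Sum>b\<in>Basis. (w \<bullet> b) *\<^sub>R (c b I *\<^sub>R bracket_field F I x0))"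
      unfolding comb a_def by (intro sum.cong refl) (simp add: scaleR_sum_left)
    also have "\<dots> = (\<Sum>b\<in>Basis. (w \<bullet> b) *\<^sub>R (\<Sum>I\<in>W. c b I *\<^sub>R bracket_field F I x0))"
      by (subst sum.swap) (simp add: scaleR_sum_right)
    also have "\<dots> = (\<Sum>b\<in>Basis. (w \<bullet> b) *\<^sub>R b)" using c by simp
    finally show ?thesis by (simp add: euclidean_representation)
  qed
  define R where "R = norm x0 + 1"
  have Is': "\<forall>I\<in>set Is. I \<noteq> [] \<and> length I \<le> Suc m" unfolding Is(1) W_def by simp
  obtain C \<delta>0 where C: "0 \<le> C" "0 < \<delta>0" "\<delta>0 \<le> 1" "\<And>x a \<delta>. norm x \<le> R \<Longrightarrow> 0 \<le> \<delta> \<Longrightarrow> \<delta> \<le> \<delta>0 \<Longrightarrow>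
      \<forall>I. \<bar>a I\<bar> \<le> \<delta> \<Longrightarrow>
      \<exists>y. reach F (C * root (Suc m) \<delta>) x y \<and> norm (y - x - field_comb F a Is x) \<le> C * (\<delta> * root (Suc m) \<delta>)"
    using comb_move[where F = F and r = "Suc m" and Is = Is and R = R, OF F _ Is'] unfolding R_def by auto
  obtain L where L: "L \<ge> 0" "\<And>a \<delta> x y. (\<And>I. \<bar>a I\<bar> \<le> \<delta>) \<Longrightarrow> norm x \<le> R \<Longrightarrow> norm y \<le> R \<Longrightarrow>
     norm (field_comb F a Is x - field_comb F a Is y) \<le> L * \<delta> * norm (x - y)"
    using field_comb_lipschitz[where F = F and B = R and Is = Is, OF F] by blast
  \<comment> \<open>\<open>\<rho>\<close> makes \<open>L * A * \<rho>\<close> at most 1/4, which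
    bounds the variation of the fields. \<open>q\<close> does the same for the error of the move,
    whose relative size is \<open>C * A * root (Suc m) A * root (Suc m) (norm w)\<close>; hence the
    entry \<open>q ^ Suc m\<close> in \<open>s\<close>.\<close>
  define \<rho> where "\<rho> = min 1 (1 / (4 * (L * A + 1)))"
  define q where "q = 1 / (4 * (C * A * root (Suc m) A + 1))"
  define s where "s = min 1 (min (\<delta>0 / A) (q ^ Suc m))"
  have LA: "0 < 4 * (L * A + 1)" using L A by (simp add: add_nonneg_pos)
  have rA: "0 \<le> root (Suc m) A" using A by simp
  have CA: "0 < 4 * (C * A * root (Suc m) A + 1)" using C A rA by (simp add: add_nonneg_pos)
  have \<rho>: "0 < \<rho>" "\<rho> \<le> 1" "L * A * \<rho> \<le> 1 / 4"
  proof -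
    show "0 < \<rho>" "\<rho> \<le> 1" unfolding \<rho>_def using LA by auto
    have "\<rho> \<le> 1 / (4 * (L * A + 1))" unfolding \<rho>_def by simp
    then have "\<rho> * (4 * (L * A + 1)) \<le> 1" using LA by (simp add: pos_le_divide_eq)
    then show "L * A * \<rho> \<le> 1 / 4" using \<open>0 < \<rho>\<close> by (simp add: algebra_simps)
  qed
  have q: "0 < q" unfolding q_def using CA by simp
  have qC: "C * A * root (Suc m) A * q \<le> 1 / 4"
  proof -
    have "q * (4 * (C * A * root (Suc m) A + 1)) = 1" unfolding q_def using CA by simp
    then show ?thesis using q by (simp add: algebra_simps)
  qed
  have s: "0 < s" "s \<le> 1" unfolding s_def using C A q by auto
  have main: "\<exists>y. reach F (C * root (Suc m) A * root (Suc m) (norm w)) x y \<and> norm (y - x - w) \<le> norm w / 2"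
    if x: "norm (x - x0) < \<rho>" and w: "norm w \<le> s" for x w
  proof -
    define \<delta> where "\<delta> = A * norm w"
    have d: "0 \<le> \<delta>" "\<delta> \<le> \<delta>0"
    proof -
      show "0 \<le> \<delta>" unfolding \<delta>_def using A by simp
      have "norm w \<le> \<delta>0 / A" using w unfolding s_def by simp
      then show "\<delta> \<le> \<delta>0" unfolding \<delta>_def using A by (simp add: pos_le_divide_eq mult.commute)
    qed
    have xR: "norm x \<le> R"
      using norm_triangle_ineq[of x0 "x - x0"] x \<rho> unfolding R_def by simp
    have wa: "\<forall>I. \<bar>a w I\<bar> \<le> \<delta>" unfolding \<delta>_def using a_le by simp
    obtain y where y: "reach F (C * root (Suc m) \<delta>) x y"
      "norm (y - x - field_comb F (a w) Is x) \<le> C * (\<delta> * root (Suc m) \<delta>)"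
      using C(4)[OF xR d wa] by blast
    have rt: "root (Suc m) \<delta> = root (Suc m) A * root (Suc m) (norm w)"
      unfolding \<delta>_def by (rule real_root_mult)
    have rq: "root (Suc m) (norm w) \<le> q"
    proof -
      have "norm w \<le> q ^ Suc m" using w unfolding s_def by simp
      then have "root (Suc m) (norm w) \<le> root (Suc m) (q ^ Suc m)" by simp
      also have "\<dots> = q" using q by (intro real_root_power_cancel) auto
      finally show ?thesis .
    qed
    have "C * (\<delta> * root (Suc m) \<delta>) = norm w * (C * A * root (Suc m) A * root (Suc m) (norm w))"
      unfolding rt unfolding \<delta>_def by (simp add: mult_ac)
    also have "\<dots> \<le> norm w * (1 / 4)"
      by (intro mult_left_mono order_trans[OF mult_left_mono[OF rq] qC]) (use C A rA in auto)
    finally have 1: "norm (y - x - field_comb F (a w) Is x) \<le> norm w / 4" using y(2) by simp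
    have "norm (field_comb F (a w) Is x - field_comb F (a w) Is x0) \<le> L * \<delta> * norm (x - x0)"
      by (rule L(2)) (use wa xR in \<open>auto simp: R_def\<close>)
    also have "\<dots> \<le> L * \<delta> * \<rho>" using L d x by (intro mult_left_mono) auto
    also have "\<dots> = norm w * (L * A * \<rho>)" unfolding \<delta>_def by simp
    also have "\<dots> \<le> norm w * (1 / 4)" by (intro mult_left_mono \<rho>) auto
    finally have 2: "norm (field_comb F (a w) Is x - w) \<le> norm w / 4" unfolding a_comb by simp
    have "norm (y - x - w) \<le> norm w / 2"
      using norm_triangle_mono[OF 1 2] by simp
    then show ?thesis using y(1) unfolding rt by (auto simp: mult.assoc)
  qed
  have "0 \<le> C * root (Suc m) A" using C rA by simp
  then show ?thesis using \<rho>(1) s main by blast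
qed

lemma uniform_step:
  fixes F :: "'n::finite \<Rightarrow> 'a::euclidean_space \<Rightarrow> 'a"
  assumes F: "\<And>i. smooth_on UNIV (F i)"
    and gen: "\<And>x. span {g x | g. g \<in> (\<Union>i\<in>{0..m}. iterated_brackets (range F) i)} = UNIV"
  obtains s C where "0 < s" "s \<le> 1" "0 \<le> C" "\<And>x w. norm x \<le> R \<Longrightarrow> norm w \<le> s \<Longrightarrow>
     \<exists>y. reach F (C * root (Suc m) (norm w)) x y \<and> norm (y - x - w) \<le> norm w / 2"
\<comment> \<open>A negative radius makes the claim vacuous; otherwise the finite subcover is
  nonempty and \<open>Min\<close> and \<open>Max\<close> are meaningful.\<close>
proof (cases "R < 0")
  case True
  then show ?thesis by (intro that[of 1 0]) (auto, smt (verit) norm_ge_zero)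
next
  case False
  have "\<forall>x0. \<exists>\<rho> s C. 0 < \<rho> \<and> 0 < s \<and> s \<le> 1 \<and> 0 \<le> C \<and> (\<forall>x w. norm (x - x0) < \<rho> \<longrightarrow> norm w \<le> s \<longrightarrow>
     (\<exists>y. reach F (C * root (Suc m) (norm w)) x y \<and> norm (y - x - w) \<le> norm w / 2))"
    using local_step[where F = F, OF F gen] by blast
  then obtain \<rho> s C where L: "\<And>x0. 0 < \<rho> x0" "\<And>x0. 0 < s x0" "\<And>x0. s x0 \<le> 1" "\<And>x0. 0 \<le> C x0"
    "\<And>x0 x w. norm (x - x0) < \<rho> x0 \<Longrightarrow> norm w \<le> s x0 \<Longrightarrow>
     \<exists>y. reach F (C x0 * root (Suc m) (norm w)) x y \<and> norm (y - x - w) \<le> norm w / 2"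
    by metis
  have "compact (cball (0 :: 'a) R)" by simp
  then obtain T where T: "T \<subseteq> cball 0 R" "finite T" "cball 0 R \<subseteq> (\<Union>x0\<in>T. ball x0 (\<rho> x0))"
    by (rule compactE_image[of _ "cball 0 R" "\<lambda>x0. ball x0 (\<rho> x0)"]) (use L(1) in auto)
  have T0: "T \<noteq> {}" using T(3) False by auto
  show ?thesis
  proof (rule that[of "Min (s ` T)" "Max (C ` T)"])
    show "0 < Min (s ` T)" using T T0 L by simp
    show "Min (s ` T) \<le> 1" using T T0 L by (meson Min_le finite_imageI imageI ex_in_conv order_trans)
    show "0 \<le> Max (C ` T)" using T T0 L by (meson Max_ge finite_imageI imageI ex_in_conv order_trans)
    fix x w :: 'a assume x: "norm x \<le> R" and w: "norm w \<le> Min (s ` T)"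
    then obtain x0 where x0: "x0 \<in> T" "dist x0 x < \<rho> x0" using T(3) by force
    have "Min (s ` T) \<le> s x0" by (rule Min_le) (use x0 T in auto)
    then have "norm w \<le> s x0" using w by linarith
    then obtain y where y: "reach F (C x0 * root (Suc m) (norm w)) x y" "norm (y - x - w) \<le> norm w / 2"
      using L(5)[of x x0 w] x0(2) by (auto simp: dist_norm norm_minus_commute)
    have "C x0 * root (Suc m) (norm w) \<le> Max (C ` T) * root (Suc m) (norm w)"
      using x0 T by (intro mult_right_mono) auto
    from reach_mono[OF y(1) this] show "\<exists>y. reach F (Max (C ` T) * root (Suc m) (norm w)) x y \<and> norm (y - x - w) \<le> norm w / 2"
      using y(2) by blast
  qed
qed

text \<open>
  Iterating a step that halves the distance to the target costs a convergent geometric series, so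
  the length needed to come arbitrarily close to the target stays bounded.
\<close>

lemma approx_local:
  fixes F :: "'n::finite \<Rightarrow> 'a::euclidean_space \<Rightarrow> 'a"
  assumes s: "0 < s" "s \<le> 1" and C: "0 \<le> C"
    and step: "\<And>x w. norm x \<le> R + 1 \<Longrightarrow> norm w \<le> s \<Longrightarrow>
     \<exists>y. reach F (C * root (Suc m) (norm w)) x y \<and> norm (y - x - w) \<le> norm w / 2"
  obtains D where "0 \<le> D" "\<And>x y e. norm x \<le> R + 1 \<Longrightarrow> norm y \<le> R \<Longrightarrow> norm (y - x) \<le> s \<Longrightarrow> e > 0 \<Longrightarrow>
     \<exists>z. reach F D x z \<and> norm (y - z) \<le> e"
proof -
  \<comment> \<open>Since \<open>s \<le> 1\<close>, the error after \<open>n\<close> steps is at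
    most the \<open>n\<close>-th power of 1/2, so the next step costs at most
    \<open>C * \<theta> ^ n\<close>.\<close>
  define \<theta> where "\<theta> = root (Suc m) (1 / 2)"
  have \<theta>: "0 < \<theta>" "\<theta> < 1" unfolding \<theta>_def by (simp_all add: real_root_lt_1_iff)
  have iter: "\<exists>z. reach F (\<Sum>j<n. C * \<theta> ^ j) x z \<and> norm (y - z) \<le> s / 2 ^ n"
    if x: "norm x \<le> R + 1" and y: "norm y \<le> R" and xy: "norm (y - x) \<le> s" for x y n
  proof (induction n)
    case 0
    show ?case using reach_refl[of 0 F x] xy by (intro exI[of _ x]) simp
  next
    case (Suc n)
    then obtain z where z: "reach F (\<Sum>j<n. C * \<theta> ^ j) x z" "norm (y - z) \<le> s / 2 ^ n" by blast
    have sn: "s / 2 ^ n \<le> s" using s by (simp add: divide_le_eq mult_left_mono[of 1 "2 ^ n" s, simplified])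
    have zs: "norm (y - z) \<le> s" using z(2) sn by simp
    have "norm z \<le> norm y + norm (y - z)" using norm_triangle_ineq4[of y "y - z"] by simp
    then have "norm z \<le> R + 1" using y zs s by simp
    from step[OF this zs] obtain z' where z': "reach F (C * root (Suc m) (norm (y - z))) z z'"
      "norm (z' - z - (y - z)) \<le> norm (y - z) / 2" by blast
    have "root (Suc m) (norm (y - z)) \<le> root (Suc m) ((1/2) ^ n)"
    proof -
      have "norm (y - z) \<le> (1/2) ^ n"
        using z(2) s by (auto simp: power_one_over divide_simps intro: order_trans)
      then show ?thesis by simp
    qed
    also have "\<dots> = \<theta> ^ n" unfolding \<theta>_def by (rule real_root_power) simp
    finally have "C * root (Suc m) (norm (y - z)) \<le> C * \<theta> ^ n" using C by (rule mult_left_mono)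
    from reach_trans[OF z(1) reach_mono[OF z'(1) this]]
    have "reach F (\<Sum>j<Suc n. C * \<theta> ^ j) x z'" by simp
    moreover have "norm (y - z') \<le> s / 2 ^ Suc n"
      using z'(2) z(2) by (simp add: norm_minus_commute)
    ultimately show ?case by blast
  qed
  show ?thesis
  proof (rule that[of "C * (1 / (1 - \<theta>))"])
    show "0 \<le> C * (1 / (1 - \<theta>))" using C \<theta> by simp
    fix x y :: 'a and e :: real assume xy: "norm x \<le> R + 1" "norm y \<le> R" "norm (y - x) \<le> s" and e: "e > 0"
    have "(\<lambda>n. s * (1/2) ^ n) \<longlonglongrightarrow> s * 0" by (intro tendsto_mult tendsto_const LIMSEQ_power_zero) simp
    then have "\<forall>\<^sub>F n in sequentially. s * (1/2) ^ n < e"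
      using e by (intro order_tendstoD(2)) auto
    then obtain n where n: "s * (1/2) ^ n < e" by (auto simp: eventually_sequentially)
    obtain z where z: "reach F (\<Sum>j<n. C * \<theta> ^ j) x z" "norm (y - z) \<le> s / 2 ^ n" using iter[OF xy] by blast
    have "(\<Sum>j<n. \<theta> ^ j) \<le> 1 / (1 - \<theta>)"
      using \<theta> by (simp add: sum_gp_strict divide_right_mono)
    then have "(\<Sum>j<n. C * \<theta> ^ j) \<le> C * (1 / (1 - \<theta>))"
      unfolding sum_distrib_left[symmetric] using C by (rule mult_left_mono)
    then have "reach F (C * (1 / (1 - \<theta>))) x z" by (rule reach_mono[OF z(1)])
    moreover have "s / 2 ^ n = s * (1/2) ^ n" by (simp add: power_divide)
    then have "norm (y - z) \<le> e" using z(2) n by linarith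
    ultimately show "\<exists>z. reach F (C * (1 / (1 - \<theta>))) x z \<and> norm (y - z) \<le> e" by blast
  qed
qed

text \<open>An approximate Chow-Rashevskii theorem with uniform length. The segment from
  \<open>x\<close> to \<open>y\<close>, which stays in the ball by convexity, is followed through
  intermediate targets. Each target is approached from a point within \<open>s / 2\<close> of the
  previous one, so it is within \<open>s\<close> of the current position and the local lemma
  applies; only the last target is approached with the prescribed accuracy.\<close>

theorem chow_approx:
  fixes F :: "'n::finite \<Rightarrow> 'a::euclidean_space \<Rightarrow> 'a"
  assumes F: "\<And>i. smooth_on UNIV (F i)"
    and gen: "\<And>x. span {g x | g. g \<in> (\<Union>i\<in>{0..m}. iterated_brackets (range F) i)} = UNIV"
    and R: "R > 0"
  obtains C where "0 \<le> C" "\<And>x y e. norm x \<le> R \<Longrightarrow> norm y \<le> R \<Longrightarrow> e > 0 \<Longrightarrow>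
     \<exists>z. reach F C x z \<and> norm (z - y) \<le> e"
proof -
  obtain s C where s: "0 < s" "s \<le> 1" "0 \<le> C" "\<And>x w. norm x \<le> R + 1 \<Longrightarrow> norm w \<le> s \<Longrightarrow>
     \<exists>y. reach F (C * root (Suc m) (norm w)) x y \<and> norm (y - x - w) \<le> norm w / 2"
    using uniform_step[where F = F and R = "R + 1" and m = m, OF F gen] by blast
  obtain D where D: "0 \<le> D" "\<And>x y e. norm x \<le> R + 1 \<Longrightarrow> norm y \<le> R \<Longrightarrow> norm (y - x) \<le> s \<Longrightarrow> e > 0 \<Longrightarrow>
     \<exists>z. reach F D x z \<and> norm (y - z) \<le> e"
    using approx_local[OF s] by blast
  \<comment> \<open>With \<open>N\<close> pieces consecutive targets are at most
    \<open>2 * R / N\<close> apart, and this is at most \<open>s / 2\<close>.\<close>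
  obtain N :: nat where N: "4 * R / s < real N" using reals_Archimedean2 by blast
  have N0: "0 < real N" using N R s by (meson divide_pos_pos mult_pos_pos order_less_trans zero_less_numeral)
  have chain: "\<exists>z. reach F (real i * D) x z \<and> norm (x + (real i / N) *\<^sub>R (y - x) - z) \<le> e"
    if x: "norm x \<le> R" and y: "norm y \<le> R" and e: "e > 0" and "i \<le> N" for x y e i
    using e \<open>i \<le> N\<close>
  proof (induction i arbitrary: e)
    case 0
    show ?case using reach_refl[of 0 F x] 0 by (intro exI[of _ x]) simp
  next
    case (Suc i)
    define p where "p j = x + (real j / N) *\<^sub>R (y - x)" for j
    have pR: "norm (p j) \<le> R" if "j \<le> N" for j
    proof -
      have "convex (cball (0::'a) R)" by simp
      moreover have "p j = (1 - real j / N) *\<^sub>R x + (real j / N) *\<^sub>R y" unfolding p_def by (simp add: algebra_simps)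
      moreover have "0 \<le> real j / N" "real j / N \<le> 1" using that N0 by auto
      ultimately have "p j \<in> cball 0 R"
        using convexD_alt[of "cball 0 R" x y "real j / N"] x y by auto
      then show ?thesis by simp
    qed
    have "norm (p (Suc i) - p i) \<le> s / 2"
    proof -
      have "p (Suc i) - p i = (1 / N) *\<^sub>R (y - x)" unfolding p_def by (simp add: algebra_simps add_divide_distrib)
      then have "norm (p (Suc i) - p i) = norm (y - x) / N" by simp
      also have "norm (y - x) \<le> 2 * R" using norm_triangle_ineq4[of y x] x y by simp
      then have "norm (y - x) / N \<le> 2 * R / N" using N0 by (simp add: divide_right_mono)
      also have "2 * R / N \<le> s / 2" using N N0 s by (simp add: divide_simps mult.commute)
      finally show ?thesis .
    qed
    moreover obtain z where z: "reach F (real i * D) x z" "norm (p i - z) \<le> s / 2"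
      using Suc.IH[of "s / 2"] Suc.prems s unfolding p_def by auto
    ultimately have near: "norm (p (Suc i) - z) \<le> s"
      using norm_triangle_mono[of "p (Suc i) - p i" "s / 2" "p i - z" "s / 2"] by simp
    have "norm z \<le> norm (p i) + norm (p i - z)" using norm_triangle_ineq4[of "p i" "p i - z"] by simp
    then have "norm z \<le> R + 1" using pR[of i] Suc.prems z(2) s by simp
    from D(2)[OF this pR near, of e] obtain z' where z': "reach F D z z'" "norm (p (Suc i) - z') \<le> e"
      using Suc.prems by auto
    have "reach F (real (Suc i) * D) x z'" using reach_trans[OF z(1) z'(1)] by (simp add: algebra_simps)
    then show ?case using z'(2) unfolding p_def by blast
  qed
  show ?thesis
  proof (rule that[of "real N * D"])
    show "0 \<le> real N * D" using D by simp
    fix x y :: 'a and e :: real assume "norm x \<le> R" "norm y \<le> R" "e > 0"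
    from chain[OF this, of N] show "\<exists>z. reach F (real N * D) x z \<and> norm (z - y) \<le> e"
      using N0 by (auto simp: norm_minus_commute)
  qed
qed

subsection \<open>Plans and their compactness\<close>

definition ctrl :: "('n::finite \<Rightarrow> 'a::euclidean_space \<Rightarrow> 'a) \<Rightarrow> 'a \<Rightarrow> real ^ 'n \<Rightarrow> 'a" where
  "ctrl F x v = (\<Sum>i\<in>UNIV. (v $ i) *\<^sub>R F i x)"

text \<open>
  Test functions on \<open>[0,T] \<times> \<real>\<^sup>d\<close> together with their time derivative \<open>A\<close> and space gradient \<open>G\<close>,
  both extended to all times.
\<close>

definition C1T_fun :: "real \<Rightarrow> (real \<times> 'a::euclidean_space \<Rightarrow> real) \<Rightarrow> (real \<times> 'a \<Rightarrow> real) \<Rightarrow> (real \<times> 'a \<Rightarrow> 'a) \<Rightarrow> bool" where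
  "C1T_fun T \<phi> A G \<longleftrightarrow>
     (\<forall>z\<in>{0..T} \<times> UNIV. (\<phi> has_derivative (\<lambda>w. A z * fst w + G z \<bullet> snd w)) (at z within {0..T} \<times> UNIV)) \<and>
     continuous_on UNIV A \<and> continuous_on UNIV G \<and> bounded (range A) \<and> bounded (range G) \<and>
     (\<exists>R. \<forall>z. norm (snd z) > R \<longrightarrow> A z = 0 \<and> G z = 0 \<and> (fst z \<in> {0..T} \<longrightarrow> \<phi> z = 0))"

text \<open>
  A plan is a curve \<open>\<mu>\<close> with a Young measure \<open>\<eta>\<close>, the (normalised) joint law of time, position and
  control. In these variables the weak continuity equation is linear in \<open>\<eta>\<close>.
\<close>

definition plan :: "real \<Rightarrow> ('n::finite \<Rightarrow> 'a::euclidean_space \<Rightarrow> 'a) \<Rightarrow> (real \<Rightarrow> 'a measure) \<Rightarrow>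
    (real \<times> 'a \<times> (real ^ 'n)) measure \<Rightarrow> bool" where
  "plan T F \<mu> \<eta> \<longleftrightarrow>
     (\<forall>t\<in>{0..T}. \<mu> t \<in> space (prob_algebra borel)) \<and> \<eta> \<in> space (prob_algebra borel) \<and>
     (\<forall>\<psi> G. C1c_fun \<psi> G \<longrightarrow> continuous_on {0..T} (\<lambda>t. LINT x|\<mu> t. \<psi> x)) \<and>
     distr \<eta> borel fst = uniform_measure lborel {0..T} \<and>
     (\<forall>a \<psi> G. continuous_on UNIV a \<longrightarrow> bounded (range a) \<longrightarrow> C1c_fun \<psi> G \<longrightarrow>
        T * (LINT z|\<eta>. a (fst z) * \<psi> (fst (snd z))) = (LINT t:{0..T}|lborel. a t * (LINT x|\<mu> t. \<psi> x))) \<and>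
     integrable \<eta> (\<lambda>z. (norm (snd (snd z)))\<^sup>2) \<and>
     (\<forall>\<phi> A G. C1T_fun T \<phi> A G \<longrightarrow>
        T * (LINT z|\<eta>. A (fst z, fst (snd z)) + G (fst z, fst (snd z)) \<bullet> ctrl F (fst (snd z)) (snd (snd z)))
          = (LINT x|\<mu> T. \<phi> (T, x)) - (LINT x|\<mu> 0. \<phi> (0, x)))"

definition plan_energy :: "(real \<times> 'a \<times> (real ^ 'n)) measure \<Rightarrow> real" where
  "plan_energy \<eta> = (LINT z|\<eta>. (norm (snd (snd z)))\<^sup>2)"

lemma planD:
  assumes "plan T F \<mu> \<eta>"
  shows "t \<in> {0..T} \<Longrightarrow> \<mu> t \<in> space (prob_algebra borel)"
    and "\<eta> \<in> space (prob_algebra borel)"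
    and "C1c_fun \<psi> G \<Longrightarrow> continuous_on {0..T} (\<lambda>t. LINT x|\<mu> t. \<psi> x)"
    and "distr \<eta> borel fst = uniform_measure lborel {0..T}"
    and "continuous_on UNIV a \<Longrightarrow> bounded (range a) \<Longrightarrow> C1c_fun \<psi> G \<Longrightarrow>
        T * (LINT z|\<eta>. a (fst z) * \<psi> (fst (snd z))) = (LINT t:{0..T}|lborel. a t * (LINT x|\<mu> t. \<psi> x))"
    and "integrable \<eta> (\<lambda>z. (norm (snd (snd z)))\<^sup>2)"
    and "C1T_fun T \<phi> A H \<Longrightarrow>
        T * (LINT z|\<eta>. A (fst z, fst (snd z)) + H (fst z, fst (snd z)) \<bullet> ctrl F (fst (snd z)) (snd (snd z)))
          = (LINT x|\<mu> T. \<phi> (T, x)) - (LINT x|\<mu> 0. \<phi> (0, x))"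
proof -
  note c1 = assms[unfolded plan_def]
  note c2 = conjunct2[OF c1] note c3 = conjunct2[OF c2] note c4 = conjunct2[OF c3]
  note c5 = conjunct2[OF c4] note c6 = conjunct2[OF c5] note c7 = conjunct2[OF c6]
  show "t \<in> {0..T} \<Longrightarrow> \<mu> t \<in> space (prob_algebra borel)"
    by (rule bspec[OF conjunct1[OF c1]])
  show "\<eta> \<in> space (prob_algebra borel)" by (rule conjunct1[OF c2])
  show "C1c_fun \<psi> G \<Longrightarrow> continuous_on {0..T} (\<lambda>t. LINT x|\<mu> t. \<psi> x)"
    by (rule conjunct1[OF c3, rule_format])
  show "distr \<eta> borel fst = uniform_measure lborel {0..T}" by (rule conjunct1[OF c4])
  show "continuous_on UNIV a \<Longrightarrow> bounded (range a) \<Longrightarrow> C1c_fun \<psi> G \<Longrightarrow>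
        T * (LINT z|\<eta>. a (fst z) * \<psi> (fst (snd z))) = (LINT t:{0..T}|lborel. a t * (LINT x|\<mu> t. \<psi> x))"
    by (rule conjunct1[OF c5, rule_format])
  show "integrable \<eta> (\<lambda>z. (norm (snd (snd z)))\<^sup>2)" by (rule conjunct1[OF c6])
  show "C1T_fun T \<phi> A H \<Longrightarrow>
        T * (LINT z|\<eta>. A (fst z, fst (snd z)) + H (fst z, fst (snd z)) \<bullet> ctrl F (fst (snd z)) (snd (snd z)))
          = (LINT x|\<mu> T. \<phi> (T, x)) - (LINT x|\<mu> 0. \<phi> (0, x))"
    by (rule c7[rule_format])
qed

text \<open>Compactness and the passage between plans and pairs rest on continuity and linear growth
  of the fields; smoothness and the bracket condition enter as hypotheses of
  \<open>plan_exists\<close>.\<close>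

locale control_system =
  fixes T :: real and F :: "'n::finite \<Rightarrow> 'a::euclidean_space \<Rightarrow> 'a" and M :: real
  assumes T: "0 < T" and F_cont: "\<And>i. continuous_on UNIV (F i)"
    and M: "0 < M" and growth: "\<And>i x. norm (F i x) \<le> M * (norm x + 1)"
begin

lemma ctrl_bound: "norm (ctrl F x v) \<le> M * real CARD('n) * (norm x + 1) * norm v"
proof -
  have "norm (ctrl F x v) \<le> (\<Sum>i\<in>UNIV. norm ((v $ i) *\<^sub>R F i x))"
    unfolding ctrl_def by (rule norm_sum)
  also have "\<dots> \<le> (\<Sum>i\<in>(UNIV :: 'n set). norm v * (M * (norm x + 1)))"
    unfolding norm_scaleR
    by (intro sum_mono mult_mono growth) (auto simp: component_le_norm_cart)
  finally show ?thesis by (simp add: mult_ac)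
qed

lemma ctrl_continuous:
  assumes "continuous_on S f" "continuous_on S g"
  shows "continuous_on S (\<lambda>z. ctrl F (f z) (g z))"
  unfolding ctrl_def
proof (intro continuous_on_sum continuous_on_scaleR)
  show "continuous_on S (\<lambda>z. g z $ i)" for i by (rule continuous_on_component[OF assms(2)])
  show "continuous_on S (\<lambda>z. F i (f z))" for i
    by (rule continuous_on_compose2[OF F_cont assms(1)]) simp
qed

lemma flux_continuous:
  assumes "continuous_on UNIV G"
  shows "continuous_on UNIV (\<lambda>z :: real \<times> 'a \<times> (real ^ 'n). G (fst (snd z)) \<bullet> ctrl F (fst (snd z)) (snd (snd z)))"
proof (rule continuous_on_inner)
  have 1: "continuous_on UNIV (\<lambda>z :: real \<times> 'a \<times> (real ^ 'n). fst (snd z))"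
    "continuous_on UNIV (\<lambda>z :: real \<times> 'a \<times> (real ^ 'n). snd (snd z))"
    by (intro continuous_on_fst continuous_on_snd continuous_on_id)+
  show "continuous_on UNIV (\<lambda>z :: real \<times> 'a \<times> (real ^ 'n). G (fst (snd z)))"
    by (rule continuous_on_compose2[OF assms 1(1)]) simp
  show "continuous_on UNIV (\<lambda>z :: real \<times> 'a \<times> (real ^ 'n). ctrl F (fst (snd z)) (snd (snd z)))"
    by (rule ctrl_continuous[OF 1])
qed

text \<open>On the support of the gradient the fields are bounded, so the flux grows only with the
  control, and linearly.\<close>

lemma flux_bound:
  assumes "norm (G z) \<le> B" "norm (snd z) > R \<Longrightarrow> G z = 0" "B \<ge> 0" "R \<ge> 0"
  shows "\<bar>G z \<bullet> ctrl F (snd z) v\<bar> \<le> B * (M * real CARD('n) * (R + 1)) * norm v"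
proof (cases "norm (snd z) > R")
  case True
  then show ?thesis using assms M by simp
next
  case False
  have "\<bar>G z \<bullet> ctrl F (snd z) v\<bar> \<le> norm (G z) * norm (ctrl F (snd z) v)"
    by (rule Cauchy_Schwarz_ineq2)
  also have "\<dots> \<le> B * (M * real CARD('n) * (R + 1) * norm v)"
  proof (rule mult_mono[OF assms(1) order_trans[OF ctrl_bound]])
    show "M * real CARD('n) * (norm (snd z) + 1) * norm v \<le> M * real CARD('n) * (R + 1) * norm v"
      using False M by (intro mult_right_mono mult_left_mono) auto
  qed (use assms in auto)
  finally show ?thesis by (simp add: mult.assoc)
qed

lemma C1c_flux_bound:
  assumes "C1c_fun \<psi> G"
  obtains K where "K > 0" "\<And>x v. \<bar>G x \<bullet> ctrl F x v\<bar> \<le> K * norm v"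
proof -
  obtain R where R: "R > 0" "\<forall>x. norm x > R \<longrightarrow> \<psi> x = 0 \<and> G x = 0" using C1c_funD(2)[OF assms] by blast
  obtain B where B: "B > 0" "\<And>x. norm (G x) \<le> B" using C1c_fun_bounded[OF assms] by blast
  have "\<bar>G x \<bullet> ctrl F x v\<bar> \<le> B * (M * real CARD('n) * (R + 1)) * norm v" for x v
  proof -
    have 1: "norm (G (snd (0 :: real, x))) \<le> B" using B(2) by simp
    have 2: "G (snd (0 :: real, x)) = 0" if "norm (snd (0 :: real, x)) > R" using R(2) that by simp
    from flux_bound[where G = "\<lambda>z. G (snd z)" and z = "(0 :: real, x)" and v = v, OF 1 2 less_imp_le[OF B(1)] less_imp_le[OF R(1)]]
    show ?thesis unfolding snd_conv .
  qed
  moreover have "0 < B * (M * real CARD('n) * (R + 1))"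
    using B(1) R(1) M by (intro mult_pos_pos) (auto simp: add_pos_pos)
  ultimately show ?thesis by (intro that)
qed

end

section \<open>Fluxes of plans and increments of test integrals\<close>

lemma plan_integrable_norm:
  assumes "\<eta> \<in> space (prob_algebra borel)" "integrable \<eta> (\<lambda>z :: real \<times> 'a::euclidean_space \<times> (real ^ 'n). (norm (snd (snd z)))\<^sup>2)"
  shows "integrable \<eta> (\<lambda>z. norm (snd (snd z)))"
    "(LINT z|\<eta>. norm (snd (snd z))) \<le> 1 + plan_energy \<eta>"
proof -
  note M = prob_algebra_borelD[OF assms(1)]
  interpret prob_space \<eta> by (rule M)
  note [measurable_cong] = M(2)
  have le: "norm (snd (snd z)) \<le> 1 + (norm (snd (snd z)))\<^sup>2" for z :: "real \<times> 'a \<times> (real ^ 'n)"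
  proof -
    have "0 \<le> (norm (snd (snd z)) - 1)\<^sup>2" by simp
    then have "2 * norm (snd (snd z)) \<le> 1 + (norm (snd (snd z)))\<^sup>2"
      by (simp add: power2_eq_square algebra_simps)
    then show ?thesis using norm_ge_zero[of "snd (snd z)"] by linarith
  qed
  have i: "integrable \<eta> (\<lambda>z. 1 + (norm (snd (snd z)))\<^sup>2)" using assms(2) by simp
  have [measurable]: "(\<lambda>z :: real \<times> 'a \<times> (real ^ 'n). norm (snd (snd z))) \<in> borel_measurable borel"
    by (intro borel_measurable_continuous_onI continuous_intros)
  show int: "integrable \<eta> (\<lambda>z. norm (snd (snd z)))"
    by (rule Bochner_Integration.integrable_bound[OF i]) (use le in \<open>auto simp: abs_of_nonneg\<close>)
  have "(LINT z|\<eta>. norm (snd (snd z))) \<le> (LINT z|\<eta>. 1 + (norm (snd (snd z)))\<^sup>2)"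
    by (rule integral_mono[OF int i le])
  then show "(LINT z|\<eta>. norm (snd (snd z))) \<le> 1 + plan_energy \<eta>"
    using assms(2) by (simp add: plan_energy_def prob_space)
qed

lemma uniform_time_AE:
  assumes "T > 0" "\<eta> \<in> space (prob_algebra (borel :: (real \<times> 'b::euclidean_space) measure))"
    "distr \<eta> borel fst = uniform_measure lborel {0..T}"
  shows "AE z in \<eta>. fst z \<in> {0..T}" "AE z in \<eta>. fst z \<noteq> s"
proof -
  note M = prob_algebra_borelD[OF assms(2)]
  note [measurable_cong] = M(2)
  have f: "fst \<in> borel_measurable \<eta>"
    using borel_measurable_continuous_onI[OF continuous_on_fst[OF continuous_on_id], where 'b = real] by measurable
  have "AE t in uniform_measure lborel {0..T}. t \<in> {0..T}"
    by (rule AE_uniform_measureI) (use assms in auto)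
  then have "AE t in distr \<eta> borel fst. t \<in> {0..T}" unfolding assms(3) .
  then show "AE z in \<eta>. fst z \<in> {0..T}" using f by (subst (asm) AE_distr_iff) auto
  have "AE t in uniform_measure lborel {0..T}. t \<noteq> s"
    by (rule AE_uniform_measureI) (use AE_lborel_singleton[of s] in auto)
  then have "AE t in distr \<eta> borel fst. t \<noteq> s" unfolding assms(3) .
  then show "AE z in \<eta>. fst z \<noteq> s" using f by (subst (asm) AE_distr_iff) auto
qed

context control_system begin

lemma C1c_flux_integrable:
  assumes p: "\<eta> \<in> space (prob_algebra borel)" "integrable \<eta> (\<lambda>z :: real \<times> 'a \<times> (real ^ 'n). (norm (snd (snd z)))\<^sup>2)"
    and c: "C1c_fun \<psi> G" and a: "a \<in> borel_measurable borel" "\<And>t. \<bar>a t\<bar> \<le> 1"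
  shows "integrable \<eta> (\<lambda>z. a (fst z) * (G (fst (snd z)) \<bullet> ctrl F (fst (snd z)) (snd (snd z))))"
proof -
  note Mb = prob_algebra_borelD[OF p(1)]
  note [measurable_cong] = Mb(2)
  obtain K where K: "K > 0" "\<And>x v. \<bar>G x \<bullet> ctrl F x v\<bar> \<le> K * norm v"
    using C1c_flux_bound[OF c] by blast
  have [measurable]: "(\<lambda>z. G (fst (snd z)) \<bullet> ctrl F (fst (snd z)) (snd (snd z))) \<in> borel_measurable (borel :: (real \<times> 'a \<times> (real ^ 'n)) measure)"
    by (rule borel_measurable_continuous_onI[OF flux_continuous[OF C1_funD(2)[OF C1c_funD(1)[OF c]]]])
  have [measurable]: "(\<lambda>z. a (fst z)) \<in> borel_measurable (borel :: (real \<times> 'a \<times> (real ^ 'n)) measure)"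
    by (rule measurable_compose[OF borel_measurable_continuous_onI[OF continuous_on_fst[OF continuous_on_id]] a(1)])
  have i: "integrable \<eta> (\<lambda>z. K * norm (snd (snd z)))"
    using plan_integrable_norm(1)[OF p] by simp
  show ?thesis
  proof (rule Bochner_Integration.integrable_bound[OF i])
    have "\<bar>a (fst z)\<bar> * \<bar>G (fst (snd z)) \<bullet> ctrl F (fst (snd z)) (snd (snd z))\<bar> \<le> 1 * (K * norm (snd (snd z)))" for z
      by (intro mult_mono a K) auto
    then show "AE z in \<eta>. norm (a (fst z) * (G (fst (snd z)) \<bullet> ctrl F (fst (snd z)) (snd (snd z)))) \<le> norm (K * norm (snd (snd z)))"
      using K by (intro AE_I2) (simp add: abs_mult)
  qed measurable
qed

text \<open>The factor \<open>T\<close> undoes the normalisation of \<open>\<eta>\<close>, so this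
  is the flux through the time interval from 0 to \<open>t\<close> with respect to Lebesgue measure
  in time.\<close>

definition flux_upto :: "(real \<times> 'a \<times> (real ^ 'n)) measure \<Rightarrow> ('a \<Rightarrow> 'a) \<Rightarrow> real \<Rightarrow> real" where
  "flux_upto \<eta> G t = T * (LINT z|\<eta>. indicator {..t} (fst z) * (G (fst (snd z)) \<bullet> ctrl F (fst (snd z)) (snd (snd z))))"

text \<open>The time marginal of \<open>\<eta>\<close> is uniform and has no atom at
  \<open>t\<close>, so the indicators of the past converge almost everywhere and dominated
  convergence applies.\<close>

lemma flux_upto_continuous:
  assumes p: "\<eta> \<in> space (prob_algebra borel)" "integrable \<eta> (\<lambda>z :: real \<times> 'a \<times> (real ^ 'n). (norm (snd (snd z)))\<^sup>2)"
    and tm: "distr \<eta> borel fst = uniform_measure lborel {0..T}" and c: "C1c_fun \<psi> G"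
  shows "continuous_on UNIV (flux_upto \<eta> G)"
proof -
  let ?g = "\<lambda>z :: real \<times> 'a \<times> (real ^ 'n). G (fst (snd z)) \<bullet> ctrl F (fst (snd z)) (snd (snd z))"
  have ig: "integrable \<eta> ?g"
    using C1c_flux_integrable[OF p c, of "\<lambda>_. 1"] by simp
  have im: "integrable \<eta> (\<lambda>z. indicator {..t} (fst z) * ?g z)" for t :: real
    by (rule C1c_flux_integrable[OF p c]) (auto simp: indicator_def)
  show ?thesis
    unfolding continuous_on_sequentially
  proof (intro allI ballI impI)
    fix x and t :: real assume x: "(\<forall>n. x n \<in> UNIV) \<and> x \<longlonglongrightarrow> t"
    have "(\<lambda>n. LINT z|\<eta>. indicator {..x n} (fst z) * ?g z) \<longlonglongrightarrow> (LINT z|\<eta>. indicator {..t} (fst z) * ?g z)"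
    proof (rule integral_dominated_convergence[of _ _ _ "\<lambda>z. \<bar>?g z\<bar>"])
      show "AE z in \<eta>. (\<lambda>n. indicator {..x n} (fst z) * ?g z) \<longlonglongrightarrow> indicator {..t} (fst z) * ?g z"
        using uniform_time_AE(2)[OF T p(1) tm, of t]
      proof eventually_elim
        case (elim z)
        have "(\<lambda>n. indicator {..x n} (fst z) :: real) \<longlonglongrightarrow> indicator {..t} (fst z)"
        proof (cases "fst z < t")
          case True
          then have "\<forall>\<^sub>F n in sequentially. x n > fst z" using x by (auto intro: order_tendstoD)
          then have "\<forall>\<^sub>F n in sequentially. indicator {..x n} (fst z) = (1 :: real)"
            by eventually_elim auto
          then show ?thesis using True by (simp add: tendsto_eventually)
        next
          case False
          then have "fst z > t" using elim by simp
          then have "\<forall>\<^sub>F n in sequentially. x n < fst z" using x by (auto intro: order_tendstoD)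
          then have "\<forall>\<^sub>F n in sequentially. indicator {..x n} (fst z) = (0 :: real)"
            by eventually_elim auto
          then show ?thesis using \<open>fst z > t\<close> by (simp add: tendsto_eventually)
        qed
        then show ?case by (intro tendsto_mult tendsto_const)
      qed
      show "AE z in \<eta>. norm (indicator {..x n} (fst z) * ?g z) \<le> \<bar>?g z\<bar>" for n
        by (rule AE_I2) (auto simp: indicator_def)
    qed (use ig im in auto)
    then show "((flux_upto \<eta> G) \<circ> x) \<longlonglongrightarrow> flux_upto \<eta> G t"
      unfolding flux_upto_def o_def by (intro tendsto_mult tendsto_const)
  qed
qed

text \<open>\<open>C1T_fun\<close> asks for derivatives defined at all times, but the primitive
  \<open>a\<close> is controlled only on [0,T]. Clamping the time in the gradient supplies a bounded
  continuous extension.\<close>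

lemma product_test_fun:
  fixes \<psi> :: "'a \<Rightarrow> real"
  assumes c: "C1c_fun \<psi> G" and D: "continuous_on UNIV D" "bounded (range D)"
    and a: "\<And>t. t \<in> {0..T} \<Longrightarrow> (a has_vector_derivative D t) (at t within {0..T})"
  shows "C1T_fun T (\<lambda>z. a (fst z) * \<psi> (snd z)) (\<lambda>z. D (fst z) * \<psi> (snd z))
     (\<lambda>z. a (max 0 (min T (fst z))) *\<^sub>R G (snd z))"
proof -
  obtain R where R: "R > 0" "\<forall>x. norm x > R \<longrightarrow> \<psi> x = 0 \<and> G x = 0" using C1c_funD(2)[OF c] by blast
  obtain B where B: "B > 0" "\<And>x. \<bar>\<psi> x\<bar> \<le> B" "\<And>x. norm (G x) \<le> B" using C1c_fun_bounded[OF c] by blast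
  note c1 = C1c_funD(1)[OF c]
  have cl: "max 0 (min T t) \<in> {0..T}" for t using T by auto
  have ac: "continuous_on {0..T} a"
    using has_vector_derivative_continuous[OF a] continuous_on_eq_continuous_within by blast
  then have "compact (a ` {0..T})" by (rule compact_continuous_image) simp
  then have "bounded (a ` {0..T})" by (rule compact_imp_bounded)
  then obtain A where A: "A > 0" "\<And>t. t \<in> {0..T} \<Longrightarrow> norm (a t) \<le> A"
    unfolding bounded_pos by blast
  obtain E where E: "E > 0" "\<And>t. norm (D t) \<le> E"
    using D(2) unfolding bounded_pos by blast
  show ?thesis
    unfolding C1T_fun_def
  proof (intro conjI ballI)
    fix z :: "real \<times> 'a" assume z: "z \<in> {0..T} \<times> UNIV"
    have zt: "fst z \<in> {0..T}" using z by auto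
    have 1: "((\<lambda>z. a (fst z)) has_derivative (\<lambda>w. fst w *\<^sub>R D (fst z))) (at z within {0..T} \<times> UNIV)"
    proof (rule has_derivative_in_compose[of fst fst])
      show "(fst has_derivative fst) (at z within {0..T} \<times> UNIV)" by (rule has_derivative_fst[OF has_derivative_ident])
      have "fst ` ({0..T} \<times> (UNIV :: 'a set)) = {0..T}" by auto
      then show "(a has_derivative (\<lambda>h. h *\<^sub>R D (fst z))) (at (fst z) within fst ` ({0..T} \<times> (UNIV :: 'a set)))"
        using a[OF zt] unfolding has_vector_derivative_def by simp
    qed
    have 2: "((\<lambda>z. \<psi> (snd z)) has_derivative (\<lambda>w. G (snd z) \<bullet> snd w)) (at z within {0..T} \<times> UNIV)"
      by (rule has_derivative_compose[OF has_derivative_snd[OF has_derivative_ident] C1_funD(1)[OF c1]])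
    have "max 0 (min T (fst z)) = fst z" using zt by auto
    then show "((\<lambda>z. a (fst z) * \<psi> (snd z)) has_derivative
        (\<lambda>w. D (fst z) * \<psi> (snd z) * fst w + (a (max 0 (min T (fst z))) *\<^sub>R G (snd z)) \<bullet> snd w)) (at z within {0..T} \<times> UNIV)"
      using has_derivative_mult[OF 1 2] by (simp add: algebra_simps)
  next
    show "continuous_on UNIV (\<lambda>z :: real \<times> 'a. D (fst z) * \<psi> (snd z))"
      by (intro continuous_intros continuous_on_compose2[OF D(1)] continuous_on_compose2[OF C1_funD(3)[OF c1, of UNIV]]) auto
    show "continuous_on UNIV (\<lambda>z :: real \<times> 'a. a (max 0 (min T (fst z))) *\<^sub>R G (snd z))"
      by (intro continuous_intros continuous_on_compose2[OF ac] continuous_on_compose2[OF C1_funD(2)[OF c1, of UNIV]])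
         (use cl in auto)
    show "bounded (range (\<lambda>z :: real \<times> 'a. D (fst z) * \<psi> (snd z)))"
      unfolding bounded_iff
      by (rule exI[of _ "E * B"]) (use E B in \<open>auto simp: abs_mult intro!: mult_mono\<close>)
    show "bounded (range (\<lambda>z :: real \<times> 'a. a (max 0 (min T (fst z))) *\<^sub>R G (snd z)))"
      unfolding bounded_iff
      by (rule exI[of _ "A * B"]) (use A(1) A(2)[OF cl] B in \<open>auto intro!: mult_mono\<close>)
    show "\<exists>R. \<forall>z :: real \<times> 'a. R < norm (snd z) \<longrightarrow> D (fst z) * \<psi> (snd z) = 0 \<and>
        a (max 0 (min T (fst z))) *\<^sub>R G (snd z) = 0 \<and> (fst z \<in> {0..T} \<longrightarrow> a (fst z) * \<psi> (snd z) = 0)"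
      using R by (intro exI[of _ R]) auto
  qed
qed

text \<open>
  The difference \<open>D\<close> of the two sides is continuous and orthogonal to all continuous functions, as
  one sees by testing with \<open>a(t) \<psi>(x)\<close> for a primitive \<open>a\<close> of \<open>D\<close> itself.
\<close>

lemma plan_increment:
  assumes p: "plan T F \<mu> \<eta>" and c: "C1c_fun \<psi> G" and t: "t \<in> {0..T}"
  shows "(LINT x|\<mu> t. \<psi> x) - (LINT x|\<mu> 0. \<psi> x) = flux_upto \<eta> G t"
proof -
  let ?g = "\<lambda>z :: real \<times> 'a \<times> (real ^ 'n). G (fst (snd z)) \<bullet> ctrl F (fst (snd z)) (snd (snd z))"
  note P = planD[OF p]
  note Mb = prob_algebra_borelD[OF P(2)]
  interpret \<eta>: prob_space \<eta> by (rule Mb)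
  note [measurable_cong] = Mb(2)
  interpret pair_sigma_finite lborel \<eta> by (simp add: pair_sigma_finite_def \<eta>.sigma_finite_measure_axioms sigma_finite_lborel)
  define m where "m t = (LINT x|\<mu> t. \<psi> x)" for t
  define \<Lambda> where "\<Lambda> = flux_upto \<eta> G"
  define cl where "cl t = max 0 (min T t)" for t
  have cl: "cl t \<in> {0..T}" "t \<in> {0..T} \<Longrightarrow> cl t = t" for t unfolding cl_def using T by auto
  have mc: "continuous_on {0..T} m" unfolding m_def by (rule P(3)[OF c])
  have \<Lambda>c: "continuous_on UNIV \<Lambda>" unfolding \<Lambda>_def by (rule flux_upto_continuous[OF P(2,6,4) c])
  define D where "D s = m (cl s) - m 0 - \<Lambda> (cl s)" for s
  have Dc: "continuous_on UNIV D"
    unfolding D_def cl_def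
    by (intro continuous_intros continuous_on_compose2[OF mc] continuous_on_compose2[OF \<Lambda>c]) (use T in auto)
  have Drange: "range D = D ` {0..T}"
  proof -
    have "D s = D (cl s)" for s unfolding D_def using cl by simp
    then show ?thesis using cl by blast
  qed
  have "compact (D ` {0..T})" by (intro compact_continuous_image continuous_on_subset[OF Dc]) auto
  then have Db: "bounded (range D)" unfolding Drange by (rule compact_imp_bounded)
  then obtain E where E: "E > 0" "\<And>s. \<bar>D s\<bar> \<le> E" unfolding bounded_pos by auto
  have Dint: "D integrable_on {u..w}" for u w
    by (intro integrable_continuous_real continuous_on_subset[OF Dc]) auto
  have Dm [measurable]: "D \<in> borel_measurable borel" by (rule borel_measurable_continuous_onI[OF Dc])
  \<comment> \<open>This primitive of \<open>D\<close> is normalised to vanish at \<open>T\<close>,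
    so the terminal marginal drops out of the weak equation.\<close>
  define a where "a s = integral {0..s} D - integral {0..T} D" for s
  have ad: "(a has_vector_derivative D s) (at s within {0..T})" if "s \<in> {0..T}" for s
    unfolding a_def
    using has_vector_derivative_diff[OF integral_has_vector_derivative[OF continuous_on_subset[OF Dc] that] has_vector_derivative_const]
    by simp
  have ac: "continuous_on {0..T} a"
    using has_vector_derivative_continuous[OF ad] by (simp add: continuous_on_eq_continuous_within)
  have clc: "continuous_on UNIV cl" unfolding cl_def[abs_def] by (intro continuous_intros)
  have acl: "continuous_on UNIV (\<lambda>s. a (cl s))"
    by (rule continuous_on_compose2[OF ac clc]) (use cl in auto)
  have aclm: "(\<lambda>z :: real \<times> 'a \<times> (real ^ 'n). a (cl (fst z))) \<in> borel_measurable borel"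
    by (intro borel_measurable_continuous_onI continuous_on_compose2[OF acl continuous_on_fst[OF continuous_on_id]]) simp
  have aT: "a T = 0" unfolding a_def by simp
  have a0: "a 0 = - integral {0..T} D" unfolding a_def by simp
  note W = P(7)[OF product_test_fun[OF c Dc Db ad]]
  have ig: "integrable \<eta> ?g" using C1c_flux_integrable[OF P(2,6) c, of "\<lambda>_. 1"] by simp
  have gm [measurable]: "?g \<in> borel_measurable borel"
    by (rule borel_measurable_continuous_onI[OF flux_continuous[OF C1_funD(2)[OF C1c_funD(1)[OF c]]]])
  have \<psi>m [measurable]: "\<psi> \<in> borel_measurable borel" by (rule C1c_fun_measurable(1)[OF c])
  obtain B where B: "B > 0" "\<And>x. \<bar>\<psi> x\<bar> \<le> B" "\<And>x. norm (G x) \<le> B"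
    using C1c_fun_bounded[OF c] by blast
  have fstm [measurable]: "(fst :: real \<times> 'a \<times> (real ^ 'n) \<Rightarrow> real) \<in> borel_measurable borel"
    "(\<lambda>z :: real \<times> 'a \<times> (real ^ 'n). fst (snd z)) \<in> borel_measurable borel"
    by (intro borel_measurable_continuous_onI continuous_on_fst continuous_on_snd continuous_on_id)+
  have i1: "integrable \<eta> (\<lambda>z. D (fst z) * \<psi> (fst (snd z)))"
  proof (rule \<eta>.integrable_const_bound[of _ "E * B"])
    show "AE z in \<eta>. norm (D (fst z) * \<psi> (fst (snd z))) \<le> E * B"
      using E B by (intro AE_I2) (auto simp: abs_mult intro!: mult_mono)
  qed measurable
  \<comment> \<open>Integrating \<open>h\<close> over \<open>z\<close> first gives
    \<open>D s * \<Lambda> s / T\<close> on [0,T]; integrating over \<open>s\<close> first leaves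
    the integral of \<open>D\<close> from the time of \<open>z\<close> to \<open>T\<close>, which is
    \<open>- a\<close>.\<close>
  define h where "h = (\<lambda>(s, z :: real \<times> 'a \<times> (real ^ 'n)). indicator {0..T} s * D s * (indicator {..s} (fst z) * ?g z))"
  have hm: "h \<in> borel_measurable (lborel \<Otimes>\<^sub>M \<eta>)"
  proof -
    have [measurable]: "Measurable.pred (lborel \<Otimes>\<^sub>M \<eta>) (\<lambda>p. fst (snd p) \<le> fst p)"
      by measurable
    have "h = (\<lambda>p. indicator {0..T} (fst p) * D (fst p) * ((if fst (snd p) \<le> fst p then 1 else 0) * ?g (snd p)))"
      unfolding h_def by (auto simp: fun_eq_iff indicator_def)
    then show ?thesis by simp
  qed
  have hs: "integrable \<eta> (\<lambda>z. h (s, z))" for s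
    unfolding h_def split by (intro integrable_mult_right C1c_flux_integrable[OF P(2,6) c]) (auto simp: indicator_def)
  have ih: "integrable (lborel \<Otimes>\<^sub>M \<eta>) h"
  proof (rule Fubini_integrable[OF hm])
    show "AE s in lborel. integrable \<eta> (\<lambda>z. h (s, z))" using hs by simp
    have b: "norm (LINT z|\<eta>. norm (h (s, z))) \<le> indicator {0..T} s * (E * (LINT z|\<eta>. \<bar>?g z\<bar>))" for s
    proof -
      have "(LINT z|\<eta>. norm (h (s, z))) \<le> (LINT z|\<eta>. indicator {0..T} s * E * \<bar>?g z\<bar>)"
      proof (rule integral_mono)
        show "norm (h (s, z)) \<le> indicator {0..T} s * E * \<bar>?g z\<bar>" for z
        proof -
          have "\<bar>D s\<bar> * (indicator {..s} (fst z) * \<bar>?g z\<bar>) \<le> E * (1 * \<bar>?g z\<bar>)"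
            by (intro mult_mono E(2)) (auto simp: indicator_def E(1) less_imp_le)
          then show ?thesis unfolding h_def by (auto simp: abs_mult indicator_def)
        qed
      qed (use hs ig in auto)
      moreover have "0 \<le> (LINT z|\<eta>. norm (h (s, z)))" by simp
      ultimately show ?thesis by (simp add: mult.assoc)
    qed
    show "integrable lborel (\<lambda>s. LINT z|\<eta>. norm (h (s, z)))"
    proof (rule Bochner_Integration.integrable_bound)
      show "integrable lborel (\<lambda>s. indicator {0..T} s * (E * (LINT z|\<eta>. \<bar>?g z\<bar>)))"
        by (intro integrable_mult_left) (simp add: integrable_indicator_iff emeasure_lborel_Icc_eq)
      show "(\<lambda>s. LINT z|\<eta>. norm (h (s, z))) \<in> borel_measurable lborel"
      proof -
        have "(\<lambda>p. norm (h p)) \<in> borel_measurable (lborel \<Otimes>\<^sub>M \<eta>)" using hm by simp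
        then show ?thesis
          by (intro \<eta>.borel_measurable_lebesgue_integral) (simp add: case_prod_beta')
      qed
      show "AE s in lborel. norm (LINT z|\<eta>. norm (h (s, z))) \<le> norm (indicator {0..T} s * (E * (LINT z|\<eta>. \<bar>?g z\<bar>)))"
        unfolding real_norm_def[of "indicator {0..T} s * (E * (LINT z|\<eta>. \<bar>?g z\<bar>))" for s]
        by (intro AE_I2 order_trans[OF b abs_ge_self])
    qed
  qed
  have inner: "(LINT s|lborel. h (s, z)) = - a (cl (fst z)) * ?g z" if z: "fst z \<in> {0..T}" for z
  proof -
    have "(LINT s|lborel. h (s, z)) = (LINT s|lborel. indicator {fst z..T} s *\<^sub>R D s) * ?g z"
    proof -
      have "h (s, z) = (indicator {fst z..T} s *\<^sub>R D s) * ?g z" for s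
        unfolding h_def using z by (auto simp: indicator_def)
      then show ?thesis by simp
    qed
    also have "(LINT s|lborel. indicator {fst z..T} s *\<^sub>R D s) = integral {fst z..T} D"
      using set_borel_integral_eq_integral(2)[OF borel_integrable_atLeastAtMost', OF continuous_on_subset[OF Dc]]
      unfolding set_lebesgue_integral_def by blast
    also have "integral {fst z..T} D = - a (fst z)"
      unfolding a_def using Henstock_Kurzweil_Integration.integral_combine[OF _ _ Dint, of 0 "fst z" T] z by simp
    finally show ?thesis using cl(2)[OF z] by simp
  qed
  have fub: "T * (LINT z|\<eta>. a (cl (fst z)) * ?g z) = - (LINT s:{0..T}|lborel. D s * \<Lambda> s)"
  proof -
    have "(LINT z|\<eta>. a (cl (fst z)) * ?g z) = (LINT z|\<eta>. - (LINT s|lborel. h (s, z)))"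
    proof (rule integral_cong_AE)
      show "AE z in \<eta>. a (cl (fst z)) * ?g z = - (LINT s|lborel. h (s, z))"
        using uniform_time_AE(1)[OF T P(2) P(4)] by eventually_elim (simp add: inner)
      show "(\<lambda>z. a (cl (fst z)) * ?g z) \<in> borel_measurable \<eta>"
        by (intro borel_measurable_times) (use aclm gm measurable_cong_sets[OF Mb(2) refl] in auto)
      have "(\<lambda>z. LINT s|lborel. h (s, z)) \<in> borel_measurable \<eta>"
        using measurable_compose[OF measurable_pair_swap' hm]
        by (intro lborel.borel_measurable_lebesgue_integral) (simp add: case_prod_beta)
      then show "(\<lambda>z. - (LINT s|lborel. h (s, z))) \<in> borel_measurable \<eta>" by simp
    qed
    also have "\<dots> = - (LINT z|\<eta>. (LINT s|lborel. h (s, z)))" by simp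
    also have "(LINT z|\<eta>. (LINT s|lborel. h (s, z))) = (LINT s|lborel. (LINT z|\<eta>. h (s, z)))"
      using Fubini_integral[of "\<lambda>s z. h (s, z)"] ih by (simp add: case_prod_eta)
    also have "(LINT s|lborel. (LINT z|\<eta>. h (s, z))) = (LINT s|lborel. (indicator {0..T} s *\<^sub>R (D s * \<Lambda> s)) / T)"
      unfolding h_def split \<Lambda>_def flux_upto_def using T by (simp add: mult.assoc)
    finally show ?thesis unfolding set_lebesgue_integral_def using T by simp
  qed
  have "T * (LINT z|\<eta>. D (fst z) * \<psi> (fst (snd z)) + a (cl (fst z)) * ?g z) = a T * m T - a 0 * m 0"
    using W unfolding cl_def m_def by simp
  moreover have "(LINT z|\<eta>. D (fst z) * \<psi> (fst (snd z)) + a (cl (fst z)) * ?g z)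
      = (LINT z|\<eta>. D (fst z) * \<psi> (fst (snd z))) + (LINT z|\<eta>. a (cl (fst z)) * ?g z)"
  proof (rule Bochner_Integration.integral_add[OF i1])
    have "compact (a ` {0..T})" by (rule compact_continuous_image[OF ac]) simp
    then have "bounded (a ` {0..T})" by (rule compact_imp_bounded)
    then obtain A where A: "A > 0" "\<And>s. s \<in> {0..T} \<Longrightarrow> norm (a s) \<le> A"
      unfolding bounded_pos by blast
    have am: "(\<lambda>s. a (cl s) / A) \<in> borel_measurable borel"
      by (intro borel_measurable_divide borel_measurable_continuous_onI[OF acl]) simp
    have aA: "\<bar>a (cl s) / A\<bar> \<le> 1" for s using A(2)[OF cl(1), of s] A(1) by simp
    have "integrable \<eta> (\<lambda>z. A * (a (cl (fst z)) / A * ?g z))"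
      by (intro integrable_mult_right C1c_flux_integrable[OF P(2,6) c am aA])
    then show "integrable \<eta> (\<lambda>z. a (cl (fst z)) * ?g z)" using A by simp
  qed
  \<comment> \<open>With \<open>a T = 0\<close> and \<open>a 0 = - integral {0..T} D\<close>, the
    weak equation states that \<open>D\<close> is orthogonal to
    \<open>m s - \<Lambda> s - m 0\<close>, that is, to itself.\<close>
  ultimately have eq: "(LINT s:{0..T}|lborel. D s * m s) - (LINT s:{0..T}|lborel. D s * \<Lambda> s) = integral {0..T} D * m 0"
    using P(5)[OF Dc Db c] fub aT a0 unfolding m_def by (simp add: distrib_left)
  have si: "set_integrable lborel {0..T} (\<lambda>s. D s * k s)" "(LINT s:{0..T}|lborel. D s * k s) = integral {0..T} (\<lambda>s. D s * k s)"
    if "continuous_on {0..T} k" for k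
  proof -
    show "set_integrable lborel {0..T} (\<lambda>s. D s * k s)"
      by (intro borel_integrable_atLeastAtMost' continuous_intros continuous_on_subset[OF Dc] that) auto
    then show "(LINT s:{0..T}|lborel. D s * k s) = integral {0..T} (\<lambda>s. D s * k s)"
      by (rule set_borel_integral_eq_integral)
  qed
  have \<Lambda>c': "continuous_on {0..T} \<Lambda>" by (rule continuous_on_subset[OF \<Lambda>c]) simp
  have int: "(\<lambda>s. D s * k s) integrable_on {0..T}" if "continuous_on {0..T} k" for k
    by (intro integrable_continuous_real continuous_intros continuous_on_subset[OF Dc] that) auto
  have "integral {0..T} (\<lambda>s. D s * D s) = integral {0..T} (\<lambda>s. D s * m s - D s * \<Lambda> s - D s * m 0)"
    by (rule integral_cong) (simp add: D_def[of s for s] cl algebra_simps)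
  also have "\<dots> = integral {0..T} (\<lambda>s. D s * m s) - integral {0..T} (\<lambda>s. D s * \<Lambda> s) - integral {0..T} (\<lambda>s. D s * m 0)"
    by (simp only: Henstock_Kurzweil_Integration.integral_diff int mc \<Lambda>c' continuous_on_const integrable_diff)
  also have "\<dots> = 0" using eq si(2)[OF mc] si(2)[OF \<Lambda>c'] by simp
  finally have "integral {0..T} (\<lambda>s. D s * D s) = 0" .
  moreover have "continuous_on {0..T} (\<lambda>s. D s * D s)"
    by (intro continuous_on_mult continuous_on_subset[OF Dc]) auto
  ultimately have "\<forall>s\<in>{0..T}. D s * D s = 0"
    using integral_eq_0_iff[of 0 T "\<lambda>s. D s * D s"] T by simp
  then have "D t = 0" using t by simp
  then show ?thesis unfolding D_def m_def \<Lambda>_def cl(2)[OF t] by simp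
qed

end

lemma C1T_slice:
  fixes \<phi> :: "real \<times> 'a::euclidean_space \<Rightarrow> real"
  assumes "C1T_fun T \<phi> A G" "t \<in> {0..T}"
  shows "C1c_fun (\<lambda>x. \<phi> (t, x)) (\<lambda>x. G (t, x))"
proof -
  have d: "(\<phi> has_derivative (\<lambda>w. A z * fst w + G z \<bullet> snd w)) (at z within {0..T} \<times> UNIV)"
    if "z \<in> {0..T} \<times> UNIV" for z
    using assms that unfolding C1T_fun_def by blast
  obtain R where R: "\<And>z. norm (snd z) > R \<Longrightarrow> fst z \<in> {0..T} \<Longrightarrow> \<phi> z = 0"
    using assms unfolding C1T_fun_def by blast
  have Gc: "continuous_on UNIV G" using assms unfolding C1T_fun_def by blast
  show ?thesis
  proof (rule C1c_funI)
    show "C1_fun (\<lambda>x. \<phi> (t, x)) (\<lambda>x. G (t, x))"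
      unfolding C1_fun_def
    proof (intro conjI allI)
      fix x :: 'a
      have "((\<lambda>x. (t, x)) has_derivative (\<lambda>w. (0, w))) (at x)"
        by (auto intro!: derivative_eq_intros)
      moreover have "(\<phi> has_derivative (\<lambda>w. A (t, x) * fst w + G (t, x) \<bullet> snd w)) (at (t, x) within range (\<lambda>x. (t, x)))"
        by (rule has_derivative_subset[OF d]) (use assms(2) in auto)
      ultimately show "((\<lambda>x. \<phi> (t, x)) has_derivative (\<lambda>w. G (t, x) \<bullet> w)) (at x)"
        using has_derivative_in_compose[of "\<lambda>x. (t, x)" "\<lambda>w. (0, w)" x UNIV \<phi>] by fastforce
      show "continuous_on UNIV (\<lambda>x. G (t, x))"
        by (intro continuous_on_compose2[OF Gc] continuous_intros) auto
    qed
    show "\<phi> (t, x) = 0" if "norm x > R" for x using R[of "(t, x)"] that assms(2) by auto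
  qed
qed

context control_system begin

section \<open>Uniform tightness of plans of bounded energy\<close>

lemma log_flux_bound:
  assumes "R > 0"
  shows "\<bar>log_cutoff_grad R x \<bullet> ctrl F x v\<bar> \<le> 8 / R * (M * real CARD('n)) * norm v"
proof -
  have "\<bar>log_cutoff_grad R x \<bullet> ctrl F x v\<bar> \<le> norm (log_cutoff_grad R x) * norm (ctrl F x v)"
    by (rule Cauchy_Schwarz_ineq2)
  also have "\<dots> \<le> norm (log_cutoff_grad R x) * ((M * real CARD('n)) * (norm x + 1) * norm v)"
    by (intro mult_left_mono ctrl_bound) auto
  also have "\<dots> = (norm (log_cutoff_grad R x) * (norm x + 1)) * ((M * real CARD('n)) * norm v)" by simp
  also have "\<dots> \<le> (8 / R) * ((M * real CARD('n)) * norm v)"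
    by (intro mult_right_mono log_cutoff_bounds assms) (use M in auto)
  finally show ?thesis by simp
qed

text \<open>The cutoff integral at time \<open>t\<close> differs from the one at time 0 by a flux,
  and for the logarithmic cutoff that flux is at most of order \<open>(1 + E) / R\<close>. The
  estimate depends on the plan only through \<open>R0\<close> and \<open>E\<close>.\<close>

lemma plan_log_cutoff:
  assumes p: "plan T F \<mu> \<eta>" and R0: "AE x in \<mu> 0. norm x \<le> R0" and R: "R > 0" and t: "t \<in> {0..T}"
    and E: "plan_energy \<eta> \<le> E"
  shows "1 - (LINT x|\<mu> t. log_cutoff R x) \<le> (2 * ln (1 + R0\<^sup>2) + T * 8 * (M * real CARD('n)) * (1 + E)) / R"
proof -
  note P = planD[OF p]
  have "0 \<in> {0..T}" using T by auto
  note M0 = prob_algebra_borelD[OF P(1)[OF this]]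
  interpret \<mu>0: prob_space "\<mu> 0" by (rule M0)
  note [measurable_cong] = M0(2)
  note c = C1c_log_cutoff[OF R, where 'a = 'a]
  have lm [measurable]: "(log_cutoff R :: 'a \<Rightarrow> real) \<in> borel_measurable borel" by (rule C1c_fun_measurable(1)[OF c])
  have "(LINT x|\<mu> 0. 1 - 2 * ln (1 + R0\<^sup>2) / R) \<le> (LINT x|\<mu> 0. log_cutoff R x)"
  proof (rule integral_mono_AE)
    show "integrable (\<mu> 0) (log_cutoff R)"
      by (rule \<mu>0.integrable_const_bound[of _ 1]) (auto simp: log_cutoff_bounds[OF R])
    show "AE x in \<mu> 0. 1 - 2 * ln (1 + R0\<^sup>2) / R \<le> log_cutoff R x"
      using R0
    proof eventually_elim
      case (elim x)
      then have "x \<bullet> x \<le> R0\<^sup>2" unfolding dot_square_norm by (intro power_mono) auto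
      then have "ln (1 + x \<bullet> x) \<le> ln (1 + R0\<^sup>2)" by (simp add: add_pos_nonneg)
      then have "2 * ln (1 + x \<bullet> x) / R \<le> 2 * ln (1 + R0\<^sup>2) / R" using R by (simp add: divide_right_mono)
      then show ?case using log_cutoff_bounds(3)[OF R, of x] by linarith
    qed
  qed simp
  then have 1: "1 - 2 * ln (1 + R0\<^sup>2) / R \<le> (LINT x|\<mu> 0. log_cutoff R x)"
    by (simp add: \<mu>0.prob_space)
  have "\<bar>LINT z|\<eta>. indicator {..t} (fst z) * (log_cutoff_grad R (fst (snd z)) \<bullet> ctrl F (fst (snd z)) (snd (snd z)))\<bar>
      \<le> (LINT z|\<eta>. 8 / R * (M * real CARD('n)) * norm (snd (snd z)))"
  proof (rule order_trans[OF integral_abs_bound integral_mono])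
    show "integrable \<eta> (\<lambda>z. \<bar>indicator {..t} (fst z) * (log_cutoff_grad R (fst (snd z)) \<bullet> ctrl F (fst (snd z)) (snd (snd z)))\<bar>)"
      by (intro integrable_abs C1c_flux_integrable[OF P(2,6) c]) (auto simp: indicator_def)
    show "integrable \<eta> (\<lambda>z. 8 / R * (M * real CARD('n)) * norm (snd (snd z)))"
      by (intro integrable_mult_right plan_integrable_norm[OF P(2,6)])
    show "\<bar>indicator {..t} (fst z) * (log_cutoff_grad R (fst (snd z)) \<bullet> ctrl F (fst (snd z)) (snd (snd z)))\<bar>
        \<le> 8 / R * (M * real CARD('n)) * norm (snd (snd z))" for z
      using log_flux_bound[OF R, of "fst (snd z)" "snd (snd z)"] R M by (auto simp: indicator_def)
  qed
  also have "\<dots> = 8 / R * (M * real CARD('n)) * (LINT z|\<eta>. norm (snd (snd z)))" by simp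
  also have "\<dots> \<le> 8 / R * (M * real CARD('n)) * (1 + E)"
    using plan_integrable_norm(2)[OF P(2,6)] E R M by (intro mult_left_mono) auto
  finally have "\<bar>LINT z|\<eta>. indicator {..t} (fst z) * (log_cutoff_grad R (fst (snd z)) \<bullet> ctrl F (fst (snd z)) (snd (snd z)))\<bar>
      \<le> 8 / R * (M * real CARD('n)) * (1 + E)" .
  then have "T * \<bar>LINT z|\<eta>. indicator {..t} (fst z) * (log_cutoff_grad R (fst (snd z)) \<bullet> ctrl F (fst (snd z)) (snd (snd z)))\<bar>
      \<le> T * (8 / R * (M * real CARD('n)) * (1 + E))" using T by (intro mult_left_mono) auto
  then have "\<bar>flux_upto \<eta> (log_cutoff_grad R) t\<bar> \<le> T * (8 / R * (M * real CARD('n)) * (1 + E))"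
    unfolding flux_upto_def using T by (simp add: abs_mult)
  moreover have "(LINT x|\<mu> t. log_cutoff R x) - (LINT x|\<mu> 0. log_cutoff R x) = flux_upto \<eta> (log_cutoff_grad R) t"
    by (rule plan_increment[OF p c t])
  ultimately have "1 - (LINT x|\<mu> t. log_cutoff R x) \<le> 2 * ln (1 + R0\<^sup>2) / R + T * (8 / R * (M * real CARD('n)) * (1 + E))"
    using 1 by linarith
  then show ?thesis by (simp add: add_divide_distrib)
qed

text \<open>Time is bounded by \<open>T\<close>, the position is controlled by averaging the cutoff
  estimate over time, and the control by Chebyshev's inequality for its second moment.\<close>

lemma plan_tail:
  assumes p: "plan T F \<mu> \<eta>" and R0: "AE x in \<mu> 0. norm x \<le> R0" and R: "R > 0" and V: "V > 0"
    and E: "plan_energy \<eta> \<le> E"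
  shows "measure \<eta> {z. norm z > T + exp R + V} \<le> (2 * ln (1 + R0\<^sup>2) + T * 8 * (M * real CARD('n)) * (1 + E)) / R + E / V\<^sup>2"
proof -
  note P = planD[OF p]
  note Mb = prob_algebra_borelD[OF P(2)]
  interpret \<eta>: prob_space \<eta> by (rule Mb)
  note [measurable_cong] = Mb(2)
  define c where "c = (2 * ln (1 + R0\<^sup>2) + T * 8 * (M * real CARD('n)) * (1 + E)) / R"
  note cc = C1c_log_cutoff[OF R, where 'a = 'a]
  have [measurable]: "(\<lambda>z :: real \<times> 'a \<times> (real ^ 'n). log_cutoff R (fst (snd z))) \<in> borel_measurable borel"
    by (intro borel_measurable_continuous_onI continuous_on_compose2[OF C1_funD(3)[OF C1c_funD(1)[OF cc], of UNIV]] continuous_intros) auto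
  have il: "integrable \<eta> (\<lambda>z. log_cutoff R (fst (snd z)))"
    by (rule \<eta>.integrable_const_bound[of _ 1]) (auto simp: log_cutoff_bounds[OF R])
  have "T * (LINT z|\<eta>. 1 * log_cutoff R (fst (snd z))) = (LINT t:{0..T}|lborel. 1 * (LINT x|\<mu> t. log_cutoff R x))"
    by (rule P(5)[OF _ _ cc]) auto
  also have "\<dots> \<ge> (LINT t:{0..T}|lborel. 1 - c)"
  proof (rule set_integral_mono)
    show "set_integrable lborel {0..T} (\<lambda>t. 1 * (LINT x|\<mu> t. log_cutoff R x))"
      by (intro borel_integrable_atLeastAtMost') (use P(3)[OF cc] in simp)
    show "1 - c \<le> 1 * (LINT x|\<mu> t. log_cutoff R x)" if "t \<in> {0..T}" for t
      using plan_log_cutoff[OF p R0 R that E] unfolding c_def by simp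
  qed (intro borel_integrable_atLeastAtMost', auto)
  also have "(LINT t:{0..T}|lborel. 1 - c) = T * (1 - c)"
    unfolding set_lebesgue_integral_def using T by simp
  finally have 1: "1 - c \<le> (LINT z|\<eta>. log_cutoff R (fst (snd z)))" using T by simp
  have S: "{z :: real \<times> 'a \<times> (real ^ 'n). norm z > T + exp R + V} \<in> sets borel"
    by (intro borel_open open_Collect_less continuous_intros)
  have "measure \<eta> {z. norm z > T + exp R + V} = (LINT z|\<eta>. indicator {z. norm z > T + exp R + V} z)"
    using S Mb by simp
  also have "\<dots> \<le> (LINT z|\<eta>. (1 - log_cutoff R (fst (snd z))) + (norm (snd (snd z)))\<^sup>2 / V\<^sup>2)"
  proof (rule integral_mono_AE)
    show "integrable \<eta> (indicator {z. norm z > T + exp R + V} :: _ \<Rightarrow> real)"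
      by (rule \<eta>.integrable_const_bound[of _ 1]) (use S in \<open>auto simp: indicator_def\<close>)
    show "AE z in \<eta>. indicator {z. norm z > T + exp R + V} z \<le> (1 - log_cutoff R (fst (snd z))) + (norm (snd (snd z)))\<^sup>2 / V\<^sup>2"
      using uniform_time_AE(1)[OF T P(2) P(4)]
    proof eventually_elim
      case (elim z)
      have b: "log_cutoff R (fst (snd z)) \<le> 1" by (rule log_cutoff_bounds[OF R])
      show ?case
      proof (cases "norm z > T + exp R + V")
        case True
        have "norm z \<le> norm (fst z) + norm (snd z)"
          using norm_Pair_le[of "fst z" "snd z"] by simp
        also have "norm (snd z) \<le> norm (fst (snd z)) + norm (snd (snd z))"
          using norm_Pair_le[of "fst (snd z)" "snd (snd z)"] by simp
        finally have "norm (fst (snd z)) > exp R \<or> norm (snd (snd z)) > V" using elim True by auto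
        then show ?thesis
        proof
          assume "norm (fst (snd z)) > exp R"
          then have "log_cutoff R (fst (snd z)) = 0" by (rule log_cutoff_zero[OF R])
          then show ?thesis using True by simp
        next
          assume "norm (snd (snd z)) > V"
          then have "V\<^sup>2 \<le> (norm (snd (snd z)))\<^sup>2" using V by (intro power_mono) auto
          then have "1 \<le> (norm (snd (snd z)))\<^sup>2 / V\<^sup>2" using V by simp
          then show ?thesis using b True by simp
        qed
      qed (use b in simp)
    qed
  qed (use il P(6) in auto)
  also have "\<dots> = (1 - (LINT z|\<eta>. log_cutoff R (fst (snd z)))) + plan_energy \<eta> / V\<^sup>2"
    using il P(6) by (simp add: plan_energy_def \<eta>.prob_space)
  also have "\<dots> \<le> c + E / V\<^sup>2"
    using 1 E by (intro add_mono divide_right_mono) auto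
  finally show ?thesis unfolding c_def .
qed

end

text \<open>Bounded second moments give uniform integrability. Truncating \<open>h\<close> at height
  \<open>b\<close> changes it by at most the square of \<open>h\<close> divided by \<open>b\<close>,
  and the integral of that is of order \<open>(1 + E) / b\<close>, uniformly along the sequence; the
  truncation itself is bounded and continuous.\<close>

lemma young_linear_growth_limit:
  fixes \<eta> :: "nat \<Rightarrow> (real \<times> 'a::euclidean_space \<times> (real ^ 'n::finite)) measure"
  assumes \<eta>: "\<And>k. \<eta> k \<in> space (prob_algebra borel)" and \<eta>': "\<eta>' \<in> space (prob_algebra borel)"
    and int: "\<And>k. integrable (\<eta> k) (\<lambda>z. (norm (snd (snd z)))\<^sup>2)" "integrable \<eta>' (\<lambda>z. (norm (snd (snd z)))\<^sup>2)"
    and E: "\<And>k. plan_energy (\<eta> k) \<le> E" "plan_energy \<eta>' \<le> E"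
    and conv: "\<And>g :: _ \<Rightarrow> real. continuous_on UNIV g \<Longrightarrow> bounded (range g) \<Longrightarrow>
       (\<lambda>k. LINT z|\<eta> k. g z) \<longlonglongrightarrow> (LINT z|\<eta>'. g z)"
    and h: "continuous_on UNIV h" "\<And>z. \<bar>h z\<bar> \<le> K * (1 + norm (snd (snd z)))" and K: "K \<ge> 0"
  shows "(\<lambda>k. LINT z|\<eta> k. h z) \<longlonglongrightarrow> (LINT z|\<eta>'. h z :: real)"
proof -
  define cut where "cut b z = max (- b) (min b (h z))" for b z
  have hm [measurable]: "h \<in> borel_measurable borel" by (rule borel_measurable_continuous_onI[OF h(1)])
  have cut_c: "continuous_on UNIV (cut b)" for b
    unfolding cut_def by (intro continuous_intros h(1))
  have [measurable]: "cut b \<in> borel_measurable borel" for b by (rule borel_measurable_continuous_onI[OF cut_c])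
  have cut_b: "\<bar>cut b z\<bar> \<le> b" if "b > 0" for b z unfolding cut_def using that by auto
  have h2: "\<bar>h z - cut b z\<bar> \<le> (2 * K\<^sup>2 / b) * (1 + (norm (snd (snd z)))\<^sup>2)" if b: "b > 0" for b z
  proof -
    have "\<bar>h z - cut b z\<bar> \<le> (h z)\<^sup>2 / b"
    proof (cases "\<bar>h z\<bar> \<le> b")
      case True
      then have "cut b z = h z" unfolding cut_def by auto
      then show ?thesis using b by simp
    next
      case False
      then have "\<bar>h z - cut b z\<bar> \<le> \<bar>h z\<bar>" unfolding cut_def using b by (auto simp: max_def min_def)
      also have "\<dots> * b \<le> \<bar>h z\<bar> * \<bar>h z\<bar>" using False by (intro mult_left_mono) auto
      then have "\<bar>h z\<bar> \<le> (h z)\<^sup>2 / b" using b by (simp add: pos_le_divide_eq power2_eq_square)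
      finally show ?thesis .
    qed
    also have "(h z)\<^sup>2 \<le> (K * (1 + norm (snd (snd z))))\<^sup>2"
      using h(2)[of z] by (rule abs_le_square_iff[THEN iffD1, OF order_trans[OF _ abs_ge_self]])
    then have "(h z)\<^sup>2 / b \<le> (K * (1 + norm (snd (snd z))))\<^sup>2 / b" using b by (simp add: divide_right_mono)
    also have "\<dots> \<le> (2 * K\<^sup>2 / b) * (1 + (norm (snd (snd z)))\<^sup>2)"
    proof -
      have "0 \<le> (1 - norm (snd (snd z)))\<^sup>2" by simp
      then have "(1 + norm (snd (snd z)))\<^sup>2 \<le> 2 * (1 + (norm (snd (snd z)))\<^sup>2)"
        by (simp add: power2_eq_square algebra_simps)
      then have "K\<^sup>2 * (1 + norm (snd (snd z)))\<^sup>2 / b \<le> K\<^sup>2 * (2 * (1 + (norm (snd (snd z)))\<^sup>2)) / b"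
        using b by (intro divide_right_mono mult_left_mono) auto
      moreover have "K\<^sup>2 * (2 * (1 + (norm (snd (snd z)))\<^sup>2)) / b = (2 * K\<^sup>2 / b) * (1 + (norm (snd (snd z)))\<^sup>2)"
        by simp
      ultimately show ?thesis unfolding power_mult_distrib by (rule ord_le_eq_trans)
    qed
    finally show ?thesis .
  qed
  have err: "\<bar>(LINT z|N. h z) - (LINT z|N. cut b z)\<bar> \<le> 2 * K\<^sup>2 / b * (1 + E)"
    if N: "N \<in> space (prob_algebra borel)" "integrable N (\<lambda>z. (norm (snd (snd z)))\<^sup>2)" "plan_energy N \<le> E"
      and b: "b > 0" for N :: "(real \<times> 'a \<times> (real ^ 'n)) measure" and b
  proof -
    note Mb = prob_algebra_borelD[OF N(1)]
    interpret prob_space N by (rule Mb)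
    note [measurable_cong] = Mb(2)
    have ih: "integrable N h"
    proof (rule Bochner_Integration.integrable_bound)
      show "integrable N (\<lambda>z. K * (1 + norm (snd (snd z))))"
        by (intro integrable_mult_right Bochner_Integration.integrable_add plan_integrable_norm[OF N(1,2)]) simp
      show "AE z in N. norm (h z) \<le> norm (K * (1 + norm (snd (snd z))))"
        using h(2) K by (intro AE_I2) simp
    qed measurable
    have ic: "integrable N (cut b)"
      by (rule integrable_const_bound[of _ b]) (use cut_b[OF b] in auto)
    have "\<bar>(LINT z|N. h z) - (LINT z|N. cut b z)\<bar> = \<bar>LINT z|N. h z - cut b z\<bar>"
      using ih ic by simp
    also have "\<dots> \<le> (LINT z|N. (2 * K\<^sup>2 / b) * (1 + (norm (snd (snd z)))\<^sup>2))"
      by (rule order_trans[OF integral_abs_bound integral_mono]) (use ih ic N(2) h2[OF b] in auto)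
    also have "\<dots> = (2 * K\<^sup>2 / b) * (1 + plan_energy N)"
      using N(2) by (simp add: plan_energy_def prob_space)
    also have "\<dots> \<le> 2 * K\<^sup>2 / b * (1 + E)" using N(3) b by (intro mult_left_mono) auto
    finally show ?thesis .
  qed
  show ?thesis
    unfolding LIMSEQ_iff
  proof (intro allI impI)
    fix e :: real assume e: "e > 0"
    have "0 \<le> plan_energy \<eta>'" unfolding plan_energy_def by simp
    then have E0: "0 \<le> E" using E(2) by linarith
    \<comment> \<open>Chosen so that the truncation error \<open>2 * K\<^sup>2 / b * (1 + E)\<close>
      is at most \<open>e / 4\<close>; the summand 1 keeps \<open>b\<close> positive when
      \<open>K = 0\<close>.\<close>
    define b where "b = 1 + 8 * K\<^sup>2 * (1 + E) / e"
    have b: "b > 0" unfolding b_def using E0 e by (simp add: add_pos_nonneg)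
    have "e * b = e + 8 * K\<^sup>2 * (1 + E)" unfolding b_def using e by (simp add: distrib_left[of e])
    then have "2 * K\<^sup>2 * (1 + E) \<le> e / 4 * b" using e by simp
    then have "2 * K\<^sup>2 * (1 + E) / b \<le> e / 4" using b by (simp only: pos_divide_le_eq)
    then have be: "2 * K\<^sup>2 / b * (1 + E) \<le> e / 4" by simp
    have "(\<lambda>k. LINT z|\<eta> k. cut b z) \<longlonglongrightarrow> (LINT z|\<eta>'. cut b z)"
      by (rule conv[OF cut_c]) (use cut_b[OF b] in \<open>auto simp: bounded_iff\<close>)
    then obtain k0 where k0: "\<And>k. k \<ge> k0 \<Longrightarrow> \<bar>(LINT z|\<eta> k. cut b z) - (LINT z|\<eta>'. cut b z)\<bar> < e / 4"
      unfolding LIMSEQ_iff using e by (metis divide_pos_pos real_norm_def zero_less_numeral)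
    have "norm ((LINT z|\<eta> k. h z) - (LINT z|\<eta>'. h z)) < e" if "k \<ge> k0" for k
      using k0[OF that] err[OF \<eta> int(1) E(1) b, of k] err[OF \<eta>' int(2) E(2) b] be e unfolding real_norm_def by linarith
    then show "\<exists>k0. \<forall>k\<ge>k0. norm ((LINT z|\<eta> k. h z) - (LINT z|\<eta>'. h z)) < e" by blast
  qed
qed

text \<open>The truncations \<open>min N\<close> of the square norm are bounded and continuous, so
  their integrals pass to the limit and stay below \<open>e\<close>; monotone convergence in
  \<open>N\<close> then recovers the energy and its finiteness.\<close>

lemma young_energy_lsc:
  fixes \<eta> :: "nat \<Rightarrow> (real \<times> 'a::euclidean_space \<times> (real ^ 'n::finite)) measure"
  assumes \<eta>: "\<And>k. \<eta> k \<in> space (prob_algebra borel)" and \<eta>': "\<eta>' \<in> space (prob_algebra borel)"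
    and int: "\<And>k. integrable (\<eta> k) (\<lambda>z. (norm (snd (snd z)))\<^sup>2)"
    and E: "\<And>k. plan_energy (\<eta> k) \<le> E k" "E \<longlonglongrightarrow> e"
    and conv: "\<And>g :: _ \<Rightarrow> real. continuous_on UNIV g \<Longrightarrow> bounded (range g) \<Longrightarrow>
       (\<lambda>k. LINT z|\<eta> k. g z) \<longlonglongrightarrow> (LINT z|\<eta>'. g z)"
  shows "integrable \<eta>' (\<lambda>z. (norm (snd (snd z)))\<^sup>2)" "plan_energy \<eta>' \<le> e"
proof -
  let ?q = "\<lambda>z :: real \<times> 'a \<times> (real ^ 'n). (norm (snd (snd z)))\<^sup>2"
  define g where "g N z = min (real N) (?q z)" for N z
  note Mb' = prob_algebra_borelD[OF \<eta>']
  interpret \<eta>': prob_space \<eta>' by (rule Mb')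
  note [measurable_cong] = Mb'(2)
  have qm [measurable]: "?q \<in> borel_measurable borel"
    by (intro borel_measurable_continuous_onI continuous_intros)
  have gc: "continuous_on UNIV (g N)" for N unfolding g_def by (intro continuous_intros)
  have [measurable]: "g N \<in> borel_measurable borel" for N by (rule borel_measurable_continuous_onI[OF gc])
  have gb: "0 \<le> g N z" "g N z \<le> real N" for N z unfolding g_def by auto
  have le: "(LINT z|\<eta>'. g N z) \<le> e" for N
  proof (rule LIMSEQ_le[OF conv[OF gc] E(2)])
    show "bounded (range (g N))" unfolding bounded_iff by (rule exI[of _ "real N"]) (use gb in auto)
    have "(LINT z|\<eta> k. g N z) \<le> E k" for k
    proof -
      note Mb = prob_algebra_borelD[OF \<eta>[of k]]
      interpret prob_space "\<eta> k" by (rule Mb)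
      note [measurable_cong] = Mb(2)
      have "(LINT z|\<eta> k. g N z) \<le> (LINT z|\<eta> k. ?q z)"
      proof (rule integral_mono[OF _ int])
        show "integrable (\<eta> k) (g N)" by (rule integrable_const_bound[of _ "real N"]) (use gb in auto)
      qed (simp add: g_def)
      then show ?thesis using E(1)[of k] unfolding plan_energy_def by linarith
    qed
    then show "\<exists>N'. \<forall>k\<ge>N'. (LINT z|\<eta> k. g N z) \<le> E k" by blast
  qed
  have e0: "0 \<le> e" using le[of 0] gb(1)[of 0] by (metis Bochner_Integration.integral_nonneg order_trans)
  have "(\<integral>\<^sup>+z. ennreal (?q z) \<partial>\<eta>') = (\<integral>\<^sup>+z. (SUP N. ennreal (g N z)) \<partial>\<eta>')"
  proof (intro nn_integral_cong)
    fix z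
    obtain N :: nat where N: "?q z \<le> real N" using real_arch_simple by blast
    show "ennreal (?q z) = (SUP N. ennreal (g N z))"
    proof (rule antisym)
      have "ennreal (?q z) = ennreal (g N z)" unfolding g_def using N by simp
      also have "\<dots> \<le> (SUP N. ennreal (g N z))" by (rule SUP_upper) simp
      finally show "ennreal (?q z) \<le> (SUP N. ennreal (g N z))" .
      show "(SUP N. ennreal (g N z)) \<le> ennreal (?q z)"
        by (rule SUP_least) (auto simp: g_def intro!: ennreal_leI)
    qed
  qed
  also have "\<dots> = (SUP N. \<integral>\<^sup>+z. ennreal (g N z) \<partial>\<eta>')"
    by (rule nn_integral_monotone_convergence_SUP)
       (auto simp: incseq_def le_fun_def g_def intro!: ennreal_leI)
  also have "\<dots> \<le> ennreal e"
  proof (rule SUP_least)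
    fix N
    have "integrable \<eta>' (g N)" by (rule \<eta>'.integrable_const_bound[of _ "real N"]) (use gb in auto)
    then have "(\<integral>\<^sup>+z. ennreal (g N z) \<partial>\<eta>') = ennreal (LINT z|\<eta>'. g N z)"
      by (rule nn_integral_eq_integral) (use gb in auto)
    then show "(\<integral>\<^sup>+z. ennreal (g N z) \<partial>\<eta>') \<le> ennreal e" using le[of N] by (simp add: ennreal_leI)
  qed
  finally have fin: "(\<integral>\<^sup>+z. ennreal (?q z) \<partial>\<eta>') \<le> ennreal e" .
  show i: "integrable \<eta>' ?q"
    by (rule integrableI_nonneg) (use fin in \<open>auto intro: le_less_trans\<close>)
  have "ennreal (plan_energy \<eta>') \<le> ennreal e"
    unfolding plan_energy_def using nn_integral_eq_integral[OF i] fin by simp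
  then show "plan_energy \<eta>' \<le> e" using e0 by simp
qed

context control_system begin

section \<open>Convergence of fluxes and compactness of plans\<close>

lemma uniform_prob: "uniform_measure lborel {0..T} \<in> space (prob_algebra borel)"
proof -
  have "prob_space (uniform_measure lborel {0..T})"
    by (rule prob_space_uniform_measure) (use T in auto)
  then show ?thesis by (simp add: space_prob_algebra)
qed

text \<open>By Young's inequality \<open>n \<le> 1 / \<theta> + \<theta> * n\<^sup>2\<close>, the
  flux through a time window is bounded by a part proportional to the window's length and a part
  proportional to the energy. The free parameter \<open>\<theta>\<close> makes the second part small
  before the window is shortened, uniformly over plans of bounded energy.\<close>

lemma window_flux_bound:
  assumes p: "\<eta> \<in> space (prob_algebra borel)" "integrable \<eta> (\<lambda>z :: real \<times> 'a \<times> (real ^ 'n). (norm (snd (snd z)))\<^sup>2)"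
    and tm: "distr \<eta> borel fst = uniform_measure lborel {0..T}" and c: "C1c_fun \<psi> G"
    and K: "K > 0" "\<And>x v. \<bar>G x \<bullet> ctrl F x v\<bar> \<le> K * norm v" and E: "plan_energy \<eta> \<le> E"
    and a: "a \<in> borel_measurable borel" "\<And>s. \<bar>a s\<bar> \<le> 1" "\<And>s. s \<notin> {t..t + \<epsilon>} \<Longrightarrow> a s = 0"
    and pos: "\<epsilon> > 0" "\<theta> > 0"
  shows "\<bar>LINT z|\<eta>. a (fst z) * (G (fst (snd z)) \<bullet> ctrl F (fst (snd z)) (snd (snd z)))\<bar> \<le> K * (\<epsilon> / (T * \<theta>) + \<theta> * E)"
proof -
  note Mb = prob_algebra_borelD[OF p(1)]
  interpret prob_space \<eta> by (rule Mb)
  note [measurable_cong] = Mb(2)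
  let ?g = "\<lambda>z :: real \<times> 'a \<times> (real ^ 'n). G (fst (snd z)) \<bullet> ctrl F (fst (snd z)) (snd (snd z))"
  have fm: "(fst :: real \<times> 'a \<times> (real ^ 'n) \<Rightarrow> real) \<in> borel_measurable \<eta>"
    using borel_measurable_continuous_onI[OF continuous_on_fst[OF continuous_on_id], where 'b = real]
      measurable_cong_sets[OF Mb(2) refl] by auto
  have J: "(LINT z|\<eta>. indicator {t..t + \<epsilon>} (fst z)) \<le> \<epsilon> / T"
  proof -
    have "(LINT z|\<eta>. indicator {t..t + \<epsilon>} (fst z)) = (LINT s|distr \<eta> borel fst. indicator {t..t + \<epsilon>} s :: real)"
      by (subst integral_distr[OF fm]) auto
    also have "\<dots> = measure (uniform_measure lborel {0..T}) {t..t + \<epsilon>}" unfolding tm by simp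
    also have "\<dots> = measure lborel ({0..T} \<inter> {t..t + \<epsilon>}) / measure lborel {0..T}"
      by (rule measure_uniform_measure) (use T in auto)
    also have "\<dots> \<le> \<epsilon> / T"
    proof -
      have "measure lborel ({0..T} \<inter> {t..t + \<epsilon>}) \<le> measure lborel {t..t + \<epsilon>}"
        by (rule measure_mono_fmeasurable) (auto simp: fmeasurable_def emeasure_lborel_Icc_eq)
      then show ?thesis using T pos by (simp add: divide_right_mono)
    qed
    finally show ?thesis .
  qed
  have iJ: "integrable \<eta> (\<lambda>z. indicator {t..t + \<epsilon>} (fst z) :: real)"
    by (rule integrable_const_bound[of _ 1]) (use fm in \<open>auto simp: indicator_def\<close>)
  have "\<bar>LINT z|\<eta>. a (fst z) * ?g z\<bar> \<le> (LINT z|\<eta>. K * (indicator {t..t + \<epsilon>} (fst z) / \<theta> + \<theta> * (norm (snd (snd z)))\<^sup>2))"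
  proof (rule order_trans[OF integral_abs_bound integral_mono])
    show "integrable \<eta> (\<lambda>z. \<bar>a (fst z) * ?g z\<bar>)"
      by (intro integrable_abs C1c_flux_integrable[OF p c a(1,2)])
    show "integrable \<eta> (\<lambda>z. K * (indicator {t..t + \<epsilon>} (fst z) / \<theta> + \<theta> * (norm (snd (snd z)))\<^sup>2))"
      using iJ p(2) by (intro integrable_mult_right Bochner_Integration.integrable_add integrable_divide)
    fix z :: "real \<times> 'a \<times> (real ^ 'n)"
    show "\<bar>a (fst z) * ?g z\<bar> \<le> K * (indicator {t..t + \<epsilon>} (fst z) / \<theta> + \<theta> * (norm (snd (snd z)))\<^sup>2)"
    proof (cases "fst z \<in> {t..t + \<epsilon>}")
      case True
      have "\<bar>a (fst z)\<bar> * \<bar>?g z\<bar> \<le> 1 * (K * norm (snd (snd z)))"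
        by (intro mult_mono a K) auto
      moreover have "norm (snd (snd z)) \<le> 1 / \<theta> + \<theta> * (norm (snd (snd z)))\<^sup>2"
      proof -
        define n where "n = norm (snd (snd z))"
        have "0 \<le> (\<theta> * n - 1)\<^sup>2" by simp
        moreover have "0 \<le> \<theta> * n" using pos unfolding n_def by simp
        ultimately have "\<theta> * n \<le> 1 + \<theta> * n * (\<theta> * n)" by (simp add: power2_eq_square algebra_simps)
        then have "\<theta> * n / \<theta> \<le> (1 + \<theta> * n * (\<theta> * n)) / \<theta>" using pos by (intro divide_right_mono) auto
        then have "n \<le> 1 / \<theta> + \<theta> * n\<^sup>2" using pos by (simp add: add_divide_distrib power2_eq_square mult_ac)
        then show ?thesis unfolding n_def .
      qed
      then have "K * norm (snd (snd z)) \<le> K * (1 / \<theta> + \<theta> * (norm (snd (snd z)))\<^sup>2)"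
        using K(1) by (intro mult_left_mono) auto
      ultimately show ?thesis using True by (simp add: abs_mult)
    next
      case False
      then show ?thesis using a(3)[of "fst z"] K(1) pos by simp
    qed
  qed
  also have "\<dots> = K * ((LINT z|\<eta>. indicator {t..t + \<epsilon>} (fst z)) / \<theta> + \<theta> * plan_energy \<eta>)"
    using iJ p(2) by (simp add: plan_energy_def)
  also have "\<dots> \<le> K * (\<epsilon> / T / \<theta> + \<theta> * E)"
    using J E K(1) pos by (intro mult_left_mono add_mono divide_right_mono) auto
  finally show ?thesis by simp
qed

text \<open>The indicator of the past is discontinuous in time. It is replaced by the ramp
  \<open>r\<close> descending from 1 to 0 on \<open>{t..t + \<epsilon>}\<close>, for which the limit
  theorem for linear growth applies; the error is the flux through that window.\<close>

lemma flux_upto_limit: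
  fixes \<eta> :: "nat \<Rightarrow> (real \<times> 'a \<times> (real ^ 'n)) measure"
  assumes \<eta>: "\<And>k. \<eta> k \<in> space (prob_algebra borel)" and \<eta>': "\<eta>' \<in> space (prob_algebra borel)"
    and int: "\<And>k. integrable (\<eta> k) (\<lambda>z. (norm (snd (snd z)))\<^sup>2)" "integrable \<eta>' (\<lambda>z. (norm (snd (snd z)))\<^sup>2)"
    and E: "\<And>k. plan_energy (\<eta> k) \<le> E" "plan_energy \<eta>' \<le> E"
    and tm: "\<And>k. distr (\<eta> k) borel fst = uniform_measure lborel {0..T}" "distr \<eta>' borel fst = uniform_measure lborel {0..T}"
    and conv: "\<And>g :: _ \<Rightarrow> real. continuous_on UNIV g \<Longrightarrow> bounded (range g) \<Longrightarrow>
       (\<lambda>k. LINT z|\<eta> k. g z) \<longlonglongrightarrow> (LINT z|\<eta>'. g z)"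
    and c: "C1c_fun \<psi> G"
  shows "(\<lambda>k. flux_upto (\<eta> k) G t) \<longlonglongrightarrow> flux_upto \<eta>' G t"
proof -
  let ?g = "\<lambda>z :: real \<times> 'a \<times> (real ^ 'n). G (fst (snd z)) \<bullet> ctrl F (fst (snd z)) (snd (snd z))"
  obtain K where K: "K > 0" "\<And>x v. \<bar>G x \<bullet> ctrl F x v\<bar> \<le> K * norm v"
    using C1c_flux_bound[OF c] by blast
  have E0: "0 \<le> E" using E(2) unfolding plan_energy_def by (meson Bochner_Integration.integral_nonneg order_trans zero_le_power2)
  have "(\<lambda>k. LINT z|\<eta> k. indicator {..t} (fst z) * ?g z) \<longlonglongrightarrow> (LINT z|\<eta>'. indicator {..t} (fst z) * ?g z)"
    unfolding LIMSEQ_iff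
  proof (intro allI impI)
    fix e :: real assume e: "e > 0"
    \<comment> \<open>First \<open>\<theta>\<close> brings the energy part of the window bound down
      to \<open>e / 8\<close>, then \<open>\<epsilon>\<close> does the same for the length
      part.\<close>
    define \<theta> where "\<theta> = e / (8 * K * (E + 1))"
    have \<theta>: "\<theta> > 0" unfolding \<theta>_def using e K E0 by (simp add: add_nonneg_pos)
    define \<epsilon> where "\<epsilon> = e * T * \<theta> / (8 * K)"
    have \<epsilon>: "\<epsilon> > 0" unfolding \<epsilon>_def using e K \<theta> T by simp
    have small: "K * (\<epsilon> / (T * \<theta>) + \<theta> * E) \<le> e / 4"
    proof -
      have "K * (\<epsilon> / (T * \<theta>)) = e / 8" unfolding \<epsilon>_def using T \<theta> K by simp
      moreover have "K * (\<theta> * E) \<le> K * (\<theta> * (E + 1))" using K \<theta> by (intro mult_left_mono) auto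
      moreover have "K * (\<theta> * (E + 1)) = e / 8" unfolding \<theta>_def using K E0 by (simp add: add_nonneg_eq_0_iff)
      ultimately show ?thesis by (simp add: distrib_left)
    qed
    define r where "r s = max 0 (min 1 ((t + \<epsilon> - s) / \<epsilon>))" for s
    have rc: "continuous_on UNIV r" unfolding r_def using \<epsilon> by (intro continuous_intros) auto
    have r1: "\<bar>r s\<bar> \<le> 1" for s unfolding r_def by auto
    define a where "a s = r s - indicator {..t} s" for s
    have am: "a \<in> borel_measurable borel"
      unfolding a_def using borel_measurable_continuous_onI[OF rc] by measurable
    have a1: "\<bar>a s\<bar> \<le> 1" for s unfolding a_def r_def by (auto simp: indicator_def)
    have a0: "a s = 0" if "s \<notin> {t..t + \<epsilon>}" for s
    proof (cases "s < t")
      case True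
      then have "1 \<le> (t + \<epsilon> - s) / \<epsilon>" using \<epsilon> by (simp add: pos_le_divide_eq)
      then show ?thesis unfolding a_def r_def using True by simp
    next
      case False
      then have s: "s > t + \<epsilon>" using that by auto
      then have "(t + \<epsilon> - s) / \<epsilon> \<le> 0" using \<epsilon> by (simp add: divide_nonpos_pos)
      then show ?thesis unfolding a_def r_def using s \<epsilon> by simp
    qed
    have err: "\<bar>(LINT z|N. r (fst z) * ?g z) - (LINT z|N. indicator {..t} (fst z) * ?g z)\<bar> \<le> e / 4"
      if N: "N \<in> space (prob_algebra borel)" "integrable N (\<lambda>z. (norm (snd (snd z)))\<^sup>2)"
        "distr N borel fst = uniform_measure lborel {0..T}" "plan_energy N \<le> E"
      for N :: "(real \<times> 'a \<times> (real ^ 'n)) measure"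
    proof -
      have i1: "integrable N (\<lambda>z. r (fst z) * ?g z)"
        by (rule C1c_flux_integrable[OF N(1,2) c borel_measurable_continuous_onI[OF rc] r1])
      have i2: "integrable N (\<lambda>z. indicator {..t} (fst z) * ?g z)"
        by (rule C1c_flux_integrable[OF N(1,2) c]) (auto simp: indicator_def)
      have "(LINT z|N. r (fst z) * ?g z) - (LINT z|N. indicator {..t} (fst z) * ?g z) = (LINT z|N. a (fst z) * ?g z)"
        unfolding a_def left_diff_distrib using i1 i2 by simp
      then show ?thesis
        using window_flux_bound[where t = t, OF N(1,2,3) c K N(4) am a1 a0 \<epsilon> \<theta>] small by linarith
    qed
    have rlim: "(\<lambda>k. LINT z|\<eta> k. r (fst z) * ?g z) \<longlonglongrightarrow> (LINT z|\<eta>'. r (fst z) * ?g z)"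
    proof (rule young_linear_growth_limit[OF \<eta> \<eta>' int E conv])
      show "continuous_on UNIV (\<lambda>z. r (fst z) * ?g z)"
        by (intro continuous_on_mult continuous_on_compose2[OF rc continuous_on_fst[OF continuous_on_id]]
            flux_continuous C1_funD(2)[OF C1c_funD(1)[OF c]]) simp
      show "\<bar>r (fst z) * ?g z\<bar> \<le> K * (1 + norm (snd (snd z)))" for z
      proof -
        have "\<bar>r (fst z)\<bar> * \<bar>?g z\<bar> \<le> 1 * (K * (1 + norm (snd (snd z))))"
          by (intro mult_mono r1 order_trans[OF K(2)]) (use K(1) in auto)
        then show ?thesis by (simp add: abs_mult)
      qed
    qed (use K in auto)
    obtain k0 where k0: "\<And>k. k \<ge> k0 \<Longrightarrow> \<bar>(LINT z|\<eta> k. r (fst z) * ?g z) - (LINT z|\<eta>'. r (fst z) * ?g z)\<bar> < e / 4"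
      using LIMSEQ_D[OF rlim, of "e / 4"] e unfolding real_norm_def by auto
    have "norm ((LINT z|\<eta> k. indicator {..t} (fst z) * ?g z) - (LINT z|\<eta>'. indicator {..t} (fst z) * ?g z)) < e"
      if "k \<ge> k0" for k
      using k0[OF that] err[OF \<eta> int(1) tm(1) E(1), of k] err[OF \<eta>' int(2) tm(2) E(2)] e
      unfolding real_norm_def by linarith
    then show "\<exists>k0. \<forall>k\<ge>k0. norm ((LINT z|\<eta> k. indicator {..t} (fst z) * ?g z) - (LINT z|\<eta>'. indicator {..t} (fst z) * ?g z)) < e"
      by blast
  qed
  then show ?thesis unfolding flux_upto_def by (intro tendsto_mult tendsto_const)
qed

text \<open>Prokhorov's theorem is applied once to the joint laws, and then to the marginals at each
  time separately. The subsequences chosen at different times need not be compatible: every limit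
  point at time \<open>t\<close> has the test integrals \<open>lim \<psi> G t\<close>, which are
  expressed through \<open>m0\<close> and the limit law \<open>\<eta>'\<close> alone.\<close>

theorem plan_compactness:
  fixes \<mu> :: "nat \<Rightarrow> real \<Rightarrow> 'a measure"
  assumes p: "\<And>k. plan T F (\<mu> k) (\<eta> k)" and E: "\<And>k. plan_energy (\<eta> k) \<le> E k" "E \<longlonglongrightarrow> e"
    and R0: "\<And>k. AE x in \<mu> k 0. norm x \<le> R0"
    and m0: "m0 \<in> space (prob_algebra borel)" "\<And>\<psi> G. C1c_fun \<psi> G \<Longrightarrow> (\<lambda>k. LINT x|\<mu> k 0. \<psi> x) \<longlonglongrightarrow> (LINT x|m0. \<psi> x)"
    and mT: "mT \<in> space (prob_algebra borel)" "\<And>\<psi> G. C1c_fun \<psi> G \<Longrightarrow> (\<lambda>k. LINT x|\<mu> k T. \<psi> x) \<longlonglongrightarrow> (LINT x|mT. \<psi> x)"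
  obtains \<mu>' \<eta>' where "plan T F \<mu>' \<eta>'" "\<mu>' 0 = m0" "\<mu>' T = mT" "plan_energy \<eta>' \<le> e"
proof -
  note P = planD[OF p]
  have "Bseq E" using E(2) by (intro convergent_imp_Bseq convergentI)
  then obtain B where B: "B > 0" "\<And>k. norm (E k) \<le> B" unfolding Bseq_def by blast
  define Em where "Em = max B e"
  have Ek: "plan_energy (\<eta> k) \<le> Em" for k using E(1)[of k] B(2)[of k] unfolding Em_def by auto
  have Em0: "0 < Em" using B(1) unfolding Em_def by auto
  define c where "c = 2 * ln (1 + R0\<^sup>2) + T * 8 * (M * real CARD('n)) * (1 + Em)"
  have c0: "0 \<le> c" unfolding c_def using T M Em0 by (intro add_nonneg_nonneg mult_nonneg_nonneg) auto
  obtain r \<eta>' where r: "strict_mono (r :: nat \<Rightarrow> nat)" and \<eta>': "\<eta>' \<in> space (prob_algebra borel)"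
    and conv: "\<And>g :: _ \<Rightarrow> real. continuous_on UNIV g \<Longrightarrow> bounded (range g) \<Longrightarrow>
       (\<lambda>k. LINT z|\<eta> (r k). g z) \<longlonglongrightarrow> (LINT z|\<eta>'. g z)"
  proof (rule prokhorov[of \<eta>])
    fix d :: real assume d: "d > 0"
    \<comment> \<open>\<open>R\<close> makes the position part \<open>c / R\<close> of the tail
      bound at most \<open>d / 2\<close>, with \<open>c + 1\<close> in place of \<open>c\<close> to
      keep \<open>R\<close> positive; \<open>V\<close> makes the control part equal to
      \<open>d / 2\<close>.\<close>
    define R where "R = 2 * (c + 1) / d"
    define V where "V = sqrt (2 * Em / d)"
    have R: "R > 0" and V: "V > 0" unfolding R_def V_def using c0 d Em0 by auto
    have "c / R \<le> d / 2" unfolding R_def using c0 d by (simp add: divide_simps)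
    moreover have "Em / V\<^sup>2 = d / 2" unfolding V_def using d Em0 by simp
    ultimately have "measure (\<eta> k) {z. norm z > T + exp R + V} \<le> d" for k
      using plan_tail[OF p R0 R V Ek, of k] unfolding c_def[symmetric] by linarith
    then show "\<exists>R. \<forall>k. measure (\<eta> k) {z. norm z > R} \<le> d" by blast
  qed (use P in auto)
  have lsc: "integrable \<eta>' (\<lambda>z. (norm (snd (snd z)))\<^sup>2)" "plan_energy \<eta>' \<le> e"
    using young_energy_lsc[of "\<lambda>k. \<eta> (r k)", OF P(2) \<eta>' P(6) E(1) LIMSEQ_subseq_LIMSEQ[OF E(2) r, unfolded o_def] conv]
    by auto
  have Ee: "plan_energy \<eta>' \<le> Em" using lsc(2) unfolding Em_def by simp
  note M' = prob_algebra_borelD[OF \<eta>']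
  interpret \<eta>': prob_space \<eta>' by (rule M')
  have fm: "(fst :: real \<times> 'a \<times> (real ^ 'n) \<Rightarrow> real) \<in> borel_measurable borel"
    by (intro borel_measurable_continuous_onI continuous_on_fst continuous_on_id)
  have tm: "distr \<eta>' borel fst = uniform_measure lborel {0..T}"
  proof (rule prob_measure_eqI_C1c[OF _ uniform_prob])
    have fm': "fst \<in> borel_measurable \<eta>'" using fm measurable_cong_sets[OF M'(2) refl] by auto
    then show "distr \<eta>' borel fst \<in> space (prob_algebra borel)"
      by (simp add: space_prob_algebra \<eta>'.prob_space_distr)
    fix \<psi> :: "real \<Rightarrow> real" and G assume cc: "C1c_fun \<psi> G"
    have \<psi>m: "\<psi> \<in> borel_measurable borel" by (rule C1c_fun_measurable(1)[OF cc])
    obtain Bd where Bd: "Bd > 0" "\<And>x. \<bar>\<psi> x\<bar> \<le> Bd" "\<And>x. norm (G x) \<le> Bd" using C1c_fun_bounded[OF cc] by blast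
    have "(\<lambda>k. LINT z|\<eta> (r k). \<psi> (fst z)) \<longlonglongrightarrow> (LINT z|\<eta>'. \<psi> (fst z))"
    proof (rule conv)
      show "continuous_on UNIV (\<lambda>z :: real \<times> 'a \<times> (real ^ 'n). \<psi> (fst z))"
        by (intro continuous_on_compose2[OF C1_funD(3)[OF C1c_funD(1)[OF cc], of UNIV]] continuous_on_fst continuous_on_id) simp
      show "bounded (range (\<lambda>z :: real \<times> 'a \<times> (real ^ 'n). \<psi> (fst z)))"
        using Bd(2) by (auto simp: bounded_iff)
    qed
    moreover have "(LINT z|\<eta> (r k). \<psi> (fst z)) = (LINT t|uniform_measure lborel {0..T}. \<psi> t)" for k
    proof -
      have "fst \<in> borel_measurable (\<eta> (r k))"
        using fm measurable_cong_sets[OF prob_algebra_borelD(2)[OF P(2)] refl] by blast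
      then show ?thesis unfolding P(4)[of "r k", symmetric] by (subst integral_distr) (use \<psi>m in auto)
    qed
    ultimately have "(LINT t|uniform_measure lborel {0..T}. \<psi> t) = (LINT z|\<eta>'. \<psi> (fst z))"
      using LIMSEQ_unique[OF tendsto_const] by fastforce
    then show "(LINT t|distr \<eta>' borel fst. \<psi> t) = (LINT t|uniform_measure lborel {0..T}. \<psi> t)"
      by (subst integral_distr[OF fm']) (use \<psi>m in auto)
  qed
  have flux: "(\<lambda>k. flux_upto (\<eta> (r k)) G t) \<longlonglongrightarrow> flux_upto \<eta>' G t" if "C1c_fun \<psi> G" for \<psi> G t
    by (rule flux_upto_limit[of "\<lambda>k. \<eta> (r k)", OF P(2) \<eta>' P(6) lsc(1) Ek Ee P(4) tm conv that])
  define lim where "lim \<psi> G t = (LINT x|m0. \<psi> x) + flux_upto \<eta>' G t" for \<psi> G t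
  have T0: "0 \<in> {0..T}" "T \<in> {0..T}" using T by auto
  have to_lim: "(\<lambda>k. LINT x|\<mu> (r k) t. \<psi> x) \<longlonglongrightarrow> lim \<psi> G t"
    if t: "t \<in> {0..T}" and cc: "C1c_fun \<psi> G" for \<psi> G t
  proof -
    have "(\<lambda>k. (LINT x|\<mu> (r k) 0. \<psi> x) + flux_upto (\<eta> (r k)) G t) \<longlonglongrightarrow> lim \<psi> G t"
      unfolding lim_def
      using tendsto_add[OF LIMSEQ_subseq_LIMSEQ[OF m0(2)[OF cc] r] flux[OF cc]] by (simp add: o_def)
    then show ?thesis using plan_increment[OF p cc t] by (simp add: algebra_simps)
  qed
  have "\<exists>\<pi>\<in>space (prob_algebra borel). \<forall>\<psi> G. C1c_fun \<psi> G \<longrightarrow> (LINT x|\<pi>. \<psi> x) = lim \<psi> G t"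
    if t: "t \<in> {0..T}" for t
  proof -
    obtain s \<pi> where s: "strict_mono (s :: nat \<Rightarrow> nat)" "\<pi> \<in> space (prob_algebra borel)"
      and conv\<pi>: "\<And>g :: 'a \<Rightarrow> real. continuous_on UNIV g \<Longrightarrow> bounded (range g) \<Longrightarrow>
         (\<lambda>k. LINT x|\<mu> (r (s k)) t. g x) \<longlonglongrightarrow> (LINT x|\<pi>. g x)"
    proof (rule prokhorov[of "\<lambda>k. \<mu> (r k) t"])
      fix d :: real assume d: "d > 0"
      define R where "R = (c + 1) / d"
      have R: "R > 0" unfolding R_def using c0 d by simp
      have cR: "c / R \<le> d" unfolding R_def using c0 d by (simp add: divide_simps)
      have "measure (\<mu> k t) {x. norm x > exp R} \<le> d" for k
        using log_cutoff_tail[OF P(1)[OF t] R, of k] plan_log_cutoff[OF p R0 R t Ek, of k] cR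
        unfolding c_def[symmetric] by linarith
      then show "\<exists>R. \<forall>k. measure (\<mu> (r k) t) {x. norm x > R} \<le> d" by blast
    qed (use P(1)[OF t] in auto)
    show ?thesis
    proof (intro bexI[OF _ s(2)] allI impI)
      fix \<psi> :: "'a \<Rightarrow> real" and G assume cc: "C1c_fun \<psi> G"
      obtain Bd where Bd: "Bd > 0" "\<And>x. \<bar>\<psi> x\<bar> \<le> Bd" "\<And>x. norm (G x) \<le> Bd" using C1c_fun_bounded[OF cc] by blast
      have "(\<lambda>k. LINT x|\<mu> (r (s k)) t. \<psi> x) \<longlonglongrightarrow> (LINT x|\<pi>. \<psi> x)"
        by (rule conv\<pi>[OF C1_funD(3)[OF C1c_funD(1)[OF cc]]]) (use Bd(2) in \<open>auto simp: bounded_iff\<close>)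
      moreover have "(\<lambda>k. LINT x|\<mu> (r (s k)) t. \<psi> x) \<longlonglongrightarrow> lim \<psi> G t"
        using LIMSEQ_subseq_LIMSEQ[OF to_lim[OF t cc] s(1)] by (simp add: o_def)
      ultimately show "(LINT x|\<pi>. \<psi> x) = lim \<psi> G t" by (rule LIMSEQ_unique)
    qed
  qed
  then obtain \<pi> where \<pi>: "\<And>t. t \<in> {0..T} \<Longrightarrow> \<pi> t \<in> space (prob_algebra borel)"
    "\<And>t \<psi> G. t \<in> {0..T} \<Longrightarrow> C1c_fun \<psi> G \<Longrightarrow> (LINT x|\<pi> t. \<psi> x) = lim \<psi> G t"
    by metis
  \<comment> \<open>Overwriting the two end values yields the prescribed endpoints literally. The
    test integrals are still given by \<open>lim\<close>, as the endpoint hypotheses show, so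
    continuity in time survives.\<close>
  define \<mu>' where "\<mu>' = \<pi>(0 := m0, T := mT)"
  have end0: "\<mu>' 0 = m0" and endT: "\<mu>' T = mT" unfolding \<mu>'_def using T by auto
  have \<mu>'p: "\<mu>' t \<in> space (prob_algebra borel)" if "t \<in> {0..T}" for t
    unfolding \<mu>'_def using \<pi>(1)[OF that] m0(1) mT(1) by auto
  have \<mu>'l: "(LINT x|\<mu>' t. \<psi> x) = lim \<psi> G t" if t: "t \<in> {0..T}" and cc: "C1c_fun \<psi> G" for t \<psi> G
  proof -
    consider "t = 0" | "t = T" | "t \<noteq> 0" "t \<noteq> T" by blast
    then show ?thesis
    proof cases
      case 1
      then show ?thesis
        using LIMSEQ_unique[OF to_lim[OF T0(1) cc] LIMSEQ_subseq_LIMSEQ[OF m0(2)[OF cc] r, unfolded o_def]] end0 by simp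
    next
      case 2
      then show ?thesis
        using LIMSEQ_unique[OF to_lim[OF T0(2) cc] LIMSEQ_subseq_LIMSEQ[OF mT(2)[OF cc] r, unfolded o_def]] endT by simp
    next
      case 3
      then show ?thesis unfolding \<mu>'_def using \<pi>(2)[OF t cc] by simp
    qed
  qed
  have \<mu>'c: "continuous_on {0..T} (\<lambda>t. LINT x|\<mu>' t. \<psi> x)" if cc: "C1c_fun \<psi> G" for \<psi> G
  proof -
    have "continuous_on {0..T} (\<lambda>t. lim \<psi> G t)"
      unfolding lim_def
      by (intro continuous_on_add continuous_on_const continuous_on_subset[OF flux_upto_continuous[OF \<eta>' lsc(1) tm cc]]) simp
    then show ?thesis by (subst continuous_on_cong[OF refl \<mu>'l[OF _ cc]]) auto
  qed
  have "plan T F \<mu>' \<eta>'"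
    unfolding plan_def
  proof (intro conjI allI impI ballI)
    show "\<mu>' t \<in> space (prob_algebra borel)" if "t \<in> {0..T}" for t by (rule \<mu>'p[OF that])
    show "continuous_on {0..T} (\<lambda>t. LINT x|\<mu>' t. \<psi> x)" if "C1c_fun \<psi> G" for \<psi> G by (rule \<mu>'c[OF that])
    fix a :: "real \<Rightarrow> real" and \<psi> :: "'a \<Rightarrow> real" and G
    assume a: "continuous_on UNIV a" "bounded (range a)" and cc: "C1c_fun \<psi> G"
    obtain A where A: "A > 0" "\<And>t. \<bar>a t\<bar> \<le> A" using a(2) unfolding bounded_pos by auto
    obtain Bd where Bd: "Bd > 0" "\<And>x. \<bar>\<psi> x\<bar> \<le> Bd" "\<And>x. norm (G x) \<le> Bd" using C1c_fun_bounded[OF cc] by blast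
    have "(\<lambda>k. T * (LINT z|\<eta> (r k). a (fst z) * \<psi> (fst (snd z)))) \<longlonglongrightarrow> T * (LINT z|\<eta>'. a (fst z) * \<psi> (fst (snd z)))"
    proof (intro tendsto_mult tendsto_const conv)
      show "continuous_on UNIV (\<lambda>z :: real \<times> 'a \<times> (real ^ 'n). a (fst z) * \<psi> (fst (snd z)))"
        by (intro continuous_on_mult continuous_on_compose2[OF a(1)]
            continuous_on_compose2[OF C1_funD(3)[OF C1c_funD(1)[OF cc], of UNIV]]
            continuous_on_fst continuous_on_snd continuous_on_id) auto
      show "bounded (range (\<lambda>z :: real \<times> 'a \<times> (real ^ 'n). a (fst z) * \<psi> (fst (snd z))))"
        unfolding bounded_iff
        by (rule exI[of _ "A * Bd"]) (use A Bd in \<open>auto simp: abs_mult intro!: mult_mono\<close>)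
    qed
    moreover have "(\<lambda>k. T * (LINT z|\<eta> (r k). a (fst z) * \<psi> (fst (snd z))))
        \<longlonglongrightarrow> (LINT t:{0..T}|lborel. a t * (LINT x|\<mu>' t. \<psi> x))"
      unfolding P(5)[OF a cc] set_lebesgue_integral_def
    proof (rule integral_dominated_convergence[of _ _ _ "\<lambda>t. indicator {0..T} t * (A * Bd)"])
      have si: "set_integrable lborel {0..T} (\<lambda>t. a t * (LINT x|N t. \<psi> x))"
        if "continuous_on {0..T} (\<lambda>t. LINT x|N t. \<psi> x)" for N
        by (intro borel_integrable_atLeastAtMost' continuous_on_mult continuous_on_subset[OF a(1)] that) simp
      show "(\<lambda>t. indicator {0..T} t *\<^sub>R (a t * (LINT x|\<mu>' t. \<psi> x))) \<in> borel_measurable lborel"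
        using si[OF \<mu>'c[OF cc]] unfolding set_integrable_def by (rule borel_measurable_integrable)
      show "(\<lambda>t. indicator {0..T} t *\<^sub>R (a t * (LINT x|\<mu> (r k) t. \<psi> x))) \<in> borel_measurable lborel" for k
        using si[OF P(3)[OF cc]] unfolding set_integrable_def by (rule borel_measurable_integrable)
      show "integrable lborel (\<lambda>t. indicator {0..T} t * (A * Bd))"
        by (intro integrable_mult_left) (simp add: integrable_indicator_iff emeasure_lborel_Icc_eq)
      show "AE t in lborel. (\<lambda>k. indicator {0..T} t *\<^sub>R (a t * (LINT x|\<mu> (r k) t. \<psi> x)))
          \<longlonglongrightarrow> indicator {0..T} t *\<^sub>R (a t * (LINT x|\<mu>' t. \<psi> x))"
      proof (rule AE_I2)
        fix t :: real
        show "(\<lambda>k. indicator {0..T} t *\<^sub>R (a t * (LINT x|\<mu> (r k) t. \<psi> x)))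
          \<longlonglongrightarrow> indicator {0..T} t *\<^sub>R (a t * (LINT x|\<mu>' t. \<psi> x))"
        proof (cases "t \<in> {0..T}")
          case True
          then show ?thesis
            using to_lim[OF True cc] \<mu>'l[OF True cc] by (intro tendsto_scaleR tendsto_mult tendsto_const) simp
        qed simp
      qed
      show "AE t in lborel. norm (indicator {0..T} t *\<^sub>R (a t * (LINT x|\<mu> (r k) t. \<psi> x))) \<le> indicator {0..T} t * (A * Bd)" for k
      proof (rule AE_I2)
        fix t :: real
        show "norm (indicator {0..T} t *\<^sub>R (a t * (LINT x|\<mu> (r k) t. \<psi> x))) \<le> indicator {0..T} t * (A * Bd)"
        proof (cases "t \<in> {0..T}")
          case True
          note Mk = prob_algebra_borelD[OF P(1)[OF True, of "r k"]]
          interpret prob_space "\<mu> (r k) t" by (rule Mk)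
          have "\<psi> \<in> borel_measurable (\<mu> (r k) t)"
            using C1c_fun_measurable(1)[OF cc] measurable_cong_sets[OF Mk(2) refl] by blast
          then have i: "integrable (\<mu> (r k) t) \<psi>"
            by (intro integrable_const_bound[of _ Bd]) (use Bd in auto)
          have "\<bar>LINT x|\<mu> (r k) t. \<psi> x\<bar> \<le> (LINT x|\<mu> (r k) t. Bd)"
            by (rule order_trans[OF integral_abs_bound integral_mono]) (use i Bd in auto)
          then have "\<bar>LINT x|\<mu> (r k) t. \<psi> x\<bar> \<le> Bd" by (simp add: prob_space)
          then have "\<bar>a t\<bar> * \<bar>LINT x|\<mu> (r k) t. \<psi> x\<bar> \<le> A * Bd" by (intro mult_mono A) (use A in auto)
          then show ?thesis using True by (simp add: abs_mult)
        qed simp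
      qed
    qed
    ultimately show "T * (LINT z|\<eta>'. a (fst z) * \<psi> (fst (snd z))) = (LINT t:{0..T}|lborel. a t * (LINT x|\<mu>' t. \<psi> x))"
      by (rule LIMSEQ_unique)
  next
    fix \<phi> :: "real \<times> 'a \<Rightarrow> real" and A and G :: "real \<times> 'a \<Rightarrow> 'a"
    assume ph: "C1T_fun T \<phi> A G"
    have Ac: "continuous_on UNIV A" and Gc: "continuous_on UNIV G"
      using ph unfolding C1T_fun_def by blast+
    obtain A1 where A1: "A1 > 0" "\<And>z. norm (A z) \<le> A1"
      using ph unfolding C1T_fun_def bounded_pos by (metis rangeI)
    obtain B1 where B1: "B1 > 0" "\<And>z. norm (G z) \<le> B1"
      using ph unfolding C1T_fun_def bounded_pos by (metis rangeI)
    obtain R where R: "\<And>z. norm (snd z) > R \<Longrightarrow> G z = 0"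
      using ph unfolding C1T_fun_def by metis
    define K where "K = A1 + B1 * (M * real CARD('n) * (max R 0 + 1))"
    have K1: "0 \<le> B1 * (M * real CARD('n) * (max R 0 + 1))" using B1 M by simp
    let ?h = "\<lambda>z :: real \<times> 'a \<times> (real ^ 'n). A (fst z, fst (snd z)) + G (fst z, fst (snd z)) \<bullet> ctrl F (fst (snd z)) (snd (snd z))"
    have "(\<lambda>k. LINT z|\<eta> (r k). ?h z) \<longlonglongrightarrow> (LINT z|\<eta>'. ?h z)"
    proof (rule young_linear_growth_limit[of "\<lambda>k. \<eta> (r k)", OF P(2) \<eta>' P(6) lsc(1) Ek Ee conv])
      have pc: "continuous_on UNIV (\<lambda>z :: real \<times> 'a \<times> (real ^ 'n). (fst z, fst (snd z)))"
        by (intro continuous_on_Pair continuous_on_fst continuous_on_snd continuous_on_id)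
      show "continuous_on UNIV ?h"
        by (intro continuous_on_add continuous_on_inner continuous_on_compose2[OF Ac pc] continuous_on_compose2[OF Gc pc]
            ctrl_continuous continuous_on_fst continuous_on_snd continuous_on_id) auto
      show "\<bar>?h z\<bar> \<le> K * (1 + norm (snd (snd z)))" for z
      proof -
        have G0: "G (fst z, fst (snd z)) = 0" if "norm (snd (fst z, fst (snd z))) > max R 0" using R that by simp
        have "\<bar>G (fst z, fst (snd z)) \<bullet> ctrl F (snd (fst z, fst (snd z))) (snd (snd z))\<bar>
            \<le> B1 * (M * real CARD('n) * (max R 0 + 1)) * norm (snd (snd z))"
          by (rule flux_bound[where G = G and z = "(fst z, fst (snd z))", OF B1(2) G0]) (use B1 in auto)
        then have "\<bar>?h z\<bar> \<le> A1 + B1 * (M * real CARD('n) * (max R 0 + 1)) * norm (snd (snd z))"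
          using A1(2)[of "(fst z, fst (snd z))"] unfolding real_norm_def snd_conv by linarith
        also have "\<dots> \<le> K * (1 + norm (snd (snd z)))"
          unfolding K_def using A1(1) K1 mult_nonneg_nonneg[OF less_imp_le[OF A1(1)] norm_ge_zero[of "snd (snd z)"]]
          by (simp only: distrib_left distrib_right mult_1_right mult_1_left)
        finally show ?thesis .
      qed
      show "K \<ge> 0" unfolding K_def using A1(1) K1 by simp
    qed
    then have "(\<lambda>k. T * (LINT z|\<eta> (r k). ?h z)) \<longlonglongrightarrow> T * (LINT z|\<eta>'. ?h z)" by (intro tendsto_mult tendsto_const)
    moreover have "(\<lambda>k. T * (LINT z|\<eta> (r k). ?h z)) \<longlonglongrightarrow> (LINT x|mT. \<phi> (T, x)) - (LINT x|m0. \<phi> (0, x))"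
      unfolding P(7)[OF ph]
      by (intro tendsto_diff LIMSEQ_subseq_LIMSEQ[OF mT(2)[OF C1T_slice[OF ph T0(2)]] r, unfolded o_def]
          LIMSEQ_subseq_LIMSEQ[OF m0(2)[OF C1T_slice[OF ph T0(1)]] r, unfolded o_def])
    ultimately show "T * (LINT z|\<eta>'. ?h z) = (LINT x|\<mu>' T. \<phi> (T, x)) - (LINT x|\<mu>' 0. \<phi> (0, x))"
      unfolding end0 endT by (rule LIMSEQ_unique)
  qed (fact \<eta>' tm lsc(1))+
  then show ?thesis using that end0 endT lsc(2) by blast
qed

end

subsection \<open>Plans and admissible pairs\<close>

lemma strip_derivative_unique:
  fixes f :: "real \<times> 'a::euclidean_space \<Rightarrow> 'b::real_normed_vector"
  assumes T: "T > 0" and z: "z \<in> {0..T} \<times> UNIV"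
    and "(f has_derivative f') (at z within {0..T} \<times> UNIV)" "(f has_derivative f'') (at z within {0..T} \<times> UNIV)"
  shows "f' = f''"
proof (rule frechet_derivative_unique_within[OF assms(3,4)])
  fix i :: "real \<times> 'a" and e :: real assume i: "i \<in> Basis" and e: "e > 0"
  \<comment> \<open>In the time direction one steps forward, except at the final time, where only a
    backward step remains in the strip. This is how uniqueness survives with one-sided
    derivatives.\<close>
  define c where "c = (if fst z < T then min (e / 2) (T - fst z) else - min (e / 2) T)"
  have t: "0 \<le> fst z" "fst z \<le> T" using z by auto
  have c: "0 < \<bar>c\<bar>" "\<bar>c\<bar> < e" "0 \<le> fst z + c" "fst z + c \<le> T"
    unfolding c_def using t T e by (auto simp: min_def)
  have "fst i = 0 \<or> fst i = 1" using i by (auto simp: Basis_prod_def)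
  then have "z + c *\<^sub>R i \<in> {0..T} \<times> UNIV"
    using c t by (cases z, cases i) auto
  then show "\<exists>d. 0 < \<bar>d\<bar> \<and> \<bar>d\<bar> < e \<and> z + d *\<^sub>R i \<in> {0..T} \<times> UNIV"
    using c(1,2) by (intro exI[of _ c] conjI)
qed

lemma C1T_imp_C1c_test:
  assumes T: "T > 0" and ph: "C1T_fun T \<phi> A G"
  shows "C1c_test_function T \<phi>"
proof -
  let ?S = "{0..T} \<times> (UNIV :: 'a set)"
  have d: "(\<phi> has_derivative (\<lambda>w. A z * fst w + G z \<bullet> snd w)) (at z within ?S)" if "z \<in> ?S" for z
    using ph that unfolding C1T_fun_def by blast
  have Ac: "continuous_on ?S A" and Gc: "continuous_on ?S G"
    using ph unfolding C1T_fun_def by (auto intro: continuous_on_subset)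
  obtain R where R: "\<And>z. norm (snd z) > R \<Longrightarrow> fst z \<in> {0..T} \<Longrightarrow> \<phi> z = 0"
    using ph unfolding C1T_fun_def by blast
  have fd: "frechet_derivative \<phi> (at z within ?S) = (\<lambda>w. A z * fst w + G z \<bullet> snd w)" if "z \<in> ?S" for z
  proof -
    have "\<phi> differentiable (at z within ?S)" using d[OF that] unfolding differentiable_def by blast
    then have "(\<phi> has_derivative frechet_derivative \<phi> (at z within ?S)) (at z within ?S)"
      by (rule frechet_derivative_works[THEN iffD1])
    from strip_derivative_unique[OF T that this d[OF that]] show ?thesis .
  qed
  have "Ck_on 1 ?S \<phi>"
  proof -
    have "continuous_on ?S (\<lambda>z. frechet_derivative \<phi> (at z within ?S) v)" for v
    proof -
      have "continuous_on ?S (\<lambda>z. A z * fst v + G z \<bullet> snd v)"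
        by (intro continuous_on_add continuous_on_mult continuous_on_inner continuous_on_const Ac Gc)
      then show ?thesis by (rule continuous_on_eq) (simp add: fd)
    qed
    moreover have "\<forall>z\<in>?S. \<phi> differentiable (at z within ?S)" using d unfolding differentiable_def by blast
    ultimately show ?thesis by simp
  qed
  moreover have "compact (closure {z \<in> ?S. \<phi> z \<noteq> 0})"
  proof -
    have sub: "{z \<in> ?S. \<phi> z \<noteq> 0} \<subseteq> {0..T} \<times> cball 0 R"
    proof
      fix z assume "z \<in> {z \<in> ?S. \<phi> z \<noteq> 0}"
      then have "fst z \<in> {0..T}" "\<not> norm (snd z) > R" using R[of z] by auto
      then show "z \<in> {0..T} \<times> cball 0 R" by (cases z) auto
    qed
    have "compact ({0..T} \<times> cball (0 :: 'a) R)" by (intro compact_Times) auto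
    then have "bounded {z \<in> ?S. \<phi> z \<noteq> 0}" using sub compact_imp_bounded bounded_subset by blast
    then show ?thesis by (simp add: compact_closure)
  qed
  ultimately show ?thesis unfolding C1c_test_function_def by blast
qed

text \<open>The partial derivatives on the strip are extended by freezing them at the nearest time
  in [0,T]; the components of the derivative in the time direction and along the spatial basis give
  \<open>A\<close> and \<open>G\<close>.\<close>

lemma C1c_test_imp_C1T:
  fixes \<phi> :: "real \<times> 'a::euclidean_space \<Rightarrow> real"
  assumes T: "T > 0" and ph: "C1c_test_function T \<phi>"
  obtains A G where "C1T_fun T \<phi> A G"
proof -
  let ?S = "{0..T} \<times> (UNIV :: 'a set)"
  define D where "D z = frechet_derivative \<phi> (at z within ?S)" for z
  have Ck: "Ck_on (Suc 0) ?S \<phi>" and cs: "compact (closure {z \<in> ?S. \<phi> z \<noteq> 0})"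
    using ph unfolding C1c_test_function_def by auto
  have diff: "\<phi> differentiable (at z within ?S)" if "z \<in> ?S" for z using Ck that by auto
  have d: "(\<phi> has_derivative D z) (at z within ?S)" if "z \<in> ?S" for z
    unfolding D_def using frechet_derivative_works[THEN iffD1, OF diff[OF that]] .
  have Dc: "continuous_on ?S (\<lambda>z. D z v)" for v
    using Ck[unfolded Ck_on.simps] unfolding D_def by blast
  have "bounded {z \<in> ?S. \<phi> z \<noteq> 0}"
    using cs compact_imp_bounded bounded_subset closure_subset by blast
  then obtain R where R: "\<And>z. z \<in> ?S \<Longrightarrow> \<phi> z \<noteq> 0 \<Longrightarrow> norm z \<le> R" unfolding bounded_iff by blast
  have R': "\<phi> z = 0" if "z \<in> ?S" "norm (snd z) > R" for z
  proof (rule ccontr)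
    assume "\<phi> z \<noteq> 0"
    then have "norm z \<le> R" using R that(1) by blast
    moreover have "norm (snd z) \<le> norm (fst z, snd z)" by (rule norm_snd_le)
    ultimately show False using that(2) by simp
  qed
  have D0: "D z v = 0" if z: "z \<in> ?S" "norm (snd z) > R" for z v
  proof -
    have "open {w :: real \<times> 'a. norm (snd w) > R}"
      by (intro open_Collect_less continuous_on_const continuous_on_norm continuous_on_snd continuous_on_id)
    then obtain e where e: "e > 0" "\<And>w. dist w z < e \<Longrightarrow> norm (snd w) > R"
      unfolding open_dist using z(2) by blast
    have "((\<lambda>w. 0) has_derivative D z) (at z within ?S)"
      by (rule has_derivative_transform_within[OF d[OF z(1)] e(1) z(1)]) (use e R' in auto)
    from strip_derivative_unique[OF T z(1) this has_derivative_const] show ?thesis by simp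
  qed
  define cl where "cl z = (max 0 (min T (fst z)), snd z :: 'a)" for z
  have clS: "cl z \<in> ?S" and cl_id: "z \<in> ?S \<Longrightarrow> cl z = z" and cl_snd: "snd (cl z) = snd z" for z
    unfolding cl_def using T by (auto simp: prod_eq_iff)
  have clc: "continuous_on UNIV cl"
    unfolding cl_def by (intro continuous_on_Pair continuous_on_max continuous_on_min continuous_on_const continuous_on_fst continuous_on_snd continuous_on_id)
  have Dclc: "continuous_on UNIV (\<lambda>z. D (cl z) v)" for v
    by (rule continuous_on_compose2[OF Dc clc]) (rule image_subsetI, rule clS)
  define A where "A z = D (cl z) (1, 0)" for z
  define G where "G z = (\<Sum>b\<in>Basis. D (cl z) (0, b) *\<^sub>R b)" for z
  have Ac: "continuous_on UNIV A" unfolding A_def by (rule Dclc)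
  have Gc: "continuous_on UNIV G"
    unfolding G_def by (intro continuous_on_sum continuous_on_scaleR Dclc continuous_on_const)
  have rangeb: "bounded (range H)"
    if Hc: "continuous_on UNIV H" and Hcl: "\<And>z. H z = H (cl z)" and H0: "\<And>z. norm (snd z) > R \<Longrightarrow> H z = 0"
    for H :: "real \<times> 'a \<Rightarrow> 'c::real_normed_vector"
  proof -
    have "compact (H ` ({0..T} \<times> cball 0 R))"
      by (intro compact_continuous_image continuous_on_subset[OF Hc] compact_Times) auto
    then have "bounded (insert 0 (H ` ({0..T} \<times> cball 0 R)))"
      by (simp add: compact_imp_bounded)
    moreover have "range H \<subseteq> insert 0 (H ` ({0..T} \<times> cball 0 R))"
    proof clarify
      fix t x assume h: "H (t, x) \<notin> H ` ({0..T} \<times> cball 0 R)"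
      have "cl (t, x) \<notin> {0..T} \<times> cball 0 R"
        using h Hcl[of "(t, x)"] by force
      then have "norm x > R" using clS[of "(t, x)"] unfolding cl_def by auto
      then show "H (t, x) = 0" using H0 by simp
    qed
    ultimately show ?thesis by (rule bounded_subset)
  qed
  have clcl: "cl (cl z) = cl z" for z using cl_id[OF clS] .
  have A0: "A z = 0" and G0: "G z = 0" if "norm (snd z) > R" for z
    unfolding A_def G_def using D0[OF clS] cl_snd that by simp_all
  have "C1T_fun T \<phi> A G"
    unfolding C1T_fun_def
  proof (intro conjI ballI)
    fix z assume z: "z \<in> ?S"
    interpret D: bounded_linear "D z" by (rule has_derivative_bounded_linear[OF d[OF z]])
    have "D z w = A z * fst w + G z \<bullet> snd w" for w
    proof -
      have "w = fst w *\<^sub>R (1, 0) + (\<Sum>b\<in>Basis. (snd w \<bullet> b) *\<^sub>R (0, b))"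
      proof -
        have "(\<Sum>b\<in>Basis. (snd w \<bullet> b) *\<^sub>R (0 :: real, b)) = (0, \<Sum>b\<in>Basis. (snd w \<bullet> b) *\<^sub>R b)"
          by (simp add: prod_eq_iff fst_sum snd_sum)
        then show ?thesis by (simp add: euclidean_representation prod_eq_iff)
      qed
      then have "D z w = D z (fst w *\<^sub>R (1, 0) + (\<Sum>b\<in>Basis. (snd w \<bullet> b) *\<^sub>R (0, b)))" by simp
      also have "\<dots> = fst w * D z (1, 0) + (\<Sum>b\<in>Basis. (snd w \<bullet> b) * D z (0, b))"
        by (simp only: D.add D.sum D.scaleR real_scaleR_def)
      also have "\<dots> = A z * fst w + G z \<bullet> snd w"
        unfolding A_def G_def cl_id[OF z] 
          by (simp add: inner_sum_left mult.commute inner_commute[of "snd w"])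
      finally show ?thesis .
    qed
    then have "D z = (\<lambda>w. A z * fst w + G z \<bullet> snd w)" by auto
    then show "(\<phi> has_derivative (\<lambda>w. A z * fst w + G z \<bullet> snd w)) (at z within ?S)" using d[OF z] by simp
  next
    show "bounded (range A)" by (rule rangeb[OF Ac _ A0]) (simp_all add: A_def clcl)
    show "bounded (range G)" by (rule rangeb[OF Gc _ G0]) (simp_all add: G_def clcl)
    show "\<exists>R. \<forall>z. R < norm (snd z) \<longrightarrow> A z = 0 \<and> G z = 0 \<and> (fst z \<in> {0..T} \<longrightarrow> \<phi> z = 0)"
    proof (intro exI[of _ R] allI impI conjI)
      fix z :: "real \<times> 'a" assume z: "R < norm (snd z)"
      show "A z = 0" "G z = 0" by (fact A0[OF z] G0[OF z])+
      assume "fst z \<in> {0..T}"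
      then show "\<phi> z = 0" using R'[of z] z by (cases z) auto
    qed
  qed (fact Ac Gc)+
  then show ?thesis by (rule that)
qed

lemma transport_integrand_eq:
  fixes \<phi> :: "real \<times> 'a::euclidean_space \<Rightarrow> real"
  assumes T: "T > 0" and ph: "C1T_fun T \<phi> A G" and t: "t \<in> {0..T}"
  shows "transport_integrand T H u \<phi> t x = A (t, x) + G (t, x) \<bullet> H x (u t x)"
proof -
  let ?S = "{0..T} \<times> (UNIV :: 'a set)"
  have d: "(\<phi> has_derivative (\<lambda>w. A z * fst w + G z \<bullet> snd w)) (at z within ?S)" if "z \<in> ?S" for z
    using ph that unfolding C1T_fun_def by blast
  have "((\<lambda>s. \<phi> (s, x)) has_vector_derivative A (t, x)) (at t within {0..T})"
  proof -
    have "((\<lambda>s. (s, x)) has_derivative (\<lambda>h. (h, 0))) (at t within {0..T})"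
      by (auto intro!: derivative_eq_intros)
    moreover have "(\<phi> has_derivative (\<lambda>w. A (t, x) * fst w + G (t, x) \<bullet> snd w)) (at (t, x) within (\<lambda>s. (s, x)) ` {0..T})"
      by (rule has_derivative_subset[OF d]) (use t in auto)
    ultimately have "((\<lambda>s. \<phi> (s, x)) has_derivative (\<lambda>h. A (t, x) * h)) (at t within {0..T})"
      using has_derivative_in_compose[of "\<lambda>s. (s, x)" "\<lambda>h. (h, 0)" t "{0..T}" \<phi>] by fastforce
    then show ?thesis unfolding has_vector_derivative_def by (simp add: mult.commute)
  qed
  then have 1: "vector_derivative (\<lambda>s. \<phi> (s, x)) (at t within {0..T}) = A (t, x)"
    by (rule vector_derivative_within_closed_interval[OF T t])
  have "((\<lambda>y. \<phi> (t, y)) has_derivative (\<lambda>w. G (t, x) \<bullet> w)) (at x)"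
    by (rule C1_funD(1)[OF C1c_funD(1)[OF C1T_slice[OF ph t]]])
  from frechet_derivative_at[OF this]
  have 2: "frechet_derivative (\<lambda>y. \<phi> (t, y)) (at x) (H x (u t x)) = G (t, x) \<bullet> H x (u t x)"
    by (metis)
  show ?thesis unfolding transport_integrand_def 1 2 ..
qed

text \<open>Continuity is tested against compactly supported C1 functions, the form in which limits
  of plans deliver it. For curves of probability measures this is equivalent to narrow continuity,
  by the two lemmas that follow.\<close>

definition curve_ok :: "real \<Rightarrow> (real \<Rightarrow> 'a::euclidean_space measure) \<Rightarrow> bool" where
  "curve_ok T \<mu> \<longleftrightarrow> T > 0 \<and> (\<forall>t\<in>{0..T}. \<mu> t \<in> space (prob_algebra borel)) \<and>
     (\<forall>\<psi> G. C1c_fun \<psi> G \<longrightarrow> continuous_on {0..T} (\<lambda>t. LINT x|\<mu> t. \<psi> x))"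

lemma curve_ok_narrow:
  assumes "curve_ok T \<mu>"
  shows "continuous_map (top_of_set {0..T}) narrow_topology \<mu>"
  unfolding continuous_map_narrow_topology_iff
proof (intro conjI ballI allI)
  show P: "\<mu> t \<in> space (prob_algebra borel)" if "t \<in> {0..T}" for t
    using assms that unfolding curve_ok_def by blast
  fix g :: "'a \<Rightarrow>\<^sub>C real"
  show "continuous_on {0..T} (\<lambda>t. LINT x|\<mu> t. apply_bcontfun g x)"
    unfolding continuous_on_sequentially
  proof (intro ballI allI impI)
    fix s and t assume t: "t \<in> {0..T}" and s: "(\<forall>n. s n \<in> {0..T}) \<and> s \<longlonglongrightarrow> t"
    have "(\<lambda>n. LINT x|\<mu> (s n). apply_bcontfun g x) \<longlonglongrightarrow> (LINT x|\<mu> t. apply_bcontfun g x)"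
    proof (rule narrow_if_vague_limit_prob)
      fix \<psi> :: "'a \<Rightarrow> real" and G assume "C1c_fun \<psi> G"
      then have "continuous_on {0..T} (\<lambda>t. LINT x|\<mu> t. \<psi> x)" using assms unfolding curve_ok_def by blast
      then show "(\<lambda>n. LINT x|\<mu> (s n). \<psi> x) \<longlonglongrightarrow> (LINT x|\<mu> t. \<psi> x)"
        using t s unfolding continuous_on_sequentially by (auto simp: o_def)
    next
      show "bounded (range (apply_bcontfun g))" by (rule bounded_apply_bcontfun)
    qed (use P s t in auto)
    then show "((\<lambda>t. LINT x|\<mu> t. apply_bcontfun g x) \<circ> s) \<longlonglongrightarrow> (LINT x|\<mu> t. apply_bcontfun g x)"
      by (simp add: o_def)
  qed
qed

lemma narrow_curve_ok:
  fixes \<mu> :: "real \<Rightarrow> 'a::euclidean_space measure"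
  assumes T: "T > 0" and "continuous_map (top_of_set {0..T}) narrow_topology \<mu>"
  shows "curve_ok T \<mu>"
  unfolding curve_ok_def
proof (intro conjI ballI allI impI T)
  note n = assms(2)[unfolded continuous_map_narrow_topology_iff]
  show "\<mu> t \<in> space (prob_algebra borel)" if "t \<in> {0..T}" for t using n that by blast
  fix \<psi> :: "'a \<Rightarrow> real" and G assume c: "C1c_fun \<psi> G"
  obtain B where B: "B > 0" "\<And>x. \<bar>\<psi> x\<bar> \<le> B" "\<And>x. norm (G x) \<le> B" using C1c_fun_bounded[OF c] by blast
  have "\<psi> \<in> bcontfun"
    by (rule bcontfun_normI[OF C1_funD(3)[OF C1c_funD(1)[OF c]]]) (use B in auto)
  then have "apply_bcontfun (Bcontfun \<psi>) = \<psi>" by (rule Bcontfun_inverse)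
  then show "continuous_on {0..T} (\<lambda>t. LINT x|\<mu> t. \<psi> x)" using n by metis
qed

text \<open>Nothing is known about \<open>\<mu>\<close> outside [0,T]; freezing it at the end values
  produces a kernel on the whole line, to which the measurability theory of kernels applies.\<close>

definition clamped :: "real \<Rightarrow> (real \<Rightarrow> 'a measure) \<Rightarrow> real \<Rightarrow> 'a measure" where
  "clamped T \<mu> t = \<mu> (max 0 (min T t))"

text \<open>Measures of boxes are pointwise limits of integrals of C1 bumps, which depend
  continuously on the time, and boxes generate the Borel sets.\<close>

lemma clamped_kernel:
  assumes ok: "curve_ok T \<mu>"
  shows "clamped T \<mu> \<in> borel \<rightarrow>\<^sub>M prob_algebra (borel :: 'a::euclidean_space measure)"
proof (rule measurable_prob_algebra_generated[where G = "range (\<lambda>(a, b). box a b)" and \<Omega> = UNIV])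
  have T: "T > 0" using ok unfolding curve_ok_def by blast
  have P: "clamped T \<mu> t \<in> space (prob_algebra borel)" for t
    unfolding clamped_def using ok T unfolding curve_ok_def by auto
  show "sets (borel :: 'a measure) = sigma_sets UNIV (range (\<lambda>(a, b). box a b))" by (simp add: borel_eq_box)
  show "Int_stable (range (\<lambda>(a, b). box a b) :: 'a set set)" by (auto simp: Int_stable_def box_Int_box)
  show "prob_space (clamped T \<mu> t)" "sets (clamped T \<mu> t) = sets borel" for t
    using prob_algebra_borelD[OF P[of t]] by auto
  fix A :: "'a set" assume "A \<in> range (\<lambda>(a, b). box a b)"
  then obtain a b where A: "A = box a b" by auto
  have m: "(\<lambda>t. LINT x|clamped T \<mu> t. box_bump a b n x) \<in> borel_measurable borel" for n
  proof -
    obtain G where "C1c_fun (box_bump a b n) G" using C1c_box_bump by blast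
    then have "continuous_on {0..T} (\<lambda>t. LINT x|\<mu> t. box_bump a b n x)" using ok unfolding curve_ok_def by blast
    then have "continuous_on UNIV (\<lambda>t. LINT x|\<mu> (max 0 (min T t)). box_bump a b n x)"
      by (rule continuous_on_compose2) (use T in \<open>auto intro!: continuous_intros\<close>)
    then show ?thesis unfolding clamped_def by (rule borel_measurable_continuous_onI)
  qed
  have "(\<lambda>t. measure (clamped T \<mu> t) (box a b)) \<in> borel_measurable borel"
    by (rule borel_measurable_LIMSEQ_real[OF _ m]) (rule box_bump_integral_limit[OF P])
  moreover have "emeasure (clamped T \<mu> t) A = ennreal (measure (clamped T \<mu> t) (box a b))" for t
  proof -
    interpret prob_space "clamped T \<mu> t" by (rule prob_algebra_borelD[OF P])
    show ?thesis unfolding A by (rule emeasure_eq_measure)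
  qed
  ultimately show "(\<lambda>t. emeasure (clamped T \<mu> t) A) \<in> borel_measurable borel" by simp
qed auto

text \<open>The law of a uniformly distributed time together with a position drawn from the curve at
  that time, that is, Lebesgue measure on [0,T] coupled with \<open>\<mu> t\<close> and divided by
  \<open>T\<close>.\<close>

definition joint_law :: "real \<Rightarrow> (real \<Rightarrow> 'a::euclidean_space measure) \<Rightarrow> (real \<times> 'a) measure" where
  "joint_law T \<mu> = uniform_measure lborel {0..T} \<bind> (\<lambda>t. distr (clamped T \<mu> t) borel (Pair t))"

lemma joint_kernel:
  assumes ok: "curve_ok T \<mu>"
  shows "(\<lambda>t. distr (clamped T \<mu> t) borel (Pair t)) \<in> uniform_measure lborel {0..T} \<rightarrow>\<^sub>M subprob_algebra (borel :: (real \<times> 'a::euclidean_space) measure)"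
proof -
  have "(\<lambda>t. distr (clamped T \<mu> t) borel (Pair t)) \<in> borel \<rightarrow>\<^sub>M subprob_algebra (borel :: (real \<times> 'a) measure)"
    by (rule measurable_distr2[where M = borel])
       (use measurable_prob_algebraD[OF clamped_kernel[OF ok]] in \<open>auto simp: borel_prod\<close>)
  then show ?thesis by (simp add: measurable_cong_sets[of "uniform_measure lborel {0..T}" borel])
qed

lemma joint_law_prob:
  assumes ok: "curve_ok T \<mu>"
  shows "joint_law T \<mu> \<in> space (prob_algebra borel)"
proof -
  have T: "T > 0" using ok unfolding curve_ok_def by blast
  interpret U: prob_space "uniform_measure lborel {0..T}" by (rule prob_space_uniform_measure) (use T in auto)
  have "prob_space (distr (clamped T \<mu> t) borel (Pair t))" for t
  proof -
    have "clamped T \<mu> t \<in> space (prob_algebra borel)"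
      using measurable_space[OF clamped_kernel[OF ok], of t] by simp
    note C = prob_algebra_borelD[OF this]
    show ?thesis
      by (rule prob_space.prob_space_distr[OF C(1)]) (simp add: measurable_cong_sets[OF C(2) refl])
  qed
  then have "prob_space (joint_law T \<mu>)"
    unfolding joint_law_def by (intro U.prob_space_bind[OF _ joint_kernel[OF ok]] AE_I2)
  moreover have "sets (joint_law T \<mu>) = sets borel"
    unfolding joint_law_def by (rule sets_bind) auto
  ultimately show ?thesis by (simp add: space_prob_algebra)
qed

lemma nn_integral_joint_law:
  assumes ok: "curve_ok T \<mu>" and f: "f \<in> borel_measurable borel"
  shows "ennreal T * (\<integral>\<^sup>+z. f z \<partial>joint_law T \<mu>) = (\<integral>\<^sup>+t\<in>{0..T}. (\<integral>\<^sup>+x. f (t, x) \<partial>\<mu> t) \<partial>lborel)"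
    and "(\<lambda>t. \<integral>\<^sup>+x. f (t, x) \<partial>clamped T \<mu> t) \<in> borel_measurable borel"
proof -
  have T: "T > 0" using ok unfolding curve_ok_def by blast
  have C: "clamped T \<mu> t \<in> space (prob_algebra borel)" for t
    using measurable_space[OF clamped_kernel[OF ok], of t] by simp
  have d: "(\<integral>\<^sup>+z. f z \<partial>distr (clamped T \<mu> t) borel (Pair t)) = (\<integral>\<^sup>+x. f (t, x) \<partial>clamped T \<mu> t)" for t
    by (rule nn_integral_distr) (use f in \<open>simp_all add: measurable_cong_sets[OF prob_algebra_borelD(2)[OF C] refl]\<close>)
  have "(\<lambda>t. \<integral>\<^sup>+z. f z \<partial>distr (clamped T \<mu> t) borel (Pair t)) \<in> borel_measurable (uniform_measure lborel {0..T})"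
    by (rule measurable_compose[OF joint_kernel[OF ok] nn_integral_measurable_subprob_algebra[OF f]])
  then show m': "(\<lambda>t. \<integral>\<^sup>+x. f (t, x) \<partial>clamped T \<mu> t) \<in> borel_measurable borel"
    unfolding d by (simp add: measurable_cong_sets[of "uniform_measure lborel {0..T}" borel])
  have "(\<integral>\<^sup>+z. f z \<partial>joint_law T \<mu>) = (\<integral>\<^sup>+t. (\<integral>\<^sup>+x. f (t, x) \<partial>clamped T \<mu> t) \<partial>uniform_measure lborel {0..T})"
    unfolding joint_law_def nn_integral_bind[OF f joint_kernel[OF ok]] d ..
  also have "\<dots> = (\<integral>\<^sup>+t\<in>{0..T}. (\<integral>\<^sup>+x. f (t, x) \<partial>clamped T \<mu> t) \<partial>lborel) / emeasure lborel {0..T}"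
    by (rule nn_integral_uniform_measure) (use m' in auto)
  also have "emeasure lborel {0..T} = ennreal T" using T by simp
  also have "(\<integral>\<^sup>+t\<in>{0..T}. (\<integral>\<^sup>+x. f (t, x) \<partial>clamped T \<mu> t) \<partial>lborel) = (\<integral>\<^sup>+t\<in>{0..T}. (\<integral>\<^sup>+x. f (t, x) \<partial>\<mu> t) \<partial>lborel)"
    by (intro nn_integral_cong) (auto simp: clamped_def indicator_def)
  finally have e: "(\<integral>\<^sup>+z. f z \<partial>joint_law T \<mu>) = (\<integral>\<^sup>+t\<in>{0..T}. (\<integral>\<^sup>+x. f (t, x) \<partial>\<mu> t) \<partial>lborel) / ennreal T" .
  show "ennreal T * (\<integral>\<^sup>+z. f z \<partial>joint_law T \<mu>) = (\<integral>\<^sup>+t\<in>{0..T}. (\<integral>\<^sup>+x. f (t, x) \<partial>\<mu> t) \<partial>lborel)"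
    unfolding e ennreal_times_divide mult.commute[of "ennreal T"]
    by (rule mult_divide_eq_ennreal) (use T in auto)
qed

lemma integral_joint_law_nonneg:
  assumes ok: "curve_ok T \<mu>" and f: "f \<in> borel_measurable borel" "\<And>z. 0 \<le> f z" and i: "integrable (joint_law T \<mu>) f"
  shows "set_integrable lborel {0..T} (\<lambda>t. LINT x|\<mu> t. f (t, x))"
    and "(LINT t:{0..T}|lborel. (LINT x|\<mu> t. f (t, x))) = T * (LINT z|joint_law T \<mu>. f z)"
    and "AE t in lborel. t \<in> {0..T} \<longrightarrow> integrable (\<mu> t) (\<lambda>x. f (t, x))"
proof -
  have T: "T > 0" using ok unfolding curve_ok_def by blast
  have P: "\<mu> t \<in> space (prob_algebra borel)" if "t \<in> {0..T}" for t
    using ok that unfolding curve_ok_def by blast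
  define g where "g t = (\<integral>\<^sup>+x. ennreal (f (t, x)) \<partial>clamped T \<mu> t)" for t
  have fm: "(\<lambda>z. ennreal (f z)) \<in> borel_measurable borel" using f by simp
  have gm [measurable]: "g \<in> borel_measurable borel"
    unfolding g_def by (rule nn_integral_joint_law(2)[OF ok fm])
  have g\<mu>: "g t = (\<integral>\<^sup>+x. ennreal (f (t, x)) \<partial>\<mu> t)" if "t \<in> {0..T}" for t
    unfolding g_def clamped_def using that by simp
  have fin: "(\<integral>\<^sup>+z. ennreal (f z) \<partial>joint_law T \<mu>) = ennreal (LINT z|joint_law T \<mu>. f z)"
    by (rule nn_integral_eq_integral[OF i]) (use f in auto)
  have tot: "(\<integral>\<^sup>+t\<in>{0..T}. g t \<partial>lborel) = ennreal T * ennreal (LINT z|joint_law T \<mu>. f z)"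
    unfolding fin[symmetric] nn_integral_joint_law(1)[OF ok fm]
    by (intro nn_integral_cong) (auto simp: g\<mu> indicator_def)
  have fm': "(\<lambda>x. f (t, x)) \<in> borel_measurable (\<mu> t)" if "t \<in> {0..T}" for t
    using measurable_compose[OF _ f(1), of "Pair t" borel] by (simp add: measurable_cong_sets[OF prob_algebra_borelD(2)[OF P[OF that]] refl])
  have L: "(LINT x|\<mu> t. f (t, x)) = enn2real (g t)" if "t \<in> {0..T}" for t
    unfolding g\<mu>[OF that] by (rule integral_eq_nn_integral[OF fm'[OF that]]) (use f in auto)
  have ae: "AE t in lborel. g t * indicator {0..T} t \<noteq> \<infinity>"
    by (rule nn_integral_PInf_AE) (use tot in \<open>auto simp: ennreal_mult_eq_top_iff\<close>)
  show "AE t in lborel. t \<in> {0..T} \<longrightarrow> integrable (\<mu> t) (\<lambda>x. f (t, x))"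
    using ae
  proof (eventually_elim, intro impI)
    fix t assume "g t * indicator {0..T} t \<noteq> \<infinity>" and t: "t \<in> {0..T}"
    then have "g t < \<infinity>" by (simp add: less_top)
    then show "integrable (\<mu> t) (\<lambda>x. f (t, x))"
      unfolding g\<mu>[OF t] by (intro integrableI_nonneg fm'[OF t]) (use f in auto)
  qed
  have eq: "indicator {0..T} t *\<^sub>R (LINT x|\<mu> t. f (t, x)) = indicator {0..T} t * enn2real (g t)" for t
    using L by (auto simp: indicator_def)
  have nn: "(\<integral>\<^sup>+t. ennreal (indicator {0..T} t * enn2real (g t)) \<partial>lborel) = (\<integral>\<^sup>+t\<in>{0..T}. g t \<partial>lborel)"
  proof (rule nn_integral_cong_AE)
    show "AE t in lborel. ennreal (indicator {0..T} t * enn2real (g t)) = g t * indicator {0..T} t"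
      using ae by eventually_elim (auto simp: indicator_def less_top)
  qed
  have "integrable lborel (\<lambda>t. indicator {0..T} t * enn2real (g t))"
    by (rule integrableI_nonneg) (use nn tot in \<open>auto simp: ennreal_mult_less_top\<close>)
  then show "set_integrable lborel {0..T} (\<lambda>t. LINT x|\<mu> t. f (t, x))"
    unfolding set_integrable_def eq .
  have "(LINT t:{0..T}|lborel. (LINT x|\<mu> t. f (t, x))) = enn2real (\<integral>\<^sup>+t. ennreal (indicator {0..T} t * enn2real (g t)) \<partial>lborel)"
    unfolding set_lebesgue_integral_def eq by (rule integral_eq_nn_integral) auto
  also have "\<dots> = T * (LINT z|joint_law T \<mu>. f z)"
    unfolding nn tot using T f by (simp add: enn2real_mult)
  finally show "(LINT t:{0..T}|lborel. (LINT x|\<mu> t. f (t, x))) = T * (LINT z|joint_law T \<mu>. f z)" .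
qed

lemma integral_joint_law:
  assumes ok: "curve_ok T \<mu>" and i: "integrable (joint_law T \<mu>) f"
  shows "(LINT t:{0..T}|lborel. (LINT x|\<mu> t. f (t, x))) = T * (LINT z|joint_law T \<mu>. f z :: real)"
proof -
  have fm: "f \<in> borel_measurable borel"
    using borel_measurable_integrable[OF i] measurable_cong_sets[OF prob_algebra_borelD(2)[OF joint_law_prob[OF ok]] refl] by blast
  define p where "p z = max 0 (f z)" for z
  define n where "n z = max 0 (- f z)" for z
  have f: "f z = p z - n z" for z unfolding p_def n_def by auto
  have pi: "integrable (joint_law T \<mu>) p" and ni: "integrable (joint_law T \<mu>) n"
    unfolding p_def n_def using i by auto
  have pm: "p \<in> borel_measurable borel" "n \<in> borel_measurable borel" unfolding p_def n_def using fm by auto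
  have p0: "0 \<le> p z" "0 \<le> n z" for z unfolding p_def n_def by auto
  note Ip = integral_joint_law_nonneg[OF ok pm(1) p0(1) pi]
  note In = integral_joint_law_nonneg[OF ok pm(2) p0(2) ni]
  have "(LINT t:{0..T}|lborel. (LINT x|\<mu> t. f (t, x))) = (LINT t:{0..T}|lborel. (LINT x|\<mu> t. p (t, x)) - (LINT x|\<mu> t. n (t, x)))"
    unfolding set_lebesgue_integral_def
  proof (rule integral_cong_AE)
    have ae: "AE t in lborel. indicator {0..T} t *\<^sub>R (LINT x|\<mu> t. f (t, x)) = indicator {0..T} t *\<^sub>R ((LINT x|\<mu> t. p (t, x)) - (LINT x|\<mu> t. n (t, x)))"
      using Ip(3) In(3) by eventually_elim (auto simp: indicator_def f)
    then show "AE t in lborel. indicator {0..T} t *\<^sub>R (LINT x|\<mu> t. f (t, x)) = indicator {0..T} t *\<^sub>R ((LINT x|\<mu> t. p (t, x)) - (LINT x|\<mu> t. n (t, x)))" .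
    show "(\<lambda>t. indicator {0..T} t *\<^sub>R ((LINT x|\<mu> t. p (t, x)) - (LINT x|\<mu> t. n (t, x)))) \<in> borel_measurable lborel"
      using borel_measurable_diff[OF borel_measurable_integrable[OF Ip(1)[unfolded set_integrable_def]]
          borel_measurable_integrable[OF In(1)[unfolded set_integrable_def]]]
      by (simp add: algebra_simps)
    show "(\<lambda>t. indicator {0..T} t *\<^sub>R (LINT x|\<mu> t. f (t, x))) \<in> borel_measurable lborel"
    proof -
      define gp where "gp h t = enn2real (\<integral>\<^sup>+x. ennreal (h (t, x)) \<partial>clamped T \<mu> t)" for h t
      define ae where "ae t = (\<integral>\<^sup>+x. ennreal \<bar>f (t, x)\<bar> \<partial>clamped T \<mu> t)" for t
      have gpm: "gp h \<in> borel_measurable borel" if "h \<in> borel_measurable borel" for h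
        unfolding gp_def using nn_integral_joint_law(2)[OF ok, of "\<lambda>z. ennreal (h z)"] that by simp
      have [measurable]: "ae \<in> borel_measurable borel"
        unfolding ae_def using nn_integral_joint_law(2)[OF ok, of "\<lambda>z. ennreal \<bar>f z\<bar>"] fm by simp
      \<comment> \<open>At the exceptional times where the slice is not integrable, the inner
        integral is 0 by convention. The case distinction on \<open>ae t\<close> reproduces this
        value, which gives measurability in \<open>t\<close> at every time and not just almost
        everywhere.\<close>
      have eq: "indicator {0..T} t *\<^sub>R (LINT x|\<mu> t. f (t, x)) = indicator {0..T} t * (if ae t < \<infinity> then gp p t - gp n t else 0)" for t
      proof (cases "t \<in> {0..T}")
        case True
        have P: "\<mu> t \<in> space (prob_algebra borel)" using ok True unfolding curve_ok_def by blast
        have m: "(\<lambda>x. h (t, x)) \<in> borel_measurable (\<mu> t)" if "h \<in> borel_measurable borel" for h :: "real \<times> 'a \<Rightarrow> real"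
          using measurable_compose[OF _ that, of "Pair t" borel] by (simp add: measurable_cong_sets[OF prob_algebra_borelD(2)[OF P] refl])
        have cm: "clamped T \<mu> t = \<mu> t" unfolding clamped_def using True by simp
        have if_: "integrable (\<mu> t) (\<lambda>x. f (t, x)) \<longleftrightarrow> ae t < \<infinity>"
          unfolding integrable_iff_bounded ae_def cm using m[OF fm] by simp
        have hp: "(LINT x|\<mu> t. p (t, x)) = gp p t" "(LINT x|\<mu> t. n (t, x)) = gp n t"
          unfolding gp_def cm by (rule integral_eq_nn_integral; use m pm p0 in simp)+
        show ?thesis
        proof (cases "ae t < \<infinity>")
          case fin: True
          have ip: "integrable (\<mu> t) (\<lambda>x. p (t, x))" "integrable (\<mu> t) (\<lambda>x. n (t, x))"
            unfolding p_def n_def using if_ fin by auto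
          show ?thesis using fin hp ip by (simp add: f)
        next
          case False
          then show ?thesis using if_ by (simp add: not_integrable_integral_eq)
        qed
      qed simp
      have [measurable]: "gp p \<in> borel_measurable borel" "gp n \<in> borel_measurable borel"
        by (rule gpm[OF pm(1)], rule gpm[OF pm(2)])
      show ?thesis unfolding eq by measurable
    qed
  qed
  also have "\<dots> = (LINT t:{0..T}|lborel. (LINT x|\<mu> t. p (t, x))) - (LINT t:{0..T}|lborel. (LINT x|\<mu> t. n (t, x)))"
    by (rule set_integral_diff(2)[OF Ip(1) In(1)])
  also have "\<dots> = T * (LINT z|joint_law T \<mu>. f z)"
    unfolding Ip(2) In(2) using pi ni by (simp add: f algebra_simps)
  finally show ?thesis .
qed

text \<open>\<open>u\<close> is the conditional expectation of \<open>h\<close> given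
  \<open>\<pi>\<close>: the Radon-Nikodym derivative of the image of the measure with density
  \<open>h\<close> with respect to the image of \<open>\<eta>\<close>.\<close>

lemma conditional_density_nonneg:
  fixes \<eta> :: "'b::euclidean_space measure" and \<pi> :: "'b \<Rightarrow> 'c::euclidean_space"
  assumes \<eta>: "\<eta> \<in> space (prob_algebra borel)" and \<pi>: "\<pi> \<in> borel_measurable borel"
    and h: "integrable \<eta> h" "\<And>z. 0 \<le> (h z :: real)"
  shows "\<exists>u. u \<in> borel_measurable borel \<and> integrable (distr \<eta> borel \<pi>) u \<and>
    (\<forall>w. w \<in> borel_measurable borel \<longrightarrow> bounded (range w) \<longrightarrow>
      (LINT z|\<eta>. w (\<pi> z) * h z) = (LINT p|distr \<eta> borel \<pi>. w p * u p))"
proof -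
  note Mb = prob_algebra_borelD[OF \<eta>]
  interpret \<eta>: prob_space \<eta> by (rule Mb)
  note cs = measurable_cong_sets[OF Mb(2) refl]
  have \<pi>m: "\<pi> \<in> borel_measurable \<eta>" using \<pi> cs by auto
  define \<rho> where "\<rho> = distr \<eta> borel \<pi>"
  interpret \<rho>: prob_space \<rho> unfolding \<rho>_def by (rule \<eta>.prob_space_distr[OF \<pi>m])
  have hm: "h \<in> borel_measurable \<eta>" by (rule borel_measurable_integrable[OF h(1)])
  define D where "D = density \<eta> (\<lambda>z. ennreal (h z))"
  define N where "N = distr D borel \<pi>"
  have \<pi>D: "\<pi> \<in> borel_measurable D" unfolding D_def using \<pi>m by simp
  have "absolutely_continuous \<rho> N"
    unfolding absolutely_continuous_def
  proof
    fix A assume A: "A \<in> null_sets \<rho>"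
    then have As: "A \<in> sets borel" and "emeasure \<eta> (\<pi> -` A \<inter> space \<eta>) = 0"
      unfolding \<rho>_def by (auto simp: null_sets_def emeasure_distr[OF \<pi>m])
    then have "\<pi> -` A \<inter> space \<eta> \<in> null_sets \<eta>" using \<pi>m by (auto simp: null_sets_def)
    then have z: "emeasure D (\<pi> -` A \<inter> space \<eta>) = 0"
      using absolutely_continuousI_density[of "\<lambda>z. ennreal (h z)" \<eta>] hm
      unfolding D_def absolutely_continuous_def by (auto simp: null_sets_def)
    have "space D = space \<eta>" unfolding D_def by simp
    then have "emeasure N A = 0" unfolding N_def emeasure_distr[OF \<pi>D As] using z by simp
    moreover have "A \<in> sets N" unfolding N_def using As by simp
    ultimately show "A \<in> null_sets N" by (rule null_setsI)
  qed
  moreover have "sets N = sets \<rho>" unfolding N_def \<rho>_def by simp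
  ultimately obtain f where f: "f \<in> borel_measurable \<rho>" "density \<rho> f = N"
    using \<rho>.Radon_Nikodym by blast
  have tot: "(\<integral>\<^sup>+p. f p \<partial>\<rho>) = ennreal (LINT z|\<eta>. h z)"
  proof -
    have "(\<integral>\<^sup>+p. f p \<partial>\<rho>) = emeasure N (space N)"
      unfolding f(2)[symmetric] by (simp add: emeasure_density[OF f(1)] cong: nn_integral_cong)
    also have "\<dots> = (\<integral>\<^sup>+z. ennreal (h z) \<partial>\<eta>)"
      unfolding N_def by (subst emeasure_distr[OF \<pi>D]) (use hm in \<open>auto simp: D_def emeasure_density intro!: nn_integral_cong\<close>)
    also have "\<dots> = ennreal (LINT z|\<eta>. h z)" by (rule nn_integral_eq_integral[OF h(1)]) (use h in auto)
    finally show ?thesis .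
  qed
  have ae: "AE p in \<rho>. f p \<noteq> \<infinity>" by (rule nn_integral_PInf_AE[OF f(1)]) (simp add: tot)
  define u where "u p = enn2real (f p)" for p
  have um: "u \<in> borel_measurable \<rho>" unfolding u_def using f(1) by simp
  have fu: "AE p in \<rho>. f p = ennreal (u p)"
    using ae unfolding u_def by eventually_elim (simp add: less_top)
  have Nu: "N = density \<rho> (\<lambda>p. ennreal (u p))"
    unfolding f(2)[symmetric] by (rule density_cong[OF f(1) _ fu]) (use um in simp)
  have iu: "integrable \<rho> u"
  proof (rule integrableI_nonneg[OF um])
    have "(\<integral>\<^sup>+p. ennreal (u p) \<partial>\<rho>) = ennreal (LINT z|\<eta>. h z)"
      using nn_integral_cong_AE[OF fu] tot by simp
    then show "(\<integral>\<^sup>+p. ennreal (u p) \<partial>\<rho>) < \<infinity>" by simp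
  qed (simp add: u_def)
  show ?thesis
  proof (intro exI[of _ u] conjI allI impI)
    show "u \<in> borel_measurable borel" using um unfolding \<rho>_def by simp
    show "integrable (distr \<eta> borel \<pi>) u" using iu unfolding \<rho>_def .
    fix w :: "'c \<Rightarrow> real" assume w: "w \<in> borel_measurable borel" "bounded (range w)"
    have "(LINT z|\<eta>. w (\<pi> z) * h z) = (LINT z|D. w (\<pi> z))"
      unfolding D_def by (subst integral_density) (use hm h measurable_compose[OF \<pi>m w(1)] in \<open>auto simp: mult.commute\<close>)
    also have "\<dots> = (LINT p|N. w p)" unfolding N_def by (rule integral_distr[symmetric, OF \<pi>D w(1)])
    also have "\<dots> = (LINT p|\<rho>. w p * u p)"
      unfolding Nu by (subst integral_density) (use um w in \<open>auto simp: u_def \<rho>_def mult.commute\<close>)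
    finally show "(LINT z|\<eta>. w (\<pi> z) * h z) = (LINT p|distr \<eta> borel \<pi>. w p * u p)" unfolding \<rho>_def .
  qed
qed

lemma integrable_bounded_mult:
  assumes "integrable M h" "w \<in> borel_measurable M" "bounded (range w)"
  shows "integrable M (\<lambda>z. w z * (h z :: real))"
proof -
  obtain B where B: "B > 0" "\<And>z. norm (w z) \<le> B" using assms(3) unfolding bounded_pos by blast
  show ?thesis
  proof (rule Bochner_Integration.integrable_bound)
    show "integrable M (\<lambda>z. B * h z)" using assms(1) by simp
    show "AE z in M. norm (w z * h z) \<le> norm (B * h z)"
      using B by (intro AE_I2) (auto simp: abs_mult intro!: mult_right_mono)
  qed (use assms borel_measurable_integrable in auto)
qed

lemma conditional_density:
  fixes \<eta> :: "'b::euclidean_space measure" and \<pi> :: "'b \<Rightarrow> 'c::euclidean_space"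
  assumes \<eta>: "\<eta> \<in> space (prob_algebra borel)" and \<pi>: "\<pi> \<in> borel_measurable borel"
    and h: "integrable \<eta> (h :: 'b \<Rightarrow> real)"
  shows "\<exists>u. u \<in> borel_measurable borel \<and> integrable (distr \<eta> borel \<pi>) u \<and>
    (\<forall>w. w \<in> borel_measurable borel \<longrightarrow> bounded (range w) \<longrightarrow>
      (LINT z|\<eta>. w (\<pi> z) * h z) = (LINT p|distr \<eta> borel \<pi>. w p * u p))"
proof -
  note Mb = prob_algebra_borelD[OF \<eta>]
  note cs = measurable_cong_sets[OF Mb(2) refl]
  have \<pi>m: "\<pi> \<in> borel_measurable \<eta>" using \<pi> cs by auto
  have i: "integrable \<eta> (\<lambda>z. max 0 (h z))" "integrable \<eta> (\<lambda>z. max 0 (- h z))" using h by auto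
  obtain p where p: "p \<in> borel_measurable borel" "integrable (distr \<eta> borel \<pi>) p"
    "\<And>w. w \<in> borel_measurable borel \<Longrightarrow> bounded (range w) \<Longrightarrow>
      (LINT z|\<eta>. w (\<pi> z) * max 0 (h z)) = (LINT q|distr \<eta> borel \<pi>. w q * p q)"
    using conditional_density_nonneg[OF \<eta> \<pi> i(1)] by auto
  obtain n where n: "n \<in> borel_measurable borel" "integrable (distr \<eta> borel \<pi>) n"
    "\<And>w. w \<in> borel_measurable borel \<Longrightarrow> bounded (range w) \<Longrightarrow>
      (LINT z|\<eta>. w (\<pi> z) * max 0 (- h z)) = (LINT q|distr \<eta> borel \<pi>. w q * n q)"
    using conditional_density_nonneg[OF \<eta> \<pi> i(2)] by auto
  show ?thesis
  proof (intro exI[of _ "\<lambda>q. p q - n q"] conjI allI impI)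
    fix w :: "'c \<Rightarrow> real" assume w: "w \<in> borel_measurable borel" "bounded (range w)"
    have wb: "bounded (range (\<lambda>z. w (\<pi> z)))" using w(2) by (rule bounded_subset) auto
    note wm = measurable_compose[OF \<pi>m w(1)]
    have "(LINT z|\<eta>. w (\<pi> z) * h z) = (LINT z|\<eta>. w (\<pi> z) * max 0 (h z) - w (\<pi> z) * max 0 (- h z))"
      by (intro Bochner_Integration.integral_cong refl) (auto simp: max_def)
    also have "\<dots> = (LINT z|\<eta>. w (\<pi> z) * max 0 (h z)) - (LINT z|\<eta>. w (\<pi> z) * max 0 (- h z))"
      by (intro Bochner_Integration.integral_diff integrable_bounded_mult i wm wb)
    also have "\<dots> = (LINT q|distr \<eta> borel \<pi>. w q * p q) - (LINT q|distr \<eta> borel \<pi>. w q * n q)"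
      unfolding p(3)[OF w] n(3)[OF w] ..
    also have "\<dots> = (LINT q|distr \<eta> borel \<pi>. w q * p q - w q * n q)"
      by (intro Bochner_Integration.integral_diff[symmetric] integrable_bounded_mult p(2) n(2) w(2)) (use w(1) in auto)
    finally show "(LINT z|\<eta>. w (\<pi> z) * h z) = (LINT q|distr \<eta> borel \<pi>. w q * (p q - n q))"
      by (simp add: right_diff_distrib)
  qed (use p n in auto)
qed

abbreviation tx :: "real \<times> 'a::euclidean_space \<times> (real ^ 'n::finite) \<Rightarrow> real \<times> 'a" where
  "tx z \<equiv> (fst z, fst (snd z))"

lemma tx_measurable: "(\<lambda>z :: real \<times> 'a::euclidean_space \<times> (real ^ 'n::finite). tx z) \<in> borel_measurable borel"
  by (intro borel_measurable_continuous_onI continuous_on_Pair continuous_on_fst continuous_on_snd continuous_on_id)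

lemma vec_norm_sum: "(norm (v :: real ^ 'n))\<^sup>2 = (\<Sum>i\<in>UNIV. (v $ i)\<^sup>2)"
  unfolding power2_norm_eq_inner inner_vec_def by (simp add: power2_eq_square)

text \<open>\<open>u\<close> is the conditional mean of the control given time and position. Its
  second moment is bounded by testing with \<open>u\<close> itself, cut off where its norm exceeds
  \<open>N\<close>: the integral of the truncated square equals that of an inner product with the
  original control, hence is at most half of itself plus half of the energy. The cutoff makes the
  test function bounded and the absorbed term finite; monotone convergence removes it.\<close>

lemma young_projection:
  fixes \<eta> :: "(real \<times> 'a::euclidean_space \<times> (real ^ 'n::finite)) measure"
  assumes \<eta>: "\<eta> \<in> space (prob_algebra borel)" and i2: "integrable \<eta> (\<lambda>z. (norm (snd (snd z)))\<^sup>2)"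
  obtains u :: "real \<times> 'a \<Rightarrow> real ^ 'n" where "u \<in> borel_measurable borel"
    "\<And>i w. w \<in> borel_measurable borel \<Longrightarrow> bounded (range w) \<Longrightarrow>
      (LINT z|\<eta>. w (tx z) * snd (snd z) $ i) = (LINT p|distr \<eta> borel tx. w p * u p $ i)"
    "\<And>i. integrable (distr \<eta> borel tx) (\<lambda>p. u p $ i)"
    "(\<integral>\<^sup>+p. ennreal ((norm (u p))\<^sup>2) \<partial>distr \<eta> borel tx) \<le> ennreal (plan_energy \<eta>)"
proof -
  note Mb = prob_algebra_borelD[OF \<eta>]
  interpret \<eta>: prob_space \<eta> by (rule Mb)
  note cs = measurable_cong_sets[OF Mb(2) refl]
  let ?\<rho> = "distr \<eta> borel tx"
  have txm: "tx \<in> borel_measurable \<eta>" using tx_measurable cs by auto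
  interpret \<rho>: prob_space ?\<rho> by (rule \<eta>.prob_space_distr[OF txm])
  have iv: "integrable \<eta> (\<lambda>z. snd (snd z) $ i)" for i
  proof (rule Bochner_Integration.integrable_bound[OF plan_integrable_norm(1)[OF \<eta> i2]])
    have "(\<lambda>z :: real \<times> 'a \<times> (real ^ 'n). snd (snd z) $ i) \<in> borel_measurable borel"
      by (intro borel_measurable_continuous_onI continuous_on_component continuous_on_snd continuous_on_id)
    then show "(\<lambda>z. snd (snd z) $ i) \<in> borel_measurable \<eta>" using cs by auto
  qed (auto simp: component_le_norm_cart)
  have "\<forall>i. \<exists>u. u \<in> borel_measurable borel \<and> integrable ?\<rho> u \<and>
    (\<forall>w. w \<in> borel_measurable borel \<longrightarrow> bounded (range w) \<longrightarrow>
      (LINT z|\<eta>. w (tx z) * snd (snd z) $ i) = (LINT p|?\<rho>. w p * u p))"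
    using conditional_density[OF \<eta> tx_measurable iv] by blast
  from choice[OF this] obtain U where U0: "\<forall>i. U i \<in> borel_measurable borel \<and> integrable ?\<rho> (U i) \<and>
    (\<forall>w. w \<in> borel_measurable borel \<longrightarrow> bounded (range w) \<longrightarrow>
      (LINT z|\<eta>. w (tx z) * snd (snd z) $ i) = (LINT p|?\<rho>. w p * U i p))" ..
  have U: "U i \<in> borel_measurable borel" "integrable ?\<rho> (U i)"
    "w \<in> borel_measurable borel \<Longrightarrow> bounded (range w) \<Longrightarrow>
      (LINT z|\<eta>. w (tx z) * snd (snd z) $ i) = (LINT p|?\<rho>. w p * U i p)" for i w
    using U0[rule_format, of i] by auto
  define u where "u p = (\<chi> i. U i p)" for p
  have ui: "u p $ i = U i p" for p i unfolding u_def by simp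
  have um: "u \<in> borel_measurable borel"
  proof (rule borel_measurable_euclidean_space[THEN iffD2], intro ballI)
    fix b :: "real ^ 'n" assume "b \<in> Basis"
    then obtain i where "b = axis i 1" by (auto simp: Basis_vec_def)
    then have "(\<lambda>p. u p \<bullet> b) = U i" by (auto simp: inner_axis ui)
    then show "(\<lambda>p. u p \<bullet> b) \<in> borel_measurable borel" using U(1) by simp
  qed
  define q where "q N p = indicator {p. norm (u p) \<le> real N} p * (norm (u p))\<^sup>2" for N and p
  have Sm: "{p. norm (u p) \<le> real N} \<in> sets borel" for N
    using um by measurable
  have qm: "q N \<in> borel_measurable borel" for N
    unfolding q_def using um Sm by measurable
  have qb: "0 \<le> q N p" "q N p \<le> (real N)\<^sup>2" for N p
    unfolding q_def by (auto simp: indicator_def power_mono)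
  have le: "(LINT p|?\<rho>. q N p) \<le> plan_energy \<eta>" for N
  proof -
    define w where "w i p = indicator {p. norm (u p) \<le> real N} p * u p $ i" for i p
    have wm: "w i \<in> borel_measurable borel" for i
      unfolding w_def ui using U(1) Sm by (intro borel_measurable_times borel_measurable_indicator)
    have wb: "bounded (range (w i))" for i
      unfolding bounded_iff w_def
      by (rule exI[of _ "real N"]) (auto simp: indicator_def intro: order_trans[OF component_le_norm_cart])
    have iq: "integrable ?\<rho> (q N)"
      by (rule \<rho>.integrable_const_bound[of _ "(real N)\<^sup>2"]) (use qb qm in auto)
    have "(LINT p|?\<rho>. q N p) = (LINT p|?\<rho>. (\<Sum>i\<in>UNIV. w i p * u p $ i))"
      unfolding q_def w_def vec_norm_sum by (simp add: sum_distrib_left power2_eq_square mult.assoc)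
    also have "\<dots> = (\<Sum>i\<in>UNIV. (LINT p|?\<rho>. w i p * u p $ i))"
      by (rule Bochner_Integration.integral_sum) (use U(2) ui wm wb in \<open>auto intro!: integrable_bounded_mult\<close>)
    also have "\<dots> = (\<Sum>i\<in>UNIV. (LINT z|\<eta>. w i (tx z) * snd (snd z) $ i))"
      using U(3)[OF wm wb] ui by simp
    also have "\<dots> = (LINT z|\<eta>. (\<Sum>i\<in>UNIV. w i (tx z) * snd (snd z) $ i))"
    proof (rule Bochner_Integration.integral_sum[symmetric])
      fix i :: 'n
      have "bounded (range (\<lambda>z. w i (tx z)))" for \<eta> :: "(real \<times> 'a \<times> (real ^ 'n)) measure"
        using wb[of i] by (rule bounded_subset) auto
      then show "integrable \<eta> (\<lambda>z. w i (tx z) * snd (snd z) $ i)"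
        by (intro integrable_bounded_mult iv measurable_compose[OF txm wm])
    qed
    also have "\<dots> \<le> (LINT z|\<eta>. (q N (tx z) + (norm (snd (snd z)))\<^sup>2) / 2)"
    proof (rule integral_mono)
      show "integrable \<eta> (\<lambda>z. \<Sum>i\<in>UNIV. w i (tx z) * snd (snd z) $ i)"
      proof (rule Bochner_Integration.integrable_sum)
        fix i :: 'n
        have "bounded (range (\<lambda>z. w i (tx z)))" for \<eta> :: "(real \<times> 'a \<times> (real ^ 'n)) measure"
          using wb[of i] by (rule bounded_subset) auto
        then show "integrable \<eta> (\<lambda>z. w i (tx z) * snd (snd z) $ i)"
          by (intro integrable_bounded_mult iv measurable_compose[OF txm wm])
      qed
      have "integrable \<eta> (\<lambda>z. q N (tx z))"
        by (rule integrable_distr[OF txm iq])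
      then show "integrable \<eta> (\<lambda>z. (q N (tx z) + (norm (snd (snd z)))\<^sup>2) / 2)" using i2 by simp
      fix z :: "real \<times> 'a \<times> (real ^ 'n)"
      define c where "c = (indicator {p. norm (u p) \<le> real N} (tx z) :: real)"
      have c: "c * c = c" unfolding c_def by (simp add: indicator_def)
      have "(\<Sum>i\<in>UNIV. w i (tx z) * snd (snd z) $ i) \<le> (\<Sum>i\<in>UNIV. (c * (u (tx z) $ i)\<^sup>2 + (snd (snd z) $ i)\<^sup>2) / 2)"
      proof (rule sum_mono)
        fix i :: 'n
        have "0 \<le> (c * u (tx z) $ i - snd (snd z) $ i)\<^sup>2" by simp
        then have "2 * (c * u (tx z) $ i * snd (snd z) $ i) \<le> c * c * (u (tx z) $ i)\<^sup>2 + (snd (snd z) $ i)\<^sup>2"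
          by (simp add: power2_eq_square algebra_simps)
        then show "w i (tx z) * snd (snd z) $ i \<le> (c * (u (tx z) $ i)\<^sup>2 + (snd (snd z) $ i)\<^sup>2) / 2"
          unfolding w_def c_def[symmetric] c by simp
      qed
      also have "\<dots> = (q N (tx z) + (norm (snd (snd z)))\<^sup>2) / 2"
        unfolding q_def vec_norm_sum c_def[symmetric]
        by (simp add: sum.distrib sum_divide_distrib[symmetric] sum_distrib_left)
      finally show "(\<Sum>i\<in>UNIV. w i (tx z) * snd (snd z) $ i) \<le> (q N (tx z) + (norm (snd (snd z)))\<^sup>2) / 2" .
    qed
    also have "\<dots> = ((LINT z|\<eta>. q N (tx z)) + plan_energy \<eta>) / 2"
    proof -
      have "integrable \<eta> (\<lambda>z. q N (tx z))" by (rule integrable_distr[OF txm iq])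
      then show ?thesis using i2 unfolding plan_energy_def by simp
    qed
    also have "(LINT z|\<eta>. q N (tx z)) = (LINT p|?\<rho>. q N p)" by (rule integral_distr[symmetric, OF txm qm])
    finally show ?thesis by simp
  qed
  have "(\<integral>\<^sup>+p. ennreal ((norm (u p))\<^sup>2) \<partial>?\<rho>) = (\<integral>\<^sup>+p. (SUP N. ennreal (q N p)) \<partial>?\<rho>)"
  proof (intro nn_integral_cong antisym)
    fix p
    obtain N :: nat where N: "norm (u p) \<le> real N" using real_arch_simple by blast
    have "ennreal ((norm (u p))\<^sup>2) = ennreal (q N p)" unfolding q_def using N by simp
    also have "\<dots> \<le> (SUP N. ennreal (q N p))" by (rule SUP_upper) simp
    finally show "ennreal ((norm (u p))\<^sup>2) \<le> (SUP N. ennreal (q N p))" .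
    show "(SUP N. ennreal (q N p)) \<le> ennreal ((norm (u p))\<^sup>2)"
      by (rule SUP_least) (auto simp: q_def indicator_def intro!: ennreal_leI)
  qed
  also have "\<dots> = (SUP N. \<integral>\<^sup>+p. ennreal (q N p) \<partial>?\<rho>)"
  proof (rule nn_integral_monotone_convergence_SUP)
    show "incseq (\<lambda>N p. ennreal (q N p))"
      by (auto simp: incseq_def le_fun_def q_def indicator_def intro!: ennreal_leI)
    show "(\<lambda>p. ennreal (q N p)) \<in> borel_measurable ?\<rho>" for N using qm by simp
  qed
  also have "\<dots> \<le> ennreal (plan_energy \<eta>)"
  proof (rule SUP_least)
    fix N
    have "integrable ?\<rho> (q N)" by (rule \<rho>.integrable_const_bound[of _ "(real N)\<^sup>2"]) (use qb qm in auto)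
    then have "(\<integral>\<^sup>+p. ennreal (q N p) \<partial>?\<rho>) = ennreal (LINT p|?\<rho>. q N p)"
      by (rule nn_integral_eq_integral) (use qb in auto)
    then show "(\<integral>\<^sup>+p. ennreal (q N p) \<partial>?\<rho>) \<le> ennreal (plan_energy \<eta>)" using le[of N] by (simp add: ennreal_leI)
  qed
  finally have fin: "(\<integral>\<^sup>+p. ennreal ((norm (u p))\<^sup>2) \<partial>?\<rho>) \<le> ennreal (plan_energy \<eta>)" .
  show ?thesis
    by (rule that[OF um _ _ fin]) (use U ui in auto)
qed

lemma prod_Basis_prod:
  fixes f :: "'a::euclidean_space \<times> 'b::euclidean_space \<Rightarrow> real"
  shows "(\<Prod>i\<in>Basis. f i) = (\<Prod>i\<in>Basis. f (i, 0)) * (\<Prod>i\<in>Basis. f (0, i))"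
  unfolding Basis_prod_def
  by (subst prod.union_disjoint) (auto simp: prod.reindex inj_on_def)

lemma box_bump_Pair:
  "box_bump p q n (t, x) = box_bump (fst p) (fst q) n t * box_bump (snd p) (snd q) n x"
  unfolding box_bump_def prod_Basis_prod by (simp add: inner_prod_def)

lemma plan_curve_ok: "plan T F \<mu> \<eta> \<Longrightarrow> T > 0 \<Longrightarrow> curve_ok T \<mu>"
  unfolding curve_ok_def using planD(1) planD(3) by blast

text \<open>A plan prescribes the law of time and position only against products of a function of
  time and a function of space. Bumps on boxes in space-time factor in this way, and they determine
  the measure.\<close>

lemma plan_joint_law:
  fixes \<eta> :: "(real \<times> 'a::euclidean_space \<times> (real ^ 'n::finite)) measure"
  assumes p: "plan T F \<mu> \<eta>" and T: "T > 0"
  shows "distr \<eta> borel tx = joint_law T \<mu>"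
proof -
  note P = planD[OF p]
  note ok = plan_curve_ok[OF p T]
  note Mb = prob_algebra_borelD[OF P(2)]
  interpret \<eta>: prob_space \<eta> by (rule Mb)
  have txm: "tx \<in> borel_measurable \<eta>" using tx_measurable measurable_cong_sets[OF Mb(2) refl] by auto
  have D: "distr \<eta> borel tx \<in> space (prob_algebra borel)"
    by (simp add: space_prob_algebra \<eta>.prob_space_distr[OF txm])
  note J = joint_law_prob[OF ok]
  interpret J: prob_space "joint_law T \<mu>" by (rule prob_algebra_borelD[OF J])
  show ?thesis
  proof (rule prob_measure_eqI_boxes[OF D J])
    fix a b :: "real \<times> 'a"
    have "(LINT z|distr \<eta> borel tx. box_bump a b n z) = (LINT z|joint_law T \<mu>. box_bump a b n z)" for n
    proof -
      obtain G where G: "C1c_fun (box_bump (snd a) (snd b) n) G" using C1c_box_bump by blast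
      obtain H where H: "C1c_fun (box_bump (fst a) (fst b) n) H" using C1c_box_bump by blast
      have "T * (LINT z|distr \<eta> borel tx. box_bump a b n z)
          = T * (LINT z|\<eta>. box_bump (fst a) (fst b) n (fst z) * box_bump (snd a) (snd b) n (fst (snd z)))"
        by (subst integral_distr[OF txm]) (auto simp: box_bump_Pair)
      also have "\<dots> = (LINT t:{0..T}|lborel. box_bump (fst a) (fst b) n t * (LINT x|\<mu> t. box_bump (snd a) (snd b) n x))"
        by (rule P(5)[OF C1_funD(3)[OF C1c_funD(1)[OF H]] _ G])
           (auto simp: bounded_iff box_bump_bounds abs_of_nonneg intro!: exI[of _ 1])
      also have "\<dots> = (LINT t:{0..T}|lborel. (LINT x|\<mu> t. box_bump a b n (t, x)))"
        by (simp add: box_bump_Pair)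
      also have "\<dots> = T * (LINT z|joint_law T \<mu>. box_bump a b n z)"
      proof (rule integral_joint_law[OF ok])
        show "integrable (joint_law T \<mu>) (box_bump a b n)"
          by (rule J.integrable_const_bound[of _ 1])
             (auto simp: box_bump_bounds abs_of_nonneg measurable_cong_sets[OF prob_algebra_borelD(2)[OF J] refl])
      qed
      finally show ?thesis using T by simp
    qed
    then show "measure (distr \<eta> borel tx) (box a b) = measure (joint_law T \<mu>) (box a b)"
      using LIMSEQ_unique[OF box_bump_integral_limit[OF D, of a b]] box_bump_integral_limit[OF J, of a b] by simp
  qed
qed

lemma integral_uniform_time:
  assumes T: "T > 0" and f: "f \<in> borel_measurable borel"
  shows "T * (LINT t|uniform_measure lborel {0..T}. f t) = (LINT t:{0..T}|lborel. f t :: real)"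
proof -
  have "indicator {0..T} t / emeasure lborel {0..T} = ennreal (indicator {0..T} t / T)" for t :: real
    using T by (auto simp: indicator_def divide_ennreal ennreal_1[symmetric] simp del: ennreal_1)
  then have U: "uniform_measure lborel {0..T} = density lborel (\<lambda>t. ennreal (indicator {0..T} t / T))"
    unfolding uniform_measure_def by simp
  have "(LINT t|uniform_measure lborel {0..T}. f t) = (LINT t|lborel. (indicator {0..T} t / T) *\<^sub>R f t)"
    unfolding U by (rule integral_density) (use T f in auto)
  also have "\<dots> = (LINT t:{0..T}|lborel. f t) / T"
    unfolding set_lebesgue_integral_def by simp
  finally show ?thesis using T by simp
qed

context control_system begin

section \<open>From plans to admissible pairs and back\<close>

lemma C1T_bounds:
  assumes "C1T_fun T \<phi> A (G :: real \<times> 'a \<Rightarrow> 'a)"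
  obtains K where "K > 0" "\<And>p. \<bar>A p\<bar> \<le> K" "\<And>p v. \<bar>G p \<bullet> ctrl F (snd p) v\<bar> \<le> K * norm v"
    "\<And>i p. \<bar>G p \<bullet> F i (snd p)\<bar> \<le> K"
proof -
  obtain A1 where A1: "A1 > 0" "\<And>z. norm (A z) \<le> A1"
    using assms unfolding C1T_fun_def bounded_pos by (metis rangeI)
  obtain B1 where B1: "B1 > 0" "\<And>z. norm (G z) \<le> B1"
    using assms unfolding C1T_fun_def bounded_pos by (metis rangeI)
  obtain R where R: "\<And>z. norm (snd z) > R \<Longrightarrow> G z = 0"
    using assms unfolding C1T_fun_def by metis
  define C where "C = B1 * (M * real CARD('n) * (max R 0 + 1))"
  have C: "0 \<le> C" unfolding C_def using B1 M by simp
  have f: "\<bar>G p \<bullet> ctrl F (snd p) v\<bar> \<le> C * norm v" for p v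
  proof -
    have 1: "norm (snd p) > max R 0 \<Longrightarrow> G p = 0" using R by simp
    show ?thesis
      unfolding C_def by (rule flux_bound[where G = G and z = p, OF B1(2) 1]) (use B1 in auto)
  qed
  have fi: "\<bar>G p \<bullet> F i (snd p)\<bar> \<le> C" for p i
  proof -
    have "ctrl F (snd p) (axis i 1) = (\<Sum>j\<in>UNIV. if j = i then F i (snd p) else 0)"
      unfolding ctrl_def by (intro sum.cong refl) (auto simp: axis_def)
    then show ?thesis using f[of p "axis i 1"] by simp
  qed
  show ?thesis
  proof (rule that[of "A1 + C"])
    show "\<bar>A p\<bar> \<le> A1 + C" for p using A1(2)[of p] C by simp
    show "\<bar>G p \<bullet> F i (snd p)\<bar> \<le> A1 + C" for i p using fi[of p i] A1 by simp
    show "\<bar>G p \<bullet> ctrl F (snd p) v\<bar> \<le> (A1 + C) * norm v" for p v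
      using order_trans[OF f mult_right_mono[of C "A1 + C" "norm v"]] A1(1) by simp
  qed (use A1 C in simp)
qed

lemma C1T_measurable:
  assumes "C1T_fun T \<phi> A (G :: real \<times> 'a \<Rightarrow> 'a)" and u: "u \<in> borel_measurable borel"
  shows "A \<in> borel_measurable borel" "(\<lambda>p. G p \<bullet> F i (snd p)) \<in> borel_measurable borel"
    "(\<lambda>p. A p + G p \<bullet> ctrl F (snd p) (u p)) \<in> borel_measurable borel"
proof -
  have Ac: "continuous_on UNIV A" and Gc: "continuous_on UNIV G" using assms unfolding C1T_fun_def by blast+
  show A: "A \<in> borel_measurable borel" by (rule borel_measurable_continuous_onI[OF Ac])
  have Fi: "(\<lambda>p. G p \<bullet> F i (snd p)) \<in> borel_measurable borel" for i
    by (intro borel_measurable_continuous_onI continuous_on_inner Gc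
        continuous_on_compose2[OF F_cont continuous_on_snd[OF continuous_on_id]]) auto
  then show "(\<lambda>p. G p \<bullet> F i (snd p)) \<in> borel_measurable borel" .
  have ui: "(\<lambda>p. u p $ i) \<in> borel_measurable borel" for i
    by (rule measurable_compose[OF u borel_measurable_continuous_onI[OF continuous_on_component[OF continuous_on_id]]])
  have "(\<lambda>p. A p + G p \<bullet> ctrl F (snd p) (u p)) = (\<lambda>p. A p + (\<Sum>i\<in>UNIV. u p $ i * (G p \<bullet> F i (snd p))))"
    unfolding ctrl_def by (simp add: inner_sum_right)
  also have "\<dots> \<in> borel_measurable borel"
    by (intro borel_measurable_add A borel_measurable_sum borel_measurable_times ui Fi)
  finally show "(\<lambda>p. A p + G p \<bullet> ctrl F (snd p) (u p)) \<in> borel_measurable borel" .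
qed

lemma plan_integrand_measurable:
  assumes "C1T_fun T \<phi> A (G :: real \<times> 'a \<Rightarrow> 'a)"
  shows "(\<lambda>z :: real \<times> 'a \<times> (real ^ 'n). A (tx z) + G (tx z) \<bullet> ctrl F (fst (snd z)) (snd (snd z))) \<in> borel_measurable borel"
proof -
  have Ac: "continuous_on UNIV A" and Gc: "continuous_on UNIV G" using assms unfolding C1T_fun_def by blast+
  have pc: "continuous_on UNIV (\<lambda>z :: real \<times> 'a \<times> (real ^ 'n). tx z)"
    by (intro continuous_on_Pair continuous_on_fst continuous_on_snd continuous_on_id)
  show ?thesis
    by (intro borel_measurable_continuous_onI continuous_on_add continuous_on_inner continuous_on_compose2[OF Ac pc] continuous_on_compose2[OF Gc pc]
        ctrl_continuous continuous_on_fst continuous_on_snd continuous_on_id) auto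
qed

lemma plan_admissible:
  assumes p: "plan T F \<mu> \<eta>" and H: "\<And>x v. H x v = ctrl F x v"
    and L: "\<And>t x v. t \<in> {0..T} \<Longrightarrow> L t x v = ennreal (\<Sum>i\<in>UNIV. \<bar>v $ i\<bar>\<^sup>2)"
  shows "\<exists>u. (\<mu>, u) \<in> BB_admissible T H UNIV (\<mu> 0) (\<mu> T) \<and> BB_cost T L \<mu> u \<le> ennreal (T * plan_energy \<eta>)"
proof -
  note P = planD[OF p]
  note ok = plan_curve_ok[OF p T]
  note J = plan_joint_law[OF p T]
  note Mb = prob_algebra_borelD[OF P(2)]
  interpret \<eta>: prob_space \<eta> by (rule Mb)
  have txm: "tx \<in> borel_measurable \<eta>" using tx_measurable measurable_cong_sets[OF Mb(2) refl] by auto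
  obtain u :: "real \<times> 'a \<Rightarrow> real ^ 'n" where um: "u \<in> borel_measurable borel"
    and uw0: "\<And>i w. w \<in> borel_measurable borel \<Longrightarrow> bounded (range w) \<Longrightarrow>
      (LINT z|\<eta>. w (tx z) * snd (snd z) $ i) = (LINT p|distr \<eta> borel tx. w p * u p $ i)"
    and ui0: "\<And>i. integrable (distr \<eta> borel tx) (\<lambda>p. u p $ i)"
    and u20: "(\<integral>\<^sup>+p. ennreal ((norm (u p))\<^sup>2) \<partial>distr \<eta> borel tx) \<le> ennreal (plan_energy \<eta>)"
    by (rule young_projection[OF P(2,6)]) blast
  note uw = uw0[unfolded J] and ui = ui0[unfolded J] and u2 = u20[unfolded J]
  note Jp = prob_algebra_borelD[OF joint_law_prob[OF ok]]
  interpret J: prob_space "joint_law T \<mu>" by (rule Jp)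
  note Jcs = measurable_cong_sets[OF Jp(2) refl]
  define U where "U t x = u (t, x)" for t x
  have weak: "weak_continuity_equation T H \<mu> U"
    unfolding weak_continuity_equation_def
  proof (intro allI impI)
    fix \<phi> :: "real \<times> 'a \<Rightarrow> real" assume "C1c_test_function T \<phi>"
    then obtain A G where ph: "C1T_fun T \<phi> A G" using C1c_test_imp_C1T[OF T] by blast
    obtain K where K: "K > 0" "\<And>p. \<bar>A p\<bar> \<le> K" "\<And>p v. \<bar>G p \<bullet> ctrl F (snd p) v\<bar> \<le> K * norm v"
      "\<And>i p. \<bar>G p \<bullet> F i (snd p)\<bar> \<le> K" using C1T_bounds[OF ph] by blast
    define h where "h q = A q + G q \<bullet> ctrl F (snd q) (u q)" for q
    note m = C1T_measurable[OF ph um]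
    have hm: "h \<in> borel_measurable borel" unfolding h_def by (rule m)
    have tr: "transport_integrand T H U \<phi> t x = h (t, x)" if "t \<in> {0..T}" for t x
      unfolding transport_integrand_eq[OF T ph that] h_def H U_def by simp
    \<comment> \<open>The dynamics is linear in the control, so the flux is a sum of control
      components with these weights. They are bounded and depend on time and position only, which is
      what the conditional mean can be tested with; hence averaging leaves the weak equation
      unchanged.\<close>
    define w where "w i q = G q \<bullet> F i (snd q)" for i q
    have wm: "w i \<in> borel_measurable borel" for i unfolding w_def by (rule m(2))
    have wb: "bounded (range (w i))" for i unfolding bounded_iff w_def using K(4) by (intro exI[of _ K]) auto
    have h_eq: "h q = A q + (\<Sum>i\<in>UNIV. w i q * u q $ i)" for q
      unfolding h_def w_def ctrl_def by (simp add: inner_sum_right mult.commute)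
    have iA: "integrable (joint_law T \<mu>) A"
      by (rule J.integrable_const_bound[of _ K]) (use K m(1) in \<open>auto simp: Jcs\<close>)
    have iw: "integrable (joint_law T \<mu>) (\<lambda>q. w i q * u q $ i)" for i
      by (intro integrable_bounded_mult ui wb) (use wm in \<open>auto simp: Jcs\<close>)
    have ih: "integrable (joint_law T \<mu>) h"
      unfolding h_eq by (intro Bochner_Integration.integrable_add iA Bochner_Integration.integrable_sum iw)
    have "(\<integral>\<^sup>+t\<in>{0..T}. (\<integral>\<^sup>+x. ennreal \<bar>transport_integrand T H U \<phi> t x\<bar> \<partial>\<mu> t) \<partial>lborel)
        = (\<integral>\<^sup>+t\<in>{0..T}. (\<integral>\<^sup>+x. ennreal \<bar>h (t, x)\<bar> \<partial>\<mu> t) \<partial>lborel)"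
      by (intro nn_integral_cong) (auto simp: indicator_def tr)
    also have "\<dots> = ennreal T * (\<integral>\<^sup>+q. ennreal \<bar>h q\<bar> \<partial>joint_law T \<mu>)"
      by (rule nn_integral_joint_law(1)[OF ok, symmetric]) (use hm in simp)
    also have "\<dots> < \<infinity>"
      using ih unfolding integrable_iff_bounded by (simp add: ennreal_mult_less_top)
    finally have fin: "(\<integral>\<^sup>+t\<in>{0..T}. (\<integral>\<^sup>+x. ennreal \<bar>transport_integrand T H U \<phi> t x\<bar> \<partial>\<mu> t) \<partial>lborel) < \<infinity>" .
    have "(LINT t:{0..T}|lborel. (LINT x|\<mu> t. transport_integrand T H U \<phi> t x)) = (LINT t:{0..T}|lborel. (LINT x|\<mu> t. h (t, x)))"
      by (intro set_lebesgue_integral_cong) (auto simp: tr)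
    also have "\<dots> = T * (LINT q|joint_law T \<mu>. h q)" by (rule integral_joint_law[OF ok ih])
    also have "(LINT q|joint_law T \<mu>. h q) = (LINT q|joint_law T \<mu>. A q) + (\<Sum>i\<in>UNIV. (LINT q|joint_law T \<mu>. w i q * u q $ i))"
      unfolding h_eq
      by (subst Bochner_Integration.integral_add[OF iA Bochner_Integration.integrable_sum[OF iw]])
         (subst Bochner_Integration.integral_sum[OF iw], simp)
    also have "\<dots> = (LINT z|\<eta>. A (tx z)) + (\<Sum>i\<in>UNIV. (LINT z|\<eta>. w i (tx z) * snd (snd z) $ i))"
      unfolding uw[OF wm wb] unfolding J[symmetric] by (subst integral_distr[OF txm m(1)]) simp
    also have "\<dots> = (LINT z|\<eta>. A (tx z) + G (tx z) \<bullet> ctrl F (fst (snd z)) (snd (snd z)))"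
    proof -
      have iA': "integrable \<eta> (\<lambda>z. A (tx z))"
        by (rule \<eta>.integrable_const_bound[of _ K]) (use K measurable_compose[OF txm m(1)] in auto)
      have iw': "integrable \<eta> (\<lambda>z. w i (tx z) * snd (snd z) $ i)" for i
      proof (rule integrable_bounded_mult)
        show "integrable \<eta> (\<lambda>z. snd (snd z) $ i)"
        proof (rule Bochner_Integration.integrable_bound[OF plan_integrable_norm(1)[OF P(2,6)]])
          have "(\<lambda>z :: real \<times> 'a \<times> (real ^ 'n). snd (snd z) $ i) \<in> borel_measurable borel"
            by (intro borel_measurable_continuous_onI continuous_on_component continuous_on_snd continuous_on_id)
          then show "(\<lambda>z. snd (snd z) $ i) \<in> borel_measurable \<eta>" using measurable_cong_sets[OF Mb(2) refl] by auto
        qed (auto simp: component_le_norm_cart)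
        show "(\<lambda>z. w i (tx z)) \<in> borel_measurable \<eta>" by (rule measurable_compose[OF txm wm])
        show "bounded (range (\<lambda>z. w i (tx z)))" using wb[of i] by (rule bounded_subset) auto
      qed
      have "(LINT z|\<eta>. A (tx z)) + (\<Sum>i\<in>UNIV. (LINT z|\<eta>. w i (tx z) * snd (snd z) $ i))
          = (LINT z|\<eta>. A (tx z) + (\<Sum>i\<in>UNIV. w i (tx z) * snd (snd z) $ i))"
        by (subst Bochner_Integration.integral_add[OF iA' Bochner_Integration.integrable_sum[OF iw']])
           (subst Bochner_Integration.integral_sum[OF iw'], simp)
      also have "\<dots> = (LINT z|\<eta>. A (tx z) + G (tx z) \<bullet> ctrl F (fst (snd z)) (snd (snd z)))"
        unfolding w_def ctrl_def by (simp add: inner_sum_right mult.commute)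
      finally show ?thesis .
    qed
    also have "T * \<dots> = (LINT x|\<mu> T. \<phi> (T, x)) - (LINT x|\<mu> 0. \<phi> (0, x))" by (rule P(7)[OF ph])
    finally show "(\<integral>\<^sup>+t\<in>{0..T}. (\<integral>\<^sup>+x. ennreal \<bar>transport_integrand T H U \<phi> t x\<bar> \<partial>\<mu> t) \<partial>lborel) < \<infinity> \<and>
      (LINT t:{0..T}|lborel. (LINT x|\<mu> t. transport_integrand T H U \<phi> t x)) = (LINT x|\<mu> T. \<phi> (T, x)) - (LINT x|\<mu> 0. \<phi> (0, x))"
      using fin by blast
  qed
  have Uu: "(\<lambda>(t, x). U t x) = u" unfolding U_def by auto
  have "(\<mu>, U) \<in> BB_admissible T H UNIV (\<mu> 0) (\<mu> T)"
    unfolding BB_admissible_def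
    using curve_ok_narrow[OF ok] weak measurable_restrict_space1[OF um] Uu by auto
  moreover have "BB_cost T L \<mu> U \<le> ennreal (T * plan_energy \<eta>)"
  proof -
    have "BB_cost T L \<mu> U = (\<integral>\<^sup>+t\<in>{0..T}. (\<integral>\<^sup>+x. ennreal ((norm (u (t, x)))\<^sup>2) \<partial>\<mu> t) \<partial>lborel)"
      unfolding BB_cost_def
      by (intro nn_integral_cong) (auto simp: indicator_def L U_def vec_norm_sum)
    also have "\<dots> = ennreal T * (\<integral>\<^sup>+q. ennreal ((norm (u q))\<^sup>2) \<partial>joint_law T \<mu>)"
      by (rule nn_integral_joint_law(1)[OF ok, symmetric]) (use um in simp)
    also have "\<dots> \<le> ennreal T * ennreal (plan_energy \<eta>)" by (rule mult_left_mono[OF u2]) simp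
    also have "\<dots> = ennreal (T * plan_energy \<eta>)"
      using T by (intro ennreal_mult[symmetric]) (auto simp: plan_energy_def)
    finally show ?thesis .
  qed
  ultimately show ?thesis by blast
qed

text \<open>The pair is lifted to the law of \<open>(t, x, u t x)\<close> under
  \<open>joint_law\<close>. Finite cost provides the second moment demanded of a plan, and the
  energy reproduces the cost exactly.\<close>

lemma admissible_plan:
  assumes adm: "(\<mu>, u) \<in> BB_admissible T H UNIV m0 mT" and H: "\<And>x v. H x v = ctrl F x v"
    and L: "\<And>t x v. t \<in> {0..T} \<Longrightarrow> L t x v = ennreal (\<Sum>i\<in>UNIV. \<bar>v $ i\<bar>\<^sup>2)"
    and fin: "BB_cost T L \<mu> u < \<infinity>"
  shows "\<exists>\<eta>. plan T F \<mu> \<eta> \<and> BB_cost T L \<mu> u = ennreal (T * plan_energy \<eta>)"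
proof -
  have ok: "curve_ok T \<mu>" using adm narrow_curve_ok[OF T] unfolding BB_admissible_def by blast
  have weak: "weak_continuity_equation T H \<mu> u"
    and um0: "(\<lambda>(t, x). u t x) \<in> restrict_space borel ({0..T} \<times> UNIV) \<rightarrow>\<^sub>M borel"
    using adm unfolding BB_admissible_def by blast+
  \<comment> \<open>The control is measurable on the strip only; extending it by zero gives a Borel
    function on the whole space without affecting the cost or the weak equation.\<close>
  define U where "U q = (if q \<in> {0..T} \<times> UNIV then (case q of (t, x) \<Rightarrow> u t x) else 0)" for q
  have "({0..T} \<times> UNIV :: (real \<times> 'a) set) \<in> sets borel" by (intro borel_closed closed_Times) auto
  then have Um: "U \<in> borel_measurable borel"
    unfolding U_def using um0 by (subst (asm) measurable_restrict_space_iff[of _ _ 0]) auto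
  have Uu: "U (t, x) = u t x" if "t \<in> {0..T}" for t x unfolding U_def using that by simp
  define J where "J = joint_law T \<mu>"
  note Jp = joint_law_prob[OF ok, folded J_def]
  note JM = prob_algebra_borelD[OF Jp]
  interpret J: prob_space J by (rule JM)
  note Jcs = measurable_cong_sets[OF JM(2) refl]
  define e where "e q = (fst q, snd q, U q)" for q
  have em: "e \<in> borel_measurable borel"
  proof -
    have "(\<lambda>q. fst q) \<in> borel_measurable (borel :: (real \<times> 'a) measure)" "(\<lambda>q. snd q) \<in> borel_measurable (borel :: (real \<times> 'a) measure)"
      by (intro borel_measurable_continuous_onI continuous_on_fst continuous_on_snd continuous_on_id)+
    then show ?thesis unfolding e_def using Um by (intro borel_measurable_Pair)
  qed
  then have emJ: "e \<in> borel_measurable J" using Jcs by auto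
  define \<eta> where "\<eta> = distr J borel e"
  have \<eta>p: "\<eta> \<in> space (prob_algebra borel)"
    unfolding \<eta>_def by (simp add: space_prob_algebra J.prob_space_distr[OF emJ])
  have cost: "BB_cost T L \<mu> u = ennreal T * (\<integral>\<^sup>+q. ennreal ((norm (U q))\<^sup>2) \<partial>J)"
  proof -
    have "BB_cost T L \<mu> u = (\<integral>\<^sup>+t\<in>{0..T}. (\<integral>\<^sup>+x. ennreal ((norm (U (t, x)))\<^sup>2) \<partial>\<mu> t) \<partial>lborel)"
      unfolding BB_cost_def
      by (intro nn_integral_cong) (auto simp: indicator_def L Uu vec_norm_sum)
    also have "\<dots> = ennreal T * (\<integral>\<^sup>+q. ennreal ((norm (U q))\<^sup>2) \<partial>J)"
      unfolding J_def by (rule nn_integral_joint_law(1)[OF ok, symmetric]) (use Um in simp)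
    finally show ?thesis .
  qed
  have U2: "(\<integral>\<^sup>+q. ennreal ((norm (U q))\<^sup>2) \<partial>J) < \<infinity>"
    using fin T unfolding cost by (auto simp: ennreal_mult_less_top)
  have iU: "integrable J (\<lambda>q. (norm (U q))\<^sup>2)"
  proof (rule integrableI_nonneg)
    have "(\<lambda>q. (norm (U q))\<^sup>2) \<in> borel_measurable borel"
      by (rule measurable_compose[OF Um borel_measurable_continuous_onI[OF continuous_on_power[OF continuous_on_norm[OF continuous_on_id]]]])
    then show "(\<lambda>q. (norm (U q))\<^sup>2) \<in> borel_measurable J" using Jcs by auto
  qed (use U2 in auto)
  have nm: "(\<lambda>z :: real \<times> 'a \<times> (real ^ 'n). (norm (snd (snd z)))\<^sup>2) \<in> borel_measurable borel"
    by (intro borel_measurable_continuous_onI continuous_on_power continuous_on_norm continuous_on_snd continuous_on_id)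
  have i\<eta>: "integrable \<eta> (\<lambda>z. (norm (snd (snd z)))\<^sup>2)"
    unfolding \<eta>_def using iU by (subst integrable_distr_eq[OF emJ nm]) (simp add: e_def)
  have energy: "plan_energy \<eta> = (LINT q|J. (norm (U q))\<^sup>2)"
    unfolding plan_energy_def \<eta>_def by (subst integral_distr[OF emJ nm]) (simp add: e_def)
  have cost': "BB_cost T L \<mu> u = ennreal (T * plan_energy \<eta>)"
    unfolding cost energy using T nn_integral_eq_integral[OF iU] by (simp add: ennreal_mult)
  have "plan T F \<mu> \<eta>"
    unfolding plan_def
  proof (intro conjI allI impI ballI)
    show "\<mu> t \<in> space (prob_algebra borel)" if "t \<in> {0..T}" for t
      using ok that unfolding curve_ok_def by blast
    show "continuous_on {0..T} (\<lambda>t. LINT x|\<mu> t. \<psi> x)" if "C1c_fun \<psi> G" for \<psi> G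
      using ok that unfolding curve_ok_def by blast
    show "distr \<eta> borel fst = uniform_measure lborel {0..T}"
    proof (rule measure_eqI)
      fix A assume "A \<in> sets (distr \<eta> borel fst)"
      then have A: "A \<in> sets borel" by simp
      have fm: "fst \<in> borel_measurable (borel :: (real \<times> 'a) measure)" "fst \<in> borel_measurable (borel :: (real \<times> 'a \<times> (real ^ 'n)) measure)"
        by (intro borel_measurable_continuous_onI continuous_on_fst continuous_on_id)+
      have "distr \<eta> borel fst = distr J borel (fst \<circ> e)"
        unfolding \<eta>_def by (rule distr_distr[OF fm(2) emJ])
      also have "fst \<circ> e = fst" unfolding e_def by auto
      finally have "emeasure (distr \<eta> borel fst) A = emeasure (distr J borel fst) A" by simp
      also have "\<dots> = (\<integral>\<^sup>+q. indicator A (fst q) \<partial>J)"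
      proof -
        have "fst \<in> borel_measurable J" using fm(1) Jcs by auto
        then show ?thesis
          using nn_integral_distr[of fst J borel "indicator A"] nn_integral_indicator[of A "distr J borel fst"] A
          by simp
      qed
      finally have 1: "emeasure (distr \<eta> borel fst) A = (\<integral>\<^sup>+q. indicator A (fst q) \<partial>J)" .
      have im: "(\<lambda>q :: real \<times> 'a. indicator A (fst q) :: ennreal) \<in> borel_measurable borel"
        using measurable_compose[OF fm(1) borel_measurable_indicator[OF A]] by simp
      have "ennreal T * (\<integral>\<^sup>+q. indicator A (fst q) \<partial>J) = (\<integral>\<^sup>+t\<in>{0..T}. (\<integral>\<^sup>+x. indicator A t \<partial>\<mu> t) \<partial>lborel)"
        unfolding J_def using nn_integral_joint_law(1)[OF ok im] by simp
      also have "\<dots> = (\<integral>\<^sup>+t. indicator ({0..T} \<inter> A) t \<partial>lborel)"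
      proof (intro nn_integral_cong)
        fix t :: real
        show "(\<integral>\<^sup>+x. indicator A t \<partial>\<mu> t) * indicator {0..T} t = (indicator ({0..T} \<inter> A) t :: ennreal)"
        proof (cases "t \<in> {0..T}")
          case True
          then have "\<mu> t \<in> space (prob_algebra borel)" using ok unfolding curve_ok_def by blast
          then interpret prob_space "\<mu> t" by (rule prob_algebra_borelD)
          show ?thesis using True by (auto simp: indicator_def emeasure_space_1)
        qed (auto simp: indicator_def)
      qed
      also have "\<dots> = emeasure lborel ({0..T} \<inter> A)" using A by simp
      finally have 2: "ennreal T * (\<integral>\<^sup>+q. indicator A (fst q) \<partial>J) = emeasure lborel ({0..T} \<inter> A)" .
      have "emeasure (uniform_measure lborel {0..T}) A = emeasure lborel ({0..T} \<inter> A) / ennreal T"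
        using A T by (subst emeasure_uniform_measure) auto
      also have "\<dots> = (\<integral>\<^sup>+q. indicator A (fst q) \<partial>J)"
        unfolding 2[symmetric] mult.commute[of "ennreal T"]
        by (rule mult_divide_eq_ennreal) (use T in auto)
      finally show "emeasure (distr \<eta> borel fst) A = emeasure (uniform_measure lborel {0..T}) A" using 1 by simp
    qed simp
    fix a :: "real \<Rightarrow> real" and \<psi> :: "'a \<Rightarrow> real" and G
    assume a: "continuous_on UNIV a" "bounded (range a)" and c: "C1c_fun \<psi> G"
    obtain B where B: "B > 0" "\<And>x. \<bar>\<psi> x\<bar> \<le> B" "\<And>x. norm (G x) \<le> B" using C1c_fun_bounded[OF c] by blast
    obtain C where C: "C > 0" "\<And>t. norm (a t) \<le> C" using a(2) unfolding bounded_pos by blast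
    have am: "(\<lambda>z :: real \<times> 'a \<times> (real ^ 'n). a (fst z) * \<psi> (fst (snd z))) \<in> borel_measurable borel"
      by (intro borel_measurable_continuous_onI continuous_on_mult continuous_on_compose2[OF a(1)]
          continuous_on_compose2[OF C1_funD(3)[OF C1c_funD(1)[OF c], of UNIV]]
          continuous_on_fst continuous_on_snd continuous_on_id) auto
    have am': "(\<lambda>z :: real \<times> 'a. a (fst z) * \<psi> (snd z)) \<in> borel_measurable borel"
      by (intro borel_measurable_continuous_onI continuous_on_mult continuous_on_compose2[OF a(1)]
          continuous_on_compose2[OF C1_funD(3)[OF C1c_funD(1)[OF c], of UNIV]]
          continuous_on_fst continuous_on_snd continuous_on_id) auto
    have "(LINT z|\<eta>. a (fst z) * \<psi> (fst (snd z))) = (LINT q|J. a (fst q) * \<psi> (snd q))"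
      unfolding \<eta>_def by (subst integral_distr[OF emJ am]) (simp add: e_def)
    moreover have "integrable J (\<lambda>q. a (fst q) * \<psi> (snd q))"
    proof (rule J.integrable_const_bound[of _ "C * B"])
      show "AE q in J. norm (a (fst q) * \<psi> (snd q)) \<le> C * B"
        using B C by (intro AE_I2) (auto simp: abs_mult intro!: mult_mono)
    qed (use am' Jcs in auto)
    ultimately show "T * (LINT z|\<eta>. a (fst z) * \<psi> (fst (snd z))) = (LINT t:{0..T}|lborel. a t * (LINT x|\<mu> t. \<psi> x))"
      using integral_joint_law[OF ok, of "\<lambda>q. a (fst q) * \<psi> (snd q)"] unfolding J_def by simp
  next
    fix \<phi> :: "real \<times> 'a \<Rightarrow> real" and A and G :: "real \<times> 'a \<Rightarrow> 'a"
    assume ph: "C1T_fun T \<phi> A G"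
    obtain K where K: "K > 0" "\<And>p. \<bar>A p\<bar> \<le> K" "\<And>p v. \<bar>G p \<bullet> ctrl F (snd p) v\<bar> \<le> K * norm v"
      "\<And>i p. \<bar>G p \<bullet> F i (snd p)\<bar> \<le> K" using C1T_bounds[OF ph] by blast
    define h where "h q = A q + G q \<bullet> ctrl F (snd q) (U q)" for q
    have hm: "h \<in> borel_measurable borel" unfolding h_def by (rule C1T_measurable(3)[OF ph Um])
    have ih: "integrable J h"
    proof (rule Bochner_Integration.integrable_bound)
      show "integrable J (\<lambda>q. K * (2 + (norm (U q))\<^sup>2))" using iU by simp
      show "AE q in J. norm (h q) \<le> norm (K * (2 + (norm (U q))\<^sup>2))"
      proof (rule AE_I2)
        fix q
        have "0 \<le> (norm (U q) - 1)\<^sup>2" by simp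
        then have "2 * norm (U q) \<le> 1 + (norm (U q))\<^sup>2" by (simp add: power2_eq_square algebra_simps)
        then have "norm (U q) \<le> 1 + (norm (U q))\<^sup>2" using norm_ge_zero[of "U q"] by linarith
        then have "K * norm (U q) \<le> K * (1 + (norm (U q))\<^sup>2)" using K(1) by (intro mult_left_mono) auto
        then have "\<bar>h q\<bar> \<le> K * (2 + (norm (U q))\<^sup>2)"
          using K(2)[of q] K(3)[of q "U q"] unfolding h_def by (simp add: algebra_simps)
        then show "norm (h q) \<le> norm (K * (2 + (norm (U q))\<^sup>2))" by simp
      qed
    qed (use hm Jcs in auto)
    note gm = plan_integrand_measurable[OF ph]
    have "(LINT z|\<eta>. A (tx z) + G (tx z) \<bullet> ctrl F (fst (snd z)) (snd (snd z))) = (LINT q|J. h q)"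
      unfolding \<eta>_def by (subst integral_distr[OF emJ gm]) (simp add: e_def h_def[abs_def])
    then have "T * (LINT z|\<eta>. A (tx z) + G (tx z) \<bullet> ctrl F (fst (snd z)) (snd (snd z))) = (LINT t:{0..T}|lborel. (LINT x|\<mu> t. h (t, x)))"
      using integral_joint_law[OF ok ih[unfolded J_def]] unfolding J_def by simp
    also have "\<dots> = (LINT t:{0..T}|lborel. (LINT x|\<mu> t. transport_integrand T H u \<phi> t x))"
      by (intro set_lebesgue_integral_cong) (auto simp: transport_integrand_eq[OF T ph] h_def H Uu)
    also have "\<dots> = (LINT x|\<mu> T. \<phi> (T, x)) - (LINT x|\<mu> 0. \<phi> (0, x))"
      using weak C1T_imp_C1c_test[OF T ph] unfolding weak_continuity_equation_def by blast
    finally show "T * (LINT z|\<eta>. A (tx z) + G (tx z) \<bullet> ctrl F (fst (snd z)) (snd (snd z)))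
        = (LINT x|\<mu> T. \<phi> (T, x)) - (LINT x|\<mu> 0. \<phi> (0, x))" .
  qed (fact \<eta>p i\<eta>)+
  then show ?thesis using cost' by blast
qed

end

subsection \<open>Existence of plans and of minimisers\<close>

context control_system begin

text \<open>The control, and with it the integrand, is merely measurable in time. The fundamental
  theorem of calculus is therefore used for the gauge integral with a finite exceptional set, and
  the uniform bound identifies the result with the Lebesgue integral.\<close>

lemma C1T_along_path:
  assumes ph: "C1T_fun T \<phi> A (G :: real \<times> 'a \<Rightarrow> 'a)" and c: "continuous_on {0..T} \<gamma>" and S: "finite S"
    and d: "\<And>t. t \<in> {0<..<T} - S \<Longrightarrow> (\<gamma> has_vector_derivative ctrl F (\<gamma> t) (v t)) (at t)"
    and vm: "v \<in> borel_measurable borel" and \<gamma>m: "\<gamma> \<in> borel_measurable borel" and vb: "\<And>t. norm (v t) \<le> b"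
  shows "(LINT t:{0..T}|lborel. A (t, \<gamma> t) + G (t, \<gamma> t) \<bullet> ctrl F (\<gamma> t) (v t)) = \<phi> (T, \<gamma> T) - \<phi> (0, \<gamma> 0)"
proof -
  let ?D = "\<lambda>t. A (t, \<gamma> t) + G (t, \<gamma> t) \<bullet> ctrl F (\<gamma> t) (v t)"
  let ?S = "{0..T} \<times> (UNIV :: 'a set)"
  have pd: "(\<phi> has_derivative (\<lambda>w. A z * fst w + G z \<bullet> snd w)) (at z within ?S)" if "z \<in> ?S" for z
    using ph that unfolding C1T_fun_def by blast
  have pc: "continuous_on ?S \<phi>"
    using has_derivative_continuous[OF pd] by (simp add: continuous_on_eq_continuous_within)
  have gc: "continuous_on {0..T} (\<lambda>t. \<phi> (t, \<gamma> t))"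
    by (rule continuous_on_compose2[OF pc continuous_on_Pair[OF continuous_on_id c]]) auto
  have gd: "((\<lambda>t. \<phi> (t, \<gamma> t)) has_vector_derivative ?D t) (at t)" if t: "t \<in> {0<..<T} - S" for t
  proof -
    have at: "at t within {0..T} = at t" using t by (intro at_within_Icc_at) auto
    have 1: "((\<lambda>t. (t, \<gamma> t)) has_derivative (\<lambda>h. (h, h *\<^sub>R ctrl F (\<gamma> t) (v t)))) (at t within {0..T})"
      using d[OF t] unfolding at has_vector_derivative_def by (rule has_derivative_Pair[OF has_derivative_ident])
    have "((\<lambda>t. \<phi> (t, \<gamma> t)) has_derivative (\<lambda>h. A (t, \<gamma> t) * fst (h, h *\<^sub>R ctrl F (\<gamma> t) (v t)) + G (t, \<gamma> t) \<bullet> snd (h, h *\<^sub>R ctrl F (\<gamma> t) (v t))))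
      (at t within {0..T})"
      by (rule has_derivative_in_compose2[OF pd _ _ 1]) (use t in auto)
    also have "(\<lambda>h. A (t, \<gamma> t) * fst (h, h *\<^sub>R ctrl F (\<gamma> t) (v t)) + G (t, \<gamma> t) \<bullet> snd (h, h *\<^sub>R ctrl F (\<gamma> t) (v t)))
        = (\<lambda>h. h *\<^sub>R ?D t)" by (auto simp: algebra_simps)
    finally show ?thesis unfolding at has_vector_derivative_def .
  qed
  have hi: "(?D has_integral \<phi> (T, \<gamma> T) - \<phi> (0, \<gamma> 0)) {0..T}"
    by (rule fundamental_theorem_of_calculus_interior_strong[OF S _ gd gc]) (use T in auto)
  obtain K where K: "K > 0" "\<And>p. \<bar>A p\<bar> \<le> K" "\<And>p w. \<bar>G p \<bullet> ctrl F (snd p) w\<bar> \<le> K * norm w"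
    "\<And>i p. \<bar>G p \<bullet> F i (snd p)\<bar> \<le> K" using C1T_bounds[OF ph] by blast
  have Db: "\<bar>?D t\<bar> \<le> K + K * b" for t
  proof -
    have "K * norm (v t) \<le> K * b" using K(1) vb[of t] by (intro mult_left_mono) auto
    then show ?thesis using K(2)[of "(t, \<gamma> t)"] K(3)[of "(t, \<gamma> t)" "v t"] by simp
  qed
  have "(\<lambda>t. (t, \<gamma> t, v t)) \<in> borel_measurable borel"
    by (intro borel_measurable_Pair \<gamma>m vm) simp
  from measurable_compose[OF this plan_integrand_measurable[OF ph]]
  have Dm: "?D \<in> borel_measurable borel" by simp
  have si: "set_integrable lborel {0..T} ?D"
    unfolding set_integrable_def
  proof (rule Bochner_Integration.integrable_bound)
    show "integrable lborel (\<lambda>t. indicator {0..T} t * (K + K * b))"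
      by (intro integrable_mult_left integrable_real_indicator) (use T in auto)
    show "AE t in lborel. norm (indicator {0..T} t *\<^sub>R ?D t) \<le> norm (indicator {0..T} t * (K + K * b))"
      using Db by (intro AE_I2) (auto simp: indicator_def intro: order_trans[OF _ abs_ge_self])
  qed (use Dm in simp)
  show ?thesis
    using set_borel_integral_eq_integral(2)[OF si] integral_unique[OF hi] by simp
qed

text \<open>Superposition of paths: \<open>\<eta>\<close> is the law of time, position and control
  observed at an independent uniform time. Each sample path satisfies the weak equation by the
  fundamental theorem of calculus, and Fubini's theorem averages these identities over the
  samples.\<close>

lemma random_path_plan:
  fixes X :: "'c \<Rightarrow> real \<Rightarrow> 'a" and V :: "'c \<Rightarrow> real \<Rightarrow> real ^ 'n"
  assumes M: "prob_space \<M>"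
    and Xm: "(\<lambda>(t, \<omega>). X \<omega> t) \<in> borel \<Otimes>\<^sub>M \<M> \<rightarrow>\<^sub>M borel" and Vm: "(\<lambda>(t, \<omega>). V \<omega> t) \<in> borel \<Otimes>\<^sub>M \<M> \<rightarrow>\<^sub>M borel"
    and Xc: "\<And>\<omega>. continuous_on {0..T} (X \<omega>)" and Vb: "\<And>\<omega> t. norm (V \<omega> t) \<le> b"
    and path: "\<And>\<omega>. \<exists>S. finite S \<and> (\<forall>t\<in>{0<..<T} - S. (X \<omega> has_vector_derivative ctrl F (X \<omega> t) (V \<omega> t)) (at t))"
    and Xsm: "\<And>\<omega>. X \<omega> \<in> borel_measurable borel" and Vsm: "\<And>\<omega>. V \<omega> \<in> borel_measurable borel"
  shows "\<exists>\<eta>. plan T F (\<lambda>t. distr \<M> borel (\<lambda>\<omega>. X \<omega> t)) \<eta> \<and> plan_energy \<eta> \<le> b\<^sup>2"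
proof -
  interpret M: prob_space \<M> by (rule M)
  define uT where "uT = uniform_measure lborel {0..T::real}"
  interpret u: prob_space uT
    unfolding uT_def by (rule prob_space_uniform_measure) (use T in auto)
  have us: "sets uT = sets borel" unfolding uT_def by simp
  interpret P: pair_prob_space uT \<M> ..
  define K where "K = uT \<Otimes>\<^sub>M \<M>"
  have Ks: "sets K = sets (borel \<Otimes>\<^sub>M \<M>)" unfolding K_def by (rule sets_pair_measure_cong[OF us refl])
  interpret K: prob_space K unfolding K_def by unfold_locales
  have Kcs: "measurable K N = measurable (borel \<Otimes>\<^sub>M \<M>) N" for N by (rule measurable_cong_sets[OF Ks refl])
  define e where "e p = (fst p, X (snd p) (fst p), V (snd p) (fst p))" for p
  have em0: "e \<in> borel \<Otimes>\<^sub>M \<M> \<rightarrow>\<^sub>M borel"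
    unfolding e_def using Xm Vm by (intro borel_measurable_Pair measurable_fst) (simp_all add: split_beta')
  then have em: "e \<in> borel_measurable K" unfolding Kcs .
  define \<eta> where "\<eta> = distr K borel e"
  have \<eta>p: "\<eta> \<in> space (prob_algebra borel)"
    unfolding \<eta>_def by (simp add: space_prob_algebra K.prob_space_distr[OF em])
  have Xt: "(\<lambda>\<omega>. X \<omega> t) \<in> borel_measurable \<M>" for t
    using measurable_compose[OF measurable_Pair1'[of t borel \<M>] Xm] by simp
  have intK: "integrable K f" if "f \<in> borel \<Otimes>\<^sub>M \<M> \<rightarrow>\<^sub>M borel" "\<And>p. \<bar>f p\<bar> \<le> C" for f :: "real \<times> 'c \<Rightarrow> real" and C
    by (rule K.integrable_const_bound[of _ C]) (use that Kcs in auto)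
  have nm: "(\<lambda>z :: real \<times> 'a \<times> (real ^ 'n). (norm (snd (snd z)))\<^sup>2) \<in> borel_measurable borel"
    by (intro borel_measurable_continuous_onI continuous_on_power continuous_on_norm continuous_on_snd continuous_on_id)
  have V2: "(norm (V \<omega> t))\<^sup>2 \<le> b\<^sup>2" for \<omega> t by (rule power_mono[OF Vb]) simp
  have iV: "integrable K (\<lambda>p. (norm (snd (snd (e p))))\<^sup>2)"
    by (rule intK[of _ "b\<^sup>2", OF measurable_compose[OF em0 nm]]) (simp add: e_def V2)
  have i\<eta>: "integrable \<eta> (\<lambda>z. (norm (snd (snd z)))\<^sup>2)"
    unfolding \<eta>_def using iV by (subst integrable_distr_eq[OF em nm])
  have "plan_energy \<eta> = (LINT p|K. (norm (snd (snd (e p))))\<^sup>2)"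
    unfolding plan_energy_def \<eta>_def by (rule integral_distr[OF em nm])
  also have "\<dots> \<le> (LINT p|K. b\<^sup>2)"
    by (rule integral_mono[OF iV]) (auto simp: e_def V2)
  finally have energy: "plan_energy \<eta> \<le> b\<^sup>2" by (simp add: K.prob_space)
  have \<mu>i: "(LINT x|distr \<M> borel (\<lambda>\<omega>. X \<omega> t). \<psi> x) = (LINT \<omega>|\<M>. \<psi> (X \<omega> t))" if "\<psi> \<in> borel_measurable borel" for \<psi> :: "'a \<Rightarrow> real" and t
    by (rule integral_distr[OF Xt that])
  have "plan T F (\<lambda>t. distr \<M> borel (\<lambda>\<omega>. X \<omega> t)) \<eta>"
    unfolding plan_def
  proof (intro conjI allI impI ballI)
    show "distr \<M> borel (\<lambda>\<omega>. X \<omega> t) \<in> space (prob_algebra borel)" for t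
      by (simp add: space_prob_algebra M.prob_space_distr[OF Xt])
    show "continuous_on {0..T} (\<lambda>t. LINT x|distr \<M> borel (\<lambda>\<omega>. X \<omega> t). \<psi> x)" if c: "C1c_fun \<psi> G" for \<psi> G
    proof -
      obtain B where B: "B > 0" "\<And>x. \<bar>\<psi> x\<bar> \<le> B" "\<And>x. norm (G x) \<le> B" using C1c_fun_bounded[OF c] by blast
      note pc = C1_funD(3)[OF C1c_funD(1)[OF c], of UNIV]
      note pm = C1c_fun_measurable(1)[OF c]
      show ?thesis
        unfolding \<mu>i[OF pm] continuous_on_sequentially comp_def
      proof (intro allI ballI impI)
        fix s t assume "t \<in> {0..T}" "(\<forall>n. s n \<in> {0..T}) \<and> s \<longlonglongrightarrow> t"
        then have t: "t \<in> {0..T}" and s: "\<And>n. s n \<in> {0..T}" "s \<longlonglongrightarrow> t" by auto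
        have l: "(\<lambda>n. \<psi> (X \<omega> (s n))) \<longlonglongrightarrow> \<psi> (X \<omega> t)" for \<omega>
        proof -
          have "continuous_on {0..T} (\<lambda>t. \<psi> (X \<omega> t))" by (rule continuous_on_compose2[OF pc Xc]) auto
          then show ?thesis using s t unfolding continuous_on_sequentially comp_def by blast
        qed
        show "(\<lambda>n. LINT \<omega>|\<M>. \<psi> (X \<omega> (s n))) \<longlonglongrightarrow> (LINT \<omega>|\<M>. \<psi> (X \<omega> t))"
        proof (rule integral_dominated_convergence[where w = "\<lambda>_. B"])
          show "AE \<omega> in \<M>. (\<lambda>n. \<psi> (X \<omega> (s n))) \<longlonglongrightarrow> \<psi> (X \<omega> t)" using l by simp
          show "AE \<omega> in \<M>. norm (\<psi> (X \<omega> (s n))) \<le> B" for n using B(2) by simp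
        qed (auto intro!: measurable_compose[OF Xt pm])
      qed
    qed
    show "distr \<eta> borel fst = uniform_measure lborel {0..T}"
    proof -
      have fm: "fst \<in> borel_measurable (borel :: (real \<times> 'a \<times> (real ^ 'n)) measure)"
        by (intro borel_measurable_continuous_onI continuous_on_fst continuous_on_id)
      have "distr \<eta> borel fst = distr K borel (fst \<circ> e)"
        unfolding \<eta>_def by (rule distr_distr[OF fm em])
      also have "fst \<circ> e = fst" unfolding e_def by auto
      also have "distr K borel fst = distr K uT fst" by (rule distr_cong) (simp_all add: us)
      also have "\<dots> = uT" unfolding K_def by (rule M.distr_pair_fst)
      finally show ?thesis unfolding uT_def .
    qed
    fix a :: "real \<Rightarrow> real" and \<psi> :: "'a \<Rightarrow> real" and G
    assume a: "continuous_on UNIV a" "bounded (range a)" and c: "C1c_fun \<psi> G"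
    obtain B where B: "B > 0" "\<And>x. \<bar>\<psi> x\<bar> \<le> B" "\<And>x. norm (G x) \<le> B" using C1c_fun_bounded[OF c] by blast
    obtain C where C: "C > 0" "\<And>t. norm (a t) \<le> C" using a(2) unfolding bounded_pos by blast
    note pm = C1c_fun_measurable(1)[OF c]
    have am: "(\<lambda>z :: real \<times> 'a \<times> (real ^ 'n). a (fst z) * \<psi> (fst (snd z))) \<in> borel_measurable borel"
      by (intro borel_measurable_continuous_onI continuous_on_mult continuous_on_compose2[OF a(1)]
          continuous_on_compose2[OF C1_funD(3)[OF C1c_funD(1)[OF c], of UNIV]]
          continuous_on_fst continuous_on_snd continuous_on_id) auto
    define h where "h p = a (fst p) * \<psi> (X (snd p) (fst p))" for p
    have he: "h p = a (fst (e p)) * \<psi> (fst (snd (e p)))" for p unfolding h_def e_def by simp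
    have hm: "h \<in> borel \<Otimes>\<^sub>M \<M> \<rightarrow>\<^sub>M borel" unfolding he by (rule measurable_compose[OF em0 am])
    have hb: "\<bar>h p\<bar> \<le> C * B" for p unfolding h_def abs_mult using B C by (intro mult_mono) auto
    have ih: "integrable K h" by (rule intK[OF hm hb])
    have "(LINT z|\<eta>. a (fst z) * \<psi> (fst (snd z))) = (LINT p|K. h p)"
      unfolding \<eta>_def he by (rule integral_distr[OF em am])
    also have "\<dots> = (LINT t|uT. LINT \<omega>|\<M>. h (t, \<omega>))"
      unfolding K_def by (rule P.integral_fst'[OF ih[unfolded K_def], symmetric])
    finally have "T * (LINT z|\<eta>. a (fst z) * \<psi> (fst (snd z))) = T * (LINT t|uT. LINT \<omega>|\<M>. h (t, \<omega>))" by simp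
    also have "\<dots> = (LINT t:{0..T}|lborel. (LINT \<omega>|\<M>. h (t, \<omega>)))"
      unfolding uT_def by (rule integral_uniform_time[OF T]) (use M.borel_measurable_lebesgue_integral[of "\<lambda>t \<omega>. h (t, \<omega>)" borel] hm in simp)
    also have "\<dots> = (LINT t:{0..T}|lborel. a t * (LINT x|distr \<M> borel (\<lambda>\<omega>. X \<omega> t). \<psi> x))"
      unfolding \<mu>i[OF pm] h_def by simp
    finally show "T * (LINT z|\<eta>. a (fst z) * \<psi> (fst (snd z))) = (LINT t:{0..T}|lborel. a t * (LINT x|distr \<M> borel (\<lambda>\<omega>. X \<omega> t). \<psi> x))" .
  next
    fix \<phi> :: "real \<times> 'a \<Rightarrow> real" and A and G :: "real \<times> 'a \<Rightarrow> 'a"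
    assume ph: "C1T_fun T \<phi> A G"
    obtain B where B: "B > 0" "\<And>p. \<bar>A p\<bar> \<le> B" "\<And>p w. \<bar>G p \<bullet> ctrl F (snd p) w\<bar> \<le> B * norm w"
      "\<And>i p. \<bar>G p \<bullet> F i (snd p)\<bar> \<le> B" using C1T_bounds[OF ph] by blast
    define q where "q z = A (tx z) + G (tx z) \<bullet> ctrl F (fst (snd z)) (snd (snd z))" for z
    have qm: "q \<in> borel_measurable borel" unfolding q_def by (rule plan_integrand_measurable[OF ph])
    have qb: "\<bar>q (e p)\<bar> \<le> B + B * b" for p
    proof -
      have "B * norm (snd (snd (e p))) \<le> B * b" unfolding e_def using B(1) Vb by (intro mult_left_mono) auto
      then show ?thesis unfolding q_def using B(2)[of "tx (e p)"] B(3)[of "tx (e p)" "snd (snd (e p))"] by simp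
    qed
    have iq: "integrable K (\<lambda>p. q (e p))" by (rule intK[OF measurable_compose[OF em0 qm] qb])
    have "(LINT z|\<eta>. q z) = (LINT p|K. q (e p))"
      unfolding \<eta>_def by (rule integral_distr[OF em qm])
    also have "\<dots> = (LINT \<omega>|\<M>. LINT t|uT. q (e (t, \<omega>)))"
      using P.integral_snd[of "\<lambda>t \<omega>. q (e (t, \<omega>))"] iq unfolding K_def by (simp add: split_beta')
    finally have "T * (LINT z|\<eta>. q z) = (LINT \<omega>|\<M>. T * (LINT t|uT. q (e (t, \<omega>))))" by simp
    also have "\<dots> = (LINT \<omega>|\<M>. \<phi> (T, X \<omega> T) - \<phi> (0, X \<omega> 0))"
    proof (intro Bochner_Integration.integral_cong refl)
      fix \<omega>
      obtain S where S: "finite S" "\<And>t. t \<in> {0<..<T} - S \<Longrightarrow> (X \<omega> has_vector_derivative ctrl F (X \<omega> t) (V \<omega> t)) (at t)"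
        using path[of \<omega>] by blast
      have "(\<lambda>t. (t, X \<omega> t, V \<omega> t)) \<in> borel_measurable borel"
        by (intro borel_measurable_Pair Xsm Vsm) simp
      from measurable_compose[OF this qm]
      have m: "(\<lambda>t. q (e (t, \<omega>))) \<in> borel_measurable borel" unfolding e_def by simp
      have "T * (LINT t|uT. q (e (t, \<omega>))) = (LINT t:{0..T}|lborel. q (e (t, \<omega>)))"
        unfolding uT_def by (rule integral_uniform_time[OF T m])
      also have "\<dots> = \<phi> (T, X \<omega> T) - \<phi> (0, X \<omega> 0)"
        using C1T_along_path[OF ph Xc S Vsm Xsm Vb] unfolding q_def e_def by simp
      finally show "T * (LINT t|uT. q (e (t, \<omega>))) = \<phi> (T, X \<omega> T) - \<phi> (0, X \<omega> 0)" .
    qed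
    also have "\<dots> = (LINT \<omega>|\<M>. \<phi> (T, X \<omega> T)) - (LINT \<omega>|\<M>. \<phi> (0, X \<omega> 0))"
    proof (rule Bochner_Integration.integral_diff)
      have i: "integrable \<M> (\<lambda>\<omega>. \<phi> (t, X \<omega> t))" if t: "t \<in> {0..T}" for t
      proof -
        note c = C1T_slice[OF ph t]
        obtain B where B: "B > 0" "\<And>x. \<bar>\<phi> (t, x)\<bar> \<le> B" "\<And>x. norm (G (t, x)) \<le> B" using C1c_fun_bounded[OF c] by blast
        show ?thesis
          by (rule M.integrable_const_bound[of _ B]) (use B(2) measurable_compose[OF Xt C1c_fun_measurable(1)[OF c]] in auto)
      qed
      from i[of T] i[of 0] show "integrable \<M> (\<lambda>\<omega>. \<phi> (T, X \<omega> T))" "integrable \<M> (\<lambda>\<omega>. \<phi> (0, X \<omega> 0))"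
        using T by simp_all
    qed
    also have "\<dots> = (LINT x|distr \<M> borel (\<lambda>\<omega>. X \<omega> T). \<phi> (T, x)) - (LINT x|distr \<M> borel (\<lambda>\<omega>. X \<omega> 0). \<phi> (0, x))"
      using \<mu>i[OF C1c_fun_measurable(1)[OF C1T_slice[OF ph]]] T by simp
    finally show "T * (LINT z|\<eta>. A (tx z) + G (tx z) \<bullet> ctrl F (fst (snd z)) (snd (snd z)))
        = (LINT x|distr \<M> borel (\<lambda>\<omega>. X \<omega> T). \<phi> (T, x)) - (LINT x|distr \<M> borel (\<lambda>\<omega>. X \<omega> 0). \<phi> (0, x))"
      unfolding q_def .
  qed (fact \<eta>p i\<eta>)+
  then show ?thesis using energy by blast
qed

end

text \<open>The complement of the support is the union of all open null sets. By Lindelof's theorem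
  countably many of them suffice, so the complement is itself null.\<close>

lemma AE_bounded_support:
  fixes \<nu> :: "'a::euclidean_space measure"
  assumes \<nu>: "\<nu> \<in> space (prob_algebra borel)" and c: "compact (measure_support \<nu>)"
  obtains R where "AE x in \<nu>. norm x \<le> R"
proof -
  define \<F> where "\<F> = {W :: 'a set. open W \<and> W \<in> null_sets \<nu>}"
  have "open W" if "W \<in> \<F>" for W using that unfolding \<F>_def by blast
  then obtain \<F>' where F': "\<F>' \<subseteq> \<F>" "countable \<F>'" "\<Union>\<F>' = \<Union>\<F>" by (rule Lindelof)
  have "(\<Union>W\<in>\<F>'. W) \<in> null_sets \<nu>"
    by (rule null_sets_UN'[OF F'(2)]) (use F'(1) in \<open>auto simp: \<F>_def\<close>)
  then have "\<Union>\<F> \<in> null_sets \<nu>" using F'(3) by simp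
  then have AE: "AE x in \<nu>. x \<notin> \<Union>\<F>" by (rule AE_not_in)
  obtain R where R: "\<And>x. x \<in> measure_support \<nu> \<Longrightarrow> norm x \<le> R"
    using compact_imp_bounded[OF c] unfolding bounded_iff by blast
  have "norm x \<le> R" if "x \<notin> \<Union>\<F>" for x
  proof (rule R, unfold measure_support_def, intro CollectI allI impI)
    fix W assume W: "open W \<and> x \<in> W"
    then have "W \<notin> null_sets \<nu>" using that unfolding \<F>_def by blast
    moreover have "W \<in> sets \<nu>" using W prob_algebra_borelD(2)[OF \<nu>] by simp
    ultimately show "0 < emeasure \<nu> W" by (simp add: null_sets_def zero_less_iff_neq_zero)
  qed
  then have "AE x in \<nu>. norm x \<le> R" using AE by (auto elim: eventually_mono)
  then show ?thesis by (rule that)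
qed

section \<open>Random paths with nearly prescribed endpoint laws\<close>

lemma distr_pair_snd:
  assumes "prob_space N" "prob_space M"
  shows "distr (N \<Otimes>\<^sub>M M) M snd = M"
proof (rule measure_eqI)
  interpret N: prob_space N by (rule assms)
  interpret M: prob_space M by (rule assms)
  fix A assume "A \<in> sets (distr (N \<Otimes>\<^sub>M M) M snd)"
  then have A: "A \<in> sets M" by simp
  have "snd -` A \<inter> space (N \<Otimes>\<^sub>M M) = space N \<times> A"
    using sets.sets_into_space[OF A] by (auto simp: space_pair_measure)
  then show "emeasure (distr (N \<Otimes>\<^sub>M M) M snd) A = emeasure M A"
    using A by (simp add: emeasure_distr M.emeasure_pair_measure_Times N.emeasure_space_1)
qed simp

lemma tendsto_integral_C1c:
  fixes Y :: "nat \<Rightarrow> 'c \<Rightarrow> 'a::euclidean_space"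
  assumes M: "prob_space M" and c: "C1c_fun \<psi> G" and Yk: "\<And>k. Y k \<in> borel_measurable M" and Z: "Z \<in> borel_measurable M"
    and l: "AE \<omega> in M. (\<lambda>k. Y k \<omega>) \<longlonglongrightarrow> Z \<omega>"
  shows "(\<lambda>k. LINT x|distr M borel (Y k). \<psi> x) \<longlonglongrightarrow> (LINT x|distr M borel Z. \<psi> x)"
proof -
  interpret prob_space M by (rule M)
  note pm = C1c_fun_measurable(1)[OF c]
  obtain B where B: "B > 0" "\<And>x. \<bar>\<psi> x\<bar> \<le> B" "\<And>x. norm (G x) \<le> B" using C1c_fun_bounded[OF c] by blast
  have cont: "isCont \<psi> x" for x
    using C1_funD(3)[OF C1c_funD(1)[OF c], of UNIV] by (simp add: continuous_on_eq_continuous_at)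
  have "(\<lambda>k. LINT \<omega>|M. \<psi> (Y k \<omega>)) \<longlonglongrightarrow> (LINT \<omega>|M. \<psi> (Z \<omega>))"
  proof (rule integral_dominated_convergence[where w = "\<lambda>_. B"])
    show "AE \<omega> in M. (\<lambda>k. \<psi> (Y k \<omega>)) \<longlonglongrightarrow> \<psi> (Z \<omega>)"
      using l by (rule eventually_mono) (rule isCont_tendsto_compose[OF cont])
    show "AE \<omega> in M. norm (\<psi> (Y k \<omega>)) \<le> B" for k using B(2) by simp
    show "(\<lambda>\<omega>. \<psi> (Y k \<omega>)) \<in> borel_measurable M" for k by (rule measurable_compose[OF Yk pm])
    show "(\<lambda>\<omega>. \<psi> (Z \<omega>)) \<in> borel_measurable M" by (rule measurable_compose[OF Z pm])
  qed simp
  then show ?thesis unfolding integral_distr[OF Yk pm] integral_distr[OF Z pm] .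
qed

text \<open>
  Rounding the endpoints to a countable dense set makes the choice of a path between them measurable
  without a selection theorem.
\<close>

lemma dense_rounding:
  obtains d :: "nat \<Rightarrow> 'a::euclidean_space" and idx :: "nat \<Rightarrow> 'a \<Rightarrow> nat"
  where "\<forall>k. idx k \<in> borel \<rightarrow>\<^sub>M count_space UNIV" "\<forall>k x. norm (d (idx k x) - x) < inverse (real (Suc k))"
proof -
  obtain D :: "'a set" where D: "countable D" "\<And>X. open X \<Longrightarrow> X \<noteq> {} \<Longrightarrow> \<exists>d\<in>D. d \<in> X"
    by (rule countable_dense_setE) blast
  define d where "d = from_nat_into D"
  have ex: "\<exists>n. norm (d n - x) < inverse (real (Suc k))" for k x
  proof -
    obtain y where "y \<in> D" "y \<in> ball x (inverse (real (Suc k)))"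
      using D(2)[of "ball x (inverse (real (Suc k)))"] by auto
    then show ?thesis
      using from_nat_into_surj[OF D(1)] unfolding d_def by (metis dist_norm mem_ball norm_minus_commute)
  qed
  define idx where "idx k x = (LEAST n. norm (d n - x) < inverse (real (Suc k)))" for k x
  show ?thesis
  proof (rule that[of idx d])
    show "\<forall>k. idx k \<in> borel \<rightarrow>\<^sub>M count_space UNIV"
      unfolding idx_def by (intro allI) measurable
    show "\<forall>k x. norm (d (idx k x) - x) < inverse (real (Suc k))"
      unfolding idx_def by (intro allI LeastI_ex[OF ex])
  qed
qed

context control_system begin

text \<open>Running the path on [0,T] multiplies the control by \<open>C / T\<close>. One constant
  \<open>C\<close> for all pairs of points thus yields one bound on the controls, and with it on the
  energies.\<close>

lemma reach_path:
  assumes r: "reach F C x z" and C: "0 < C"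
  shows "\<exists>\<gamma> v. \<gamma> 0 = x \<and> \<gamma> T = z \<and> continuous_on {0..T} \<gamma> \<and> \<gamma> \<in> borel_measurable borel \<and> v \<in> borel_measurable borel \<and>
    (\<forall>t. norm (v t) \<le> C / T) \<and>
    (\<exists>S. finite S \<and> (\<forall>t\<in>{0<..<T} - S. (\<gamma> has_vector_derivative ctrl F (\<gamma> t) (v t)) (at t)))"
proof -
  obtain \<gamma> v where h: "horizontal F C \<gamma> v" and e: "\<gamma> 0 = x" "\<gamma> C = z" using r unfolding reach_def by blast
  have c: "continuous_on {0..C} \<gamma>" and vm: "v \<in> borel_measurable borel" and vb: "\<And>t. norm (v t) \<le> 1"
    using h unfolding horizontal_def by blast+
  obtain S where S: "finite S" "\<And>t. t \<in> {0<..<C} - S \<Longrightarrow> (\<gamma> has_vector_derivative (\<Sum>i\<in>UNIV. (v t $ i) *\<^sub>R F i (\<gamma> t))) (at t)"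
    using h unfolding horizontal_def by blast
  \<comment> \<open>Clamping extends the rescaled path continuously to the whole line, which
    supplies its Borel measurability.\<close>
  define cl where "cl t = max 0 (min T t)" for t :: real
  have cl: "cl t \<in> {0..T}" for t unfolding cl_def using T by auto
  have cl_id: "cl t = t" if "t \<in> {0..T}" for t unfolding cl_def using that by auto
  have clc: "continuous_on UNIV cl"
    unfolding cl_def by (intro continuous_on_max continuous_on_min continuous_on_id continuous_on_const)
  define \<gamma>' where "\<gamma>' t = \<gamma> (cl t * (C / T))" for t
  define v' where "v' t = (C / T) *\<^sub>R v (t * (C / T))" for t
  have range: "s * (C / T) \<in> {0..C}" if "s \<in> {0..T}" for s
    using that T C by (auto simp: field_simps)
  have \<gamma>'c: "continuous_on UNIV \<gamma>'"
    unfolding \<gamma>'_def by (rule continuous_on_compose2[OF c continuous_on_mult[OF clc continuous_on_const]]) (use range cl in blast)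
  have "(\<gamma>' has_vector_derivative ctrl F (\<gamma>' t) (v' t)) (at t)" if t: "t \<in> {0<..<T} - (\<lambda>s. s * (T / C)) ` S" for t
  proof -
    have tS: "t * (C / T) \<notin> S"
    proof
      assume "t * (C / T) \<in> S"
      then have "t * (C / T) * (T / C) \<in> (\<lambda>s. s * (T / C)) ` S" by (rule imageI)
      then show False using t T C by simp
    qed
    have t0: "t * (C / T) \<in> {0<..<C}" using t T C by (auto simp: field_simps)
    have 1: "((\<lambda>t. t * (C / T)) has_vector_derivative (C / T)) (at t)"
      using T by (auto intro!: derivative_eq_intros simp: has_vector_derivative_def)
    have "((\<gamma> \<circ> (\<lambda>t. t * (C / T))) has_vector_derivative (C / T) *\<^sub>R (\<Sum>i\<in>UNIV. (v (t * (C / T)) $ i) *\<^sub>R F i (\<gamma> (t * (C / T))))) (at t)"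
      by (rule vector_diff_chain_at[OF 1 S(2)]) (use t0 tS in blast)
    moreover have "(C / T) *\<^sub>R (\<Sum>i\<in>UNIV. (v (t * (C / T)) $ i) *\<^sub>R F i (\<gamma> (t * (C / T)))) = ctrl F (\<gamma>' t) (v' t)"
      unfolding ctrl_def v'_def \<gamma>'_def using cl_id[of t] t by (simp add: scaleR_sum_right)
    ultimately have d: "((\<gamma> \<circ> (\<lambda>t. t * (C / T))) has_vector_derivative ctrl F (\<gamma>' t) (v' t)) (at t)" by simp
    show ?thesis
      by (rule has_vector_derivative_transform_within_open[OF d, of "{0<..<T}"]) (use t cl_id in \<open>auto simp: \<gamma>'_def\<close>)
  qed
  moreover have "finite ((\<lambda>s. s * (T / C)) ` S)" using S(1) by simp
  ultimately have "\<exists>S. finite S \<and> (\<forall>t\<in>{0<..<T} - S. (\<gamma>' has_vector_derivative ctrl F (\<gamma>' t) (v' t)) (at t))" by blast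
  moreover have "\<gamma>' 0 = x" "\<gamma>' T = z" unfolding \<gamma>'_def using e cl_id[of 0] cl_id[of T] T by simp_all
  moreover have "continuous_on {0..T} \<gamma>'" "\<gamma>' \<in> borel_measurable borel"
    using \<gamma>'c continuous_on_subset[OF \<gamma>'c] borel_measurable_continuous_onI[OF \<gamma>'c] by auto
  moreover have "v' \<in> borel_measurable borel"
  proof -
    have "(\<lambda>t. t * (C / T)) \<in> borel_measurable borel" by simp
    from measurable_compose[OF this vm] show ?thesis unfolding v'_def by (intro borel_measurable_scaleR) auto
  qed
  moreover have "norm (v' t) \<le> C / T" for t
    unfolding v'_def using vb[of "t * (C / T)"] T C mult_left_mono[OF vb, of "C / T"] by simp
  ultimately show ?thesis by blast
qed

text \<open>The endpoints are drawn independently from \<open>m0\<close> and \<open>mT\<close>. For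
  each \<open>k\<close>, both are rounded to a dense sequence, and a path from the first rounded
  point to nearly the second is selected from a countable family. As \<open>k\<close> grows, the
  endpoint laws converge to the prescribed ones while the energies stay below the square of
  \<open>C / T\<close>, so compactness removes all the approximations at once.\<close>

lemma plan_exists:
  fixes m0 mT :: "'a measure"
  assumes F: "\<And>i. smooth_on UNIV (F i)"
    and gen: "\<And>x. span {g x | g. g \<in> (\<Union>i\<in>{0..m}. iterated_brackets (range F) i)} = UNIV"
    and m0: "m0 \<in> space (prob_algebra borel)" "AE x in m0. norm x \<le> R0"
    and mT: "mT \<in> space (prob_algebra borel)" "AE x in mT. norm x \<le> R0"
  obtains \<mu> \<eta> where "plan T F \<mu> \<eta>" "\<mu> 0 = m0" "\<mu> T = mT"
proof -
  note goal_rule = that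
  obtain d :: "nat \<Rightarrow> 'a" and idx where id: "\<forall>k. idx k \<in> borel \<rightarrow>\<^sub>M count_space UNIV"
    "\<forall>k x. norm (d (idx k x) - x) < inverse (real (Suc k))"
    by (rule dense_rounding)
  note idm = id(1)[rule_format] and idd = id(2)[rule_format]
  \<comment> \<open>The extra 1 leaves room for the rounding, which moves a point by less than
    \<open>inverse (real (Suc k))\<close>.\<close>
  define R where "R = \<bar>R0\<bar> + 1"
  have R: "R > 0" unfolding R_def by simp
  obtain C0 where C0: "0 \<le> C0" "\<And>x y e. norm x \<le> R \<Longrightarrow> norm y \<le> R \<Longrightarrow> e > 0 \<Longrightarrow> \<exists>z. reach F C0 x z \<and> norm (z - y) \<le> e"
    by (rule chow_approx[OF F gen R]) blast
  define C where "C = C0 + 1"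
  have C: "C > 0" unfolding C_def using C0(1) by simp
  \<comment> \<open>The condition at the final time is imposed only when both rounded endpoints lie
    in the ball. Otherwise the constant path qualifies, so that a path can be chosen for every
    triple of indices.\<close>
  define good where "good p \<gamma> v \<longleftrightarrow> \<gamma> 0 = d (fst (snd p)) \<and>
    (norm (d (fst (snd p))) \<le> R \<longrightarrow> norm (d (snd (snd p))) \<le> R \<longrightarrow> norm (\<gamma> T - d (snd (snd p))) \<le> inverse (real (Suc (fst p)))) \<and>
    continuous_on {0..T} \<gamma> \<and> \<gamma> \<in> borel_measurable borel \<and> v \<in> borel_measurable borel \<and> (\<forall>t. norm (v t) \<le> C / T) \<and>
    (\<exists>S. finite S \<and> (\<forall>t\<in>{0<..<T} - S. (\<gamma> has_vector_derivative ctrl F (\<gamma> t) (v t)) (at t)))"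
    for p :: "nat \<times> nat \<times> nat" and \<gamma> :: "real \<Rightarrow> 'a" and v :: "real \<Rightarrow> real ^ 'n"
  have "\<exists>q. good p (fst q) (snd q)" for p
  proof -
    have "\<exists>z. reach F C (d (fst (snd p))) z \<and>
      (norm (d (fst (snd p))) \<le> R \<longrightarrow> norm (d (snd (snd p))) \<le> R \<longrightarrow> norm (z - d (snd (snd p))) \<le> inverse (real (Suc (fst p))))"
    proof (cases "norm (d (fst (snd p))) \<le> R \<and> norm (d (snd (snd p))) \<le> R")
      case True
      then obtain z where z: "reach F C0 (d (fst (snd p))) z" "norm (z - d (snd (snd p))) \<le> inverse (real (Suc (fst p)))"
        using C0(2)[of "d (fst (snd p))" "d (snd (snd p))" "inverse (real (Suc (fst p)))"] by auto
      have "reach F C (d (fst (snd p))) z" by (rule reach_mono[OF z(1)]) (simp add: C_def)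
      then show ?thesis using z(2) by blast
    next
      case False
      have "reach F C (d (fst (snd p))) (d (fst (snd p)))" by (rule reach_refl) (use C in simp)
      then show ?thesis using False by blast
    qed
    then obtain z where z: "reach F C (d (fst (snd p))) z"
      "norm (d (fst (snd p))) \<le> R \<longrightarrow> norm (d (snd (snd p))) \<le> R \<longrightarrow> norm (z - d (snd (snd p))) \<le> inverse (real (Suc (fst p)))" by blast
    obtain \<gamma> v where "\<gamma> 0 = d (fst (snd p))" "\<gamma> T = z" "continuous_on {0..T} \<gamma>" "\<gamma> \<in> borel_measurable borel" "v \<in> borel_measurable borel"
      "\<forall>t. norm (v t) \<le> C / T" "\<exists>S. finite S \<and> (\<forall>t\<in>{0<..<T} - S. (\<gamma> has_vector_derivative ctrl F (\<gamma> t) (v t)) (at t))"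
      using reach_path[OF z(1) C] by blast
    then have "good p \<gamma> v" unfolding good_def using z(2) by simp
    then show ?thesis by (intro exI[of _ "(\<gamma>, v)"]) simp
  qed
  then have "\<forall>p. \<exists>q. good p (fst q) (snd q)" by blast
  from choice[OF this] obtain Q where Q: "\<And>p. good p (fst (Q p)) (snd (Q p))" by blast
  define P where "P k \<omega> = (k, idx k (fst \<omega>), idx k (snd \<omega>))" for k and \<omega> :: "'a \<times> 'a"
  define X where "X k \<omega> = fst (Q (P k \<omega>))" for k \<omega>
  define V where "V k \<omega> = snd (Q (P k \<omega>))" for k \<omega>
  have X0: "X k \<omega> 0 = d (idx k (fst \<omega>))" for k \<omega> using Q[of "P k \<omega>"] unfolding good_def X_def P_def by simp
  have XT: "norm (X k \<omega> T - d (idx k (snd \<omega>))) \<le> inverse (real (Suc k))"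
    if "norm (d (idx k (fst \<omega>))) \<le> R" "norm (d (idx k (snd \<omega>))) \<le> R" for k \<omega>
    using Q[of "P k \<omega>"] that unfolding good_def X_def P_def by simp
  have Xc: "continuous_on {0..T} (X k \<omega>)" and Xs: "X k \<omega> \<in> borel_measurable borel" and Vs: "V k \<omega> \<in> borel_measurable borel"
    and Vb: "norm (V k \<omega> t) \<le> C / T"
    and path: "\<exists>S. finite S \<and> (\<forall>t\<in>{0<..<T} - S. (X k \<omega> has_vector_derivative ctrl F (X k \<omega> t) (V k \<omega> t)) (at t))" for k \<omega> t
    using Q[of "P k \<omega>"] unfolding good_def X_def V_def by blast+
  have Qm: "fst (Q p) \<in> borel_measurable borel" "snd (Q p) \<in> borel_measurable borel" for p
    using Q[of p] unfolding good_def by blast+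
  note D0 = prob_algebra_borelD[OF m0(1)] and DT = prob_algebra_borelD[OF mT(1)]
  interpret M0: prob_space m0 by (rule D0)
  interpret MT: prob_space mT by (rule DT)
  interpret P: pair_prob_space m0 mT ..
  define \<M> where "\<M> = m0 \<Otimes>\<^sub>M mT"
  interpret M: prob_space \<M> unfolding \<M>_def by unfold_locales
  have fm: "fst \<in> \<M> \<rightarrow>\<^sub>M borel" and sm: "snd \<in> \<M> \<rightarrow>\<^sub>M borel"
    using measurable_fst[of m0 mT] measurable_snd[of m0 mT] measurable_cong_sets[OF refl D0(2)] measurable_cong_sets[OF refl DT(2)]
    unfolding \<M>_def by auto
  have sel: "(\<lambda>(t, \<omega>). h (P k \<omega>) t) \<in> borel \<Otimes>\<^sub>M \<M> \<rightarrow>\<^sub>M borel" if h: "\<And>p. h p \<in> borel_measurable borel"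
    for h :: "nat \<times> nat \<times> nat \<Rightarrow> real \<Rightarrow> 'b::euclidean_space" and k
  proof -
    have i1: "(\<lambda>q. idx k (fst (snd q))) \<in> (borel :: real measure) \<Otimes>\<^sub>M \<M> \<rightarrow>\<^sub>M count_space UNIV"
      by (rule measurable_compose[OF measurable_compose[OF measurable_snd fm] idm])
    have i2: "(\<lambda>q. idx k (snd (snd q))) \<in> (borel :: real measure) \<Otimes>\<^sub>M \<M> \<rightarrow>\<^sub>M count_space UNIV"
      by (rule measurable_compose[OF measurable_compose[OF measurable_snd sm] idm])
    have 0: "(\<lambda>q. h (k, n, l) (fst q)) \<in> borel \<Otimes>\<^sub>M \<M> \<rightarrow>\<^sub>M borel" for n l
      by (rule measurable_compose[OF measurable_fst h])
    have 1: "(\<lambda>q. h (k, n, idx k (snd (snd q))) (fst q)) \<in> borel \<Otimes>\<^sub>M \<M> \<rightarrow>\<^sub>M borel" for n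
      by (rule measurable_compose_countable[where f = "\<lambda>l q. h (k, n, l) (fst q)", OF 0 i2])
    have "(\<lambda>q. h (k, idx k (fst (snd q)), idx k (snd (snd q))) (fst q)) \<in> borel \<Otimes>\<^sub>M \<M> \<rightarrow>\<^sub>M borel"
      by (rule measurable_compose_countable[where f = "\<lambda>n q. h (k, n, idx k (snd (snd q))) (fst q)", OF 1 i1])
    then show ?thesis unfolding P_def split_beta' .
  qed
  have Xm: "(\<lambda>(t, \<omega>). X k \<omega> t) \<in> borel \<Otimes>\<^sub>M \<M> \<rightarrow>\<^sub>M borel" for k unfolding X_def by (rule sel[OF Qm(1)])
  have Vm: "(\<lambda>(t, \<omega>). V k \<omega> t) \<in> borel \<Otimes>\<^sub>M \<M> \<rightarrow>\<^sub>M borel" for k unfolding V_def by (rule sel[OF Qm(2)])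
  have Xt: "(\<lambda>\<omega>. X k \<omega> t) \<in> borel_measurable \<M>" for k t
    using measurable_compose[OF measurable_Pair1'[of t borel \<M>] Xm] by simp
  define \<mu> where "\<mu> k t = distr \<M> borel (\<lambda>\<omega>. X k \<omega> t)" for k t
  have "\<exists>\<eta>. plan T F (\<mu> k) \<eta> \<and> plan_energy \<eta> \<le> (C / T)\<^sup>2" for k
    using random_path_plan[OF M.prob_space_axioms Xm Vm Xc Vb path Xs Vs] unfolding \<mu>_def .
  then have "\<forall>k. \<exists>\<eta>. plan T F (\<mu> k) \<eta> \<and> plan_energy \<eta> \<le> (C / T)\<^sup>2" by blast
  from choice[OF this] obtain \<eta> where \<eta>: "\<And>k. plan T F (\<mu> k) (\<eta> k)" "\<And>k. plan_energy (\<eta> k) \<le> (C / T)\<^sup>2" by blast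
  have df: "distr \<M> borel fst = m0"
    using MT.distr_pair_fst[of m0] distr_cong[OF refl D0(2)[symmetric], of \<M> fst fst] unfolding \<M>_def by simp
  have ds: "distr \<M> borel snd = mT"
    using distr_pair_snd[OF D0(1) DT(1)] distr_cong[OF refl DT(2)[symmetric], of \<M> snd snd] unfolding \<M>_def by simp
  have A0: "AE \<omega> in \<M>. norm (fst \<omega>) \<le> R0" by (rule AE_distrD[OF fm]) (unfold df, rule m0(2))
  have AT: "AE \<omega> in \<M>. norm (snd \<omega>) \<le> R0" by (rule AE_distrD[OF sm]) (unfold ds, rule mT(2))
  have near: "norm (d (idx k x)) \<le> R" if "norm x \<le> R0" for k x
  proof -
    have "norm (d (idx k x)) \<le> norm x + norm (d (idx k x) - x)" using norm_triangle_ineq[of x "d (idx k x) - x"] by simp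
    moreover have "inverse (real (Suc k)) \<le> 1" by (simp add: field_simps)
    ultimately show ?thesis using idd[of k x] that unfolding R_def by linarith
  qed
  have lim: "Y \<longlonglongrightarrow> y" if "\<And>k. norm (Y k - y) \<le> 2 * inverse (real (Suc k))" for Y and y :: 'a
  proof -
    have "(\<lambda>k. 2 * inverse (real (Suc k))) \<longlonglongrightarrow> 0" using tendsto_mult_right_zero[OF LIMSEQ_inverse_real_of_nat] by blast
    then have "(\<lambda>k. Y k - y) \<longlonglongrightarrow> 0" by (rule Lim_null_comparison[rotated]) (use that in simp)
    then show ?thesis by (simp add: LIM_zero_iff)
  qed
  have l0: "AE \<omega> in \<M>. (\<lambda>k. X k \<omega> 0) \<longlonglongrightarrow> fst \<omega>"
  proof (intro AE_I2 lim)
    fix \<omega> k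
    have "0 \<le> inverse (real (Suc k))" by simp
    then show "norm (X k \<omega> 0 - fst \<omega>) \<le> 2 * inverse (real (Suc k))" using idd[of k "fst \<omega>"] unfolding X0 by linarith
  qed
  have lT: "AE \<omega> in \<M>. (\<lambda>k. X k \<omega> T) \<longlonglongrightarrow> snd \<omega>"
    using A0 AT
  proof eventually_elim
    case (elim \<omega>)
    show ?case
    proof (rule lim)
      fix k
      have "norm (X k \<omega> T - snd \<omega>) \<le> norm (X k \<omega> T - d (idx k (snd \<omega>))) + norm (d (idx k (snd \<omega>)) - snd \<omega>)"
        using norm_triangle_ineq[of "X k \<omega> T - d (idx k (snd \<omega>))" "d (idx k (snd \<omega>)) - snd \<omega>"] by simp
      then show "norm (X k \<omega> T - snd \<omega>) \<le> 2 * inverse (real (Suc k))"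
        using XT[of k \<omega>, OF near near] elim idd[of k "snd \<omega>"] by linarith
    qed
  qed
  have AE0: "AE x in \<mu> k 0. norm x \<le> R" for k
  proof -
    have "{x \<in> space borel. norm x \<le> R} \<in> sets (borel :: 'a measure)" by simp
    then have "(AE x in \<mu> k 0. norm x \<le> R) \<longleftrightarrow> (AE \<omega> in \<M>. norm (X k \<omega> 0) \<le> R)"
      unfolding \<mu>_def by (rule AE_distr_iff[OF Xt])
    also have "\<dots>" using A0 by (rule eventually_mono) (simp add: X0 near)
    finally show ?thesis by simp
  qed
  have c0: "(\<lambda>k. LINT x|\<mu> k 0. \<psi> x) \<longlonglongrightarrow> (LINT x|m0. \<psi> x)" if "C1c_fun \<psi> G" for \<psi> G
    using tendsto_integral_C1c[OF M.prob_space_axioms that Xt fm l0] unfolding \<mu>_def df .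
  have cT: "(\<lambda>k. LINT x|\<mu> k T. \<psi> x) \<longlonglongrightarrow> (LINT x|mT. \<psi> x)" if "C1c_fun \<psi> G" for \<psi> G
    using tendsto_integral_C1c[OF M.prob_space_axioms that Xt sm lT] unfolding \<mu>_def ds .
  show ?thesis
  proof (rule plan_compactness[OF \<eta>(1,2) tendsto_const AE0 m0(1) _ mT(1)])
    show "(\<lambda>k. LINT x|\<mu> k 0. \<psi> x) \<longlonglongrightarrow> (LINT x|m0. \<psi> x)" if "C1c_fun \<psi> G" for \<psi> G by (rule c0[OF that])
    show "(\<lambda>k. LINT x|\<mu> k T. \<psi> x) \<longlonglongrightarrow> (LINT x|mT. \<psi> x)" if "C1c_fun \<psi> G" for \<psi> G by (rule cT[OF that])
    show thesis if "plan T F \<mu>' \<eta>'" "\<mu>' 0 = m0" "\<mu>' T = mT" for \<mu>' \<eta>'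
      by (rule goal_rule[OF that])
  qed
qed

end

section \<open>Existence of a minimiser\<close>

lemma sublinear_growth_control_system:
  assumes "T > 0" "sublinear_growth f0 f" "controllable_driftless f0 f"
  obtains M where "control_system T f M"
proof -
  obtain M where "M > 0" "\<And>i x. norm (f i x) \<le> M * (norm x + 1)"
    using assms(2) unfolding sublinear_growth_def by blast
  moreover have "continuous_on UNIV (f i)" for i
    using assms(3) smooth_onD(3) unfolding controllable_driftless_def by blast
  ultimately have "control_system T f M" using assms(1) unfolding control_system_def by blast
  then show ?thesis by (rule that)
qed

theorem corollary3p14:
  fixes T :: real
    and f0 :: "real ^ 'd \<Rightarrow> real ^ 'd"
    and f :: "'n::finite \<Rightarrow> real ^ 'd \<Rightarrow> real ^ 'd"
    and \<mu>0 \<mu>T :: "(real ^ 'd) measure"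
    and U :: "(real ^ 'n) set"
    and L :: "real \<Rightarrow> real ^ 'd \<Rightarrow> real ^ 'n \<Rightarrow> ennreal"
  assumes "T > 0"
    and "sublinear_growth f0 f"
    and "controllable_driftless f0 f"
    and "\<mu>0 \<in> space (prob_algebra borel)" and "compact (measure_support \<mu>0)"
    and "\<mu>T \<in> space (prob_algebra borel)" and "compact (measure_support \<mu>T)"
    and "U = UNIV"
    and "\<And>t x u. t \<in> {0..T} \<Longrightarrow> L t x u = ennreal (\<Sum>i\<in>UNIV. \<bar>u $ i\<bar>\<^sup>2)"
  shows "\<exists>\<mu> u. solves_BB T (control_affine f0 f) U L \<mu>0 \<mu>T \<mu> u"
proof -
  let ?H = "control_affine f0 f"
  define Adm where "Adm = BB_admissible T ?H UNIV \<mu>0 \<mu>T"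
  define J where "J = (INF (\<nu>, v) \<in> Adm. BB_cost T L \<nu> v)"
  have J_le: "J \<le> BB_cost T L \<nu> v" if "(\<nu>, v) \<in> Adm" for \<nu> v
    unfolding J_def using INF_lower[OF that, of "\<lambda>(\<nu>, v). BB_cost T L \<nu> v"] by simp
  have H: "?H x v = ctrl f x v" for x v
    using assms(3) unfolding controllable_driftless_def control_affine_def ctrl_def by simp
  obtain M where "control_system T f M" by (rule sublinear_growth_control_system[OF assms(1-3)])
  then interpret control_system T f M .
  obtain R1 where R1: "AE x in \<mu>0. norm x \<le> R1" by (rule AE_bounded_support[OF assms(4,5)])
  obtain R2 where R2: "AE x in \<mu>T. norm x \<le> R2" by (rule AE_bounded_support[OF assms(6,7)])
  define R where "R = max R1 R2"
  have R0: "AE x in \<mu>0. norm x \<le> R" using R1 by (rule eventually_mono) (simp add: R_def)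
  have RT: "AE x in \<mu>T. norm x \<le> R" using R2 by (rule eventually_mono) (simp add: R_def)
  have smooth: "smooth_on UNIV (f i)" for i using assms(3) unfolding controllable_driftless_def by blast
  obtain m where gen: "\<And>x. span {g x | g. g \<in> (\<Union>i\<in>{0..m}. iterated_brackets (range f) i)} = UNIV"
    using assms(3) unfolding controllable_driftless_def by blast
  \<comment> \<open>A single plan shows that the infimum is finite. Without this, the members of a
    minimising sequence could not be lifted to plans, which requires finite cost.\<close>
  obtain \<mu>1 \<eta>1 where p1: "plan T f \<mu>1 \<eta>1" and e1: "\<mu>1 0 = \<mu>0" "\<mu>1 T = \<mu>T"
    by (rule plan_exists[OF smooth gen assms(4) R0 assms(6) RT])
  obtain u1 where "(\<mu>1, u1) \<in> Adm" "BB_cost T L \<mu>1 u1 \<le> ennreal (T * plan_energy \<eta>1)"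
    using plan_admissible[where H = ?H and L = L, OF p1 H assms(9)] unfolding Adm_def e1 by blast
  then have Jfin: "J < \<infinity>" using J_le[of \<mu>1 u1] by (auto simp: less_top[symmetric] top_unique)
  define j where "j = enn2real J"
  have j: "J = ennreal j" "0 \<le> j" using Jfin unfolding j_def by simp_all
  \<comment> \<open>Near-optimal pairs are replaced by their plans, whose energies are the costs
    divided by \<open>T\<close>. The limit plan then has energy at most \<open>j / T\<close>, and
    projecting it back to a pair does not raise the cost above \<open>J\<close>.\<close>
  have "\<exists>q. plan T f (fst q) (snd q) \<and> fst q 0 = \<mu>0 \<and> fst q T = \<mu>T \<and>
      plan_energy (snd q) \<le> (j + inverse (real (Suc k))) / T" for k
  proof -
    have "J < ennreal (j + inverse (real (Suc k)))" unfolding j(1)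
      using add_nonneg_pos[OF j(2), of "inverse (real (Suc k))"] by (intro ennreal_lessI) auto
    then obtain \<nu> v where a: "(\<nu>, v) \<in> Adm" and lt: "BB_cost T L \<nu> v < ennreal (j + inverse (real (Suc k)))"
      unfolding J_def INF_less_iff by auto
    have "BB_cost T L \<nu> v < \<infinity>" using lt by (rule order_less_trans) simp
    then obtain \<eta> where \<eta>: "plan T f \<nu> \<eta>" "BB_cost T L \<nu> v = ennreal (T * plan_energy \<eta>)"
      using admissible_plan[where H = ?H and L = L, OF a[unfolded Adm_def] H assms(9)] by blast
    have "T * plan_energy \<eta> < j + inverse (real (Suc k))"
    proof (rule iffD1[OF ennreal_less_iff lt[unfolded \<eta>(2)]])
      show "0 \<le> T * plan_energy \<eta>" using T by (simp add: plan_energy_def)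
    qed
    then have "plan_energy \<eta> \<le> (j + inverse (real (Suc k))) / T"
      using pos_le_divide_eq[OF T] by (simp only: mult.commute less_imp_le)
    moreover have "\<nu> 0 = \<mu>0" "\<nu> T = \<mu>T" using a unfolding Adm_def BB_admissible_def by blast+
    ultimately show ?thesis using \<eta>(1) by (intro exI[of _ "(\<nu>, \<eta>)"]) simp
  qed
  then have "\<forall>k. \<exists>q. plan T f (fst q) (snd q) \<and> fst q 0 = \<mu>0 \<and> fst q T = \<mu>T \<and>
      plan_energy (snd q) \<le> (j + inverse (real (Suc k))) / T" by blast
  from choice[OF this] obtain Q where Q: "\<And>k. plan T f (fst (Q k)) (snd (Q k))" "\<And>k. fst (Q k) 0 = \<mu>0"
    "\<And>k. fst (Q k) T = \<mu>T" "\<And>k. plan_energy (snd (Q k)) \<le> (j + inverse (real (Suc k))) / T" by blast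
  have E: "(\<lambda>k. (j + inverse (real (Suc k))) / T) \<longlonglongrightarrow> j / T"
    using tendsto_divide[OF tendsto_add[OF tendsto_const LIMSEQ_inverse_real_of_nat] tendsto_const, of T j] T by simp
  have AE: "AE x in fst (Q k) 0. norm x \<le> R" for k unfolding Q(2) by (rule R0)
  obtain \<mu> \<eta> where p: "plan T f \<mu> \<eta>" and e: "\<mu> 0 = \<mu>0" "\<mu> T = \<mu>T" and en: "plan_energy \<eta> \<le> j / T"
    by (rule plan_compactness[OF Q(1,4) E AE assms(4) _ assms(6)]) (simp_all add: Q(2,3))
  obtain u where u: "(\<mu>, u) \<in> Adm" "BB_cost T L \<mu> u \<le> ennreal (T * plan_energy \<eta>)"
    using plan_admissible[where H = ?H and L = L, OF p H assms(9)] unfolding Adm_def e by blast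
  have "T * plan_energy \<eta> \<le> j" using en T by (simp add: field_simps)
  then have "ennreal (T * plan_energy \<eta>) \<le> J" unfolding j(1) by (rule ennreal_leI)
  then have "BB_cost T L \<mu> u = J" using u(2) J_le[OF u(1)] by (intro antisym) auto
  then have "solves_BB T ?H UNIV L \<mu>0 \<mu>T \<mu> u" using u(1) unfolding solves_BB_def J_def Adm_def by blast
  then show ?thesis unfolding assms(8) by blast
qed


end
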